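(* Let $d\ge2$ and $s\in(0,d)$. If $\mu$ is a reflectionless measure for the $s$-dimensional Riesz transform on $\mathbb{R}^d$, then $\operatorname{supp}(\mu)$ is nowhere dense in $\mathbb{R}^d$.
   Context: The $s$-dimensional Riesz transform is the Calder\'on--Zygmund operator with kernel $K(x)=x/|x|^{s+1}$ on $\mathbb{R}^d$, and $K_\delta(x)=x/\max(\delta,|x|)^{s+1}$. A measure is a nonnegative locally finite Borel measure; $\langle f,g\rangle_\mu=\int f\cdot g\,d\mu$; $\operatorname{supp}(\mu)$ is the closed support. $\mu$ is $\Lambda$-nice if $\mu(B(x,r))\le\Lambda r^s$ for every ball. $T_{\mu,\delta}f(x)=\int K_\delta(x-y)f(y)d\mu(y)$. $\mu$ is $\Lambda$-good if $\Lambda$-nice and $\|T_{\mu,\delta}\|_{L^2(\mu)\to L^2(\mu)}\le\Lambda$ for all $\delta>0$; then $\langle T_\mu f,g\rangle_\mu:=\lim_{\delta\to0}\langle T_{\mu,\delta}f,g\rangle_\mu$ defines a bounded operator on $L^2(\mu)$. For $\Lambda$-good $\mu$ and compactly supported Lipschitz $\psi$ with $\int\psi d\mu=0$, choose a ball $B\supset\operatorname{supp}\psi$, $z\in B$, $\varphi\in L^2(\mu)$ with $\varphi\equiv1$ on $2B$, $0\le\varphi\le1$, and set $\langle T_\mu(1),\psi\rangle_\mu=\langle T_\mu(\varphi),\psi\rangle_\mu+\int\psi(x)\int(1-\varphi(y))[K(x-y)-K(z-y)]d\mu(y)d\mu(x)$ (independent of choices). $\mu$ is reflectionless if it is $\Lambda$-good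 for some $\Lambda>0$ and $\langle T_\mu(1),\psi\rangle_\mu=0$ for all such $\psi$. *)

theory Defs
  imports "HOL-Analysis.Analysis"
begin

definition riesz_kernel :: "real \<Rightarrow> 'a::real_normed_vector \<Rightarrow> 'a" where
  "riesz_kernel s x = x /\<^sub>R (norm x powr (s + 1))"

definition riesz_kernel_trunc :: "real \<Rightarrow> real \<Rightarrow> 'a::real_normed_vector \<Rightarrow> 'a" where
  "riesz_kernel_trunc s \<delta> x = x /\<^sub>R (max \<delta> (norm x) powr (s + 1))"

definition riesz_op_trunc ::
  "real \<Rightarrow> 'a::euclidean_space measure \<Rightarrow> real \<Rightarrow> ('a \<Rightarrow> real) \<Rightarrow> 'a \<Rightarrow> 'a" where
  "riesz_op_trunc s \<mu> \<delta> f x = (\<integral>y. f y *\<^sub>R riesz_kernel_trunc s \<delta> (x - y) \<partial>\<mu>)"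

definition loc_finite_borel_measure :: "'a::euclidean_space measure \<Rightarrow> bool" where
  "loc_finite_borel_measure \<mu> \<longleftrightarrow>
     sets \<mu> = sets borel \<and> (\<forall>C. compact C \<longrightarrow> emeasure \<mu> C < \<infinity>)"

definition in_L2 :: "'a measure \<Rightarrow> ('a \<Rightarrow> real) \<Rightarrow> bool" where
  "in_L2 \<mu> f \<longleftrightarrow> f \<in> borel_measurable \<mu> \<and> integrable \<mu> (\<lambda>x. (f x)\<^sup>2)"

definition nice :: "real \<Rightarrow> real \<Rightarrow> 'a::euclidean_space measure \<Rightarrow> bool" where
  "nice s \<Lambda> \<mu> \<longleftrightarrow> (\<forall>x r. r > 0 \<longrightarrow> emeasure \<mu> (ball x r) \<le> ennreal (\<Lambda> * r powr s))"

definition good :: "real \<Rightarrow> real \<Rightarrow> 'a::euclidean_space measure \<Rightarrow> bool" where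
  "good s \<Lambda> \<mu> \<longleftrightarrow> nice s \<Lambda> \<mu> \<and>
     (\<forall>\<delta>>0. \<forall>f. in_L2 \<mu> f \<longrightarrow>
        (\<integral>\<^sup>+x. ennreal ((norm (riesz_op_trunc s \<mu> \<delta> f x))\<^sup>2) \<partial>\<mu>)
          \<le> ennreal (\<Lambda>\<^sup>2) * (\<integral>\<^sup>+x. ennreal ((f x)\<^sup>2) \<partial>\<mu>))"

definition riesz_pair ::
  "real \<Rightarrow> 'a::euclidean_space measure \<Rightarrow> ('a \<Rightarrow> real) \<Rightarrow> ('a \<Rightarrow> real) \<Rightarrow> 'a" where
  "riesz_pair s \<mu> f g = Lim (at_right 0) (\<lambda>\<delta>. \<integral>x. g x *\<^sub>R riesz_op_trunc s \<mu> \<delta> f x \<partial>\<mu>)"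

definition measure_support :: "'a::metric_space measure \<Rightarrow> 'a set" where
  "measure_support \<mu> = {x. \<forall>r>0. emeasure \<mu> (ball x r) > 0}"

definition reflectionless :: "real \<Rightarrow> 'a::euclidean_space measure \<Rightarrow> bool" where
  "reflectionless s \<mu> \<longleftrightarrow>
     loc_finite_borel_measure \<mu> \<and> (\<exists>\<Lambda>>0. good s \<Lambda> \<mu>) \<and>
     (\<forall>(\<psi>::'a \<Rightarrow> real) c r z \<phi>.
        (\<exists>L. L-lipschitz_on UNIV \<psi>) \<and> compact (closure {x. \<psi> x \<noteq> 0}) \<and>
        (\<integral>x. \<psi> x \<partial>\<mu>) = 0 \<and>
        r > 0 \<and> closure {x. \<psi> x \<noteq> 0} \<subseteq> ball c r \<and> z \<in> ball c r \<and>
        in_L2 \<mu> \<phi> \<and> (\<forall>y\<in>ball c (2 * r). \<phi> y = 1) \<and> (\<forall>y. 0 \<le> \<phi> y \<and> \<phi> y \<le> 1)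
        \<longrightarrow> riesz_pair s \<mu> \<phi> \<psi>
              + (\<integral>x. \<psi> x *\<^sub>R (\<integral>y. (1 - \<phi> y) *\<^sub>R
                    (riesz_kernel s (x - y) - riesz_kernel s (z - y)) \<partial>\<mu>) \<partial>\<mu>) = 0)"

end

theory Submission
  imports Defs
begin

text \<open>
  Regularise the kernel to \<open>K_e(x) = x (e\<^sup>2 + |x|\<^sup>2)\<^bsup>-(s+1)/2\<^esup>\<close> and let \<open>V e\<close> be the (renormalised) potential
  of \<open>\<mu>\<close> at scale \<open>e\<close>. Weak vanishing of \<open>T_\<mu>(1)\<close> together with antisymmetry of the kernel gives a constant
  vector \<open>l\<close> such that every average of \<open>V e - l\<close> against an \<open>L\<close>-Lipschitz bump is at most of order \<open>L e\<close>
  times the measure of a ball carrying the bump. Suppose that \<open>\<mu>\<close> charges every ball centred in some ball \<open>D\<close>.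

  If \<open>s \<le> d - 1\<close>, then for almost every \<open>z\<close> in \<open>D\<close> the density of \<open>\<mu>\<close> at \<open>z\<close> decays like a power, and comparing
  averages over bumps of well chosen width shows \<open>V e z \<longlongrightarrow> l\<close> as \<open>e \<longlongrightarrow> 0\<close>. But the divergence of \<open>K_e\<close> is
  nonnegative with mass bounded below near the origin, so testing against a gradient field rules out that
  \<open>V e\<close> converges to a constant on \<open>D\<close>.

  If \<open>s > d - 1\<close>, then \<open>V e\<close> is the convolution of \<open>V 0\<close> with the dilates of an explicit positive
  kernel, hence satisfies a Harnack inequality in \<open>(x, e)\<close>. Applied near the supremum of \<open>(V e - l) \<bullet> u\<close> at
  scales selected by a pigeonhole on the density of \<open>\<mu>\<close>, it contradicts the smallness of the averages unless
  the supremum is at most 0; hence \<open>V e = l\<close> for all \<open>e > 0\<close>. Then the divergence of \<open>K_e\<close> convolved with \<open>\<mu>\<close>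
  vanishes, which makes a mollified mass decay in \<open>e\<close> more slowly than the growth bound on \<open>\<mu>\<close>
  permits; so \<open>\<mu> = 0\<close>.
\<close>


section \<open>Regularised kernels\<close>

text \<open>Reflectionlessness only controls integrals against \<mu>, with an error proportional to
  the mass of the whole carrier of the test function. The mass actually tested may be far smaller,
  as \<mu> need not be doubling, so both cases hinge on selecting a scale at which the two masses
  are comparable. The error also carries the factor L e: a bump of Lipschitz constant 1/w is useful
  at scales e much smaller than w, and the change of V between e and the scale of interest must be
  paid for separately. That is where decay of the density enters.

  The dichotomy reflects the coefficient d - s - 1 of the divergence, whose sign decides whether the
  divergence argument is available. For s > d - 1, Harnack loses 2^(k(d+1-s)) over k dyadic scales
  while V changes by 2^(-nk) with some n < 2; such an n can beat the loss exactly when s > d - 1.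
  The bound 2 is due to the kernel depending on e through e^2.

  The form (e^2 + |x|^2)^(-(s+1)/2) is chosen because its divergence is explicit, it is convex in
  e^2, and completing squares preserves it, which yields an explicit averaging kernel.\<close>

definition pk :: "real \<Rightarrow> real \<Rightarrow> 'a::real_normed_vector \<Rightarrow> real" where
  "pk k e x = (e\<^sup>2 + (norm x)\<^sup>2) powr (- (k / 2))"

text \<open>At \<open>e = 0\<close> this is the Riesz kernel, the value at the origin being the junk value 0.\<close>

definition kr :: "real \<Rightarrow> real \<Rightarrow> 'a::real_normed_vector \<Rightarrow> 'a" where
  "kr s e x = pk (s + 1) e x *\<^sub>R x"

lemma pk_nonneg [simp]: "0 \<le> pk k e x"
  by (simp add: pk_def)

lemma pk_pos: "0 < e \<Longrightarrow> 0 < pk k e x"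
  by (simp add: pk_def add_pos_nonneg pos_add_strict)

lemma pk_minus [simp]: "pk k e (- x) = pk k e x"
  by (simp add: pk_def)

lemma pk_commute: "pk k e (x - y) = pk k e (y - x)"
  by (simp add: pk_def norm_minus_commute)

lemma kr_minus [simp]: "kr s e (- x) = - kr s e x"
  by (simp add: kr_def)

lemma kr_zero [simp]: "kr s e 0 = 0"
  by (simp add: kr_def)

lemma pk_measurable [measurable]: "pk k e \<in> borel_measurable borel"
  unfolding pk_def by measurable

lemma kr_measurable [measurable]: "kr s e \<in> borel_measurable (borel :: 'a::euclidean_space measure)"
  unfolding kr_def by measurable

lemma inverse_le_mult_inverse:
  fixes X Y C :: real
  shows "0 < Y \<Longrightarrow> 0 < X \<Longrightarrow> X \<le> C * Y \<Longrightarrow> inverse Y \<le> C * inverse X"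
  by (simp add: field_simps)

lemma pk_compare:
  assumes "0 < e" "0 < e'" "0 \<le> k" "0 < c" "e\<^sup>2 + (norm x)\<^sup>2 \<le> c * (e'\<^sup>2 + (norm x')\<^sup>2)"
  shows "pk k e' x' \<le> c powr (k/2) * pk k e x"
proof -
  have A: "0 < e\<^sup>2 + (norm x)\<^sup>2" "0 < e'\<^sup>2 + (norm x')\<^sup>2"
    using assms by (auto intro: add_pos_nonneg)
  have "(e\<^sup>2 + (norm x)\<^sup>2) powr (k/2) \<le> (c * (e'\<^sup>2 + (norm x')\<^sup>2)) powr (k/2)"
    using assms A by (intro powr_mono2) auto
  also have "\<dots> = c powr (k/2) * (e'\<^sup>2 + (norm x')\<^sup>2) powr (k/2)"
    using assms A by (simp add: powr_mult)
  finally show ?thesis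

  proof -
    have Y: "0 < (e'\<^sup>2 + (norm x')\<^sup>2) powr (k/2)" "0 < (e\<^sup>2 + (norm x)\<^sup>2) powr (k/2)"
      using A by auto
    assume "(e\<^sup>2 + (norm x)\<^sup>2) powr (k/2) \<le> c powr (k/2) * (e'\<^sup>2 + (norm x')\<^sup>2) powr (k/2)"
    with Y show ?thesis
      unfolding pk_def powr_minus by (rule inverse_le_mult_inverse)
  qed
qed

lemma pk_le_norm:
  assumes "0 \<le> k" "0 < w" "w \<le> norm x"
  shows "pk k e x \<le> w powr (-k)"
proof -
  have "w\<^sup>2 \<le> e\<^sup>2 + (norm x)\<^sup>2"
    using assms power_mono[of w "norm x" 2] by (simp add: add_increasing)
  then have "pk k e x \<le> (w\<^sup>2) powr (-(k/2))"
    unfolding pk_def using assms by (intro powr_mono2') auto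
  also have "\<dots> = w powr (-k)"
    using assms by (simp add: powr_powr flip: powr_numeral)
  finally show ?thesis .
qed

lemma pk_le_scale:
  assumes "0 \<le> k" "0 < e"
  shows "pk k e x \<le> e powr (-k)"
proof -
  have "pk k e x \<le> (e\<^sup>2) powr (-(k/2))"
    unfolding pk_def using assms by (intro powr_mono2') auto
  also have "\<dots> = e powr (-k)"
    using assms by (simp add: powr_powr flip: powr_numeral)
  finally show ?thesis .
qed

lemma pk_antimono:
  assumes "0 < e" "e \<le> e'" "0 \<le> k"
  shows "pk k e' x \<le> pk k e x"
  unfolding pk_def using assms by (intro powr_mono2') (auto intro: add_pos_nonneg power_mono)

lemma norm_mult_pk_le: 
  assumes "0 < e"
  shows "norm x * pk (k + 1) e x \<le> pk k e x"
proof -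
  let ?A = "e\<^sup>2 + (norm x)\<^sup>2"
  have A: "0 < ?A" using assms by (auto intro: add_pos_nonneg)
  have "norm x \<le> sqrt ?A" by (rule real_le_rsqrt) simp
  also have "\<dots> = ?A powr (1/2)" using A by (simp add: powr_half_sqrt)
  finally have "norm x * ?A powr (-((k+1)/2)) \<le> ?A powr (1/2) * ?A powr (-((k+1)/2))"
    by (intro mult_right_mono) auto
  also have "\<dots> = ?A powr (-(k/2))" by (simp flip: powr_add add: field_simps)
  finally show ?thesis by (simp add: pk_def)
qed

lemma norm_kr_le: "0 < e \<Longrightarrow> norm (kr s e x) \<le> pk s e x"
  using norm_mult_pk_le[of e x s] by (simp add: kr_def mult.commute)

text \<open>Convexity of the power -b: it lies above its tangent at A. No order between A and A' is
  assumed, so exchanging them yields a two-sided estimate. The sharp constant b matters in the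
  iteration that excludes a constant field for s > d - 1.\<close>

lemma powr_minus_diff_le:
  fixes A A' b :: real
  assumes "0 < A" "0 < A'" "0 \<le> b"
  shows "A powr (-b) - A' powr (-b) \<le> b * (A' - A) * A powr (-b-1)"
proof -
  have "1 - b * (A'/A - 1) \<le> 1 - b * ln (A'/A)"
    using assms ln_le_minus_one[of "A'/A"] by (intro diff_left_mono mult_left_mono) auto
  also have "\<dots> \<le> exp (- b * ln (A'/A))"
    using exp_ge_add_one_self[of "- b * ln (A'/A)"] by simp
  also have "\<dots> = (A'/A) powr (-b)" using assms by (simp add: powr_def)
  also have "\<dots> = A' powr (-b) / A powr (-b)" using assms by (simp add: powr_divide)
  finally have "(1 - b * (A'/A - 1)) * A powr (-b) \<le> A' powr (-b)"
    using assms by (simp add: field_simps)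
  moreover have "(1 - b * (A'/A - 1)) * A powr (-b) = A powr (-b) - b * (A' - A) * (A powr (-b) / A)"
    using assms by (simp add: field_simps)
  moreover have "A powr (-b) / A = A powr (-b-1)"
    using assms by (simp add: powr_diff)
  ultimately show ?thesis by simp
qed

text \<open>The tangent inequality in the variable e^2 produces the factor t^2 - r^2 and the decay s
  + 3, of which the vector x uses one power. The remaining decay s + 2 makes the difference
  integrable against growth s, although \<open>kr s r\<close> alone need not be.\<close>

lemma kr_scale_diff:
  assumes "0 < r" "r \<le> t" "0 < s"
  shows "norm (kr s r x - kr s t x) \<le> (s+1)/2 * (t\<^sup>2 - r\<^sup>2) * pk (s+2) r x"
proof -
  let ?A = "r\<^sup>2 + (norm x)\<^sup>2" and ?A' = "t\<^sup>2 + (norm x)\<^sup>2" and ?b = "(s+1)/2"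
  have A: "0 < ?A" "0 < ?A'" using assms by (auto intro: add_pos_nonneg)
  have "pk (s+1) t x \<le> pk (s+1) r x" using assms by (intro pk_antimono) auto
  then have "norm (kr s r x - kr s t x) = norm x * (pk (s+1) r x - pk (s+1) t x)"
    by (simp add: kr_def flip: scaleR_diff_left)
  also have "pk (s+1) r x - pk (s+1) t x \<le> ?b * (?A' - ?A) * ?A powr (-?b-1)"
    unfolding pk_def using powr_minus_diff_le[OF A, of ?b] assms by (simp add: field_simps)
  also have "?A powr (-?b-1) = pk (s+3) r x"
    unfolding pk_def by (rule arg_cong[of _ _ "(powr) ?A"]) (simp add: field_simps)
  also have "norm x * (?b * (?A' - ?A) * pk (s+3) r x) = ?b * (t\<^sup>2 - r\<^sup>2) * (norm x * pk (s+2+1) r x)"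
    by (simp add: algebra_simps)
  also have "\<dots> \<le> ?b * (t\<^sup>2 - r\<^sup>2) * pk (s+2) r x"
    using assms by (intro mult_left_mono norm_mult_pk_le) (auto intro: power_mono)
  finally show ?thesis by (simp add: mult_left_mono)
qed

lemma sum_sq_comparable:
  fixes x x' :: "'a::real_normed_vector"
  assumes "norm (x - x') \<le> D * e" "0 \<le> D" "0 < e"
  shows "e\<^sup>2 + (norm x')\<^sup>2 \<le> (2 + 2 * D\<^sup>2) * (e\<^sup>2 + (norm x)\<^sup>2)"
proof -
  have "norm x' \<le> norm x + D * e"
    using assms norm_triangle_ineq4[of x "x - x'"] by simp
  then have "(norm x')\<^sup>2 \<le> (norm x + D * e)\<^sup>2" by (intro power_mono) auto
  also have "\<dots> \<le> 2 * (norm x)\<^sup>2 + 2 * D\<^sup>2 * e\<^sup>2"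
    using sum_squares_bound[of "norm x" "D*e"] by (simp add: power2_sum power_mult_distrib)
  finally have "(norm x')\<^sup>2 \<le> 2 * (norm x)\<^sup>2 + 2 * D\<^sup>2 * e\<^sup>2" .
  moreover have "0 \<le> e\<^sup>2" "0 \<le> D\<^sup>2 * (norm x)\<^sup>2" by auto
  moreover have "(2 + 2 * D\<^sup>2) * (e\<^sup>2 + (norm x)\<^sup>2)
    = 2 * (norm x)\<^sup>2 + 2 * D\<^sup>2 * e\<^sup>2 + 2 * e\<^sup>2 + 2 * (D\<^sup>2 * (norm x)\<^sup>2)"
    by (simp add: algebra_simps)
  ultimately show ?thesis by linarith
qed

text \<open>Here c is the ratio allowed by \<open>sum_sq_comparable\<close> for points at distance
  at most D e. In \<open>kr_trans_diff\<close> the summand 1 comes from moving the vector factor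
  alone, the other one from moving the scalar factor.\<close>

definition ctd :: "real \<Rightarrow> real \<Rightarrow> real" where
  "ctd s D = (let c = 2 + 2 * D\<^sup>2 in 1 + (s+1) * c * (1 + c) * c powr ((s+3)/2))"

lemma ctd_pos: "0 < s \<Longrightarrow> 0 < ctd s D"
  unfolding ctd_def Let_def by (intro add_pos_nonneg mult_nonneg_nonneg) auto

text \<open>A translation by at most D scales costs |x - x'| and gains one power of decay, since e^2
  + |.|^2 is comparable at both points. Decay s + 1 already beats growth s.\<close>

lemma kr_trans_diff:
  assumes "norm (x - x') \<le> D * e" "0 \<le> D" "0 < e" "0 < s"
  shows "norm (kr s e x - kr s e x') \<le> ctd s D * norm (x - x') * pk (s+1) e x"
proof -
  define c where "c = 2 + 2 * D\<^sup>2"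
  have c: "1 \<le> c" by (simp add: c_def)
  let ?A = "e\<^sup>2 + (norm x)\<^sup>2" and ?A' = "e\<^sup>2 + (norm x')\<^sup>2" and ?b = "(s+1)/2"
  have A: "0 < ?A" "0 < ?A'" using assms by (auto intro: add_pos_nonneg)
  have c1: "?A' \<le> c * ?A" unfolding c_def using assms by (intro sum_sq_comparable) auto
  have c2: "?A \<le> c * ?A'" unfolding c_def using assms
    by (intro sum_sq_comparable) (auto simp: norm_minus_commute)
  have P: "pk (s+3) e x' \<le> c powr ((s+3)/2) * pk (s+3) e x"
    using assms c c2 by (intro pk_compare) auto
  have cp: "1 \<le> c powr ((s+3)/2)" using c assms by (intro ge_one_powr_ge_zero) auto
  have P3: "max (pk (s+3) e x) (pk (s+3) e x') \<le> c powr ((s+3)/2) * pk (s+3) e x"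
    using P mult_right_mono[OF cp, of "pk (s+3) e x"] by simp
  have e3: "A powr (-?b-1) = A powr (-((s+3)/2))" for A :: real
    by (rule arg_cong[of _ _ "(powr) A"]) (simp add: field_simps)
  \<comment> \<open>The tangent inequality is used at both points because neither norm is known to
    be the larger one.\<close>
  have d: "\<bar>pk (s+1) e x - pk (s+1) e x'\<bar> \<le> ?b * \<bar>?A' - ?A\<bar> * max (pk (s+3) e x) (pk (s+3) e x')"
  proof -
    have gen: "?b * u * p \<le> ?b * v * q" if "u \<le> v" "p \<le> q" "0 \<le> v" "0 \<le> p" for u v p q
      using that assms by (intro mult_mono mult_left_mono mult_nonneg_nonneg) auto
    have m: "?b * (?A' - ?A) * pk (s+3) e x \<le> ?b * \<bar>?A' - ?A\<bar> * max (pk (s+3) e x) (pk (s+3) e x')"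
      by (rule gen) auto
    have m': "?b * (?A - ?A') * pk (s+3) e x' \<le> ?b * \<bar>?A' - ?A\<bar> * max (pk (s+3) e x) (pk (s+3) e x')"
      by (rule gen; (linarith | simp))
    have 1: "pk (s+1) e x - pk (s+1) e x' \<le> ?b * (?A' - ?A) * pk (s+3) e x"
      using powr_minus_diff_le[OF A, of ?b] assms unfolding pk_def e3 by simp
    have 2: "pk (s+1) e x' - pk (s+1) e x \<le> ?b * (?A - ?A') * pk (s+3) e x'"
      using powr_minus_diff_le[OF A(2,1), of ?b] assms unfolding pk_def e3 by simp
    show ?thesis using 1 2 m m' by linarith
  qed
  have AA: "\<bar>?A' - ?A\<bar> \<le> norm (x - x') * (norm x + norm x')"
  proof -
    have "?A' - ?A = (norm x' - norm x) * (norm x + norm x')"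
      by (simp add: power2_eq_square algebra_simps)
    moreover have "\<bar>norm x' - norm x\<bar> \<le> norm (x - x')"
      by (metis norm_minus_commute norm_triangle_ineq3)
    ultimately show ?thesis by (auto simp: abs_mult intro: mult_right_mono)
  qed
  have xx: "norm x' * (norm x + norm x') \<le> 2 * c * (1 + c) * ?A"
  proof -
    have "norm x' * (norm x + norm x') \<le> 2 * ((norm x)\<^sup>2 + (norm x')\<^sup>2)"
      using sum_squares_bound[of "norm x" "norm x'"] zero_le_square[of "norm x"] zero_le_square[of "norm x'"]
      unfolding power2_eq_square distrib_left by (simp only: mult.commute[of "norm x'" "norm x"])
    also have "\<dots> \<le> 2 * (?A + c * ?A)" using c1 zero_le_power2[of e] by (smt (verit))
    also have "\<dots> = 1 * (2 * (1 + c) * ?A)" by (simp add: algebra_simps)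
    also have "\<dots> \<le> c * (2 * (1 + c) * ?A)" using c A by (intro mult_right_mono) auto
    finally show ?thesis by (simp add: algebra_simps)
  qed
  have split: "kr s e x - kr s e x' = pk (s+1) e x *\<^sub>R (x - x') + (pk (s+1) e x - pk (s+1) e x') *\<^sub>R x'"
    by (simp add: kr_def algebra_simps)
  have "norm (kr s e x - kr s e x') \<le> pk (s+1) e x * norm (x - x') + \<bar>pk (s+1) e x - pk (s+1) e x'\<bar> * norm x'"
    unfolding split by (rule norm_triangle_le) simp
  also have "\<bar>pk (s+1) e x - pk (s+1) e x'\<bar> * norm x' \<le>
     ?b * (norm (x - x') * (norm x + norm x')) * (c powr ((s+3)/2) * pk (s+3) e x) * norm x'"
    using assms by (intro mult_right_mono order_trans[OF d] mult_mono mult_left_mono AA P3) (auto simp: le_max_iff_disj)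
  also have "\<dots> = ?b * norm (x - x') * c powr ((s+3)/2) * (norm x' * (norm x + norm x') * pk (s+3) e x)"
    by (simp only: mult_ac)
  also have "\<dots> \<le> ?b * norm (x - x') * c powr ((s+3)/2) * (2 * c * (1 + c) * ?A * pk (s+3) e x)"
    using assms by (intro mult_left_mono mult_right_mono xx) auto
  also have "?A * pk (s+3) e x = pk (s+1) e x"
  proof -
    have "?A * ?A powr (-((s+3)/2)) = ?A powr 1 * ?A powr (-((s+3)/2))" using A by simp
    also have "\<dots> = ?A powr (-((s+1)/2))" unfolding powr_add[symmetric]
      by (rule arg_cong[of _ _ "(powr) ?A"]) (simp add: field_simps)
    finally show ?thesis by (simp add: pk_def)
  qed
  then have "?b * norm (x - x') * c powr ((s+3)/2) * (2 * c * (1 + c) * ?A * pk (s+3) e x)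
     = ?b * norm (x - x') * c powr ((s+3)/2) * (2 * c * (1 + c) * pk (s+1) e x)"
    by (simp add: mult.assoc)
  finally show ?thesis
    unfolding ctd_def Let_def c_def[symmetric] by (simp add: field_simps)
qed

text \<open>The first bound is meant for |x| >= e, where two powers of decay are gained; the second
  for |x| < e, where it is just the size of the singular kernel.\<close>

lemma kr_limit_diff:
  assumes "0 < s" "0 \<le> e" "x \<noteq> 0"
  shows "norm (kr s e x - kr s 0 x) \<le> (s+1)/2 * e\<^sup>2 * norm x powr (-s-2)"
    and "norm (kr s e x - kr s 0 x) \<le> norm x powr (-s)"
proof -
  let ?A' = "e\<^sup>2 + (norm x)\<^sup>2" and ?A = "(norm x)\<^sup>2" and ?b = "(s+1)/2"
  have A: "0 < ?A" "0 < ?A'" using assms by (auto intro: add_nonneg_pos)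
  have P: "?A powr c = norm x powr (2 * c)" for c
    using assms by (simp add: powr_powr flip: powr_numeral)
  have le: "?A' powr (-?b) \<le> ?A powr (-?b)" using A assms by (intro powr_mono2') auto
  have eq: "norm (kr s e x - kr s 0 x) = norm x * (?A powr (-?b) - ?A' powr (-?b))"
    using le by (simp add: kr_def pk_def flip: scaleR_diff_left)
  have nx: "norm x * norm x powr c = norm x powr (1 + c)" for c using assms by (simp add: powr_add)
  have "norm x * (?A powr (-?b) - ?A' powr (-?b)) \<le> norm x * (?b * (?A' - ?A) * ?A powr (-?b-1))"
    using assms A by (intro mult_left_mono powr_minus_diff_le) auto
  also have "\<dots> = ?b * e\<^sup>2 * (norm x * norm x powr (2 * (-?b-1)))"
    unfolding P by (simp add: algebra_simps)
  also have "\<dots> = ?b * e\<^sup>2 * norm x powr (-s-2)" 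
  proof -
    have "1 + 2 * (-?b-1) = - s - 2" by (simp add: field_simps)
    then show ?thesis by (simp only: nx)
  qed
  finally show "norm (kr s e x - kr s 0 x) \<le> (s+1)/2 * e\<^sup>2 * norm x powr (-s-2)" using eq by simp
  have "norm x * (?A powr (-?b) - ?A' powr (-?b)) \<le> norm x * ?A powr (-?b)"
    by (intro mult_left_mono) auto
  also have "\<dots> = norm x powr (-s)" 
  proof -
    have "1 + 2 * (-?b) = - s" by (simp add: field_simps)
    then show ?thesis by (simp only: P nx)
  qed
  finally show "norm (kr s e x - kr s 0 x) \<le> norm x powr (-s)" using eq by simp
qed

text \<open>For fixed x the scalar factor decreases in the scale, so passing from e to r changes it
  by at most what passing from 0 to r does. This yields a majorant that does not depend on
  e.\<close>

lemma kr_diff_le_limit_diff: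
  assumes "0 < s" "0 \<le> e" "e \<le> r"
  shows "norm (kr s e x - kr s r x) \<le> norm (kr s r x - kr s 0 x)"
proof (cases "x = 0")
  case False
  let ?b = "(s+1)/2"
  have A: "0 < (norm x)\<^sup>2" using False by auto
  have 1: "(r\<^sup>2 + (norm x)\<^sup>2) powr (-?b) \<le> (e\<^sup>2 + (norm x)\<^sup>2) powr (-?b)"
    using assms A by (intro powr_mono2') (auto intro: add_nonneg_pos power_mono)
  have 2: "(e\<^sup>2 + (norm x)\<^sup>2) powr (-?b) \<le> (0\<^sup>2 + (norm x)\<^sup>2) powr (-?b)"
    using assms A by (intro powr_mono2') (auto intro: add_nonneg_pos)
  show ?thesis using 1 2
    by (auto simp: kr_def pk_def simp flip: scaleR_diff_left intro!: mult_right_mono)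
qed simp

section \<open>Measures of growth s\<close>

lemma nn_bound_real:
  fixes f :: "'a \<Rightarrow> real"
  assumes "f \<in> borel_measurable M" "\<And>x. 0 \<le> f x" "(\<integral>\<^sup>+x. ennreal (f x) \<partial>M) \<le> ennreal C" "0 \<le> C"
  shows "integrable M f" and "(\<integral>x. f x \<partial>M) \<le> C"
proof -
  show int: "integrable M f"
    using assms by (intro integrableI_nonneg) (auto intro: le_less_trans)
  have "ennreal (\<integral>x. f x \<partial>M) \<le> ennreal C"
    using nn_integral_eq_integral[OF int] assms by simp
  then show "(\<integral>x. f x \<partial>M) \<le> C" using assms by (simp add: ennreal_le_iff)
qed

lemma norm_integral_bound_nn:
  fixes f :: "'a \<Rightarrow> 'b::{banach, second_countable_topology}"
  assumes "f \<in> borel_measurable M" "(\<integral>\<^sup>+x. ennreal (norm (f x)) \<partial>M) \<le> ennreal C" "0 \<le> C"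
  shows "integrable M f" and "norm (\<integral>x. f x \<partial>M) \<le> C" and "(\<integral>x. norm (f x) \<partial>M) \<le> C"
proof -
  have 1: "integrable M (\<lambda>x. norm (f x))" "(\<integral>x. norm (f x) \<partial>M) \<le> C"
    using assms by (intro nn_bound_real; auto)+
  then show "integrable M f" using assms by (simp add: integrable_norm_iff)
  show "norm (\<integral>x. f x \<partial>M) \<le> C" using 1 integral_norm_bound order_trans by blast
  show "(\<integral>x. norm (f x) \<partial>M) \<le> C" using 1 by simp
qed

text \<open>Each point is charged to a single ball containing it, so summing over all balls
  overestimates the integral. Expanding balls are used for tails, shrinking ones for
  singularities.\<close>

lemma nn_integral_le_ball_sum:
  fixes M :: "'a::euclidean_space measure"
  assumes sets: "sets M = sets borel"
    and pt: "\<And>y. f y = 0 \<or> (\<exists>i::nat. y \<in> ball x (\<rho> i) \<and> f y \<le> ennreal (c i))"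
    and m: "\<And>i. emeasure M (ball x (\<rho> i)) \<le> ennreal (m i)"
    and nn: "\<And>i. 0 \<le> c i" "\<And>i. 0 \<le> m i" and S: "(\<lambda>i. c i * m i) sums S"
  shows "(\<integral>\<^sup>+y. f y \<partial>M) \<le> ennreal S"
proof -
  have [measurable]: "ball x r \<in> sets M" for r using sets by simp
  have "f y \<le> (\<Sum>i. ennreal (c i) * indicator (ball x (\<rho> i)) y)" for y
    using pt[of y]
  proof
    assume "\<exists>i::nat. y \<in> ball x (\<rho> i) \<and> f y \<le> ennreal (c i)"
    then obtain i where i: "y \<in> ball x (\<rho> i)" "f y \<le> ennreal (c i)" by blast
    have "f y \<le> (\<Sum>i\<in>{i}. ennreal (c i) * indicator (ball x (\<rho> i)) y)" using i by simp
    also have "\<dots> \<le> (\<Sum>i. ennreal (c i) * indicator (ball x (\<rho> i)) y)"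
      by (intro sum_le_suminf) auto
    finally show ?thesis .
  qed simp
  then have "(\<integral>\<^sup>+y. f y \<partial>M) \<le> (\<integral>\<^sup>+y. (\<Sum>i. ennreal (c i) * indicator (ball x (\<rho> i)) y) \<partial>M)"
    by (intro nn_integral_mono)
  also have "\<dots> = (\<Sum>i. \<integral>\<^sup>+y. ennreal (c i) * indicator (ball x (\<rho> i)) y \<partial>M)"
    by (intro nn_integral_suminf) measurable
  also have "\<dots> = (\<Sum>i. ennreal (c i) * emeasure M (ball x (\<rho> i)))"
    by (intro suminf_cong nn_integral_cmult_indicator) measurable
  also have "\<dots> \<le> (\<Sum>i. ennreal (c i * m i))"
    using m nn by (intro suminf_le) (auto simp: ennreal_mult intro!: mult_left_mono)
  also have "\<dots> = ennreal S"
    using nn S by (intro suminf_ennreal_eq) auto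
  finally show ?thesis .
qed

text \<open>Value of the dyadic sum in \<open>nn_integral_pk_dyadic\<close>: the numerator is lost
  by evaluating the kernel at half the outer radius of a shell, the denominator sums the ratio
  2^(\<kappa> - k).\<close>

definition cup :: "real \<Rightarrow> real \<Rightarrow> real" where
  "cup \<kappa> k = 2 powr k / (1 - 2 powr (\<kappa> - k))"

lemma cup_pos: "\<kappa> < k \<Longrightarrow> 0 < cup \<kappa> k"
  by (simp add: cup_def powr_less_one)

text \<open>On dyadic shells the kernel is bounded by its value at the inner radius, and the shell
  contributions sum geometrically as \<kappa> < k. The mass bound is asked only for radii 2^i e and
  with its own exponent: at points where the density decays it is applied with \<kappa> > s.\<close>

lemma nn_integral_pk_dyadic:
  fixes M :: "'a::euclidean_space measure"
  assumes sets: "sets M = sets borel" and "0 < e" "\<kappa> < k" "0 \<le> k" "0 \<le> B"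
    and m: "\<And>i::nat. emeasure M (ball x (2^i * e)) \<le> ennreal (B * (2^i * e) powr \<kappa>)"
  shows "(\<integral>\<^sup>+y. ennreal (pk k e (x - y)) \<partial>M) \<le> ennreal (cup \<kappa> k * B * e powr (\<kappa> - k))"
proof (rule nn_integral_le_ball_sum[where \<rho>="\<lambda>i. 2^i * e" and c="\<lambda>i. (2^i * e / 2) powr (-k)" and m="\<lambda>i. B * (2^i * e) powr \<kappa>"])
  fix y
  obtain n where "norm (x - y) / e < 2 ^ n" using real_arch_pow[of 2 "norm (x - y) / e"] by auto
  then have n: "norm (x - y) < 2^n * e" using assms by (simp add: field_simps)
  define i where "i = (LEAST i::nat. norm (x - y) < 2^i * e)"
  have i: "norm (x - y) < 2^i * e" unfolding i_def using n by (rule LeastI)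
  \<comment> \<open>By minimality of i the distance is at least 2^i e / 2 unless i = 0, where the
    bound by the scale takes over.\<close>
  have "pk k e (x - y) \<le> (2^i * e / 2) powr (-k)"
  proof (cases i)
    case 0
    have "pk k e (x - y) \<le> e powr (-k)" using assms by (intro pk_le_scale)
    also have "\<dots> \<le> (e/2) powr (-k)" using assms by (intro powr_mono2') auto
    finally show ?thesis using 0 by simp
  next
    case (Suc j)
    then have "\<not> norm (x - y) < 2^j * e" using not_less_Least[of j "\<lambda>i. norm (x - y) < 2^i * e"] i_def by auto
    then show ?thesis using Suc assms by (intro pk_le_norm) auto
  qed
  then show "ennreal (pk k e (x - y)) = 0 \<or> (\<exists>i::nat. y \<in> ball x (2^i * e) \<and> ennreal (pk k e (x - y)) \<le> ennreal ((2^i * e / 2) powr (-k)))"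
    using i by (intro disjI2 exI[of _ i]) (auto simp: dist_norm intro: ennreal_leI)
next
  have "(\<lambda>i. 2 powr k * B * e powr (\<kappa> - k) * (2 powr (\<kappa> - k)) ^ i) sums (2 powr k * B * e powr (\<kappa> - k) * (1 / (1 - 2 powr (\<kappa> - k))))"
    using assms by (intro sums_mult geometric_sums) (simp add: powr_less_one)
  also have "(\<lambda>i. 2 powr k * B * e powr (\<kappa> - k) * (2 powr (\<kappa> - k)) ^ i) = (\<lambda>i. (2^i * e / 2) powr (-k) * (B * (2^i * e) powr \<kappa>))"
  proof
    fix i
    have "(2 powr (\<kappa> - k)) ^ i = (2^i) powr (\<kappa> - k)"
      by (simp add: powr_powr mult.commute flip: powr_realpow)
    moreover have "(2^i * e / 2) powr (-k) = (2^i) powr (-k) * e powr (-k) * 2 powr k"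
      using assms by (simp add: powr_mult powr_divide powr_minus field_simps)
    moreover have "(2^i) powr (\<kappa> - k) = (2^i) powr \<kappa> * (2^i) powr (-k)" "e powr (\<kappa> - k) = e powr \<kappa> * e powr (-k)"
      by (simp_all flip: powr_add)
    moreover have "(2^i * e) powr \<kappa> = (2^i) powr \<kappa> * e powr \<kappa>"
      using assms by (simp add: powr_mult)
    ultimately show "2 powr k * B * e powr (\<kappa> - k) * (2 powr (\<kappa> - k)) ^ i = (2^i * e / 2) powr (-k) * (B * (2^i * e) powr \<kappa>)"
      by (simp only: mult_ac)
  qed
  finally show "(\<lambda>i. (2^i * e / 2) powr (-k) * (B * (2^i * e) powr \<kappa>)) sums (cup \<kappa> k * B * e powr (\<kappa> - k))"
    by (simp add: cup_def mult_ac)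
qed (use assms in auto)

text \<open>The constant of the dyadic sum over shrinking balls. The absolute value is there because
  the exponent a = s - 1 of the main application is negative when s < 1.\<close>

definition cdn :: "real \<Rightarrow> real \<Rightarrow> real" where
  "cdn s a = 2 powr \<bar>a\<bar> / (1 - 2 powr (a - s))"

lemma cdn_pos: "a < s \<Longrightarrow> 0 < cdn s a"
  by (simp add: cdn_def powr_less_one)

text \<open>Besides \<mu> this is instantiated with Lebesgue measure and exponent d
  (\<open>growth_measure_lborel\<close>), so the same estimates bound Lebesgue integrals of the
  kernels.\<close>

locale growth_measure =
  fixes M :: "'a::euclidean_space measure" and s \<Lambda> :: real
  assumes sets_M [measurable_cong, simp]: "sets M = sets borel"
    and s_pos: "0 < s" and \<Lambda>_pos: "0 < \<Lambda>"
    and growth: "\<And>x r. 0 < r \<Longrightarrow> emeasure M (ball x r) \<le> ennreal (\<Lambda> * r powr s)"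
begin

lemma space_M [simp]: "space M = UNIV"
  using sets_eq_imp_space_eq[OF sets_M] by simp

lemma emeasure_bounded_finite:
  assumes "bounded A"
  shows "emeasure M A < \<infinity>"
proof -
  obtain r where r: "0 < r" "A \<subseteq> ball 0 r"
    using assms bounded_subset_ballD[of A 0] by auto
  have "emeasure M A \<le> emeasure M (ball 0 r)" using r by (intro emeasure_mono) auto
  also have "\<dots> \<le> ennreal (\<Lambda> * r powr s)" using r by (intro growth)
  also have "\<dots> < \<infinity>" by simp
  finally show ?thesis .
qed

sublocale sigma_finite_measure M
proof
  show "\<exists>A. countable A \<and> A \<subseteq> sets M \<and> \<Union> A = space M \<and> (\<forall>a\<in>A. emeasure M a \<noteq> \<infinity>)"
  proof (intro exI[of _ "range (\<lambda>n::nat. ball 0 (real n))"] conjI ballI)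
    have "x \<in> ball 0 (real (nat \<lceil>norm x + 1\<rceil>))" for x :: 'a
      by (simp add: dist_norm) linarith
    then show "\<Union> (range (\<lambda>n::nat. ball (0::'a) (real n))) = space M"
      unfolding space_M by blast
    show "emeasure M a \<noteq> \<infinity>" if "a \<in> range (\<lambda>n::nat. ball 0 (real n))" for a
      using that emeasure_bounded_finite[of a] by auto
  qed auto
qed

sublocale PM: pair_sigma_finite M M ..

lemma nn_integral_pk_le:
  assumes "0 < e" "s < k"
  shows "(\<integral>\<^sup>+y. ennreal (pk k e (x - y)) \<partial>M) \<le> ennreal (cup s k * \<Lambda> * e powr (s - k))"
  using assms s_pos \<Lambda>_pos by (intro nn_integral_pk_dyadic growth) auto

lemma integrable_pk: "0 < e \<Longrightarrow> s < k \<Longrightarrow> integrable M (\<lambda>y. pk k e (x - y))"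
  and integral_pk_le: "0 < e \<Longrightarrow> s < k \<Longrightarrow> (\<integral>y. pk k e (x - y) \<partial>M) \<le> cup s k * \<Lambda> * e powr (s - k)"
proof -
  assume a: "0 < e" "s < k"
  have "0 \<le> cup s k * \<Lambda> * e powr (s - k)" using cup_pos[of s k] \<Lambda>_pos a by simp
  from nn_bound_real[OF _ _ nn_integral_pk_le[OF a] this]
  show "integrable M (\<lambda>y. pk k e (x - y))" "(\<integral>y. pk k e (x - y) \<partial>M) \<le> cup s k * \<Lambda> * e powr (s - k)"
    by auto
qed

lemma nn_integral_near_le:
  assumes "0 < e" "a < s"
  shows "(\<integral>\<^sup>+y. indicator (ball x e) y * ennreal (norm (x - y) powr (-a)) \<partial>M) \<le> ennreal (cdn s a * \<Lambda> * e powr (s - a))"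
proof (rule nn_integral_le_ball_sum[where \<rho>="\<lambda>i. e/2^i" and c="\<lambda>i. 2 powr \<bar>a\<bar> * (e/2^i) powr (-a)" and m="\<lambda>i. \<Lambda> * (e/2^i) powr s"])
  fix y
  let ?f = "indicator (ball x e) y * ennreal (norm (x - y) powr (-a))"
  show "?f = 0 \<or> (\<exists>i::nat. y \<in> ball x (e/2^i) \<and> ?f \<le> ennreal (2 powr \<bar>a\<bar> * (e/2^i) powr (-a)))"
  \<comment> \<open>At the centre \<open>0 powr (-a)\<close> is 0 in HOL, so y = x contributes
    nothing and needs no ball.\<close>
  proof (cases "y \<in> ball x e \<and> y \<noteq> x")
    case True
    let ?n = "norm (x - y)"
    have n: "0 < ?n" "?n < e" using True by (auto simp: dist_norm)
    obtain N where "e / ?n < 2 ^ N" using real_arch_pow[of 2 "e / ?n"] by auto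
    then have N: "e/2^N < ?n" using n by (simp add: field_simps)
    define j where "j = (LEAST j::nat. e/2^j \<le> ?n)"
    have j: "e/2^j \<le> ?n" unfolding j_def by (rule LeastI[of _ N]) (use N in simp)
    then have "j \<noteq> 0" using n by (intro notI) simp
    then obtain i where i: "j = Suc i" by (cases j) auto
    have i2: "?n < e/2^i" using not_less_Least[of i "\<lambda>j. e/2^j \<le> ?n"] i j_def by auto
    define \<theta> where "\<theta> = ?n / (e/2^i)"
    have th: "1/2 \<le> \<theta>" "\<theta> < 1" "?n = \<theta> * (e/2^i)"
      using j i2 n i assms by (auto simp: \<theta>_def field_simps)
    have "\<theta> powr (-a) \<le> \<theta> powr (-\<bar>a\<bar>)" using th by (intro powr_mono') auto
    also have "\<dots> \<le> (1/2) powr (-\<bar>a\<bar>)" using th by (intro powr_mono2') auto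
    also have "\<dots> = 2 powr \<bar>a\<bar>" by (simp add: powr_divide powr_minus field_simps)
    finally have le: "\<theta> powr (-a) \<le> 2 powr \<bar>a\<bar>" .
    then have "?n powr (-a) \<le> 2 powr \<bar>a\<bar> * (e/2^i) powr (-a)"
    proof -
      have "?n powr (-a) = \<theta> powr (-a) * (e/2^i) powr (-a)"
        unfolding th(3) by (rule powr_mult)
      then show ?thesis using mult_right_mono[OF le, of "(e/2^i) powr (-a)"] by simp
    qed
    then have "?f \<le> ennreal (2 powr \<bar>a\<bar> * (e/2^i) powr (-a))"
      using True by (simp add: ennreal_leI)
    then show ?thesis using i2 by (intro disjI2 exI[of _ i]) (simp add: dist_norm)
  qed (auto simp: indicator_def)
next
  have "(\<lambda>i. 2 powr \<bar>a\<bar> * \<Lambda> * e powr (s - a) * (2 powr (a - s)) ^ i) sums (2 powr \<bar>a\<bar> * \<Lambda> * e powr (s - a) * (1 / (1 - 2 powr (a - s))))"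
    using assms by (intro sums_mult geometric_sums) (simp add: powr_less_one)
  also have "(\<lambda>i. 2 powr \<bar>a\<bar> * \<Lambda> * e powr (s - a) * (2 powr (a - s)) ^ i) = (\<lambda>i. (2 powr \<bar>a\<bar> * (e/2^i) powr (-a)) * (\<Lambda> * (e/2^i) powr s))"
  proof
    fix i
    have "(2 powr (a - s)) ^ i = (2^i) powr (a - s)"
      by (simp add: powr_powr mult.commute flip: powr_realpow)
    moreover have "(2^i) powr (a - s) = (2^i) powr a * (2^i) powr (-s)" "e powr (s - a) = e powr s * e powr (-a)"
      by (simp_all flip: powr_add)
    moreover have "(e/2^i) powr c = e powr c * (2^i) powr (-c)" for c
      by (simp add: powr_divide powr_minus_divide)
    ultimately show "2 powr \<bar>a\<bar> * \<Lambda> * e powr (s - a) * (2 powr (a - s)) ^ i = (2 powr \<bar>a\<bar> * (e/2^i) powr (-a)) * (\<Lambda> * (e/2^i) powr s)"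
      by (simp only: mult_ac minus_minus)
  qed
  finally show "(\<lambda>i. (2 powr \<bar>a\<bar> * (e/2^i) powr (-a)) * (\<Lambda> * (e/2^i) powr s)) sums (cdn s a * \<Lambda> * e powr (s - a))"
    by (simp add: cdn_def mult_ac)
next
  show "emeasure M (ball x (e/2^i)) \<le> ennreal (\<Lambda> * (e/2^i) powr s)" for i :: nat
    using assms by (intro growth) simp
qed (use \<Lambda>_pos in auto)

text \<open>Needed because \<open>W\<close> ignores the centre: a mass bound derived from it says
  nothing about an atom there.\<close>

lemma emeasure_singleton: "emeasure M {x} = 0"
proof -
  have *: "emeasure M {x} \<le> ennreal \<eta>" if "0 < \<eta>" for \<eta>
  proof -
    define r where "r = (\<eta> / \<Lambda>) powr (1/s)"
    have r: "0 < r" using that \<Lambda>_pos by (simp add: r_def)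
    have "emeasure M {x} \<le> emeasure M (ball x r)" using r by (intro emeasure_mono) auto
    also have "\<dots> \<le> ennreal (\<Lambda> * r powr s)" using r by (rule growth)
    also have "\<Lambda> * r powr s = \<eta>" using that \<Lambda>_pos s_pos by (simp add: r_def powr_powr)
    finally show ?thesis .
  qed
  have "emeasure M {x} \<le> 0"
  proof (rule ennreal_le_epsilon)
    show "emeasure M {x} \<le> 0 + ennreal e" if "0 < e" for e
      using *[OF that] by simp
  qed
  then show ?thesis by simp
qed

end

lemma norm_powr_le_pk:
  assumes "e \<le> norm x" "0 < e" "0 \<le> k"
  shows "norm x powr (-k) \<le> 2 powr (k/2) * pk k e x"
proof -
  have n: "0 < norm x" using assms by linarith
  have "e\<^sup>2 \<le> (norm x)\<^sup>2" using assms by (intro power_mono) auto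
  then have "(2 * (norm x)\<^sup>2) powr (-(k/2)) \<le> (e\<^sup>2 + (norm x)\<^sup>2) powr (-(k/2))"
    using assms n by (intro powr_mono2') (auto intro: add_pos_nonneg)
  moreover have "((norm x)\<^sup>2) powr (-(k/2)) = norm x powr (-k)"
    using n by (simp add: powr_powr flip: powr_numeral)
  ultimately have "2 powr (-(k/2)) * norm x powr (-k) \<le> pk k e x"
    by (simp add: powr_mult pk_def)
  then have "2 powr (k/2) * (2 powr (-(k/2)) * norm x powr (-k)) \<le> 2 powr (k/2) * pk k e x"
    by (rule mult_left_mono) simp
  moreover have "2 powr (k/2) * 2 powr (-(k/2)) = (1::real)" by (simp flip: powr_add)
  ultimately show ?thesis by (simp add: mult.assoc[symmetric])
qed

text \<open>The two summands come from |x - y| < e and |x - y| >= e in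
  \<open>nn_integral_kr_limit\<close>.\<close>

definition cj :: "real \<Rightarrow> real" where
  "cj s = cdn s (s - 1) + (s+1)/2 * 2 powr ((s+1)/2) * cup s (s+1)"

lemma cj_pos: "0 < s \<Longrightarrow> 0 < cj s"
  unfolding cj_def using cdn_pos[of "s-1" s] cup_pos[of s "s+1"]
  by (intro add_pos_nonneg mult_nonneg_nonneg) auto

section \<open>The renormalised potential: dependence on position and on scale\<close>

context growth_measure
begin

lemma kr_borel [measurable]: "kr s' e \<in> borel_measurable (borel :: 'a measure)"
  by (rule kr_measurable)

lemma integral_pk_nonneg: "0 \<le> (\<integral>y. pk k e (x - y) \<partial>M)"
  by (intro Bochner_Integration.integral_nonneg) auto

lemma integral_kr_trans:
  assumes "0 < e" "norm (x - x') \<le> D * e" "0 \<le> D"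
  shows "(\<integral>y. norm (kr s e (x - y) - kr s e (x' - y)) \<partial>M) \<le> ctd s D * norm (x - x') * (\<integral>y. pk (s+1) e (x - y) \<partial>M)"
    and "integrable M (\<lambda>y. kr s e (x - y) - kr s e (x' - y))"
proof -
  have int: "integrable M (\<lambda>y. ctd s D * norm (x - x') * pk (s+1) e (x - y))"
    using assms integrable_pk[of e "s+1" x] by (intro integrable_mult_right) auto
  have le: "norm (kr s e (x - y) - kr s e (x' - y)) \<le> ctd s D * norm (x - x') * pk (s+1) e (x - y)" for y
    using kr_trans_diff[of "x - y" "x' - y" D e s] assms s_pos by simp
  show i: "integrable M (\<lambda>y. kr s e (x - y) - kr s e (x' - y))"
    using le by (intro Bochner_Integration.integrable_bound[OF int]) (auto intro!: AE_I2 intro: order_trans[OF le abs_ge_self])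
  have "(\<integral>y. norm (kr s e (x - y) - kr s e (x' - y)) \<partial>M) \<le> (\<integral>y. ctd s D * norm (x - x') * pk (s+1) e (x - y) \<partial>M)"
    using le i int by (intro integral_mono) auto
  then show "(\<integral>y. norm (kr s e (x - y) - kr s e (x' - y)) \<partial>M) \<le> ctd s D * norm (x - x') * (\<integral>y. pk (s+1) e (x - y) \<partial>M)"
    by simp
qed

lemma integral_kr_trans_le:
  assumes "0 < e" "norm (x - x') \<le> D * e" "0 \<le> D"
  shows "(\<integral>y. norm (kr s e (x - y) - kr s e (x' - y)) \<partial>M) \<le> ctd s D * D * cup s (s+1) * \<Lambda>"
proof -
  have c: "0 \<le> ctd s D" using ctd_pos s_pos less_imp_le by blast
  have "(\<integral>y. norm (kr s e (x - y) - kr s e (x' - y)) \<partial>M) \<le> ctd s D * norm (x - x') * (\<integral>y. pk (s+1) e (x - y) \<partial>M)"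
    using assms by (intro integral_kr_trans)
  also have "\<dots> \<le> ctd s D * (D * e) * (cup s (s+1) * \<Lambda> * e powr (s - (s+1)))"
    using assms c by (intro mult_mono mult_nonneg_nonneg integral_pk_le integral_pk_nonneg) auto
  also have "e powr (s - (s+1)) = 1 / e" using assms by (simp add: powr_minus_divide)
  finally show ?thesis using assms by (simp add: mult_ac)
qed

lemma integral_kr_scale:
  assumes "0 < r" "r \<le> t"
  shows "(\<integral>y. norm (kr s r (x - y) - kr s t (x - y)) \<partial>M) \<le> (s+1)/2 * (t\<^sup>2 - r\<^sup>2) * (\<integral>y. pk (s+2) r (x - y) \<partial>M)"
    and "integrable M (\<lambda>y. kr s r (x - y) - kr s t (x - y))"
proof -
  have int: "integrable M (\<lambda>y. (s+1)/2 * (t\<^sup>2 - r\<^sup>2) * pk (s+2) r (x - y))"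
    using assms integrable_pk[of r "s+2" x] by (intro integrable_mult_right) auto
  have le: "norm (kr s r (x - y) - kr s t (x - y)) \<le> (s+1)/2 * (t\<^sup>2 - r\<^sup>2) * pk (s+2) r (x - y)" for y
    using assms s_pos by (intro kr_scale_diff)
  show i: "integrable M (\<lambda>y. kr s r (x - y) - kr s t (x - y))"
  proof (rule Bochner_Integration.integrable_bound[OF int])
    show "AE y in M. norm (kr s r (x - y) - kr s t (x - y)) \<le> norm ((s+1)/2 * (t\<^sup>2 - r\<^sup>2) * pk (s+2) r (x - y))"
      unfolding real_norm_def by (intro AE_I2 order_trans[OF le abs_ge_self])
  qed measurable
  have "(\<integral>y. norm (kr s r (x - y) - kr s t (x - y)) \<partial>M) \<le> (\<integral>y. (s+1)/2 * (t\<^sup>2 - r\<^sup>2) * pk (s+2) r (x - y) \<partial>M)"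
    using le i int by (intro integral_mono) auto
  then show "(\<integral>y. norm (kr s r (x - y) - kr s t (x - y)) \<partial>M) \<le> (s+1)/2 * (t\<^sup>2 - r\<^sup>2) * (\<integral>y. pk (s+2) r (x - y) \<partial>M)"
    by simp
qed

lemma integrable_kr_scale:
  assumes "0 < r" "0 < t"
  shows "integrable M (\<lambda>y. kr s r (x - y) - kr s t (x - y))"
proof (cases "r \<le> t")
  case False
  then have "integrable M (\<lambda>y. kr s t (x - y) - kr s r (x - y))" using assms by (intro integral_kr_scale) auto
  from integrable_minus[OF this] show ?thesis by simp
qed (use assms integral_kr_scale in auto)

text \<open>The integral of \<open>kr s e (x - y)\<close> alone diverges in general; subtracting \<open>kr s 1 (- y)\<close> changes \<open>V\<close> by a
  formal constant that depends neither on \<open>e\<close> nor on \<open>x\<close>.\<close>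

definition V :: "real \<Rightarrow> 'a \<Rightarrow> 'a" where
  "V e x = (\<integral>y. kr s e (x - y) - kr s 1 (- y) \<partial>M)"

lemma integrable_V:
  assumes "0 < e"
  shows "integrable M (\<lambda>y. kr s e (x - y) - kr s 1 (- y))"
proof -
  have "integrable M (\<lambda>y. (kr s e (x - y) - kr s 1 (x - y)) + (kr s 1 (x - y) - kr s 1 (0 - y)))"
    using assms by (intro Bochner_Integration.integrable_add integrable_kr_scale
        integral_kr_trans(2)[where D="norm x"]) auto
  then show ?thesis by simp
qed

lemma V_diff:
  assumes "0 < e" "0 < e'"
  shows "V e x - V e' x' = (\<integral>y. kr s e (x - y) - kr s e' (x' - y) \<partial>M)"
  unfolding V_def
  by (subst Bochner_Integration.integral_diff[symmetric, OF integrable_V[OF assms(1)] integrable_V[OF assms(2)]]) simp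

lemma V_trans:
  assumes "0 < e" "norm (x - x') \<le> D * e" "0 \<le> D"
  shows "norm (V e x - V e x') \<le> ctd s D * norm (x - x') * (\<integral>y. pk (s+1) e (x - y) \<partial>M)"
    and "norm (V e x - V e x') \<le> ctd s D * D * cup s (s+1) * \<Lambda>"
proof -
  have *: "norm (V e x - V e x') \<le> (\<integral>y. norm (kr s e (x - y) - kr s e (x' - y)) \<partial>M)"
    unfolding V_diff[OF assms(1,1)] by (rule integral_norm_bound)
  show "norm (V e x - V e x') \<le> ctd s D * norm (x - x') * (\<integral>y. pk (s+1) e (x - y) \<partial>M)"
    using integral_kr_trans(1)[OF assms] * by linarith
  show "norm (V e x - V e x') \<le> ctd s D * D * cup s (s+1) * \<Lambda>"
    using integral_kr_trans_le[OF assms] * by linarith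
qed

lemma V_scale:
  assumes "0 < r" "r \<le> t"
  shows "norm (V r x - V t x) \<le> (s+1)/2 * (t\<^sup>2 - r\<^sup>2) * (\<integral>y. pk (s+2) r (x - y) \<partial>M)"
proof -
  have "norm (V r x - V t x) \<le> (\<integral>y. norm (kr s r (x - y) - kr s t (x - y)) \<partial>M)"
    using assms by (subst V_diff) (auto intro: integral_norm_bound)
  then show ?thesis using integral_kr_scale(1)[OF assms] by (rule order_trans)
qed

lemma V_measurable [measurable]: "V e \<in> borel_measurable borel"
proof -
  have "(\<lambda>x. \<integral>y. kr s e (x - y) - kr s 1 (- y) \<partial>M) \<in> borel_measurable borel"
    by measurable
  then show ?thesis unfolding V_def .
qed

lemma ball_sets_M [measurable]: "ball x r \<in> sets M" "cball x r \<in> sets M"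
  by simp_all

text \<open>The factor |x - y| stands for the Lipschitz increment of a test function. It lowers the
  singularity to |x - y|^(-(s-1)) inside the ball of radius e and leaves e^2 |x - y|^(-(s+1))
  outside; against growth s both contribute order e.\<close>

lemma nn_integral_kr_limit:
  assumes "0 < e"
  shows "(\<integral>\<^sup>+y. ennreal (norm (x - y) * norm (kr s e (x - y) - kr s 0 (x - y))) \<partial>M) \<le> ennreal (cj s * \<Lambda> * e)"
proof -
  have pt: "ennreal (norm w * norm (kr s e w - kr s 0 w)) \<le>
      indicator (ball 0 e) w * ennreal (norm w powr (-(s-1))) + ennreal ((s+1)/2 * e\<^sup>2 * 2 powr ((s+1)/2)) * ennreal (pk (s+1) e w)" for w :: 'a
  proof (cases "w = 0")
    case False
    then have n: "0 < norm w" by simp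
    have nw: "norm w * norm w powr c = norm w powr (1 + c)" for c using n by (simp add: powr_add)
    show ?thesis
    proof (cases "norm w < e")
      case True
      have "norm w * norm (kr s e w - kr s 0 w) \<le> norm w * norm w powr (-s)"
        using False assms s_pos by (intro mult_left_mono kr_limit_diff) auto
      also have "\<dots> = norm w powr (-(s-1))" unfolding nw by simp
      finally show ?thesis using True by (intro add_increasing2) (auto intro: ennreal_leI)
    next
      case big: False
      have "norm w * norm (kr s e w - kr s 0 w) \<le> norm w * ((s+1)/2 * e\<^sup>2 * norm w powr (-s-2))"
        using False assms s_pos by (intro mult_left_mono kr_limit_diff) auto
      also have "\<dots> = (s+1)/2 * e\<^sup>2 * (norm w * norm w powr (-s-2))" by simp
      also have "norm w * norm w powr (-s-2) = norm w powr (-(s+1))" unfolding nw by (rule arg_cong[of _ _ "(powr) (norm w)"]) simp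
      also have "(s+1)/2 * e\<^sup>2 * norm w powr (-(s+1)) \<le> (s+1)/2 * e\<^sup>2 * (2 powr ((s+1)/2) * pk (s+1) e w)"
        using big assms s_pos by (intro mult_left_mono norm_powr_le_pk) auto
      finally have "ennreal (norm w * norm (kr s e w - kr s 0 w)) \<le> ennreal ((s+1)/2 * e\<^sup>2 * 2 powr ((s+1)/2) * pk (s+1) e w)"
        by (intro ennreal_leI) (simp add: mult_ac)
      also have "\<dots> = ennreal ((s+1)/2 * e\<^sup>2 * 2 powr ((s+1)/2)) * ennreal (pk (s+1) e w)"
        using s_pos by (intro ennreal_mult) auto
      finally show ?thesis by (intro add_increasing) auto
    qed
  qed simp
  have "(\<integral>\<^sup>+y. ennreal (norm (x - y) * norm (kr s e (x - y) - kr s 0 (x - y))) \<partial>M) \<le>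
     (\<integral>\<^sup>+y. indicator (ball x e) y * ennreal (norm (x - y) powr (-(s-1))) + ennreal ((s+1)/2 * e\<^sup>2 * 2 powr ((s+1)/2)) * ennreal (pk (s+1) e (x - y)) \<partial>M)"
    by (intro nn_integral_mono order_trans[OF pt]) (auto simp: dist_norm indicator_def norm_minus_commute)
  also have "\<dots> = (\<integral>\<^sup>+y. indicator (ball x e) y * ennreal (norm (x - y) powr (-(s-1))) \<partial>M) + ennreal ((s+1)/2 * e\<^sup>2 * 2 powr ((s+1)/2)) * (\<integral>\<^sup>+y. ennreal (pk (s+1) e (x - y)) \<partial>M)"
    by (subst nn_integral_add) (measurable, simp add: nn_integral_cmult)
  also have "\<dots> \<le> ennreal (cdn s (s-1) * \<Lambda> * e powr (s - (s-1))) + ennreal ((s+1)/2 * e\<^sup>2 * 2 powr ((s+1)/2)) * ennreal (cup s (s+1) * \<Lambda> * e powr (s - (s+1)))"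
    using assms by (intro add_mono mult_left_mono nn_integral_near_le nn_integral_pk_le) auto
  also have "\<dots> = ennreal (cdn s (s-1) * \<Lambda> * e powr (s - (s-1)) + (s+1)/2 * e\<^sup>2 * 2 powr ((s+1)/2) * (cup s (s+1) * \<Lambda> * e powr (s - (s+1))))"
    using cdn_pos[of "s-1" s] cup_pos[of s "s+1"] s_pos \<Lambda>_pos
    by (simp add: ennreal_plus[symmetric] ennreal_mult[symmetric] del: ennreal_plus)
  also have "cdn s (s-1) * \<Lambda> * e powr (s - (s-1)) + (s+1)/2 * e\<^sup>2 * 2 powr ((s+1)/2) * (cup s (s+1) * \<Lambda> * e powr (s - (s+1))) = cj s * \<Lambda> * e"
    using assms by (simp add: cj_def powr_minus_divide power2_eq_square) (simp add: field_simps)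
  finally show ?thesis .
qed

text \<open>Away from the diagonal the decay s + 2 suffices without a Lipschitz factor; the unit
  ball is left to \<open>W\<close>.\<close>

lemma nn_integral_kr_limit_far:
  "(\<integral>\<^sup>+y. indicator (- ball x 1) y * ennreal (norm (kr s 1 (x - y) - kr s 0 (x - y))) \<partial>M) \<le> ennreal ((s+1)/2 * 2 powr ((s+2)/2) * cup s (s+2) * \<Lambda>)"
proof -
  have pt: "indicator (- ball x 1) y * ennreal (norm (kr s 1 (x - y) - kr s 0 (x - y))) \<le> ennreal ((s+1)/2 * 2 powr ((s+2)/2)) * ennreal (pk (s+2) 1 (x - y))" for y
  proof (cases "y \<in> ball x 1")
    case False
    let ?w = "x - y"
    have n: "1 \<le> norm ?w" using False by (simp add: dist_norm)
    then have "?w \<noteq> 0" by auto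
    then have "norm (kr s 1 ?w - kr s 0 ?w) \<le> (s+1)/2 * 1\<^sup>2 * norm ?w powr (-s-2)"
      using s_pos by (intro kr_limit_diff) auto
    also have "- s - 2 = -(s+2)" by simp
    also have "(s+1)/2 * 1\<^sup>2 * norm ?w powr (-(s+2)) \<le> (s+1)/2 * 1\<^sup>2 * (2 powr ((s+2)/2) * pk (s+2) 1 ?w)"
      using n s_pos by (intro mult_left_mono norm_powr_le_pk) auto
    finally have "ennreal (norm (kr s 1 ?w - kr s 0 ?w)) \<le> ennreal ((s+1)/2 * 2 powr ((s+2)/2) * pk (s+2) 1 ?w)"
      by (intro ennreal_leI) (simp add: mult_ac)
    also have "\<dots> = ennreal ((s+1)/2 * 2 powr ((s+2)/2)) * ennreal (pk (s+2) 1 ?w)"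
      using s_pos by (intro ennreal_mult) auto
    finally show ?thesis using False by simp
  qed simp
  have "(\<integral>\<^sup>+y. indicator (- ball x 1) y * ennreal (norm (kr s 1 (x - y) - kr s 0 (x - y))) \<partial>M) \<le> (\<integral>\<^sup>+y. ennreal ((s+1)/2 * 2 powr ((s+2)/2)) * ennreal (pk (s+2) 1 (x - y)) \<partial>M)"
    by (intro nn_integral_mono pt)
  also have "\<dots> = ennreal ((s+1)/2 * 2 powr ((s+2)/2)) * (\<integral>\<^sup>+y. ennreal (pk (s+2) 1 (x - y)) \<partial>M)"
    by (intro nn_integral_cmult) measurable
  also have "\<dots> \<le> ennreal ((s+1)/2 * 2 powr ((s+2)/2)) * ennreal (cup s (s+2) * \<Lambda> * 1 powr (s - (s+2)))"
    by (intro mult_left_mono nn_integral_pk_le) auto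
  also have "\<dots> = ennreal ((s+1)/2 * 2 powr ((s+2)/2) * cup s (s+2) * \<Lambda>)"
    using s_pos \<Lambda>_pos cup_pos[of s "s+2"] by (simp add: ennreal_mult[symmetric] mult_ac)
  finally show ?thesis .
qed

end

section \<open>Averages of V for a reflectionless measure\<close>

lemma riesz_kernel_eq_kr: "riesz_kernel s x = kr s 0 x"
proof (cases "x = 0")
  case False
  then have "((norm x)\<^sup>2) powr (-((s+1)/2)) = norm x powr (2 * (-((s+1)/2)))"
    by (subst powr_powr[symmetric]) simp
  also have "2 * (-((s+1)/2)) = -(s+1)" by (simp add: field_simps)
  finally have "((norm x)\<^sup>2) powr (-((s+1)/2)) = norm x powr (-(s+1))" .
  then show ?thesis
    by (simp add: riesz_kernel_def kr_def pk_def powr_minus[symmetric])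
qed (simp add: riesz_kernel_def)

lemma norm_kr_0: "x \<noteq> 0 \<Longrightarrow> norm (kr s 0 x) = norm x powr (-s)"
  unfolding riesz_kernel_eq_kr[symmetric] riesz_kernel_def
  by (simp add: powr_add powr_minus field_simps)

lemma riesz_kernel_trunc_measurable [measurable]:
  "riesz_kernel_trunc s e \<in> borel_measurable (borel :: 'a::euclidean_space measure)"
  unfolding riesz_kernel_trunc_def by measurable

lemma riesz_kernel_trunc_minus: "riesz_kernel_trunc s e (- x) = - riesz_kernel_trunc s e x"
  by (simp add: riesz_kernel_trunc_def)

text \<open>The first bound, for a fixed truncation, justifies symmetrising; the second, uniform in
  the truncation, is the domination for the limit.\<close>

lemma norm_riesz_kernel_trunc_le:
  assumes "0 < s" "0 < e"
  shows "norm (riesz_kernel_trunc s e x) \<le> e powr (-s)"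
    and "norm (riesz_kernel_trunc s e x) \<le> norm (kr s 0 x)"
proof -
  let ?m = "max e (norm x)"
  have m: "0 < ?m" "norm x \<le> ?m" "e \<le> ?m" using assms by auto
  have "norm (riesz_kernel_trunc s e x) = norm x * ?m powr (-(s+1))"
    unfolding riesz_kernel_trunc_def norm_scaleR powr_minus by simp
  also have "\<dots> \<le> ?m * ?m powr (-(s+1))" using m by (intro mult_right_mono) auto
  also have "\<dots> = ?m powr (1 + (-(s+1)))" unfolding powr_add using m by simp
  also have "\<dots> = ?m powr (-s)" by simp
  also have "\<dots> \<le> e powr (-s)" using m assms by (intro powr_mono2') auto
  finally show "norm (riesz_kernel_trunc s e x) \<le> e powr (-s)" .
  show "norm (riesz_kernel_trunc s e x) \<le> norm (kr s 0 x)"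
  proof (cases "x = 0")
    case False
    have "norm (riesz_kernel_trunc s e x) = norm x * ?m powr (-(s+1))"
      unfolding riesz_kernel_trunc_def norm_scaleR powr_minus by simp
    also have "\<dots> \<le> norm x * norm x powr (-(s+1))"
      using False assms by (intro mult_left_mono powr_mono2') auto
    also have "\<dots> = norm x powr (1 + (-(s+1)))" unfolding powr_add using False by simp
    also have "\<dots> = norm (kr s 0 x)" using norm_kr_0[OF False] by simp
    finally show ?thesis .
  qed (simp add: riesz_kernel_trunc_def)
qed

lemma riesz_kernel_trunc_eq: "0 < e \<Longrightarrow> e \<le> norm x \<Longrightarrow> riesz_kernel_trunc s e x = kr s 0 x"
  unfolding riesz_kernel_eq_kr[symmetric] by (simp add: riesz_kernel_trunc_def riesz_kernel_def max_def)

section \<open>Symmetrisation of odd kernels and the pairing with test functions\<close>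

context sigma_finite_measure
begin

text \<open>Swapping x and y and averaging replaces \<psi>(x) by half of \<psi>(x) - \<psi>(y). For
  Lipschitz \<psi> the symmetrised integrand tolerates kernels as singular as \<open>kr s 0\<close>.
  Inner integrability is asked only where \<psi> does not vanish, because for the kernels used later
  it is known only there.\<close>

lemma antisym_integral:
  fixes G :: "'a \<Rightarrow> 'a \<Rightarrow> 'b::{banach, second_countable_topology}" and \<psi> :: "'a \<Rightarrow> real"
  assumes anti: "\<And>x y. G y x = - G x y"
    and int: "integrable (M \<Otimes>\<^sub>M M) (\<lambda>(x,y). \<psi> x *\<^sub>R G x y)"
    and inner: "\<And>x. \<psi> x \<noteq> 0 \<Longrightarrow> integrable M (G x)"
  shows "integrable (M \<Otimes>\<^sub>M M) (\<lambda>(x,y). (\<psi> x - \<psi> y) *\<^sub>R G x y)"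
    and "(\<integral>x. \<psi> x *\<^sub>R (\<integral>y. G x y \<partial>M) \<partial>M) = (1/2) *\<^sub>R (\<integral>(x,y). (\<psi> x - \<psi> y) *\<^sub>R G x y \<partial>(M \<Otimes>\<^sub>M M))"
proof -
  interpret P: pair_sigma_finite M M ..
  let ?F = "\<lambda>(x,y). \<psi> x *\<^sub>R G x y"
  have sw: "integrable (M \<Otimes>\<^sub>M M) (\<lambda>(x,y). ?F (y,x))"
    by (rule P.integrable_product_swap[OF int])
  have sweq: "(\<integral>(x,y). ?F (y,x) \<partial>(M \<Otimes>\<^sub>M M)) = (\<integral>p. ?F p \<partial>(M \<Otimes>\<^sub>M M))"
    using int by (intro P.integral_product_swap) auto
  have eq: "(\<lambda>(x,y). (\<psi> x - \<psi> y) *\<^sub>R G x y) = (\<lambda>p. ?F p + (\<lambda>(x,y). ?F (y,x)) p)"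
  proof
    fix p :: "'a \<times> 'a"
    obtain x y where "p = (x,y)" by (cases p)
    then show "(\<lambda>(x,y). (\<psi> x - \<psi> y) *\<^sub>R G x y) p = ?F p + (\<lambda>(x,y). ?F (y,x)) p"
      by (simp only: prod.case anti[of x y]) (simp add: scaleR_diff_left)
  qed
  show "integrable (M \<Otimes>\<^sub>M M) (\<lambda>(x,y). (\<psi> x - \<psi> y) *\<^sub>R G x y)"
    unfolding eq by (intro Bochner_Integration.integrable_add int sw)
  have A: "(\<integral>(x,y). (\<psi> x - \<psi> y) *\<^sub>R G x y \<partial>(M \<Otimes>\<^sub>M M)) = (\<integral>p. ?F p \<partial>(M \<Otimes>\<^sub>M M)) + (\<integral>p. ?F p \<partial>(M \<Otimes>\<^sub>M M))"
    unfolding eq Bochner_Integration.integral_add[OF int sw] sweq ..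
  have B: "(\<integral>p. ?F p \<partial>(M \<Otimes>\<^sub>M M)) = (\<integral>x. \<integral>y. ?F (x,y) \<partial>M \<partial>M)"
    by (rule P.integral_fst'[OF int, symmetric])
  have C: "(\<integral>x. \<integral>y. ?F (x,y) \<partial>M \<partial>M) = (\<integral>x. \<psi> x *\<^sub>R (\<integral>y. G x y \<partial>M) \<partial>M)"
    using inner by (intro Bochner_Integration.integral_cong) auto
  show "(\<integral>x. \<psi> x *\<^sub>R (\<integral>y. G x y \<partial>M) \<partial>M) = (1/2) *\<^sub>R (\<integral>(x,y). (\<psi> x - \<psi> y) *\<^sub>R G x y \<partial>(M \<Otimes>\<^sub>M M))"
    unfolding A unfolding scaleR_half_double using B C by (simp only:)
qed

lemma nn_integral_pair_fst:
  assumes "(\<lambda>(x,y). f x y) \<in> borel_measurable (M \<Otimes>\<^sub>M M)"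
  shows "(\<integral>\<^sup>+(x,y). f x y \<partial>(M \<Otimes>\<^sub>M M)) = (\<integral>\<^sup>+x. \<integral>\<^sup>+y. f x y \<partial>M \<partial>M)"
  using nn_integral_fst[OF assms] by simp

lemma nn_integral_pair_snd:
  assumes "(\<lambda>(x,y). f x y) \<in> borel_measurable (M \<Otimes>\<^sub>M M)"
  shows "(\<integral>\<^sup>+(x,y). f x y \<partial>(M \<Otimes>\<^sub>M M)) = (\<integral>\<^sup>+y. \<integral>\<^sup>+x. f x y \<partial>M \<partial>M)"
proof -
  interpret P: pair_sigma_finite M M ..
  show ?thesis using P.nn_integral_snd[OF assms] by simp
qed

lemma integrable_pair_bound:
  fixes f :: "'c \<times> 'a \<Rightarrow> 'b::{banach, second_countable_topology}"
  assumes [measurable]: "f \<in> borel_measurable (N \<Otimes>\<^sub>M M)"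
    and "\<And>x. (\<integral>\<^sup>+y. ennreal (norm (f (x,y))) \<partial>M) \<le> ennreal C * indicator A x"
    and A: "A \<in> sets N" "emeasure N A < \<infinity>"
  shows "integrable (N \<Otimes>\<^sub>M M) f"
proof (rule integrableI_bounded)
  have "(\<integral>\<^sup>+p. ennreal (norm (f p)) \<partial>(N \<Otimes>\<^sub>M M)) = (\<integral>\<^sup>+x. \<integral>\<^sup>+y. ennreal (norm (f (x,y))) \<partial>M \<partial>N)"
    by (rule nn_integral_fst[symmetric]) measurable
  also have "\<dots> \<le> (\<integral>\<^sup>+x. ennreal C * indicator A x \<partial>N)"
    by (intro nn_integral_mono assms(2))
  also have "\<dots> = ennreal C * emeasure N A" using A by (simp add: nn_integral_cmult_indicator)
  also have "\<dots> < \<infinity>" using A by (simp add: ennreal_mult_less_top)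
  finally show "(\<integral>\<^sup>+p. ennreal (norm (f p)) \<partial>(N \<Otimes>\<^sub>M M)) < \<infinity>" .
qed fact

end

text \<open>The number \<open>L\<close> is a Lipschitz constant of \<open>\<psi>\<close>, and \<open>cball c \<rho>\<close> carries \<open>\<psi>\<close>.\<close>

definition lipc :: "real \<Rightarrow> ('a::euclidean_space \<Rightarrow> real) \<Rightarrow> 'a \<Rightarrow> real \<Rightarrow> bool" where
  "lipc L \<psi> c \<rho> \<longleftrightarrow> L-lipschitz_on UNIV \<psi> \<and> (\<forall>x. x \<notin> cball c \<rho> \<longrightarrow> \<psi> x = 0)"

lemma lipc_meas: "lipc L \<psi> c \<rho> \<Longrightarrow> \<psi> \<in> borel_measurable borel"
  unfolding lipc_def by (auto intro: borel_measurable_continuous_onI lipschitz_on_continuous_on)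

lemma lipc_bounded:
  assumes "lipc L \<psi> c \<rho>"
  obtains B where "0 < B" "\<And>x. \<bar>\<psi> x\<bar> \<le> B"
proof -
  have "compact (\<psi> ` cball c \<rho>)"
    using assms unfolding lipc_def
    by (intro compact_continuous_image) (auto intro: lipschitz_on_continuous_on lipschitz_on_subset)
  then obtain B where B: "0 < B" "\<forall>y\<in>\<psi> ` cball c \<rho>. norm y \<le> B"
    using compact_imp_bounded bounded_pos by blast
  have "\<bar>\<psi> x\<bar> \<le> B" for x using B assms unfolding lipc_def by (cases "x \<in> cball c \<rho>") auto
  with B show ?thesis by (intro that) auto
qed

lemma lipc_diff_le: "lipc L \<psi> c \<rho> \<Longrightarrow> \<bar>\<psi> x - \<psi> y\<bar> \<le> L * norm (x - y)"
  unfolding lipc_def lipschitz_on_def by (auto simp: dist_norm)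

lemma lipc_nonneg: "lipc L \<psi> c \<rho> \<Longrightarrow> 0 \<le> L"
  unfolding lipc_def lipschitz_on_def by auto

context growth_measure
begin

lemma lipc_borel: "lipc L \<psi> c \<rho> \<Longrightarrow> \<psi> \<in> borel_measurable M"
  using lipc_meas by (simp cong: measurable_cong_sets)

lemma finite_balls: "emeasure M (cball c \<rho>) < \<infinity>" "emeasure M (ball c \<rho>) < \<infinity>"
  by (auto intro: emeasure_bounded_finite[simplified])

lemma integrable_lipc_scaleR:
  fixes f :: "'a \<Rightarrow> 'b::{banach, second_countable_topology}"
  assumes "lipc L \<psi> c \<rho>" and f: "f \<in> borel_measurable M" "\<And>x. x \<in> cball c \<rho> \<Longrightarrow> norm (f x) \<le> C"
  shows "integrable M (\<lambda>x. \<psi> x *\<^sub>R f x)"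
proof -
  obtain B where B: "0 < B" "\<And>x. \<bar>\<psi> x\<bar> \<le> B" using lipc_bounded[OF assms(1)] by blast
  have [measurable]: "\<psi> \<in> borel_measurable M" using assms(1) by (rule lipc_borel)
  have int: "integrable M (\<lambda>x. (B * C) * indicator (cball c \<rho>) x)"
    using finite_balls by (intro integrable_mult_right integrable_real_indicator) auto
  show ?thesis
  proof (rule Bochner_Integration.integrable_bound[OF int])
    show "AE x in M. norm (\<psi> x *\<^sub>R f x) \<le> norm (B * C * indicator (cball c \<rho>) x)"
    proof (rule AE_I2)
      fix x
      show "norm (\<psi> x *\<^sub>R f x) \<le> norm (B * C * indicator (cball c \<rho>) x)"
      proof (cases "x \<in> cball c \<rho>")
        case True
        then have "\<bar>\<psi> x\<bar> * norm (f x) \<le> B * C" using B f by (intro mult_mono) auto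
        then show ?thesis using True by (auto intro: order_trans[OF _ abs_ge_self])
      next
        case False then show ?thesis using assms(1) by (auto simp: lipc_def)
      qed
    qed
  qed (use f in measurable)
qed

lemma integrable_lipc: "lipc L \<psi> c \<rho> \<Longrightarrow> integrable M \<psi>"
  using integrable_lipc_scaleR[of L \<psi> c \<rho> "\<lambda>_. 1 :: real" 1] by simp

text \<open>The correction between the regularised and the singular kernel. Its size at the diagonal
  is |x - y|^(-s), so a Lipschitz factor has to accompany it.\<close>

definition J :: "real \<Rightarrow> 'a \<Rightarrow> 'a \<Rightarrow> 'a" where
  "J e x y = kr s e (x - y) - kr s 0 (x - y)"

lemma J_anti: "J e y x = - J e x y"
proof -
  have "y - x = - (x - y)" by simp
  then show ?thesis unfolding J_def by (simp only: kr_minus) simp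
qed

lemma J_meas [measurable]: "(\<lambda>(x,y). J e x y) \<in> borel_measurable (M \<Otimes>\<^sub>M M)"
  unfolding J_def by measurable

lemma nn_integral_J_pair:
  assumes "0 < e"
  shows "(\<integral>\<^sup>+(x,y). indicator (cball c \<rho>) x * ennreal (norm (x - y) * norm (J e x y)) \<partial>(M \<Otimes>\<^sub>M M)) \<le> ennreal (cj s * \<Lambda> * e * measure M (cball c \<rho>))"
    and "(\<integral>\<^sup>+(x,y). indicator (cball c \<rho>) y * ennreal (norm (x - y) * norm (J e x y)) \<partial>(M \<Otimes>\<^sub>M M)) \<le> ennreal (cj s * \<Lambda> * e * measure M (cball c \<rho>))"
proof -
  have C: "0 \<le> cj s * \<Lambda> * e" using cj_pos[OF s_pos] \<Lambda>_pos assms by simp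
  have 1: "(\<integral>\<^sup>+x. \<integral>\<^sup>+y. indicator (cball c \<rho>) x * ennreal (norm (x - y) * norm (J e x y)) \<partial>M \<partial>M) \<le> ennreal (cj s * \<Lambda> * e * measure M (cball c \<rho>))"
  proof -
    have "(\<integral>\<^sup>+x. \<integral>\<^sup>+y. indicator (cball c \<rho>) x * ennreal (norm (x - y) * norm (J e x y)) \<partial>M \<partial>M)
       = (\<integral>\<^sup>+x. indicator (cball c \<rho>) x * (\<integral>\<^sup>+y. ennreal (norm (x - y) * norm (J e x y)) \<partial>M) \<partial>M)"
      by (intro nn_integral_cong nn_integral_cmult) (simp add: J_def)
    also have "\<dots> \<le> (\<integral>\<^sup>+x. ennreal (cj s * \<Lambda> * e) * indicator (cball c \<rho>) x \<partial>M)"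
      unfolding J_def using assms by (intro nn_integral_mono) (auto simp: indicator_def intro: nn_integral_kr_limit)
    also have "\<dots> = ennreal (cj s * \<Lambda> * e) * emeasure M (cball c \<rho>)"
      by (intro nn_integral_cmult_indicator) simp
    also have "\<dots> = ennreal (cj s * \<Lambda> * e) * ennreal (measure M (cball c \<rho>))"
      using finite_balls(1)[of c \<rho>] by (simp add: emeasure_eq_ennreal_measure)
    also have "\<dots> = ennreal (cj s * \<Lambda> * e * measure M (cball c \<rho>))"
      using C by (simp add: ennreal_mult)
    finally show ?thesis .
  qed
  show "(\<integral>\<^sup>+(x,y). indicator (cball c \<rho>) x * ennreal (norm (x - y) * norm (J e x y)) \<partial>(M \<Otimes>\<^sub>M M)) \<le> ennreal (cj s * \<Lambda> * e * measure M (cball c \<rho>))"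
    by (rule order_trans[OF eq_refl[OF nn_integral_pair_fst] 1]) measurable
  have sym: "norm (x - y) * norm (J e x y) = norm (y - x) * norm (J e y x)" for x y
    using J_anti[of e y x] by (simp add: norm_minus_commute)
  have "(\<integral>\<^sup>+(x,y). indicator (cball c \<rho>) y * ennreal (norm (x - y) * norm (J e x y)) \<partial>(M \<Otimes>\<^sub>M M)) =
     (\<integral>\<^sup>+y. \<integral>\<^sup>+x. indicator (cball c \<rho>) y * ennreal (norm (x - y) * norm (J e x y)) \<partial>M \<partial>M)"
    by (rule nn_integral_pair_snd) measurable
  also have "\<dots> = (\<integral>\<^sup>+x. \<integral>\<^sup>+y. indicator (cball c \<rho>) x * ennreal (norm (x - y) * norm (J e x y)) \<partial>M \<partial>M)"
    by (subst sym) simp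
  finally show "(\<integral>\<^sup>+(x,y). indicator (cball c \<rho>) y * ennreal (norm (x - y) * norm (J e x y)) \<partial>(M \<Otimes>\<^sub>M M)) \<le> ennreal (cj s * \<Lambda> * e * measure M (cball c \<rho>))"
    using 1 by simp
qed

text \<open>A pair contributes only if one of its points lies in the carrier, and the Lipschitz
  increment provides the factor |x - y| required by \<open>nn_integral_kr_limit\<close>. This is the
  origin of the error L e times the mass of the carrier in all averages of V.\<close>

lemma pair_J_bound:
  assumes "0 < e" "lipc L \<psi> c \<rho>"
  shows "integrable (M \<Otimes>\<^sub>M M) (\<lambda>(x,y). (\<psi> x - \<psi> y) *\<^sub>R J e x y)"
    and "norm (\<integral>(x,y). (\<psi> x - \<psi> y) *\<^sub>R J e x y \<partial>(M \<Otimes>\<^sub>M M)) \<le> 2 * (cj s * \<Lambda> * L * e * measure M (cball c \<rho>))"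
proof -
  have [measurable]: "\<psi> \<in> borel_measurable M" using assms(2) by (rule lipc_borel)
  have L: "0 \<le> L" using assms lipc_nonneg by blast
  let ?C = "cj s * \<Lambda> * e * measure M (cball c \<rho>)"
  have C: "0 \<le> ?C" using cj_pos[OF s_pos] \<Lambda>_pos assms by simp
  let ?k = "\<lambda>x y. ennreal (norm (x - y) * norm (J e x y))"
  have pt: "ennreal (norm ((\<psi> x - \<psi> y) *\<^sub>R J e x y)) \<le> ennreal L * (indicator (cball c \<rho>) x * ?k x y + indicator (cball c \<rho>) y * ?k x y)" for x y
  proof (cases "x \<in> cball c \<rho> \<or> y \<in> cball c \<rho>")
    case True
    have "norm ((\<psi> x - \<psi> y) *\<^sub>R J e x y) \<le> L * norm (x - y) * norm (J e x y)"
      using lipc_diff_le[OF assms(2), of x y] by (simp add: mult_right_mono)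
    then have "ennreal (norm ((\<psi> x - \<psi> y) *\<^sub>R J e x y)) \<le> ennreal (L * (norm (x - y) * norm (J e x y)))"
      by (intro ennreal_leI) (simp add: mult_ac)
    also have "\<dots> = ennreal L * ?k x y" using L by (intro ennreal_mult) auto
    also have "\<dots> \<le> ennreal L * (indicator (cball c \<rho>) x * ?k x y + indicator (cball c \<rho>) y * ?k x y)"
      using True by (intro mult_left_mono) (auto simp: indicator_def)
    finally show ?thesis .
  next
    case False
    then show ?thesis using assms(2) by (simp add: lipc_def)
  qed
  have "(\<integral>\<^sup>+p. ennreal (norm ((\<lambda>(x,y). (\<psi> x - \<psi> y) *\<^sub>R J e x y) p)) \<partial>(M \<Otimes>\<^sub>M M)) \<le>
     (\<integral>\<^sup>+p. ennreal L * ((\<lambda>(x,y). indicator (cball c \<rho>) x * ?k x y) p + (\<lambda>(x,y). indicator (cball c \<rho>) y * ?k x y) p) \<partial>(M \<Otimes>\<^sub>M M))"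
    using pt by (intro nn_integral_mono) (auto split: prod.split)
  also have "\<dots> = ennreal L * (\<integral>\<^sup>+p. (\<lambda>(x,y). indicator (cball c \<rho>) x * ?k x y) p + (\<lambda>(x,y). indicator (cball c \<rho>) y * ?k x y) p \<partial>(M \<Otimes>\<^sub>M M))"
    by (intro nn_integral_cmult) measurable
  also have "\<dots> = ennreal L * ((\<integral>\<^sup>+p. (\<lambda>(x,y). indicator (cball c \<rho>) x * ?k x y) p \<partial>(M \<Otimes>\<^sub>M M)) + (\<integral>\<^sup>+p. (\<lambda>(x,y). indicator (cball c \<rho>) y * ?k x y) p \<partial>(M \<Otimes>\<^sub>M M)))"
    by (intro arg_cong[of _ _ "\<lambda>t. ennreal L * t"] nn_integral_add) measurable
  also have "\<dots> \<le> ennreal L * (ennreal ?C + ennreal ?C)"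
    using assms by (intro mult_left_mono add_mono nn_integral_J_pair) auto
  also have "\<dots> = ennreal (2 * (cj s * \<Lambda> * L * e * measure M (cball c \<rho>)))"
    using C L by (simp add: ennreal_plus[symmetric] ennreal_mult[symmetric] mult_ac del: ennreal_plus)
  finally have *: "(\<integral>\<^sup>+p. ennreal (norm ((\<lambda>(x,y). (\<psi> x - \<psi> y) *\<^sub>R J e x y) p)) \<partial>(M \<Otimes>\<^sub>M M)) \<le> ennreal (2 * (cj s * \<Lambda> * L * e * measure M (cball c \<rho>)))" .
  have C2: "0 \<le> 2 * (cj s * \<Lambda> * L * e * measure M (cball c \<rho>))" using C L cj_pos[OF s_pos] \<Lambda>_pos assms by simp
  have m: "(\<lambda>(x,y). (\<psi> x - \<psi> y) *\<^sub>R J e x y) \<in> borel_measurable (M \<Otimes>\<^sub>M M)" by measurable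
  show "integrable (M \<Otimes>\<^sub>M M) (\<lambda>(x,y). (\<psi> x - \<psi> y) *\<^sub>R J e x y)"
    "norm (\<integral>(x,y). (\<psi> x - \<psi> y) *\<^sub>R J e x y \<partial>(M \<Otimes>\<^sub>M M)) \<le> 2 * (cj s * \<Lambda> * L * e * measure M (cball c \<rho>))"
    by (rule norm_integral_bound_nn[OF m * C2])+
qed

end

lemma lipc_mono: "lipc L \<psi> c \<rho> \<Longrightarrow> cball c \<rho> \<subseteq> cball c' \<rho>' \<Longrightarrow> lipc L \<psi> c' \<rho>'"
  unfolding lipc_def by blast

lemma lipc_diff_cmult:
  assumes "lipc L1 \<psi>1 c \<rho>" "lipc L2 \<psi>2 c \<rho>"
  shows "lipc (L1 + \<bar>a\<bar> * L2) (\<lambda>x. \<psi>1 x - a * \<psi>2 x) c \<rho>"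
  using assms unfolding lipc_def
  by (auto intro!: lipschitz_on_diff lipschitz_on_cmult_real)

definition tent :: "'a::euclidean_space \<Rightarrow> real \<Rightarrow> 'a \<Rightarrow> real" where
  "tent c \<rho> y = max 0 (1 - dist c y / \<rho>)"

lemma lipc_tent:
  assumes "0 < \<rho>"
  shows "lipc (1/\<rho>) (tent c \<rho>) c \<rho>"
  unfolding lipc_def
proof
  show "(1/\<rho>)-lipschitz_on UNIV (tent c \<rho>)"
  proof (rule lipschitz_onI)
    fix x y
    have "\<bar>tent c \<rho> x - tent c \<rho> y\<bar> \<le> \<bar>dist c x / \<rho> - dist c y / \<rho>\<bar>"
      unfolding tent_def by (auto simp: max_def)
    also have "\<dots> = \<bar>dist c x - dist c y\<bar> / \<rho>" using assms by (simp add: diff_divide_distrib[symmetric] abs_divide)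
    also have "\<dots> \<le> dist x y / \<rho>"
      using assms abs_dist_diff_le[of c x y] dist_triangle2[of c x y] dist_triangle[of c y x]
      by (intro divide_right_mono) (auto simp: dist_commute abs_le_iff)
    finally show "dist (tent c \<rho> x) (tent c \<rho> y) \<le> 1 / \<rho> * dist x y" by (simp add: dist_real_def)
  qed (use assms in simp)
  show "\<forall>x. x \<notin> cball c \<rho> \<longrightarrow> tent c \<rho> x = 0"
    using assms by (auto simp: tent_def max_def field_simps)
qed

lemma tent_nonneg: "0 \<le> tent c \<rho> y"
  by (simp add: tent_def)

lemma tent_ge_half: "0 < \<rho> \<Longrightarrow> y \<in> ball c (\<rho>/2) \<Longrightarrow> 1/2 \<le> tent c \<rho> y"
  by (auto simp: tent_def max_def field_simps)

context growth_measure
begin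

lemma V_bounded_on:
  assumes "0 < e"
  obtains C where "0 \<le> C" "\<And>x. x \<in> cball c \<rho> \<Longrightarrow> norm (V e x) \<le> C"
proof -
  let ?D = "\<bar>\<rho>\<bar> / e"
  let ?C = "norm (V e c) + ctd s ?D * ?D * cup s (s+1) * \<Lambda>"
  have "norm (V e x) \<le> ?C" if "x \<in> cball c \<rho>" for x
  proof -
    have "norm (V e x - V e c) \<le> ctd s ?D * ?D * cup s (s+1) * \<Lambda>"
      using that assms by (intro V_trans) (auto simp: dist_norm norm_minus_commute)
    then show ?thesis using norm_triangle_sub[of "V e x" "V e c"] by linarith
  qed
  moreover have "0 \<le> ?C"
    using ctd_pos[OF s_pos, of ?D] cup_pos[of s "s+1"] \<Lambda>_pos assms by (intro add_nonneg_nonneg mult_nonneg_nonneg) auto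
  ultimately show ?thesis by (rule that[rotated])
qed

lemma V_measurable_M [measurable]: "V e \<in> borel_measurable M"
  using V_measurable by (simp cong: measurable_cong_sets)

lemma integrable_lipc_V:
  assumes "0 < e" "lipc L \<psi> c \<rho>"
  shows "integrable M (\<lambda>x. \<psi> x *\<^sub>R V e x)"
proof -
  obtain C where "\<And>x. x \<in> cball c \<rho> \<Longrightarrow> norm (V e x) \<le> C" using V_bounded_on[OF assms(1)] by blast
  then show ?thesis using assms by (intro integrable_lipc_scaleR) auto
qed

text \<open>By antisymmetry of \<open>J e\<close>, formally this is the pairing of \<open>T_\<mu>(1)\<close> with \<open>\<psi>\<close>, up to the renormalising
  constant of \<open>V\<close>; hence it does not depend on \<open>e\<close>.\<close>

definition weak_V :: "real \<Rightarrow> ('a \<Rightarrow> real) \<Rightarrow> 'a" where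
  "weak_V e \<psi> = (\<integral>x. \<psi> x *\<^sub>R V e x \<partial>M) - (1/2) *\<^sub>R (\<integral>(x,y). (\<psi> x - \<psi> y) *\<^sub>R J e x y \<partial>(M \<Otimes>\<^sub>M M))"

lemma weak_V_diff_cmult:
  assumes "0 < e" "lipc L1 \<psi>1 c \<rho>" "lipc L2 \<psi>2 c \<rho>"
  shows "weak_V e (\<lambda>x. \<psi>1 x - a * \<psi>2 x) = weak_V e \<psi>1 - a *\<^sub>R weak_V e \<psi>2"
proof -
  note i = integrable_lipc_V[OF assms(1,2)] integrable_lipc_V[OF assms(1,3)]
  note j = pair_J_bound(1)[OF assms(1,2)] pair_J_bound(1)[OF assms(1,3)]
  have 1: "(\<integral>x. (\<psi>1 x - a * \<psi>2 x) *\<^sub>R V e x \<partial>M) = (\<integral>x. \<psi>1 x *\<^sub>R V e x \<partial>M) - a *\<^sub>R (\<integral>x. \<psi>2 x *\<^sub>R V e x \<partial>M)"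
  proof -
    have "(\<integral>x. (\<psi>1 x - a * \<psi>2 x) *\<^sub>R V e x \<partial>M) = (\<integral>x. \<psi>1 x *\<^sub>R V e x - a *\<^sub>R (\<psi>2 x *\<^sub>R V e x) \<partial>M)"
      by (simp add: scaleR_diff_left)
    also have "\<dots> = (\<integral>x. \<psi>1 x *\<^sub>R V e x \<partial>M) - (\<integral>x. a *\<^sub>R (\<psi>2 x *\<^sub>R V e x) \<partial>M)"
      by (intro Bochner_Integration.integral_diff i integrable_scaleR_right)
    also have "(\<integral>x. a *\<^sub>R (\<psi>2 x *\<^sub>R V e x) \<partial>M) = a *\<^sub>R (\<integral>x. \<psi>2 x *\<^sub>R V e x \<partial>M)"
      by (intro integral_scaleR_right i)
    finally show ?thesis .
  qed
  let ?g = "\<lambda>\<psi>. \<lambda>(x,y). (\<psi> x - \<psi> y) *\<^sub>R J e x y"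
  have 2: "integral\<^sup>L (M \<Otimes>\<^sub>M M) (?g (\<lambda>x. \<psi>1 x - a * \<psi>2 x)) = integral\<^sup>L (M \<Otimes>\<^sub>M M) (?g \<psi>1) - a *\<^sub>R integral\<^sup>L (M \<Otimes>\<^sub>M M) (?g \<psi>2)"
  proof -
    have "?g (\<lambda>x. \<psi>1 x - a * \<psi>2 x) = (\<lambda>p. ?g \<psi>1 p - a *\<^sub>R ?g \<psi>2 p)"
      by (auto simp: fun_eq_iff algebra_simps)
    then have "integral\<^sup>L (M \<Otimes>\<^sub>M M) (?g (\<lambda>x. \<psi>1 x - a * \<psi>2 x)) = (\<integral>p. ?g \<psi>1 p - a *\<^sub>R ?g \<psi>2 p \<partial>(M \<Otimes>\<^sub>M M))"
      by (simp only:)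
    also have "\<dots> = integral\<^sup>L (M \<Otimes>\<^sub>M M) (?g \<psi>1) - (\<integral>p. a *\<^sub>R ?g \<psi>2 p \<partial>(M \<Otimes>\<^sub>M M))"
      by (intro Bochner_Integration.integral_diff j integrable_scaleR_right)
    also have "(\<integral>p. a *\<^sub>R ?g \<psi>2 p \<partial>(M \<Otimes>\<^sub>M M)) = a *\<^sub>R integral\<^sup>L (M \<Otimes>\<^sub>M M) (?g \<psi>2)"
      by (intro integral_scaleR_right j)
    finally show ?thesis .
  qed
  show ?thesis unfolding weak_V_def 1 2 by (simp add: algebra_simps)
qed

text \<open>\<open>kr s r - kr s t\<close> is integrable against the measure, so it can be
  symmetrised directly; the result is precisely the change of the correction term.\<close>

lemma weak_V_indep:
  assumes "0 < e" "0 < e'" "lipc L \<psi> c \<rho>"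
  shows "weak_V e \<psi> = weak_V e' \<psi>"
proof -
  have "weak_V r \<psi> = weak_V t \<psi>" if rt: "0 < r" "r \<le> t" for r t
  proof -
    have t: "0 < t" using rt by simp
    have [measurable]: "\<psi> \<in> borel_measurable M" using assms(3) by (rule lipc_borel)
    obtain B where B: "0 < B" "\<And>x. \<bar>\<psi> x\<bar> \<le> B" using lipc_bounded[OF assms(3)] by blast
    define G where "G x y = kr s r (x - y) - kr s t (x - y)" for x y :: 'a
    have GJ: "G x y = J r x y - J t x y" for x y by (simp add: G_def J_def)
    have Gm [measurable]: "(\<lambda>(x,y). G x y) \<in> borel_measurable (M \<Otimes>\<^sub>M M)" unfolding G_def by measurable
    have Gi: "integrable M (G x)" for x unfolding G_def using rt t by (intro integrable_kr_scale) auto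
    define C where "C = (s+1)/2 * (t\<^sup>2 - r\<^sup>2) * (cup s (s+2) * \<Lambda> * r powr (s - (s+2)))"
    have GC: "(\<integral>y. norm (G x y) \<partial>M) \<le> C" for x
    proof -
      have "(\<integral>y. norm (G x y) \<partial>M) \<le> (s+1)/2 * (t\<^sup>2 - r\<^sup>2) * (\<integral>y. pk (s+2) r (x - y) \<partial>M)"
        unfolding G_def using rt by (intro integral_kr_scale)
      also have "\<dots> \<le> C" unfolding C_def using rt s_pos
        by (intro mult_left_mono integral_pk_le) (auto intro: power_mono)
      finally show ?thesis .
    qed
    have C0: "0 \<le> C" using order_trans[OF _ GC] by (simp add: Bochner_Integration.integral_nonneg)
    have anti: "G y x = - G x y" for x y unfolding GJ using J_anti[of r y x] J_anti[of t y x] by simp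
    have int: "integrable (M \<Otimes>\<^sub>M M) (\<lambda>(x,y). \<psi> x *\<^sub>R G x y)"
    proof (rule integrable_pair_bound)
      fix x
      show "(\<integral>\<^sup>+y. ennreal (norm ((\<lambda>(x,y). \<psi> x *\<^sub>R G x y) (x,y))) \<partial>M) \<le> ennreal (B * C) * indicator (cball c \<rho>) x"
      proof (cases "x \<in> cball c \<rho>")
        case True
        have "(\<integral>\<^sup>+y. ennreal (norm ((\<lambda>(x,y). \<psi> x *\<^sub>R G x y) (x,y))) \<partial>M) = ennreal (\<integral>y. norm (\<psi> x *\<^sub>R G x y) \<partial>M)"
          using Gi[of x] by (subst nn_integral_eq_integral) auto
        also have "(\<integral>y. norm (\<psi> x *\<^sub>R G x y) \<partial>M) = \<bar>\<psi> x\<bar> * (\<integral>y. norm (G x y) \<partial>M)" by simp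
        also have "\<dots> \<le> B * C" using B GC C0 by (intro mult_mono) (auto simp: Bochner_Integration.integral_nonneg)
        finally show ?thesis using True by (simp add: ennreal_leI)
      next
        case False then show ?thesis using assms(3) by (simp add: lipc_def)
      qed
    qed (use finite_balls in auto)
    have eq: "(\<integral>x. \<psi> x *\<^sub>R (\<integral>y. G x y \<partial>M) \<partial>M) = (1/2) *\<^sub>R (\<integral>(x,y). (\<psi> x - \<psi> y) *\<^sub>R G x y \<partial>(M \<Otimes>\<^sub>M M))"
      using anti int Gi by (rule antisym_integral(2))
    have "(\<integral>x. \<psi> x *\<^sub>R V r x \<partial>M) - (\<integral>x. \<psi> x *\<^sub>R V t x \<partial>M) = (\<integral>x. \<psi> x *\<^sub>R V r x - \<psi> x *\<^sub>R V t x \<partial>M)"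
      using integrable_lipc_V[OF rt(1) assms(3)] integrable_lipc_V[OF t assms(3)] by simp
    also have "\<dots> = (\<integral>x. \<psi> x *\<^sub>R (\<integral>y. G x y \<partial>M) \<partial>M)"
      unfolding G_def V_diff[OF rt(1) t, symmetric] by (simp add: scaleR_diff_right)
    also have "\<dots> = (1/2) *\<^sub>R (\<integral>(x,y). (\<psi> x - \<psi> y) *\<^sub>R G x y \<partial>(M \<Otimes>\<^sub>M M))" by (rule eq)
    also have "(\<lambda>(x,y). (\<psi> x - \<psi> y) *\<^sub>R G x y) = (\<lambda>p. (\<lambda>(x,y). (\<psi> x - \<psi> y) *\<^sub>R J r x y) p - (\<lambda>(x,y). (\<psi> x - \<psi> y) *\<^sub>R J t x y) p)"
      by (auto simp: GJ fun_eq_iff scaleR_diff_right)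
    also have "(\<integral>p. (\<lambda>(x,y). (\<psi> x - \<psi> y) *\<^sub>R J r x y) p - (\<lambda>(x,y). (\<psi> x - \<psi> y) *\<^sub>R J t x y) p \<partial>(M \<Otimes>\<^sub>M M)) =
      (\<integral>(x,y). (\<psi> x - \<psi> y) *\<^sub>R J r x y \<partial>(M \<Otimes>\<^sub>M M)) - (\<integral>(x,y). (\<psi> x - \<psi> y) *\<^sub>R J t x y \<partial>(M \<Otimes>\<^sub>M M))"
      by (rule Bochner_Integration.integral_diff[OF pair_J_bound(1)[OF rt(1) assms(3)] pair_J_bound(1)[OF t assms(3)]])
    finally show ?thesis unfolding weak_V_def by (simp add: algebra_simps)
  qed
  then show ?thesis using assms by (metis linear)
qed

text \<open>Both points are cut off to the same ball so that the product with an odd kernel stays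
  antisymmetric. The additional cut in x is invisible, since \<psi> is carried by a smaller
  ball.\<close>

lemma antisym_ball:
  assumes lip: "lipc L \<psi> c \<rho>" and r: "\<rho> < r" and [measurable]: "k \<in> borel_measurable borel"
    and odd: "\<And>w. k (- w) = - k w" and bd: "\<And>w. norm (k w) \<le> C"
  shows "(\<integral>x. \<psi> x *\<^sub>R (\<integral>y. indicator (ball c r) y *\<^sub>R k (x - y) \<partial>M) \<partial>M) =
      (1/2) *\<^sub>R (\<integral>(x,y). (\<psi> x - \<psi> y) *\<^sub>R ((indicator (ball c r) x * indicator (ball c r) y) *\<^sub>R k (x - y)) \<partial>(M \<Otimes>\<^sub>M M))" (is ?A)
    and "integrable (M \<Otimes>\<^sub>M M) (\<lambda>(x,y). (\<psi> x - \<psi> y) *\<^sub>R ((indicator (ball c r) x * indicator (ball c r) y) *\<^sub>R (k (x - y) :: 'a)))" (is ?B)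
    and "\<And>x. integrable M (\<lambda>y. indicator (ball c r) y *\<^sub>R k (x - y))"
    and "\<And>x. norm (\<integral>y. indicator (ball c r) y *\<^sub>R k (x - y) \<partial>M) \<le> C * measure M (ball c r)"
proof -
  have [measurable]: "\<psi> \<in> borel_measurable M" using lip by (rule lipc_borel)
  obtain B where B: "0 < B" "\<And>x. \<bar>\<psi> x\<bar> \<le> B" using lipc_bounded[OF lip] by blast
  have C: "0 \<le> C" using order_trans[OF norm_ge_zero bd] .
  define G where "G x y = (indicator (ball c r) x * indicator (ball c r) y) *\<^sub>R k (x - y)" for x y
  have nn: "(\<integral>\<^sup>+y. ennreal (norm (indicator (ball c r) y *\<^sub>R k (x - y))) \<partial>M) \<le> ennreal (C * measure M (ball c r))" for x
  proof -
    have "(\<integral>\<^sup>+y. ennreal (norm (indicator (ball c r) y *\<^sub>R k (x - y))) \<partial>M) \<le> (\<integral>\<^sup>+y. ennreal C * indicator (ball c r) y \<partial>M)"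
      using bd by (intro nn_integral_mono) (auto simp: indicator_def intro: ennreal_leI)
    also have "\<dots> = ennreal C * emeasure M (ball c r)" by (intro nn_integral_cmult_indicator) simp
    also have "\<dots> = ennreal (C * measure M (ball c r))"
      using C finite_balls(2)[of c r] by (simp add: emeasure_eq_ennreal_measure ennreal_mult)
    finally show ?thesis .
  qed
  have mm: "(\<lambda>y. indicator (ball c r) y *\<^sub>R k (x - y)) \<in> borel_measurable M" for x by measurable
  have C': "0 \<le> C * measure M (ball c r)" using C by simp
  show i: "\<And>x. integrable M (\<lambda>y. indicator (ball c r) y *\<^sub>R k (x - y))"
    and "\<And>x. norm (\<integral>y. indicator (ball c r) y *\<^sub>R k (x - y) \<partial>M) \<le> C * measure M (ball c r)"
    by (rule norm_integral_bound_nn[OF mm nn C'])+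
  have anti: "G y x = - G x y" for x y
    unfolding G_def using odd[of "x - y"] by (simp add: mult.commute)
  have Gi: "integrable M (G x)" for x
    unfolding G_def using i[of x] by (simp flip: scaleR_scaleR)
  have int: "integrable (M \<Otimes>\<^sub>M M) (\<lambda>(x,y). \<psi> x *\<^sub>R G x y)"
  proof (rule integrable_pair_bound)
    show "(\<lambda>(x,y). \<psi> x *\<^sub>R G x y) \<in> borel_measurable (M \<Otimes>\<^sub>M M)" unfolding G_def by measurable
    fix x
    show "(\<integral>\<^sup>+y. ennreal (norm ((\<lambda>(x,y). \<psi> x *\<^sub>R G x y) (x,y))) \<partial>M) \<le> ennreal (B * (C * measure M (ball c r))) * indicator (ball c r) x"
    proof (cases "x \<in> ball c r")
      case True
      have "(\<integral>\<^sup>+y. ennreal (norm ((\<lambda>(x,y). \<psi> x *\<^sub>R G x y) (x,y))) \<partial>M) \<le> (\<integral>\<^sup>+y. ennreal B * ennreal (norm (indicator (ball c r) y *\<^sub>R k (x - y))) \<partial>M)"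
        using B True by (intro nn_integral_mono) (auto simp: G_def ennreal_mult[symmetric] abs_mult mult.assoc intro!: ennreal_leI mult_right_mono)
      also have "\<dots> = ennreal B * (\<integral>\<^sup>+y. ennreal (norm (indicator (ball c r) y *\<^sub>R k (x - y))) \<partial>M)"
        by (intro nn_integral_cmult) measurable
      also have "\<dots> \<le> ennreal B * ennreal (C * measure M (ball c r))" by (intro mult_left_mono nn) auto
      finally show ?thesis using True B C by (simp add: ennreal_mult)
    next
      case False then show ?thesis by (simp add: G_def)
    qed
  qed (use finite_balls in auto)
  note AI = antisym_integral[OF anti int Gi]
  show ?B using AI(1) unfolding G_def .
  have "(\<integral>x. \<psi> x *\<^sub>R (\<integral>y. G x y \<partial>M) \<partial>M) = (\<integral>x. \<psi> x *\<^sub>R (\<integral>y. indicator (ball c r) y *\<^sub>R k (x - y) \<partial>M) \<partial>M)"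
  proof (rule Bochner_Integration.integral_cong[OF refl])
    fix x
    show "\<psi> x *\<^sub>R (\<integral>y. G x y \<partial>M) = \<psi> x *\<^sub>R (\<integral>y. indicator (ball c r) y *\<^sub>R k (x - y) \<partial>M)"
      using lip r by (cases "x \<in> ball c r") (auto simp: G_def lipc_def)
  qed
  then show ?A using AI(2) unfolding G_def by simp
qed


lemma kr_bounded: "0 < e \<Longrightarrow> norm (kr s e w) \<le> e powr (-s)"
  using norm_kr_le[of e s w] pk_le_scale[of s e w] s_pos by simp

lemma integrable_pair_kr_0:
  assumes lip: "lipc L \<psi> c \<rho>" and r: "0 < r"
  shows "integrable (M \<Otimes>\<^sub>M M) (\<lambda>(x,y). L * norm (x - y) * ((indicator (ball c r) x * indicator (ball c r) y) * norm (kr s 0 (x - y))))"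
proof (rule integrable_pair_bound)
  have L: "0 \<le> L" using lip lipc_nonneg by blast
  fix x
  show "(\<integral>\<^sup>+y. ennreal (norm ((\<lambda>(x,y). L * norm (x - y) * ((indicator (ball c r) x * indicator (ball c r) y) * norm (kr s 0 (x - y)))) (x,y))) \<partial>M)
     \<le> ennreal (L * (cdn s (s-1) * \<Lambda> * (2*r) powr (s - (s-1)))) * indicator (ball c r) x"
  proof (cases "x \<in> ball c r")
    case True
    have pt: "norm (x - y) * norm (kr s 0 (x - y)) = norm (x - y) powr (-(s-1))" for y
    proof (cases "x = y")
      case False
      then have "norm (x - y) * norm (kr s 0 (x - y)) = norm (x - y) powr (1 + (-s))"
        using norm_kr_0[of "x - y" s] powr_add[of "norm (x - y)" 1 "-s"] by simp
      then show ?thesis by simp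
    qed simp
    have sub: "y \<in> ball c r \<Longrightarrow> y \<in> ball x (2*r)" for y
      using True dist_triangle[of x y c] by (auto simp: dist_commute)
    have "(\<integral>\<^sup>+y. ennreal (norm ((\<lambda>(x,y). L * norm (x - y) * ((indicator (ball c r) x * indicator (ball c r) y) * norm (kr s 0 (x - y)))) (x,y))) \<partial>M)
       \<le> (\<integral>\<^sup>+y. ennreal L * (indicator (ball x (2*r)) y * ennreal (norm (x - y) powr (-(s-1)))) \<partial>M)"
    proof (intro nn_integral_mono)
      fix y
      show "ennreal (norm ((\<lambda>(x,y). L * norm (x - y) * ((indicator (ball c r) x * indicator (ball c r) y) * norm (kr s 0 (x - y)))) (x,y)))
        \<le> ennreal L * (indicator (ball x (2*r)) y * ennreal (norm (x - y) powr (-(s-1))))"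
      proof (cases "y \<in> ball c r")
        case True
        then have "ennreal (norm ((\<lambda>(x,y). L * norm (x - y) * ((indicator (ball c r) x * indicator (ball c r) y) * norm (kr s 0 (x - y)))) (x,y)))
          = ennreal (L * (norm (x - y) * norm (kr s 0 (x - y))))"
          using \<open>x \<in> ball c r\<close> L by (simp add: mult.assoc abs_mult)
        also have "\<dots> = ennreal L * ennreal (norm (x - y) powr (-(s-1)))"
          unfolding pt using L by (intro ennreal_mult) auto
        finally show ?thesis using sub[OF True] by simp
      qed simp
    qed
    also have "\<dots> = ennreal L * (\<integral>\<^sup>+y. indicator (ball x (2*r)) y * ennreal (norm (x - y) powr (-(s-1))) \<partial>M)"
      by (intro nn_integral_cmult) measurable
    also have "\<dots> \<le> ennreal L * ennreal (cdn s (s-1) * \<Lambda> * (2*r) powr (s - (s-1)))"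
      using r by (intro mult_left_mono nn_integral_near_le) auto
    also have "\<dots> = ennreal (L * (cdn s (s-1) * \<Lambda> * (2*r) powr (s - (s-1))))"
      using L cdn_pos[of "s-1" s] \<Lambda>_pos by (simp add: ennreal_mult)
    finally show ?thesis using True by simp
  qed simp
qed (use finite_balls in auto)

text \<open>After symmetrisation all truncations are dominated by L |x - y| times the norm of
  \<open>kr s 0 (x - y)\<close>, which is integrable over the square of the ball. This identifies
  the limit hidden in \<open>riesz_pair\<close>.\<close>

lemma pair_trunc_limit:
  assumes lip: "lipc L \<psi> c \<rho>" and r: "\<rho> < r" "0 < r"
  shows "riesz_pair s M (indicator (ball c r)) \<psi> =
     (1/2) *\<^sub>R (\<integral>(x,y). (\<psi> x - \<psi> y) *\<^sub>R ((indicator (ball c r) x * indicator (ball c r) y) *\<^sub>R kr s 0 (x - y)) \<partial>(M \<Otimes>\<^sub>M M))" (is "_ = (1/2) *\<^sub>R integral\<^sup>L _ ?Q")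
    and "integrable (M \<Otimes>\<^sub>M M) (\<lambda>(x,y). (\<psi> x - \<psi> y) *\<^sub>R ((indicator (ball c r) x * indicator (ball c r) y) *\<^sub>R kr s 0 (x - y)))"
proof -
  have [measurable]: "\<psi> \<in> borel_measurable M" using lip by (rule lipc_borel)
  let ?ind = "\<lambda>x y. indicator (ball c r) x * indicator (ball c r) y :: real"
  let ?w = "\<lambda>(x,y). L * norm (x - y) * (?ind x y * norm (kr s 0 (x - y)))"
  let ?T = "\<lambda>d. \<lambda>(x,y). (\<psi> x - \<psi> y) *\<^sub>R (?ind x y *\<^sub>R riesz_kernel_trunc s d (x - y))"
  have w: "integrable (M \<Otimes>\<^sub>M M) ?w" using lip r by (intro integrable_pair_kr_0) auto
  have Qm: "?Q \<in> borel_measurable (M \<Otimes>\<^sub>M M)" by measurable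
  have Tm: "?T d \<in> borel_measurable (M \<Otimes>\<^sub>M M)" for d by measurable
  have le: "norm ((\<psi> x - \<psi> y) *\<^sub>R (?ind x y *\<^sub>R k)) \<le> L * norm (x - y) * (?ind x y * norm (kr s 0 (x - y)))"
    if "norm k \<le> norm (kr s 0 (x - y))" for x y and k :: 'a
  proof -
    have "\<bar>\<psi> x - \<psi> y\<bar> * (?ind x y * norm k) \<le> L * norm (x - y) * (?ind x y * norm (kr s 0 (x - y)))"
      using that lipc_nonneg[OF lip] by (intro mult_mono lipc_diff_le[OF lip] mult_left_mono mult_nonneg_nonneg) auto
    then show ?thesis by (simp add: abs_mult)
  qed
  have Qw: "norm (?Q p) \<le> ?w p" for p
    using le[of "kr s 0 (fst p - snd p)" "fst p" "snd p"] by (cases p) simp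
  show Qi: "integrable (M \<Otimes>\<^sub>M M) ?Q"
    by (rule Bochner_Integration.integrable_bound[OF w Qm]) (unfold real_norm_def, intro AE_I2 order_trans[OF Qw abs_ge_self])
  \<comment> \<open>Dominated convergence is used with a parameter tending to infinity, hence the
    truncation \<open>inverse t\<close>.\<close>
  have "((\<lambda>t. integral\<^sup>L (M \<Otimes>\<^sub>M M) (?T (inverse t))) \<longlongrightarrow> integral\<^sup>L (M \<Otimes>\<^sub>M M) ?Q) at_top"
  proof (rule integral_dominated_convergence_at_top[OF Qm Tm w])
    show "\<forall>\<^sub>F t in at_top. AE p in M \<Otimes>\<^sub>M M. norm (?T (inverse t) p) \<le> ?w p"
      using eventually_gt_at_top[of 0]
    proof eventually_elim
      case (elim t)
      have "norm (?T (inverse t) p) \<le> ?w p" for p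
        using le[OF norm_riesz_kernel_trunc_le(2)[OF s_pos, of "inverse t" "fst p - snd p"]] elim
        by (cases p) simp
      then show ?case by simp
    qed
    show "AE p in M \<Otimes>\<^sub>M M. ((\<lambda>t. ?T (inverse t) p) \<longlongrightarrow> ?Q p) at_top"
    proof (rule AE_I2)
      fix p :: "'a \<times> 'a"
      \<comment> \<open>A truncation at or below |x - y| does not alter the kernel there, and on the
        diagonal both integrands vanish.\<close>
      obtain x y where p: "p = (x,y)" by (cases p)
      have "\<forall>\<^sub>F t in at_top. ?T (inverse t) p = ?Q p"
      proof (cases "x = y")
        case False
        then have "0 < norm (x - y)" by simp
        show ?thesis using eventually_gt_at_top[of "inverse (norm (x - y))"] eventually_gt_at_top[of 0]
        proof eventually_elim
          case (elim t)
          then have "inverse t \<le> norm (x - y)"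
            using False by (simp add: field_simps)
          then show ?case using riesz_kernel_trunc_eq[of "inverse t" "x - y" s] elim p by simp
        qed
      qed (simp add: p)
      then show "((\<lambda>t. ?T (inverse t) p) \<longlongrightarrow> ?Q p) at_top" by (rule tendsto_eventually)
    qed
  qed
  then have lim: "((\<lambda>d. integral\<^sup>L (M \<Otimes>\<^sub>M M) (?T d)) \<longlongrightarrow> integral\<^sup>L (M \<Otimes>\<^sub>M M) ?Q) (at_right 0)"
    by (simp add: filterlim_at_right_to_top)
  have "\<forall>\<^sub>F d in at_right 0. (\<integral>x. \<psi> x *\<^sub>R riesz_op_trunc s M d (indicator (ball c r)) x \<partial>M) = (1/2) *\<^sub>R integral\<^sup>L (M \<Otimes>\<^sub>M M) (?T d)"
    using eventually_at_right_less[of 0]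
  proof eventually_elim
    case (elim d)
    show ?case unfolding riesz_op_trunc_def
      using norm_riesz_kernel_trunc_le(1)[OF s_pos elim]
      by (intro antisym_ball(1)[OF lip r(1)] riesz_kernel_trunc_measurable riesz_kernel_trunc_minus) auto
  qed
  then have "((\<lambda>d. \<integral>x. \<psi> x *\<^sub>R riesz_op_trunc s M d (indicator (ball c r)) x \<partial>M) \<longlongrightarrow> (1/2) *\<^sub>R integral\<^sup>L (M \<Otimes>\<^sub>M M) ?Q) (at_right 0)"
    by (rule iffD2[OF tendsto_cong tendsto_scaleR[OF tendsto_const lim]])
  then show "riesz_pair s M (indicator (ball c r)) \<psi> = (1/2) *\<^sub>R integral\<^sup>L (M \<Otimes>\<^sub>M M) ?Q"
    unfolding riesz_pair_def by (intro tendsto_Lim) auto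
qed

text \<open>The reflectionless identity is read with \<phi> the indicator of a large ball and z = c.
  Its terms are matched with \<open>weak_V\<close>: inside the ball by
  \<open>pair_trunc_limit\<close>, outside by symmetrising G. Whatever is constant in x disappears
  because \<psi> has mean zero.\<close>

lemma weak_V_eq_zero:
  assumes rfl: "reflectionless s M" and e: "0 < e" and lip: "lipc L \<psi> c \<rho>" and \<rho>: "0 < \<rho>" and mean: "(\<integral>x. \<psi> x \<partial>M) = 0"
  shows "weak_V e \<psi> = 0"
proof -
  have [measurable]: "\<psi> \<in> borel_measurable M" using lip by (rule lipc_borel)
  obtain B where B: "0 < B" "\<And>x. \<bar>\<psi> x\<bar> \<le> B" using lipc_bounded[OF lip] by blast
  \<comment> \<open>The closed support lies in the ball of radius \<rho> + 1, whose double is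
    exactly where \<phi> must equal 1.\<close>
  define r where "r = 2 * (\<rho> + 1)"
  have r: "\<rho> < r" "0 < r" using \<rho> by (auto simp: r_def)
  let ?i = "indicator (ball c r) :: 'a \<Rightarrow> real"
  let ?K = "\<lambda>y. \<lambda>x. kr s 0 (x - y)"
  have clos: "closure {x. \<psi> x \<noteq> 0} \<subseteq> cball c \<rho>"
    using lip by (intro closure_minimal) (auto simp: lipc_def)
  have cpt: "compact (closure {x. \<psi> x \<noteq> 0})"
    using clos by (meson bounded_cball bounded_subset closed_closure compact_eq_bounded_closed)
  have L2: "in_L2 M ?i"
    using finite_balls(2)[of c r] by (auto simp: in_L2_def power2_eq_square indicator_inter_arith[symmetric])
  have refl': "\<forall>\<psi> c r z \<phi>.
        (\<exists>L. L-lipschitz_on UNIV \<psi>) \<and> compact (closure {x. \<psi> x \<noteq> 0}) \<and>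
        (\<integral>x. \<psi> x \<partial>M) = 0 \<and>
        r > 0 \<and> closure {x. \<psi> x \<noteq> 0} \<subseteq> ball c r \<and> z \<in> ball c r \<and>
        in_L2 M \<phi> \<and> (\<forall>y\<in>ball c (2 * r). \<phi> y = 1) \<and> (\<forall>y. 0 \<le> \<phi> y \<and> \<phi> y \<le> 1)
        \<longrightarrow> riesz_pair s M \<phi> \<psi>
              + (\<integral>x. \<psi> x *\<^sub>R (\<integral>y. (1 - \<phi> y) *\<^sub>R
                    (riesz_kernel s (x - y) - riesz_kernel s (z - y)) \<partial>M) \<partial>M) = 0"
    using rfl unfolding reflectionless_def by blast
  have Z: "riesz_pair s M ?i \<psi> + (\<integral>x. \<psi> x *\<^sub>R (\<integral>y. (1 - ?i y) *\<^sub>R (kr s 0 (x - y) - kr s 0 (c - y)) \<partial>M) \<partial>M) = 0"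
    unfolding riesz_kernel_eq_kr[symmetric]
  proof (rule refl'[THEN spec[of _ \<psi>], THEN spec[of _ c], THEN spec[of _ "\<rho> + 1"], THEN spec[of _ c], THEN spec[of _ ?i], THEN mp])
    show "(\<exists>L. L-lipschitz_on UNIV \<psi>) \<and> compact (closure {x. \<psi> x \<noteq> 0}) \<and>
        (\<integral>x. \<psi> x \<partial>M) = 0 \<and> \<rho> + 1 > 0 \<and> closure {x. \<psi> x \<noteq> 0} \<subseteq> ball c (\<rho> + 1) \<and> c \<in> ball c (\<rho> + 1) \<and>
        in_L2 M ?i \<and> (\<forall>y\<in>ball c (2 * (\<rho> + 1)). ?i y = 1) \<and> (\<forall>y. 0 \<le> ?i y \<and> ?i y \<le> 1)"
    proof (intro conjI)
      show "\<exists>L. L-lipschitz_on UNIV \<psi>" using lip by (auto simp: lipc_def)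
      show "closure {x. \<psi> x \<noteq> 0} \<subseteq> ball c (\<rho> + 1)"
      proof
        fix x assume "x \<in> closure {x. \<psi> x \<noteq> 0}"
        with clos have "x \<in> cball c \<rho>" by blast
        then show "x \<in> ball c (\<rho> + 1)" by simp
      qed
    qed (use cpt mean L2 \<rho> in \<open>auto simp: r_def indicator_def\<close>)
  qed
  let ?Fe = "\<lambda>x y. (1 - ?i y) *\<^sub>R (kr s e (x - y) - kr s e (c - y))"
  let ?F0 = "\<lambda>x y. (1 - ?i y) *\<^sub>R (kr s 0 (x - y) - kr s 0 (c - y))"
  let ?FJ = "\<lambda>x y. (1 - ?i y) *\<^sub>R J e x y"
  let ?D = "\<rho> / e"
  \<comment> \<open>Outside the large ball the distance to the carrier is at least 1, so the bound
    on |x - y| times J controls J itself.\<close>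
  have xy1: "1 \<le> norm (x - y)" if "x \<in> cball c \<rho>" "y \<notin> ball c r" for x y
  proof -
    have "r \<le> dist c y" "dist c x \<le> \<rho>" using that by auto
    then have "r - \<rho> \<le> dist x y" using dist_triangle[of c y x] by linarith
    then show ?thesis using \<rho> by (simp add: r_def dist_norm)
  qed
  have cJ0: "0 \<le> cj s * \<Lambda> * e" using cj_pos[OF s_pos] \<Lambda>_pos e by simp
  have FJnn: "(\<integral>\<^sup>+y. ennreal (norm (?FJ x y)) \<partial>M) \<le> ennreal (cj s * \<Lambda> * e)" if "x \<in> cball c \<rho>" for x
  proof -
    have "norm (?FJ x y) \<le> norm (x - y) * norm (kr s e (x - y) - kr s 0 (x - y))" for y
    proof (cases "y \<in> ball c r")
      case False
      then show ?thesis using mult_right_mono[OF xy1[OF that False], of "norm (J e x y)"] by (simp add: J_def)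
    qed simp
    then have "(\<integral>\<^sup>+y. ennreal (norm (?FJ x y)) \<partial>M) \<le> (\<integral>\<^sup>+y. ennreal (norm (x - y) * norm (kr s e (x - y) - kr s 0 (x - y))) \<partial>M)"
      by (intro nn_integral_mono ennreal_leI)
    also have "\<dots> \<le> ennreal (cj s * \<Lambda> * e)" using e by (rule nn_integral_kr_limit)
    finally show ?thesis .
  qed
  have FJm: "?FJ x \<in> borel_measurable M" for x unfolding J_def by measurable
  have FJi: "integrable M (?FJ x)" "norm (\<integral>y. ?FJ x y \<partial>M) \<le> cj s * \<Lambda> * e" if "x \<in> cball c \<rho>" for x
    using norm_integral_bound_nn[OF FJm FJnn[OF that] cJ0] by auto
  have Fei: "integrable M (?Fe x)" "norm (\<integral>y. ?Fe x y \<partial>M) \<le> ctd s ?D * ?D * cup s (s+1) * \<Lambda>" if "x \<in> cball c \<rho>" for x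
  proof -
    have n: "norm (x - c) \<le> ?D * e" using that e by (simp add: dist_norm norm_minus_commute)
    have D: "0 \<le> ?D" using \<rho> e by simp
    have i: "integrable M (\<lambda>y. kr s e (x - y) - kr s e (c - y))" using integral_kr_trans(2)[OF e n D] .
    have le: "norm (?Fe x y) \<le> norm (kr s e (x - y) - kr s e (c - y))" for y
      by (auto simp: indicator_def)
    show i2: "integrable M (?Fe x)"
      by (rule Bochner_Integration.integrable_bound[OF i]) (use le in auto)
    have "norm (\<integral>y. ?Fe x y \<partial>M) \<le> (\<integral>y. norm (?Fe x y) \<partial>M)" by (rule integral_norm_bound)
    also have "\<dots> \<le> (\<integral>y. norm (kr s e (x - y) - kr s e (c - y)) \<partial>M)"
      by (rule integral_mono[OF integrable_norm[OF i2] integrable_norm[OF i] le])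
    also have "\<dots> \<le> ctd s ?D * ?D * cup s (s+1) * \<Lambda>" using integral_kr_trans_le[OF e n D] .
    finally show "norm (\<integral>y. ?Fe x y \<partial>M) \<le> ctd s ?D * ?D * cup s (s+1) * \<Lambda>" .
  qed
  have cc: "c \<in> cball c \<rho>" using \<rho> by simp
  \<comment> \<open>Replacing the singular kernels by regularised ones at x and at c costs one J
    term each; the one at c is constant in x.\<close>
  have F0eq: "(\<integral>y. ?F0 x y \<partial>M) = (\<integral>y. ?Fe x y \<partial>M) - (\<integral>y. ?FJ x y \<partial>M) + (\<integral>y. ?FJ c y \<partial>M)" if "x \<in> cball c \<rho>" for x
  proof -
    have "(\<integral>y. ?F0 x y \<partial>M) = (\<integral>y. (?Fe x y - ?FJ x y) + ?FJ c y \<partial>M)"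
      by (intro Bochner_Integration.integral_cong) (auto simp: J_def algebra_simps)
    also have "\<dots> = (\<integral>y. ?Fe x y - ?FJ x y \<partial>M) + (\<integral>y. ?FJ c y \<partial>M)"
      by (intro Bochner_Integration.integral_add Bochner_Integration.integrable_diff Fei FJi that cc)
    also have "(\<integral>y. ?Fe x y - ?FJ x y \<partial>M) = (\<integral>y. ?Fe x y \<partial>M) - (\<integral>y. ?FJ x y \<partial>M)"
      by (intro Bochner_Integration.integral_diff Fei FJi that)
    finally show ?thesis .
  qed
  have mFe: "(\<lambda>x. \<integral>y. ?Fe x y \<partial>M) \<in> borel_measurable M" by measurable
  have mFJ: "(\<lambda>x. \<integral>y. ?FJ x y \<partial>M) \<in> borel_measurable M" unfolding J_def by measurable
  have iFe: "integrable M (\<lambda>x. \<psi> x *\<^sub>R (\<integral>y. ?Fe x y \<partial>M))"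
    using lip mFe Fei(2) by (rule integrable_lipc_scaleR)
  have iFJ: "integrable M (\<lambda>x. \<psi> x *\<^sub>R (\<integral>y. ?FJ x y \<partial>M))"
    using lip mFJ FJi(2) by (rule integrable_lipc_scaleR)
  have i\<psi>: "integrable M \<psi>" using lip by (rule integrable_lipc)
  have Z2: "(\<integral>x. \<psi> x *\<^sub>R (\<integral>y. ?F0 x y \<partial>M) \<partial>M) = (\<integral>x. \<psi> x *\<^sub>R (\<integral>y. ?Fe x y \<partial>M) \<partial>M) - (\<integral>x. \<psi> x *\<^sub>R (\<integral>y. ?FJ x y \<partial>M) \<partial>M)"
  proof -
    have "(\<integral>x. \<psi> x *\<^sub>R (\<integral>y. ?F0 x y \<partial>M) \<partial>M) = (\<integral>x. (\<psi> x *\<^sub>R (\<integral>y. ?Fe x y \<partial>M) - \<psi> x *\<^sub>R (\<integral>y. ?FJ x y \<partial>M)) + \<psi> x *\<^sub>R (\<integral>y. ?FJ c y \<partial>M) \<partial>M)"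
    proof (rule Bochner_Integration.integral_cong[OF refl])
      fix x
      show "\<psi> x *\<^sub>R (\<integral>y. ?F0 x y \<partial>M) = (\<psi> x *\<^sub>R (\<integral>y. ?Fe x y \<partial>M) - \<psi> x *\<^sub>R (\<integral>y. ?FJ x y \<partial>M)) + \<psi> x *\<^sub>R (\<integral>y. ?FJ c y \<partial>M)"
      proof (cases "x \<in> cball c \<rho>")
        case True
        show ?thesis unfolding F0eq[OF True] by (simp add: scaleR_diff_right scaleR_add_right)
      next
        case False
        then have "\<psi> x = 0" using lip by (simp add: lipc_def)
        then show ?thesis by simp
      qed
    qed
    also have "\<dots> = (\<integral>x. \<psi> x *\<^sub>R (\<integral>y. ?Fe x y \<partial>M) - \<psi> x *\<^sub>R (\<integral>y. ?FJ x y \<partial>M) \<partial>M) + (\<integral>x. \<psi> x *\<^sub>R (\<integral>y. ?FJ c y \<partial>M) \<partial>M)"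
      by (intro Bochner_Integration.integral_add Bochner_Integration.integrable_diff iFe iFJ integrable_scaleR_left i\<psi>)
    also have "(\<integral>x. \<psi> x *\<^sub>R (\<integral>y. ?FJ c y \<partial>M) \<partial>M) = (\<integral>x. \<psi> x \<partial>M) *\<^sub>R (\<integral>y. ?FJ c y \<partial>M)"
      by (intro integral_scaleR_left i\<psi>)
    also have "(\<integral>x. \<psi> x *\<^sub>R (\<integral>y. ?Fe x y \<partial>M) - \<psi> x *\<^sub>R (\<integral>y. ?FJ x y \<partial>M) \<partial>M) = (\<integral>x. \<psi> x *\<^sub>R (\<integral>y. ?Fe x y \<partial>M) \<partial>M) - (\<integral>x. \<psi> x *\<^sub>R (\<integral>y. ?FJ x y \<partial>M) \<partial>M)"
      by (intro Bochner_Integration.integral_diff iFe iFJ)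
    finally show ?thesis using mean by simp
  qed
  let ?N = "\<lambda>x y. ?i y *\<^sub>R kr s e (x - y)"
  note near = antisym_ball[OF lip r(1) kr_borel[of s e] kr_minus kr_bounded[OF e]]
  \<comment> \<open>Collects the part of V that does not depend on x; the renormalising term ends up
    here.\<close>
  define C0 where "C0 = (\<integral>y. (1 - ?i y) *\<^sub>R kr s e (c - y) - kr s 1 (- y) \<partial>M)"
  have C0i: "integrable M (\<lambda>y. (1 - ?i y) *\<^sub>R kr s e (c - y) - kr s 1 (- y))"
  proof -
    have "integrable M (\<lambda>y. (kr s e (c - y) - kr s 1 (- y)) - ?N c y)"
      by (intro Bochner_Integration.integrable_diff integrable_V e near)
    then show ?thesis by (simp add: algebra_simps)
  qed
  have Veq: "V e x = ((\<integral>y. ?N x y \<partial>M) + (\<integral>y. ?Fe x y \<partial>M)) + C0" if "x \<in> cball c \<rho>" for x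
  proof -
    have "V e x = (\<integral>y. (?N x y + ?Fe x y) + ((1 - ?i y) *\<^sub>R kr s e (c - y) - kr s 1 (- y)) \<partial>M)"
      unfolding V_def by (intro Bochner_Integration.integral_cong) (auto simp: algebra_simps)
    also have "\<dots> = (\<integral>y. ?N x y + ?Fe x y \<partial>M) + C0" unfolding C0_def
      by (intro Bochner_Integration.integral_add Bochner_Integration.integrable_add C0i near Fei that)
    also have "(\<integral>y. ?N x y + ?Fe x y \<partial>M) = (\<integral>y. ?N x y \<partial>M) + (\<integral>y. ?Fe x y \<partial>M)"
      by (intro Bochner_Integration.integral_add near Fei that)
    finally show ?thesis .
  qed
  have mN: "(\<lambda>x. \<integral>y. ?N x y \<partial>M) \<in> borel_measurable M" by measurable
  have iN: "integrable M (\<lambda>x. \<psi> x *\<^sub>R (\<integral>y. ?N x y \<partial>M))"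
    using lip mN near(4) by (rule integrable_lipc_scaleR)
  have VV: "(\<integral>x. \<psi> x *\<^sub>R V e x \<partial>M) = (\<integral>x. \<psi> x *\<^sub>R (\<integral>y. ?N x y \<partial>M) \<partial>M) + (\<integral>x. \<psi> x *\<^sub>R (\<integral>y. ?Fe x y \<partial>M) \<partial>M)"
  proof -
    have "(\<integral>x. \<psi> x *\<^sub>R V e x \<partial>M) = (\<integral>x. (\<psi> x *\<^sub>R (\<integral>y. ?N x y \<partial>M) + \<psi> x *\<^sub>R (\<integral>y. ?Fe x y \<partial>M)) + \<psi> x *\<^sub>R C0 \<partial>M)"
    proof (rule Bochner_Integration.integral_cong[OF refl])
      fix x
      show "\<psi> x *\<^sub>R V e x = (\<psi> x *\<^sub>R (\<integral>y. ?N x y \<partial>M) + \<psi> x *\<^sub>R (\<integral>y. ?Fe x y \<partial>M)) + \<psi> x *\<^sub>R C0"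
      proof (cases "x \<in> cball c \<rho>")
        case True
        show ?thesis unfolding Veq[OF True] by (simp add: scaleR_add_right)
      next
        case False
        then have "\<psi> x = 0" using lip by (simp add: lipc_def)
        then show ?thesis by simp
      qed
    qed
    also have "\<dots> = (\<integral>x. \<psi> x *\<^sub>R (\<integral>y. ?N x y \<partial>M) + \<psi> x *\<^sub>R (\<integral>y. ?Fe x y \<partial>M) \<partial>M) + (\<integral>x. \<psi> x *\<^sub>R C0 \<partial>M)"
      by (intro Bochner_Integration.integral_add Bochner_Integration.integrable_add iFe iN integrable_scaleR_left i\<psi>)
    also have "(\<integral>x. \<psi> x *\<^sub>R C0 \<partial>M) = (\<integral>x. \<psi> x \<partial>M) *\<^sub>R C0"
      by (intro integral_scaleR_left i\<psi>)
    also have "(\<integral>x. \<psi> x *\<^sub>R (\<integral>y. ?N x y \<partial>M) + \<psi> x *\<^sub>R (\<integral>y. ?Fe x y \<partial>M) \<partial>M) = (\<integral>x. \<psi> x *\<^sub>R (\<integral>y. ?N x y \<partial>M) \<partial>M) + (\<integral>x. \<psi> x *\<^sub>R (\<integral>y. ?Fe x y \<partial>M) \<partial>M)"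
      by (intro Bochner_Integration.integral_add iFe iN)
    finally show ?thesis using mean by simp
  qed
  \<comment> \<open>The part of J with at least one point outside the ball. Unlike a cut in y alone
    it is antisymmetric, and it agrees with that cut for x in the carrier.\<close>
  define G where "G x y = (1 - ?i x * ?i y) *\<^sub>R J e x y" for x y
  have Gm [measurable]: "(\<lambda>(x,y). G x y) \<in> borel_measurable (M \<Otimes>\<^sub>M M)"
    unfolding G_def J_def by measurable
  have Ganti: "G y x = - G x y" for x y unfolding G_def using J_anti[of e y x] by (simp add: mult.commute)
  have GF: "G x y = ?FJ x y" if "x \<in> cball c \<rho>" for x y
  proof -
    have "x \<in> ball c r" using that r by auto
    then show ?thesis by (simp add: G_def)
  qed
  have Gi: "integrable M (G x)" if "\<psi> x \<noteq> 0" for x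
  proof -
    have "x \<in> cball c \<rho>" using that lip by (auto simp: lipc_def)
    then show ?thesis using FJi(1)[of x] GF[of x] by (simp cong: Bochner_Integration.integrable_cong)
  qed
  have Gint: "integrable (M \<Otimes>\<^sub>M M) (\<lambda>(x,y). \<psi> x *\<^sub>R G x y)"
  proof (rule integrable_pair_bound)
    fix x
    show "(\<integral>\<^sup>+y. ennreal (norm ((\<lambda>(x,y). \<psi> x *\<^sub>R G x y) (x,y))) \<partial>M) \<le> ennreal (B * (cj s * \<Lambda> * e)) * indicator (cball c \<rho>) x"
    proof (cases "x \<in> cball c \<rho>")
      case True
      have "(\<integral>\<^sup>+y. ennreal (norm ((\<lambda>(x,y). \<psi> x *\<^sub>R G x y) (x,y))) \<partial>M) \<le> (\<integral>\<^sup>+y. ennreal B * ennreal (norm (?FJ x y)) \<partial>M)"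
        unfolding prod.case GF[OF True]
      proof (intro nn_integral_mono)
        fix y
        have "norm (\<psi> x *\<^sub>R ?FJ x y) \<le> B * norm (?FJ x y)"
          unfolding norm_scaleR[of "\<psi> x"] using B by (intro mult_right_mono) auto
        then have "ennreal (norm (\<psi> x *\<^sub>R ?FJ x y)) \<le> ennreal (B * norm (?FJ x y))" by (rule ennreal_leI)
        also have "\<dots> = ennreal B * ennreal (norm (?FJ x y))" using B by (intro ennreal_mult) auto
        finally show "ennreal (norm (\<psi> x *\<^sub>R ?FJ x y)) \<le> ennreal B * ennreal (norm (?FJ x y))" .
      qed
      also have "\<dots> = ennreal B * (\<integral>\<^sup>+y. ennreal (norm (?FJ x y)) \<partial>M)"
        using FJm[of x] by (intro nn_integral_cmult) measurable
      also have "\<dots> \<le> ennreal B * ennreal (cj s * \<Lambda> * e)" by (intro mult_left_mono FJnn True) auto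
      also have "\<dots> = ennreal (B * (cj s * \<Lambda> * e))" using B cJ0 by (intro ennreal_mult[symmetric]) auto
      finally show ?thesis using True by simp
    next
      case False then show ?thesis using lip by (simp add: lipc_def)
    qed
  qed (use finite_balls in auto)
  note AG = antisym_integral[OF Ganti Gint Gi]
  have FG: "(\<integral>x. \<psi> x *\<^sub>R (\<integral>y. ?FJ x y \<partial>M) \<partial>M) = (\<integral>x. \<psi> x *\<^sub>R (\<integral>y. G x y \<partial>M) \<partial>M)"
  proof (rule Bochner_Integration.integral_cong[OF refl])
    fix x
    show "\<psi> x *\<^sub>R (\<integral>y. ?FJ x y \<partial>M) = \<psi> x *\<^sub>R (\<integral>y. G x y \<partial>M)"
      using lip by (cases "x \<in> cball c \<rho>") (auto simp: GF lipc_def)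
  qed
  let ?gN = "\<lambda>(x,y). (\<psi> x - \<psi> y) *\<^sub>R ((?i x * ?i y) *\<^sub>R kr s e (x - y))"
  let ?g0 = "\<lambda>(x,y). (\<psi> x - \<psi> y) *\<^sub>R ((?i x * ?i y) *\<^sub>R kr s 0 (x - y))"
  let ?gG = "\<lambda>(x,y). (\<psi> x - \<psi> y) *\<^sub>R G x y"
  let ?gJ = "\<lambda>(x,y). (\<psi> x - \<psi> y) *\<^sub>R J e x y"
  note lim = pair_trunc_limit[OF lip r]
  have "?gJ = (\<lambda>p. (?gN p - ?g0 p) + ?gG p)"
    by (auto simp: fun_eq_iff G_def J_def algebra_simps)
  then have "integral\<^sup>L (M \<Otimes>\<^sub>M M) ?gJ = (\<integral>p. (?gN p - ?g0 p) + ?gG p \<partial>(M \<Otimes>\<^sub>M M))" by (simp only:)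
  also have "\<dots> = (\<integral>p. ?gN p - ?g0 p \<partial>(M \<Otimes>\<^sub>M M)) + integral\<^sup>L (M \<Otimes>\<^sub>M M) ?gG"
    by (intro Bochner_Integration.integral_add Bochner_Integration.integrable_diff near(2) lim(2) AG(1))
  also have "(\<integral>p. ?gN p - ?g0 p \<partial>(M \<Otimes>\<^sub>M M)) = integral\<^sup>L (M \<Otimes>\<^sub>M M) ?gN - integral\<^sup>L (M \<Otimes>\<^sub>M M) ?g0"
    by (intro Bochner_Integration.integral_diff near(2) lim(2))
  finally have A: "integral\<^sup>L (M \<Otimes>\<^sub>M M) ?gJ = (integral\<^sup>L (M \<Otimes>\<^sub>M M) ?gN - integral\<^sup>L (M \<Otimes>\<^sub>M M) ?g0) + integral\<^sup>L (M \<Otimes>\<^sub>M M) ?gG" .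
  have FG2: "(\<integral>x. \<psi> x *\<^sub>R (\<integral>y. ?FJ x y \<partial>M) \<partial>M) = (1/2) *\<^sub>R integral\<^sup>L (M \<Otimes>\<^sub>M M) ?gG"
    by (rule trans[OF FG AG(2)])
  have Z0: "(1/2) *\<^sub>R integral\<^sup>L (M \<Otimes>\<^sub>M M) ?g0 + ((\<integral>x. \<psi> x *\<^sub>R (\<integral>y. ?Fe x y \<partial>M) \<partial>M) - (1/2) *\<^sub>R integral\<^sup>L (M \<Otimes>\<^sub>M M) ?gG) = 0"
    using Z FG2 by (simp only: lim(1) Z2)
  have "(\<integral>x. \<psi> x *\<^sub>R V e x \<partial>M) = (1/2) *\<^sub>R integral\<^sup>L (M \<Otimes>\<^sub>M M) ?gN + (\<integral>x. \<psi> x *\<^sub>R (\<integral>y. ?Fe x y \<partial>M) \<partial>M)"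
    unfolding VV near(1) ..
  then show ?thesis
    unfolding weak_V_def A using Z0 by (simp add: scaleR_add_right scaleR_diff_right algebra_simps)
qed

text \<open>A linear functional that vanishes on mean-zero functions is a multiple of the integral.
  The multiple l is read off from one fixed bump of positive mass and is independent of e by
  \<open>weak_V_indep\<close>; what remains of the average is the J term.\<close>

lemma reflectionless_average:
  assumes rfl: "reflectionless s M" and nz: "0 < emeasure M (ball c0 r0)"
  obtains l where "\<And>e L \<psi> c \<rho>. 0 < e \<Longrightarrow> 0 < \<rho> \<Longrightarrow> lipc L \<psi> c \<rho> \<Longrightarrow>
    norm (\<integral>x. \<psi> x *\<^sub>R (V e x - l) \<partial>M) \<le> cj s * \<Lambda> * L * e * measure M (cball c \<rho>)"
proof -
  have r0: "0 < r0" using nz by (cases "r0 > 0") (auto simp: ball_empty)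
  define \<psi>0 where "\<psi>0 = tent c0 (2 * r0)"
  have lip0: "lipc (1 / (2 * r0)) \<psi>0 c0 (2 * r0)" unfolding \<psi>0_def using r0 by (intro lipc_tent) auto
  have i0: "integrable M \<psi>0" using lip0 by (rule integrable_lipc)
  have fin: "emeasure M (ball c0 r0) < \<infinity>" by (rule finite_balls)
  have "0 < measure M (ball c0 r0) / 2" using nz fin by (simp add: measure_def enn2real_positive_iff)
  also have "\<dots> = (\<integral>x. (1/2) * indicator (ball c0 r0) x \<partial>M)" using fin by simp
  also have "\<dots> \<le> (\<integral>x. \<psi>0 x \<partial>M)"
  proof (intro integral_mono integrable_mult_right integrable_real_indicator i0)
    show "1 / 2 * indicator (ball c0 r0) x \<le> \<psi>0 x" for x
      unfolding \<psi>0_def using tent_ge_half[of "2*r0" x c0] tent_nonneg[of c0 "2*r0" x] r0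
      by (cases "x \<in> ball c0 r0") auto
  qed (use fin in auto)
  finally have m0: "0 < (\<integral>x. \<psi>0 x \<partial>M)" .
  define l where "l = (1 / (\<integral>x. \<psi>0 x \<partial>M)) *\<^sub>R weak_V 1 \<psi>0"
  show ?thesis
  proof (rule that)
    fix e L \<rho> :: real and \<psi> :: "'a \<Rightarrow> real" and c :: 'a
    assume e: "0 < e" and \<rho>: "0 < \<rho>" and lip: "lipc L \<psi> c \<rho>"
    have i: "integrable M \<psi>" using lip by (rule integrable_lipc)
    define a where "a = (\<integral>x. \<psi> x \<partial>M) / (\<integral>x. \<psi>0 x \<partial>M)"
    \<comment> \<open>One ball about the origin carries both bumps, so that their combination is
      again of the form \<open>lipc\<close>. The final estimate still uses the original carrier of
      \<psi>.\<close>
    define R where "R = norm c + \<rho> + norm c0 + 2 * r0"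
    have R: "0 < R" using \<rho> r0 by (simp add: R_def add_nonneg_pos add_pos_nonneg)
    have sub: "cball c \<rho> \<subseteq> cball 0 R" "cball c0 (2*r0) \<subseteq> cball 0 R"
      using \<rho> r0 unfolding R_def by (auto simp: subset_eq dist_norm) (smt (verit) norm_triangle_sub norm_ge_zero norm_minus_commute)+
    have l1: "lipc L \<psi> 0 R" by (rule lipc_mono[OF lip sub(1)])
    have l2: "lipc (1 / (2 * r0)) \<psi>0 0 R" by (rule lipc_mono[OF lip0 sub(2)])
    have l3: "lipc (L + \<bar>a\<bar> * (1 / (2 * r0))) (\<lambda>x. \<psi> x - a * \<psi>0 x) 0 R" using l1 l2 by (rule lipc_diff_cmult)
    have "(\<integral>x. \<psi> x - a * \<psi>0 x \<partial>M) = 0"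
      using i i0 m0 by (simp add: a_def)
    then have "weak_V e (\<lambda>x. \<psi> x - a * \<psi>0 x) = 0" by (rule weak_V_eq_zero[OF rfl e l3 R])
    then have "weak_V e \<psi> = a *\<^sub>R weak_V e \<psi>0" using weak_V_diff_cmult[OF e l1 l2, of a] by simp
    also have "weak_V e \<psi>0 = weak_V 1 \<psi>0" using weak_V_indep[OF e _ l2, of 1] by simp
    also have "a *\<^sub>R weak_V 1 \<psi>0 = (\<integral>x. \<psi> x \<partial>M) *\<^sub>R l" by (simp add: a_def l_def)
    finally have F: "weak_V e \<psi> = (\<integral>x. \<psi> x \<partial>M) *\<^sub>R l" .
    have "(\<integral>x. \<psi> x *\<^sub>R (V e x - l) \<partial>M) = (\<integral>x. \<psi> x *\<^sub>R V e x - \<psi> x *\<^sub>R l \<partial>M)"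
      by (simp add: scaleR_diff_right)
    also have "\<dots> = (\<integral>x. \<psi> x *\<^sub>R V e x \<partial>M) - (\<integral>x. \<psi> x \<partial>M) *\<^sub>R l"
      using integrable_lipc_V[OF e lip] i by simp
    also have "\<dots> = (1/2) *\<^sub>R (\<integral>(x,y). (\<psi> x - \<psi> y) *\<^sub>R J e x y \<partial>(M \<Otimes>\<^sub>M M))"
      using F unfolding weak_V_def by (simp add: algebra_simps)
    finally have "norm (\<integral>x. \<psi> x *\<^sub>R (V e x - l) \<partial>M) = norm (\<integral>(x,y). (\<psi> x - \<psi> y) *\<^sub>R J e x y \<partial>(M \<Otimes>\<^sub>M M)) / 2"
      by simp
    then show "norm (\<integral>x. \<psi> x *\<^sub>R (V e x - l) \<partial>M) \<le> cj s * \<Lambda> * L * e * measure M (cball c \<rho>)"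
      using pair_J_bound(2)[OF e lip] by linarith
  qed
qed

end

section \<open>The divergence of the regularised kernel\<close>

lemma growth_measure_lborel:
  "growth_measure (lborel :: 'a::euclidean_space measure) (real DIM('a)) (unit_ball_vol (real DIM('a)))"
proof
  show "emeasure lborel (ball x r) \<le> ennreal (unit_ball_vol (real DIM('a)) * r powr real DIM('a))" if "0 < r" for x :: 'a and r
    using that by (simp add: emeasure_ball powr_realpow)
qed (auto simp: unit_ball_vol_pos)

lemma integral_lborel_translate:
  fixes f :: "'a::euclidean_space \<Rightarrow> 'b::{banach, second_countable_topology}"
  assumes "f \<in> borel_measurable borel"
  shows "(\<integral>x. f (a + x) \<partial>lborel) = (\<integral>x. f x \<partial>lborel)"
    and "integrable lborel f \<Longrightarrow> integrable lborel (\<lambda>x. f (a + x))"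
proof -
  have d: "distr lborel borel ((+) a) = (lborel :: 'a measure)" by (rule lborel_distr_plus)
  show "(\<integral>x. f (a + x) \<partial>lborel) = (\<integral>x. f x \<partial>lborel)"
    using integral_distr[of "(+) a" lborel borel f] assms by (simp add: d)
  show "integrable lborel f \<Longrightarrow> integrable lborel (\<lambda>x. f (a + x))"
    using integrable_distr_eq[of "(+) a" lborel borel f] assms by (simp add: d)
qed

lemma nn_integral_lborel_translate:
  fixes f :: "'a::euclidean_space \<Rightarrow> ennreal"
  assumes "f \<in> borel_measurable borel"
  shows "(\<integral>\<^sup>+x. f (a + x) \<partial>lborel) = (\<integral>\<^sup>+x. f x \<partial>lborel)"
  using nn_integral_distr[of "(+) a" lborel borel f] assms by (simp add: lborel_distr_plus)

lemma integral_lborel_odd: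
  fixes f :: "'a::euclidean_space \<Rightarrow> 'b::{banach, second_countable_topology}"
  assumes "f \<in> borel_measurable borel" "\<And>x. f (- x) = - f x"
  shows "(\<integral>x. f x \<partial>lborel) = 0"
proof -
  have "(\<integral>x. f x \<partial>lborel) = (\<integral>x. f (- x) \<partial>lborel)"
    by (subst lborel_affine[of "-1" 0]) (use assms(1) in \<open>simp_all add: integral_density integral_distr density_1\<close>)
  also have "\<dots> = - (\<integral>x. f x \<partial>lborel)" by (simp add: assms(2))
  finally have "(\<integral>x. f x \<partial>lborel) + (\<integral>x. f x \<partial>lborel) = 0" by (metis add.right_inverse)
  then show ?thesis by (metis scaleR_2 scaleR_eq_0_iff zero_neq_numeral)
qed

text \<open>The difference quotients of g integrate to zero by translation invariance and are
  bounded by B on a fixed ball, so dominated convergence passes this on to the derivative.\<close>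

lemma integral_deriv_zero:
  fixes g D :: "'a::euclidean_space \<Rightarrow> real"
  assumes der: "\<And>z t. ((\<lambda>t. g (z + t *\<^sub>R i)) has_real_derivative D (z + t *\<^sub>R i)) (at t)"
    and bd: "\<And>z. \<bar>D z\<bar> \<le> B" and supp: "\<And>z. z \<notin> cball c q \<Longrightarrow> g z = 0"
    and gm [measurable]: "g \<in> borel_measurable borel" and gi: "integrable lborel g" and [measurable]: "D \<in> borel_measurable borel"
    and i: "norm i \<le> 1"
  shows "(\<integral>z. D z \<partial>lborel) = 0"
proof -
  define h where "h n = 1 / real (Suc n)" for n
  have h: "0 < h n" "h n \<le> 1" for n by (auto simp: h_def)
  have h0: "h \<longlonglongrightarrow> 0" unfolding h_def by (rule LIMSEQ_Suc[OF lim_1_over_n])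
  define f where "f n z = (g (h n *\<^sub>R i + z) - g z) / h n" for n z
  have B: "0 \<le> B" using order_trans[OF abs_ge_zero bd] .
  have mvt: "\<bar>g (z + t *\<^sub>R i) - g z\<bar> \<le> B * t" if t: "0 < t" for z t
  proof -
    obtain u where u: "g (z + t *\<^sub>R i) - g (z + 0 *\<^sub>R i) = (t - 0) * D (z + u *\<^sub>R i)"
      using MVT2[where f="\<lambda>t. g (z + t *\<^sub>R i)" and f'="\<lambda>t. D (z + t *\<^sub>R i)", OF t der] by auto
    then show ?thesis using bd[of "z + u *\<^sub>R i"] t by (simp add: abs_mult mult.commute mult_left_mono)
  qed
  have bound: "\<bar>f n z\<bar> \<le> B * indicator (cball c (\<bar>q\<bar> + 1)) z" for n z
  proof (cases "z \<in> cball c (\<bar>q\<bar> + 1)")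
    case True
    then show ?thesis using mvt[OF h(1), of z n] h(1)[of n]
      by (simp add: f_def abs_divide divide_le_eq add.commute)
  next
    case False
    have "norm (h n *\<^sub>R i) \<le> 1" using h[of n] i mult_mono[of "h n" 1 "norm i" 1] by simp
    then have "\<bar>q\<bar> < dist c (h n *\<^sub>R i + z)"
      using False norm_triangle_ineq2[of "c - z" "h n *\<^sub>R i"] by (simp add: dist_norm algebra_simps)
    then have "h n *\<^sub>R i + z \<notin> cball c q" "z \<notin> cball c q" using False by auto
    then show ?thesis using supp False by (simp add: f_def)
  qed
  have "(\<lambda>n. \<integral>z. f n z \<partial>lborel) \<longlonglongrightarrow> (\<integral>z. D z \<partial>lborel)"
  proof (rule integral_dominated_convergence[where w="\<lambda>z. B * indicator (cball c (\<bar>q\<bar> + 1)) z"])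
    show "integrable lborel (\<lambda>z. B * indicator (cball c (\<bar>q\<bar> + 1)) z)"
      using emeasure_lborel_cball_finite[of c "\<bar>q\<bar> + 1"] by (intro integrable_mult_right integrable_real_indicator) auto
    show "AE z in lborel. norm (f n z) \<le> B * indicator (cball c (\<bar>q\<bar> + 1)) z" for n
      using bound by simp
    show "AE z in lborel. (\<lambda>n. f n z) \<longlonglongrightarrow> D z"
    proof (rule AE_I2)
      fix z
      have "((\<lambda>t. (g (z + (0 + t) *\<^sub>R i) - g (z + 0 *\<^sub>R i)) / t) \<longlongrightarrow> D (z + 0 *\<^sub>R i)) (at 0)"
        using der[of z 0] unfolding DERIV_def .
      then have "((\<lambda>t. (g (z + t *\<^sub>R i) - g z) / t) \<longlongrightarrow> D z) (at 0)" by simp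
      moreover have "filterlim h (at 0) sequentially"
        using h0 h by (intro filterlim_atI) (auto simp: less_imp_neq[symmetric])
      ultimately show "(\<lambda>n. f n z) \<longlonglongrightarrow> D z"
        unfolding f_def add.commute[of _ z] by (rule filterlim_compose)
    qed
  qed (auto simp: f_def)
  moreover have "(\<integral>z. f n z \<partial>lborel) = 0" for n
  proof -
    have "(\<integral>z. f n z \<partial>lborel) = (\<integral>z. g (h n *\<^sub>R i + z) - g z \<partial>lborel) / h n" unfolding f_def by simp
    also have "(\<integral>z. g (h n *\<^sub>R i + z) - g z \<partial>lborel) = 0"
      using integral_lborel_translate[OF gm] gi by (subst Bochner_Integration.integral_diff) auto
    finally show ?thesis by simp
  qed
  ultimately have "(\<lambda>n. 0) \<longlonglongrightarrow> (\<integral>z. D z \<partial>lborel)" by simp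
  then show ?thesis using LIMSEQ_unique[OF _ tendsto_const] by auto
qed

section \<open>A differentiable bump and integration by parts against the kernel\<close>

lemma has_real_derivative_max0_sq:
  "((\<lambda>u. (max 0 u)\<^sup>2) has_real_derivative 2 * max 0 u) (at (u::real))"
proof -
  consider "u < 0" | "u = 0" | "0 < u" by linarith
  then show ?thesis
  proof cases
    case 1
    have "((\<lambda>u. 0) has_real_derivative 0) (at u)" by simp
    moreover have "\<forall>\<^sub>F x in nhds u. 0 = (max 0 x)\<^sup>2"
      using eventually_nhds_in_open[of "{..<0}" u] 1 by (auto elim!: eventually_mono)
    ultimately have "((\<lambda>u. (max 0 u)\<^sup>2) has_real_derivative 0) (at u)" using DERIV_cong_ev[OF refl, of "\<lambda>_. 0" "\<lambda>u. (max 0 u)\<^sup>2" u 0 0] by simp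
    then show ?thesis using 1 by simp
  next
    case 2
    have "((\<lambda>h. ((max 0 (0 + h))\<^sup>2 - (max 0 0)\<^sup>2) / h) \<longlongrightarrow> (0::real)) (at 0)"
    proof (rule tendsto_sandwich)
      show "\<forall>\<^sub>F h in at 0. - \<bar>h\<bar> \<le> ((max 0 (0 + h))\<^sup>2 - (max 0 0)\<^sup>2) / (h::real)"
        by (intro always_eventually) (auto simp: max_def power2_eq_square)
      show "\<forall>\<^sub>F h in at 0. ((max 0 (0 + h))\<^sup>2 - (max 0 0)\<^sup>2) / h \<le> \<bar>h::real\<bar>"
        by (intro always_eventually) (auto simp: max_def power2_eq_square)
      show "((\<lambda>h. - \<bar>h\<bar>) \<longlongrightarrow> (0::real)) (at 0)" using tendsto_minus[OF tendsto_rabs_zero[OF tendsto_ident_at]] by simp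
      show "((\<lambda>h. \<bar>h\<bar>) \<longlongrightarrow> (0::real)) (at 0)" by (rule tendsto_rabs_zero[OF tendsto_ident_at])
    qed
    then show ?thesis using 2 by (simp add: DERIV_def)
  next
    case 3
    have "((\<lambda>u. u\<^sup>2) has_real_derivative 2 * u) (at u)" by (auto intro!: derivative_eq_intros)
    moreover have "\<forall>\<^sub>F x in nhds u. x\<^sup>2 = (max 0 x)\<^sup>2"
      using eventually_nhds_in_open[of "{0<..}" u] 3 by (auto elim!: eventually_mono)
    ultimately have "((\<lambda>u. (max 0 u)\<^sup>2) has_real_derivative 2 * u) (at u)" using DERIV_cong_ev[OF refl, of "\<lambda>u. u\<^sup>2" "\<lambda>u. (max 0 u)\<^sup>2" u "2*u" "2*u"] by simp
    then show ?thesis using 3 by simp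
  qed
qed

text \<open>The square makes the truncated paraboloid differentiable across the sphere of radius q,
  with an explicit bounded gradient.\<close>

definition chi :: "'a::euclidean_space \<Rightarrow> real \<Rightarrow> 'a \<Rightarrow> real" where
  "chi c q z = (max 0 (q\<^sup>2 - (norm (z - c))\<^sup>2))\<^sup>2"

text \<open>This is minus the gradient of \<open>chi c q\<close>, and \<open>dvk s e\<close> below is the divergence of \<open>kr s e\<close>.\<close>

definition vf :: "'a::euclidean_space \<Rightarrow> real \<Rightarrow> 'a \<Rightarrow> 'a" where
  "vf c q z = (4 * max 0 (q\<^sup>2 - (norm (z - c))\<^sup>2)) *\<^sub>R (z - c)"

definition dvk :: "real \<Rightarrow> real \<Rightarrow> 'a::euclidean_space \<Rightarrow> real" where
  "dvk s e w = (real DIM('a) * e\<^sup>2 + (real DIM('a) - s - 1) * (norm w)\<^sup>2) * pk (s+3) e w"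

lemma chi_measurable [measurable]: "chi c q \<in> borel_measurable borel"
  and vf_measurable [measurable]: "vf c q \<in> borel_measurable borel"
  and dvk_measurable [measurable]: "dvk s e \<in> borel_measurable (borel :: 'a::euclidean_space measure)"
  unfolding chi_def vf_def dvk_def by measurable

lemma chi_nonneg: "0 \<le> chi c q z" by (simp add: chi_def)

lemma max0_outside: "0 \<le> q \<Longrightarrow> z \<notin> cball c q \<Longrightarrow> max 0 (q\<^sup>2 - (norm (z - c))\<^sup>2) = 0"
  using power_strict_mono[of q "norm (z - c)" 2] by (auto simp: dist_norm norm_minus_commute max_def)

lemma chi_outside: "0 \<le> q \<Longrightarrow> z \<notin> cball c q \<Longrightarrow> chi c q z = 0"
  and vf_outside: "0 \<le> q \<Longrightarrow> z \<notin> cball c q \<Longrightarrow> vf c q z = 0"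
  using max0_outside[of q z c] by (simp_all add: chi_def vf_def)

lemma max0_le: "max 0 (q\<^sup>2 - (norm (z - c))\<^sup>2) \<le> q\<^sup>2"
  by simp

lemma chi_le: "chi c q z \<le> q ^ 4"
  using power_mono[OF max0_le[of q z c], of 2] by (simp add: chi_def)

lemma norm_vf_le: "0 \<le> q \<Longrightarrow> norm (vf c q z) \<le> 4 * q ^ 3"
proof (cases "z \<in> cball c q")
  case True
  assume q: "0 \<le> q"
  have "norm (vf c q z) = 4 * (max 0 (q\<^sup>2 - (norm (z - c))\<^sup>2) * norm (z - c))" by (simp add: vf_def)
  also have "\<dots> \<le> 4 * (q\<^sup>2 * q)"
    using True q by (intro mult_left_mono mult_mono max0_le) (auto simp: dist_norm norm_minus_commute)
  finally show ?thesis by (simp add: power3_eq_cube power2_eq_square)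
qed (simp add: vf_outside)

lemma norm_line_sq:
  fixes z i :: "'a::euclidean_space"
  shows "(norm (z + t *\<^sub>R i - y))\<^sup>2 = (norm (z - y))\<^sup>2 + 2 * t * ((z - y) \<bullet> i) + t\<^sup>2 * (i \<bullet> i)"
  unfolding power2_norm_eq_inner by (simp add: algebra_simps inner_commute power2_eq_square)

lemma norm_line_sq_deriv:
  fixes z i :: "'a::euclidean_space"
  shows "((\<lambda>t. (norm (z + t *\<^sub>R i - y))\<^sup>2) has_real_derivative 2 * ((z + t *\<^sub>R i - y) \<bullet> i)) (at t)"
  unfolding norm_line_sq by (auto intro!: derivative_eq_intros simp: algebra_simps)

lemma chi_deriv:
  fixes z i :: "'a::euclidean_space"
  shows "((\<lambda>t. chi c q (z + t *\<^sub>R i)) has_real_derivative - (vf c q (z + t *\<^sub>R i) \<bullet> i)) (at t)"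
proof -
  have 1: "((\<lambda>t. q\<^sup>2 - (norm (z + t *\<^sub>R i - c))\<^sup>2) has_real_derivative - (2 * ((z + t *\<^sub>R i - c) \<bullet> i))) (at t)"
    using DERIV_diff[OF DERIV_const norm_line_sq_deriv] by simp
  from DERIV_chain2[OF has_real_derivative_max0_sq 1]
  show ?thesis unfolding chi_def vf_def by (simp add: algebra_simps)
qed

lemma pk_deriv:
  fixes z i :: "'a::euclidean_space"
  assumes "0 < e"
  shows "((\<lambda>t. pk k e (z + t *\<^sub>R i - y)) has_real_derivative - k * ((z + t *\<^sub>R i - y) \<bullet> i) * pk (k+2) e (z + t *\<^sub>R i - y)) (at t)"
proof -
  let ?A = "\<lambda>t. e\<^sup>2 + (norm (z + t *\<^sub>R i - y))\<^sup>2"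
  have A: "0 < ?A t" for t using assms by (intro add_pos_nonneg) auto
  have 1: "(?A has_real_derivative 2 * ((z + t *\<^sub>R i - y) \<bullet> i)) (at t)"
    using DERIV_add[OF DERIV_const norm_line_sq_deriv] by simp
  have "((\<lambda>t. ?A t powr (-(k/2))) has_real_derivative (-(k/2)) * ?A t powr (-(k/2) - 1) * (2 * ((z + t *\<^sub>R i - y) \<bullet> i))) (at t)"
    by (rule DERIV_chain2[OF has_real_derivative_powr[OF A] 1])
  moreover have "-(k/2) - 1 = -((k+2)/2)" by (simp add: field_simps)
  ultimately show ?thesis unfolding pk_def by (simp add: mult_ac)
qed

lemma abs_dvk_le:
  assumes "0 < e" "0 < s"
  shows "\<bar>dvk s e (w :: 'a::euclidean_space)\<bar> \<le> (2 * real DIM('a) + s + 1) * pk (s+1) e w"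
proof -
  let ?d = "real DIM('a)" and ?A = "e\<^sup>2 + (norm w)\<^sup>2"
  have A: "0 < ?A" using assms by (intro add_pos_nonneg) auto
  have "\<bar>?d * e\<^sup>2 + (?d - s - 1) * (norm w)\<^sup>2\<bar> \<le> ?d * e\<^sup>2 + \<bar>?d - s - 1\<bar> * (norm w)\<^sup>2"
    by (intro order_trans[OF abs_triangle_ineq]) (simp add: abs_mult)
  also have "\<dots> \<le> (2 * ?d + s + 1) * e\<^sup>2 + (2 * ?d + s + 1) * (norm w)\<^sup>2"
    using assms by (intro add_mono mult_right_mono) auto
  finally have "\<bar>?d * e\<^sup>2 + (?d - s - 1) * (norm w)\<^sup>2\<bar> * pk (s+3) e w \<le> (2 * ?d + s + 1) * (?A * pk (s+3) e w)"
    unfolding mult.assoc[symmetric] by (intro mult_right_mono) (auto simp: algebra_simps)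
  also have "?A * pk (s+3) e w = pk (s+1) e w"
  proof -
    have "?A * ?A powr (-((s+3)/2)) = ?A powr 1 * ?A powr (-((s+3)/2))" using A by simp
    also have "\<dots> = ?A powr (-((s+1)/2))" unfolding powr_add[symmetric]
      by (rule arg_cong[of _ _ "(powr) ?A"]) (simp add: field_simps)
    finally show ?thesis by (simp add: pk_def)
  qed
  finally show ?thesis unfolding dvk_def abs_mult by simp
qed

lemma integrable_lborel_cball:
  fixes f :: "'a::euclidean_space \<Rightarrow> 'b::{banach, second_countable_topology}"
  assumes "f \<in> borel_measurable borel" "\<And>z. norm (f z) \<le> C" "\<And>z. z \<notin> cball c q \<Longrightarrow> f z = 0"
  shows "integrable lborel f"
proof (rule Bochner_Integration.integrable_bound)
  show "integrable lborel (\<lambda>z. C * indicator (cball c q) z)"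
    using emeasure_lborel_cball_finite[of c q] by (intro integrable_mult_right integrable_real_indicator) auto
  show "AE z in lborel. norm (f z) \<le> norm (C * indicator (cball c q) z)"
    using assms(2,3) by (intro AE_I2) (auto simp: indicator_def intro: order_trans[OF _ abs_ge_self])
qed (use assms in simp)

text \<open>The divergence theorem for \<open>chi c q\<close> times the kernel, one coordinate at a
  time: each coordinate derivative integrates to zero by \<open>integral_deriv_zero\<close>, and
  their sum is the difference of the two integrands.\<close>

lemma vf_kr_ibp:
  fixes c y :: "'a::euclidean_space"
  assumes "0 < e" "0 < s" "0 \<le> q"
  shows "(\<integral>z. vf c q z \<bullet> kr s e (z - y) \<partial>lborel) = (\<integral>z. chi c q z * dvk s e (z - y) \<partial>lborel)"
proof -
  have P1: "pk (s+1) e w \<le> e powr (-(s+1))" for w :: 'a using assms by (intro pk_le_scale) auto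
  have K: "norm (kr s e w) \<le> e powr (-s)" for w :: 'a
    using norm_kr_le[of e s w] pk_le_scale[of s e w] assms by simp
  have i1: "integrable lborel (\<lambda>z. vf c q z \<bullet> kr s e (z - y))"
  proof (rule integrable_lborel_cball[where c=c and q=q and C="4*q^3 * e powr (-s)"])
    fix z
    have "\<bar>vf c q z \<bullet> kr s e (z - y)\<bar> \<le> norm (vf c q z) * norm (kr s e (z - y))" by (rule Cauchy_Schwarz_ineq2)
    also have "\<dots> \<le> 4*q^3 * e powr (-s)" using assms by (intro mult_mono norm_vf_le K) auto
    finally show "norm (vf c q z \<bullet> kr s e (z - y)) \<le> 4*q^3 * e powr (-s)" by simp
  qed (use assms in \<open>auto simp: vf_outside\<close>)
  have i2: "integrable lborel (\<lambda>z. chi c q z * dvk s e (z - y))"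
  proof (rule integrable_lborel_cball[where c=c and q=q and C="q^4 * ((2 * real DIM('a) + s + 1) * e powr (-(s+1)))"])
    fix z
    have "\<bar>dvk s e (z - y)\<bar> \<le> (2 * real DIM('a) + s + 1) * e powr (-(s+1))"
      using assms by (intro order_trans[OF abs_dvk_le] mult_left_mono P1) auto
    then show "norm (chi c q z * dvk s e (z - y)) \<le> q^4 * ((2 * real DIM('a) + s + 1) * e powr (-(s+1)))"
      unfolding real_norm_def abs_mult using chi_nonneg[of c q z] by (intro mult_mono) (auto simp: chi_le)
  qed (use assms in \<open>auto simp: chi_outside\<close>)
  \<comment> \<open>g i is the i-th component of the product field and D i its derivative in
    direction i.\<close>
  define g where "g i z = chi c q z * (((z - y) \<bullet> i) * pk (s+1) e (z - y))" for i z
  define D where "D i z = - (vf c q z \<bullet> i) * (((z - y) \<bullet> i) * pk (s+1) e (z - y))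
     + chi c q z * ((i \<bullet> i) * pk (s+1) e (z - y) - (s+1) * ((z - y) \<bullet> i)\<^sup>2 * pk (s+3) e (z - y))" for i z
  have gm: "g i \<in> borel_measurable borel" "D i \<in> borel_measurable borel" for i
    unfolding g_def D_def by measurable
  have der: "((\<lambda>t. g i (z + t *\<^sub>R i)) has_real_derivative D i (z + t *\<^sub>R i)) (at t)" for i z t
  proof -
    have li: "((\<lambda>t. (z + t *\<^sub>R i - y) \<bullet> i) has_real_derivative i \<bullet> i) (at t)"
      unfolding inner_add_left inner_diff_left inner_scaleR_left by (auto intro!: derivative_eq_intros)
    note d = DERIV_mult[OF chi_deriv[of c q z i t] DERIV_mult[OF li pk_deriv[OF assms(1), of "s+1" z i y t]]]
    have "s + 1 + 2 = s + 3" by simp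
    then show ?thesis unfolding g_def D_def
      by (intro DERIV_cong[OF d]) (simp add: power2_eq_square algebra_simps)
  qed
  have ab: "\<bar>w \<bullet> i\<bar> * pk (k+1) e w \<le> pk k e w" if "i \<in> Basis" for w i :: 'a and k
  proof -
    have "\<bar>w \<bullet> i\<bar> * pk (k+1) e w \<le> norm w * pk (k+1) e w" using Basis_le_norm[OF that] by (intro mult_right_mono) auto
    then show ?thesis using norm_mult_pk_le[OF assms(1), of w k] by linarith
  qed
  have gb: "\<bar>g i z\<bar> \<le> q^4 * e powr (-s)" if "i \<in> Basis" for i z
    unfolding g_def abs_mult using chi_nonneg[of c q z] ab[OF that, of "z - y" s] pk_le_scale[of s e "z - y"] assms
    by (intro mult_mono) (auto simp: chi_le intro: order_trans)
  have Db: "\<bar>D i z\<bar> \<le> 4*q^3 * e powr (-s) + q^4 * (e powr (-(s+1)) + (s+1) * e powr (-(s+1)))" if i: "i \<in> Basis" for i z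
  proof -
    let ?w = "z - y"
    have 1: "\<bar>(vf c q z \<bullet> i) * ((?w \<bullet> i) * pk (s+1) e ?w)\<bar> \<le> 4*q^3 * e powr (-s)"
      unfolding abs_mult using norm_vf_le[OF assms(3), of c z] Basis_le_norm[OF i, of "vf c q z"] ab[OF i, of ?w s] pk_le_scale[of s e ?w] assms
      by (intro mult_mono) auto
    have "(?w \<bullet> i)\<^sup>2 * pk (s+3) e ?w = \<bar>?w \<bullet> i\<bar> * (\<bar>?w \<bullet> i\<bar> * pk (s+2+1) e ?w)"
      by (simp add: power2_eq_square mult.assoc[symmetric] add.commute)
    also have "\<dots> \<le> \<bar>?w \<bullet> i\<bar> * pk (s+1+1) e ?w"
      using ab[OF i, of ?w "s+2"] by (intro mult_left_mono) (auto simp: add.commute add.left_commute)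
    also have "\<dots> \<le> pk (s+1) e ?w" by (rule ab[OF i])
    finally have 3: "(?w \<bullet> i)\<^sup>2 * pk (s+3) e ?w \<le> e powr (-(s+1))" using P1[of ?w] by linarith
    have 2: "\<bar>chi c q z * ((i \<bullet> i) * pk (s+1) e ?w - (s+1) * (?w \<bullet> i)\<^sup>2 * pk (s+3) e ?w)\<bar> \<le> q^4 * (e powr (-(s+1)) + (s+1) * e powr (-(s+1)))"
    proof -
      have "\<bar>(i \<bullet> i) * pk (s+1) e ?w - (s+1) * (?w \<bullet> i)\<^sup>2 * pk (s+3) e ?w\<bar> \<le> pk (s+1) e ?w + (s+1) * ((?w \<bullet> i)\<^sup>2 * pk (s+3) e ?w)"
        using i assms by (intro order_trans[OF abs_triangle_ineq4]) (simp add: abs_mult)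
      also have "\<dots> \<le> e powr (-(s+1)) + (s+1) * e powr (-(s+1))"
        using assms 3 by (intro add_mono mult_left_mono P1) auto
      finally show ?thesis unfolding abs_mult[of "chi c q z"] using chi_nonneg[of c q z]
        by (intro mult_mono) (auto simp: chi_le)
    qed
    have "\<bar>D i z\<bar> \<le> \<bar>(vf c q z \<bullet> i) * ((?w \<bullet> i) * pk (s+1) e ?w)\<bar> + \<bar>chi c q z * ((i \<bullet> i) * pk (s+1) e ?w - (s+1) * (?w \<bullet> i)\<^sup>2 * pk (s+3) e ?w)\<bar>"
      unfolding D_def by (intro order_trans[OF abs_triangle_ineq]) simp
    then show ?thesis using 1 2 by linarith
  qed
  have g0: "z \<notin> cball c q \<Longrightarrow> g i z = 0" and D0: "z \<notin> cball c q \<Longrightarrow> D i z = 0" for i z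
    using chi_outside[OF assms(3), of z c] vf_outside[OF assms(3), of z c] by (simp_all add: g_def D_def)
  have gi: "integrable lborel (g i)" if "i \<in> Basis" for i
    using gb[OF that] g0 by (intro integrable_lborel_cball[where c=c and q=q and C="q^4 * e powr (-s)"] gm) auto
  have Di: "integrable lborel (D i)" if "i \<in> Basis" for i
    using Db[OF that] D0 by (intro integrable_lborel_cball[where c=c and q=q] gm) auto
  have Z: "(\<integral>z. D i z \<partial>lborel) = 0" if "i \<in> Basis" for i
    using g0 that by (intro integral_deriv_zero[OF der Db[OF that] _ gm(1) gi gm(2)]) auto
  have sumD: "(\<Sum>i\<in>Basis. D i z) = chi c q z * dvk s e (z - y) - vf c q z \<bullet> kr s e (z - y)" for z
  proof -
    let ?w = "z - y" and ?d = "real DIM('a)" and ?A = "e\<^sup>2 + (norm (z - y))\<^sup>2"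
    have A: "0 < ?A" using assms by (intro add_pos_nonneg) auto
    have pp: "pk (s+1) e ?w = ?A * pk (s+3) e ?w"
    proof -
      have "?A * ?A powr (-((s+3)/2)) = ?A powr 1 * ?A powr (-((s+3)/2))" using A by simp
      also have "\<dots> = ?A powr (-((s+1)/2))" unfolding powr_add[symmetric]
        by (rule arg_cong[of _ _ "(powr) ?A"]) (simp add: field_simps)
      finally show ?thesis by (simp add: pk_def)
    qed
    have s1: "(\<Sum>i\<in>Basis. (vf c q z \<bullet> i) * (?w \<bullet> i)) = vf c q z \<bullet> ?w" by (rule euclidean_inner[symmetric])
    have s2: "(\<Sum>i\<in>Basis. (?w \<bullet> i)\<^sup>2) = (norm ?w)\<^sup>2"
      unfolding power2_norm_eq_inner euclidean_inner[of ?w ?w] by (simp add: power2_eq_square)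
    have Di: "D i z = ((vf c q z \<bullet> i) * (?w \<bullet> i)) * (- pk (s+1) e ?w) + (i \<bullet> i) * (chi c q z * pk (s+1) e ?w)
        + (?w \<bullet> i)\<^sup>2 * (- (chi c q z * (s+1) * pk (s+3) e ?w))" for i
      unfolding D_def by (simp add: algebra_simps)
    have "(\<Sum>i\<in>Basis. D i z) = - (\<Sum>i\<in>Basis. (vf c q z \<bullet> i) * (?w \<bullet> i)) * pk (s+1) e ?w
        + chi c q z * ((\<Sum>i\<in>Basis. i \<bullet> (i::'a)) * pk (s+1) e ?w - (s+1) * (\<Sum>i\<in>Basis. (?w \<bullet> i)\<^sup>2) * pk (s+3) e ?w)"
      unfolding Di sum.distrib sum_distrib_right[symmetric] by (simp add: right_diff_distrib mult_ac)
    also have "(\<Sum>i\<in>Basis. i \<bullet> (i::'a)) = ?d" by simp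
    also have "?d * pk (s+1) e ?w - (s+1) * (\<Sum>i\<in>Basis. (?w \<bullet> i)\<^sup>2) * pk (s+3) e ?w = dvk s e ?w"
      unfolding s2 pp dvk_def by (simp add: algebra_simps)
    finally show ?thesis unfolding s1 by (simp add: kr_def mult.commute)
  qed
  have "0 = (\<Sum>i\<in>Basis. \<integral>z. D i z \<partial>lborel)" using Z by simp
  also have "\<dots> = (\<integral>z. (\<Sum>i\<in>Basis. D i z) \<partial>lborel)" using Di by (intro Bochner_Integration.integral_sum[symmetric]) auto
  also have "\<dots> = (\<integral>z. chi c q z * dvk s e (z - y) \<partial>lborel) - (\<integral>z. vf c q z \<bullet> kr s e (z - y) \<partial>lborel)"
    unfolding sumD using i1 i2 by (rule Bochner_Integration.integral_diff[rotated])
  finally show ?thesis by simp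
qed

text \<open>Used with \<open>g t\<close> proportional to a power of the measure of \<open>cball z t\<close>: the result is a radius \<open>t\<close> for
  which a bump equal to 1 on \<open>cball z t\<close> can be cut off over the much shorter distance \<open>g t\<close>.\<close>

lemma select_radius:
  fixes g :: "real \<Rightarrow> real"
  assumes t0: "0 < t0" "0 < g t0" and g: "\<And>t. 0 < t \<Longrightarrow> g t \<le> t/4"
  shows "\<exists>t\<ge>t0. t \<le> 2 * t0 \<and> g t0 \<le> g t \<and> (\<forall>t'\<ge>t. g t' \<le> 2 * g t + (t' - t))"
proof (rule ccontr)
  assume neg: "\<not> ?thesis"
  \<comment> \<open>If every t fails, each failure gives a larger t' with g more than doubled and
    with the move t' - t covered by the increase of g. Then t - t0 <= g t <= t/4 keeps t bounded
    while g grows like 2^n.\<close>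
  have "\<exists>t\<ge>t0. t - t0 \<le> g t - g t0 \<and> 2^n * g t0 \<le> g t" for n
  proof (induction n)
    case 0
    then show ?case by (intro exI[of _ t0]) auto
  next
    case (Suc n)
    then obtain t where t: "t0 \<le> t" "t - t0 \<le> g t - g t0" "2^n * g t0 \<le> g t" by blast
    have "g t \<le> t/4" using t t0 by (intro g) auto
    then have "t \<le> 2 * t0" using t t0 by linarith
    moreover have "g t0 \<le> g t" using t by linarith
    ultimately obtain t' where t': "t \<le> t'" "2 * g t + (t' - t) < g t'" using neg t(1) by force
    have "0 < g t" using t t0 by linarith
    then show ?case using t t' t0 by (intro exI[of _ t']) auto
  qed
  moreover obtain n where "t0 / g t0 < 2^n" using real_arch_pow[of 2 "t0 / g t0"] by auto
  ultimately obtain t where t: "t0 \<le> t" "t - t0 \<le> g t - g t0" "2^n * g t0 \<le> g t" "t0 / g t0 < 2^n" by blast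
  have "t0 < 2^n * g t0" using t(4) t0 by (simp add: field_simps)
  moreover have "g t \<le> t/4" using t t0 by (intro g) auto
  ultimately show False using t t0 by linarith
qed

text \<open>With q > 0 the telescoping sum is governed by its largest scale. The constant is the
  fixed point of the recursion: K/(2^q - 1) + K = 2^q K/(2^q - 1).\<close>

lemma norm_diff_dyadic_le:
  fixes f :: "real \<Rightarrow> 'b::real_normed_vector"
  assumes q: "0 < q" and K: "0 \<le> K"
    and step: "\<And>i::nat. i < N \<Longrightarrow> norm (f (2^i * e) - f (2 * (2^i * e))) \<le> K * (2^i * e) powr q"
  shows "norm (f e - f (2^N * e)) \<le> K / (2 powr q - 1) * (2^N * e) powr q"
  using step
proof (induction N)
  case 0
  have "1 < (2::real) powr q" using q by (simp add: gr_one_powr)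
  then show ?case using K by simp
next
  case (Suc N)
  have q1: "1 < (2::real) powr q" using q by (simp add: gr_one_powr)
  have "norm (f e - f (2^Suc N * e)) \<le> norm (f e - f (2^N * e)) + norm (f (2^N * e) - f (2 * (2^N * e)))"
    using norm_triangle_ineq[of "f e - f (2^N * e)" "f (2^N * e) - f (2 * (2^N * e))"] by (simp add: mult.assoc)
  also have "\<dots> \<le> K / (2 powr q - 1) * (2^N * e) powr q + K * (2^N * e) powr q"
    using Suc by (intro add_mono) auto
  also have "\<dots> = K / (2 powr q - 1) * (2 powr q * (2^N * e) powr q)"
  proof -
    have "K / (a - 1) * X + K * X = K / (a - 1) * (a * X)" if "1 < a" for a X :: real
      using that by (simp add: divide_simps) (simp add: algebra_simps)
    then show ?thesis using q1 by blast
  qed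
  also have "2 powr q * (2^N * e) powr q = (2^Suc N * e) powr q"
    by (simp add: powr_mult[symmetric] mult.assoc)
  finally show ?case .
qed

section \<open>Finiteness almost everywhere and testing V against gradient fields\<close>

context growth_measure
begin

text \<open>Finite almost everywhere for \<open>a < d\<close>. For \<open>a > s\<close> its finiteness at \<open>z\<close> forces the density of the
  measure at \<open>z\<close> to decay like a power.\<close>

definition W :: "real \<Rightarrow> 'a \<Rightarrow> ennreal" where
  "W a z = (\<integral>\<^sup>+y. (if dist z y < 1 then ennreal (norm (z - y) powr (-a)) else 0) \<partial>M)"

lemma W_measurable [measurable]: "W a \<in> borel_measurable borel"
proof -
  have "(\<lambda>z. \<integral>\<^sup>+y. (if dist z y < 1 then ennreal (norm (z - y) powr (-a)) else 0) \<partial>M) \<in> borel_measurable borel"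
    by measurable
  then show ?thesis unfolding W_def .
qed

text \<open>By Tonelli the singularity is integrated in z against Lebesgue measure, where any
  exponent below d is harmless.\<close>

lemma nn_integral_W_local:
  assumes a: "a < real DIM('a)" "0 \<le> q"
  shows "(\<integral>\<^sup>+z. indicator (cball c q) z * W a z \<partial>lborel) < \<infinity>"
proof -
  let ?d = "real DIM('a)"
  interpret leb: growth_measure "lborel :: 'a measure" ?d "unit_ball_vol ?d" by (rule growth_measure_lborel)
  interpret P: pair_sigma_finite "lborel :: 'a measure" M ..
  let ?k = "\<lambda>z y. (if dist z y < 1 then ennreal (norm (z - y) powr (-a)) else 0)"
  let ?C = "cdn ?d a * unit_ball_vol ?d * 1 powr (?d - a)"
  have "(\<integral>\<^sup>+z. indicator (cball c q) z * W a z \<partial>lborel) = (\<integral>\<^sup>+z. \<integral>\<^sup>+y. indicator (cball c q) z * ?k z y \<partial>M \<partial>lborel)"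
    unfolding W_def by (intro nn_integral_cong nn_integral_cmult[symmetric]) measurable
  also have "\<dots> = (\<integral>\<^sup>+y. \<integral>\<^sup>+z. indicator (cball c q) z * ?k z y \<partial>lborel \<partial>M)"
    by (rule P.Fubini'[symmetric]) measurable
  also have "\<dots> \<le> (\<integral>\<^sup>+y. ennreal ?C * indicator (ball c (q+1)) y \<partial>M)"
  proof (rule nn_integral_mono)
    fix y
    show "(\<integral>\<^sup>+z. indicator (cball c q) z * ?k z y \<partial>lborel) \<le> ennreal ?C * indicator (ball c (q+1)) y"
    proof (cases "y \<in> ball c (q+1)")
      case True
      have "(\<integral>\<^sup>+z. indicator (cball c q) z * ?k z y \<partial>lborel) \<le> (\<integral>\<^sup>+z. indicator (ball y 1) z * ennreal (norm (y - z) powr (-a)) \<partial>lborel)"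
        by (intro nn_integral_mono) (auto simp: indicator_def dist_commute norm_minus_commute)
      also have "\<dots> \<le> ennreal ?C" using a by (intro leb.nn_integral_near_le) auto
      finally show ?thesis using True by simp
    next
      case False
      have "(\<integral>\<^sup>+z. indicator (cball c q) z * ?k z y \<partial>lborel) = (\<integral>\<^sup>+z. 0 \<partial>(lborel :: 'a measure))"
      proof (intro nn_integral_cong)
        fix z
        show "indicator (cball c q) z * ?k z y = 0"
        proof (cases "z \<in> cball c q")
          case True
          then have "\<not> dist z y < 1" using False dist_triangle[of c y z] by auto
          then show ?thesis by simp
        qed simp
      qed
      then show ?thesis by simp
    qed
  qed
  also have "\<dots> = ennreal ?C * emeasure M (ball c (q+1))" by (intro nn_integral_cmult_indicator) simp
  also have "\<dots> < \<infinity>" using finite_balls(2)[of c "q+1"] by (simp add: ennreal_mult_less_top)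
  finally show ?thesis .
qed

lemma AE_W_finite:
  assumes a: "a < real DIM('a)"
  shows "AE z in lborel. W a z < \<infinity>"
proof -
  have "AE z in lborel. indicator (cball 0 (real n)) z * W a z \<noteq> \<infinity>" for n :: nat
    using nn_integral_W_local[OF a, of "real n" 0] by (intro nn_integral_PInf_AE) auto
  then have "AE z in lborel. \<forall>n::nat. indicator (cball 0 (real n)) z * W a z \<noteq> \<infinity>"
    by (simp add: AE_all_countable)
  then show ?thesis
  proof eventually_elim
    case (elim z)
    obtain n :: nat where "norm z \<le> real n" using real_arch_simple by blast
    then have "indicator (cball 0 (real n)) z = (1::ennreal)" by simp
    with elim[rule_format, of n] show ?case by (simp add: less_top)
  qed
qed

definition CF :: real where "CF = (s+1)/2 * 2 powr ((s+2)/2) * cup s (s+2) * \<Lambda>"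

lemma CF_nonneg: "0 \<le> CF"
  unfolding CF_def using s_pos \<Lambda>_pos cup_pos[of s "s+2"] by simp

lemma nn_integral_J1:
  "(\<integral>\<^sup>+y. ennreal (norm (kr s 1 (z - y) - kr s 0 (z - y))) \<partial>M) \<le> W s z + ennreal CF"
proof -
  have "(\<integral>\<^sup>+y. ennreal (norm (kr s 1 (z - y) - kr s 0 (z - y))) \<partial>M) \<le>
     (\<integral>\<^sup>+y. (if dist z y < 1 then ennreal (norm (z - y) powr (-s)) else 0) + indicator (- ball z 1) y * ennreal (norm (kr s 1 (z - y) - kr s 0 (z - y))) \<partial>M)"
  proof (rule nn_integral_mono)
    fix y
    show "ennreal (norm (kr s 1 (z - y) - kr s 0 (z - y))) \<le> (if dist z y < 1 then ennreal (norm (z - y) powr (-s)) else 0) + indicator (- ball z 1) y * ennreal (norm (kr s 1 (z - y) - kr s 0 (z - y)))"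
    proof (cases "z = y")
      case False
      then show ?thesis using kr_limit_diff(2)[OF s_pos, of 1 "z - y"] by (auto intro: ennreal_leI)
    qed simp
  qed
  also have "\<dots> = W s z + (\<integral>\<^sup>+y. indicator (- ball z 1) y * ennreal (norm (kr s 1 (z - y) - kr s 0 (z - y))) \<partial>M)"
    unfolding W_def by (intro nn_integral_add) measurable
  also have "\<dots> \<le> W s z + ennreal CF" unfolding CF_def by (intro add_mono nn_integral_kr_limit_far order_refl)
  finally show ?thesis .
qed

text \<open>The bound does not depend on e, so it dominates V on bounded sets when e tends to
  0.\<close>

lemma V_near_bound:
  assumes e: "0 < e" "e \<le> 1" and W: "W s z < \<infinity>"
  shows "norm (V e z - V 1 z) \<le> enn2real (W s z) + CF"
proof -
  have "(\<integral>\<^sup>+y. ennreal (norm (kr s e (z - y) - kr s 1 (z - y))) \<partial>M) \<le> (\<integral>\<^sup>+y. ennreal (norm (kr s 1 (z - y) - kr s 0 (z - y))) \<partial>M)"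
    using e s_pos by (intro nn_integral_mono ennreal_leI kr_diff_le_limit_diff) auto
  also have "\<dots> \<le> W s z + ennreal CF" by (rule nn_integral_J1)
  also have "\<dots> = ennreal (enn2real (W s z) + CF)" using W CF_nonneg by (simp add: ennreal_plus)
  finally have "norm (\<integral>y. kr s e (z - y) - kr s 1 (z - y) \<partial>M) \<le> enn2real (W s z) + CF"
    using CF_nonneg by (intro norm_integral_bound_nn) auto
  then show ?thesis using e by (simp add: V_diff)
qed

text \<open>Fubini followed by integration by parts in z for each y. The renormalising term
  \<open>kr s 1 (- y)\<close> drops out because \<open>vf\<close> has integral zero.\<close>

lemma test_identity:
  assumes e: "0 < e" and q: "0 < q"
  shows "(\<integral>z. vf c q z \<bullet> V e z \<partial>lborel) = (\<integral>y. (\<integral>z. chi c q z * dvk s e (z - y) \<partial>lborel) \<partial>M)"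
    and "integrable M (\<lambda>y. \<integral>z. chi c q z * dvk s e (z - y) \<partial>lborel)"
proof -
  interpret P: pair_sigma_finite "lborel :: 'a measure" M ..
  let ?f = "\<lambda>(z,y). vf c q z \<bullet> (kr s e (z - y) - kr s 1 (- y))"
  let ?D = "q / e"
  \<comment> \<open>Bounds the inner integral uniformly for z in the carrier of \<open>vf\<close>,
    by moving z to the centre c.\<close>
  define C where "C = ctd s ?D * ?D * cup s (s+1) * \<Lambda> + (\<integral>y. norm (kr s e (c - y) - kr s 1 (- y)) \<partial>M)"
  have C: "(\<integral>y. norm (kr s e (z - y) - kr s 1 (- y)) \<partial>M) \<le> C" if "z \<in> cball c q" for z
  proof -
    have n: "norm (z - c) \<le> ?D * e" "0 \<le> ?D" using that e q by (auto simp: dist_norm norm_minus_commute)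
    note i = integral_kr_trans(2)[OF e n] integrable_V[OF e, of c]
    have "(\<integral>y. norm (kr s e (z - y) - kr s 1 (- y)) \<partial>M) \<le> (\<integral>y. norm (kr s e (z - y) - kr s e (c - y)) + norm (kr s e (c - y) - kr s 1 (- y)) \<partial>M)"
    proof (intro integral_mono Bochner_Integration.integrable_add integrable_norm integrable_V e i)
      show "norm (kr s e (z - y) - kr s 1 (- y)) \<le> norm (kr s e (z - y) - kr s e (c - y)) + norm (kr s e (c - y) - kr s 1 (- y))" for y
        using norm_triangle_ineq[of "kr s e (z - y) - kr s e (c - y)" "kr s e (c - y) - kr s 1 (- y)"] by (simp only: diff_add_cancel add_diff_eq diff_add_eq)
    qed
    also have "\<dots> = (\<integral>y. norm (kr s e (z - y) - kr s e (c - y)) \<partial>M) + (\<integral>y. norm (kr s e (c - y) - kr s 1 (- y)) \<partial>M)"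
      by (intro Bochner_Integration.integral_add integrable_norm i)
    also have "\<dots> \<le> C" unfolding C_def using integral_kr_trans_le[OF e n] by simp
    finally show ?thesis .
  qed
  have int: "integrable (lborel \<Otimes>\<^sub>M M) ?f"
  proof (rule integrable_pair_bound[where A="cball c q" and C="4*q^3*C"])
    fix z
    show "(\<integral>\<^sup>+y. ennreal (norm (?f (z,y))) \<partial>M) \<le> ennreal (4*q^3*C) * indicator (cball c q) z"
    proof (cases "z \<in> cball c q")
      case True
      have "0 \<le> C" using order_trans[OF _ C[OF True]] by (simp add: Bochner_Integration.integral_nonneg)
      have "(\<integral>\<^sup>+y. ennreal (norm (?f (z,y))) \<partial>M) \<le> (\<integral>\<^sup>+y. ennreal (4*q^3 * norm (kr s e (z - y) - kr s 1 (- y))) \<partial>M)"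
      proof (intro nn_integral_mono ennreal_leI)
        fix y
        have "\<bar>vf c q z \<bullet> (kr s e (z - y) - kr s 1 (- y))\<bar> \<le> norm (vf c q z) * norm (kr s e (z - y) - kr s 1 (- y))" by (rule Cauchy_Schwarz_ineq2)
        also have "\<dots> \<le> 4*q^3 * norm (kr s e (z - y) - kr s 1 (- y))" using q by (intro mult_right_mono norm_vf_le) auto
        finally show "norm (?f (z,y)) \<le> 4*q^3 * norm (kr s e (z - y) - kr s 1 (- y))" by simp
      qed
      also have "\<dots> = ennreal (\<integral>y. 4*q^3 * norm (kr s e (z - y) - kr s 1 (- y)) \<partial>M)"
        using integrable_V[OF e, of z] q by (intro nn_integral_eq_integral integrable_mult_right integrable_norm) auto
      also have "\<dots> \<le> ennreal (4*q^3*C)" using C[OF True] q by (intro ennreal_leI) simp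
      finally show ?thesis using True by simp
    next
      case False
      then show ?thesis using vf_outside[of q z c] q by simp
    qed
  qed (use emeasure_lborel_cball_finite[of c q] in auto)
  have vi: "integrable lborel (\<lambda>z. vf c q z)"
    using q norm_vf_le[of q c] vf_outside[of q _ c] by (intro integrable_lborel_cball[where C="4*q^3" and c=c and q=q]) auto
  have v0: "(\<integral>z. vf c q z \<partial>lborel) = 0"
  proof -
    have "(\<integral>z. vf c q z \<partial>lborel) = (\<integral>z. vf c q (c + z) \<partial>lborel)"
      by (rule integral_lborel_translate(1)[symmetric]) measurable
    also have "\<dots> = 0" by (rule integral_lborel_odd) (auto simp: vf_def)
    finally show ?thesis .
  qed
  have K: "norm (kr s e w) \<le> e powr (-s)" for w :: 'a by (rule kr_bounded[OF e])
  have inner: "(\<integral>z. ?f (z,y) \<partial>lborel) = (\<integral>z. chi c q z * dvk s e (z - y) \<partial>lborel)" for y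
  proof -
    have i1: "integrable lborel (\<lambda>z. vf c q z \<bullet> kr s e (z - y))"
    proof (rule integrable_lborel_cball[where c=c and q=q and C="4*q^3 * e powr (-s)"])
      fix z
      have "\<bar>vf c q z \<bullet> kr s e (z - y)\<bar> \<le> norm (vf c q z) * norm (kr s e (z - y))" by (rule Cauchy_Schwarz_ineq2)
      also have "\<dots> \<le> 4*q^3 * e powr (-s)" using q by (intro mult_mono norm_vf_le K) auto
      finally show "norm (vf c q z \<bullet> kr s e (z - y)) \<le> 4*q^3 * e powr (-s)" by simp
    qed (use q in \<open>auto simp: vf_outside\<close>)
    have i2: "integrable lborel (\<lambda>z. vf c q z \<bullet> kr s 1 (- y))" using vi by (rule integrable_inner_left)
    have "(\<integral>z. ?f (z,y) \<partial>lborel) = (\<integral>z. vf c q z \<bullet> kr s e (z - y) \<partial>lborel) - (\<integral>z. vf c q z \<bullet> kr s 1 (- y) \<partial>lborel)"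
      unfolding prod.case inner_diff_right using i1 i2 by (rule Bochner_Integration.integral_diff)
    also have "(\<integral>z. vf c q z \<bullet> kr s 1 (- y) \<partial>lborel) = (\<integral>z. vf c q z \<partial>lborel) \<bullet> kr s 1 (- y)"
      using vi by (rule integral_inner_left)
    finally show ?thesis using v0 e s_pos q by (simp add: vf_kr_ibp)
  qed
  have int': "integrable (lborel \<Otimes>\<^sub>M M) (case_prod (\<lambda>z y. vf c q z \<bullet> (kr s e (z - y) - kr s 1 (- y))))" using int .
  show "integrable M (\<lambda>y. \<integral>z. chi c q z * dvk s e (z - y) \<partial>lborel)"
    using P.integrable_snd[OF int'] inner by simp
  have "(\<integral>z. vf c q z \<bullet> V e z \<partial>lborel) = (\<integral>z. \<integral>y. ?f (z,y) \<partial>M \<partial>lborel)"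
    unfolding V_def prod.case
    by (intro Bochner_Integration.integral_cong refl integral_inner_right[symmetric] integrable_V e)
  also have "\<dots> = (\<integral>y. \<integral>z. ?f (z,y) \<partial>lborel \<partial>M)"
    using P.Fubini_integral[OF int'] by simp
  also have "\<dots> = (\<integral>y. (\<integral>z. chi c q z * dvk s e (z - y) \<partial>lborel) \<partial>M)" unfolding inner ..
  finally show "(\<integral>z. vf c q z \<bullet> V e z \<partial>lborel) = (\<integral>y. (\<integral>z. chi c q z * dvk s e (z - y) \<partial>lborel) \<partial>M)" .
qed

lemma vf_integral_zero:
  "(\<integral>z. vf c q z \<bullet> l \<partial>lborel) = 0"
proof -
  have "(\<integral>z. vf c q z \<bullet> l \<partial>lborel) = (\<integral>z. vf c q (c + z) \<bullet> l \<partial>lborel)"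
    by (rule integral_lborel_translate(1)[symmetric]) measurable
  also have "\<dots> = 0" by (rule integral_lborel_odd) (auto simp: vf_def)
  finally show ?thesis .
qed

text \<open>v - l is the average of V e - l minus the average of V e - v. The first costs E divided
  by the integral of \<psi>; this is useful only if the carrier does not have much more mass than
  \<psi> sees.\<close>

lemma average_bound:
  assumes e: "0 < e" and lip: "lipc L \<psi> c \<rho>" and nn: "\<And>y. 0 \<le> \<psi> y" and I: "0 < (\<integral>y. \<psi> y \<partial>M)"
    and E: "norm (\<integral>x. \<psi> x *\<^sub>R (V e x - l) \<partial>M) \<le> E"
    and F: "\<And>u. u \<in> cball c \<rho> \<Longrightarrow> norm (V e u - v) \<le> F"
  shows "norm (v - l) \<le> E / (\<integral>y. \<psi> y \<partial>M) + F"
proof -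
  let ?I = "\<integral>y. \<psi> y \<partial>M"
  have i: "integrable M \<psi>" "integrable M (\<lambda>x. \<psi> x *\<^sub>R V e x)" using lip integrable_lipc integrable_lipc_V[OF e] by auto
  have i3: "integrable M (\<lambda>x. \<psi> x *\<^sub>R (V e x - v))"
    unfolding scaleR_diff_right using i by (intro Bochner_Integration.integrable_diff integrable_scaleR_left) auto
  have d: "(\<integral>x. \<psi> x *\<^sub>R (V e x - w) \<partial>M) = (\<integral>x. \<psi> x *\<^sub>R V e x \<partial>M) - ?I *\<^sub>R w" for w
    unfolding scaleR_diff_right using i by simp
  have eq: "?I *\<^sub>R (v - l) = (\<integral>x. \<psi> x *\<^sub>R (V e x - l) \<partial>M) - (\<integral>x. \<psi> x *\<^sub>R (V e x - v) \<partial>M)"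
    unfolding d by (simp add: algebra_simps)
  have "norm (\<integral>x. \<psi> x *\<^sub>R (V e x - v) \<partial>M) \<le> (\<integral>x. norm (\<psi> x *\<^sub>R (V e x - v)) \<partial>M)" by (rule integral_norm_bound)
  also have "\<dots> \<le> (\<integral>x. \<psi> x * F \<partial>M)"
  proof (rule integral_mono[OF integrable_norm[OF i3] integrable_mult_left[OF i(1)]])
    show "norm (\<psi> x *\<^sub>R (V e x - v)) \<le> \<psi> x * F" for x
      using nn[of x] F[of x] lip by (cases "x \<in> cball c \<rho>") (auto simp: lipc_def intro: mult_left_mono)
  qed
  also have "\<dots> = ?I * F" by simp
  finally have "norm (?I *\<^sub>R (v - l)) \<le> E + ?I * F"
    unfolding eq using E norm_triangle_ineq4[of "\<integral>x. \<psi> x *\<^sub>R (V e x - l) \<partial>M" "\<integral>x. \<psi> x *\<^sub>R (V e x - v) \<partial>M"] by linarith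
  moreover have "norm (?I *\<^sub>R (v - l)) = ?I * norm (v - l)" using I by simp
  ultimately have "?I * norm (v - l) \<le> E + ?I * F" by linarith
  then have "norm (v - l) \<le> (E + ?I * F) / ?I" using I by (simp add: pos_le_divide_eq mult.commute)
  also have "\<dots> = E / ?I + F" using I by (simp add: add_divide_distrib)
  finally show ?thesis .
qed

end

lemma pk_shift: 
  assumes "0 < e"
  shows "(e\<^sup>2 + (norm w)\<^sup>2) * pk (k+2) e w = pk k e w"
proof -
  let ?A = "e\<^sup>2 + (norm w)\<^sup>2"
  have A: "0 < ?A" using assms by (intro add_pos_nonneg) auto
  have "?A * ?A powr (-((k+2)/2)) = ?A powr 1 * ?A powr (-((k+2)/2))" using A by simp
  also have "\<dots> = ?A powr (-(k/2))" unfolding powr_add[symmetric]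
    by (rule arg_cong[of _ _ "(powr) ?A"]) (simp add: field_simps)
  finally show ?thesis by (simp add: pk_def)
qed

lemma sq_powr_half: "0 < e \<Longrightarrow> (e\<^sup>2) powr (-(k/2)) = e powr (-k)" for e k :: real
  by (simp add: powr_powr flip: powr_numeral)

lemma dvk_nonneg: "s \<le> real DIM('a) - 1 \<Longrightarrow> 0 \<le> dvk s e (w :: 'a::euclidean_space)"
  unfolding dvk_def by (intro mult_nonneg_nonneg add_nonneg_nonneg) auto

lemma integrable_chi_dvk:
  fixes c y :: "'a::euclidean_space"
  assumes "0 < e" "0 < s" "0 \<le> q"
  shows "integrable lborel (\<lambda>z. chi c q z * dvk s e (z - y))"
proof (rule integrable_lborel_cball[where c=c and q=q and C="q^4 * ((2 * real DIM('a) + s + 1) * e powr (-(s+1)))"])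
  fix z
  have "\<bar>dvk s e (z - y)\<bar> \<le> (2 * real DIM('a) + s + 1) * e powr (-(s+1))"
    using assms by (intro order_trans[OF abs_dvk_le] mult_left_mono pk_le_scale) auto
  then show "norm (chi c q z * dvk s e (z - y)) \<le> q^4 * ((2 * real DIM('a) + s + 1) * e powr (-(s+1)))"
    unfolding real_norm_def abs_mult using chi_nonneg[of c q z] by (intro mult_mono) (auto simp: chi_le)
qed (use assms in \<open>auto simp: chi_outside\<close>)

lemma chi_ge:
  assumes "0 < q" "z \<in> ball c (3*q/4)"
  shows "(7*q\<^sup>2/16)\<^sup>2 \<le> chi c q z"
proof -
  have "(norm (z - c))\<^sup>2 \<le> (3*q/4)\<^sup>2" using assms by (intro power_mono) (auto simp: dist_norm norm_minus_commute)
  then have "7*q\<^sup>2/16 \<le> q\<^sup>2 - (norm (z - c))\<^sup>2" by (simp add: power_mult_distrib power_divide)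
  then have "7*q\<^sup>2/16 \<le> max 0 (q\<^sup>2 - (norm (z - c))\<^sup>2)" by linarith
  then show ?thesis unfolding chi_def by (intro power_mono) auto
qed

text \<open>The lower bound must not depend on e. The subcases differ in where the mass of the
  divergence sits: spread over the ball if s < d - 1, concentrated at distance about e from y if s =
  d - 1.\<close>

lemma chi_dvk_lower:
  fixes c :: "'a::euclidean_space"
  assumes s: "0 < s" "s \<le> real DIM('a) - 1" and q: "0 < q"
  obtains \<kappa> where "0 < \<kappa>"
    "\<And>e y. 0 < e \<Longrightarrow> e \<le> 1 \<Longrightarrow> e \<le> q/4 \<Longrightarrow> y \<in> ball c (q/2) \<Longrightarrow> \<kappa> \<le> (\<integral>z. chi c q z * dvk s e (z - y) \<partial>lborel)"
proof -
  let ?d = "real DIM('a)" and ?v = "unit_ball_vol (real DIM('a))"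
  define x0 where "x0 = (7*q\<^sup>2/16)\<^sup>2"
  have x0: "0 < x0" using q by (simp add: x0_def)
  \<comment> \<open>Any ball inside the concentric ball of radius 3q/4 on which the divergence is at
    least m gives a bound; x0 bounds \<open>chi\<close> from below there, with 7/16 = 1 -
    9/16.\<close>
  have key: "(m * x0) * (?v * r ^ DIM('a)) \<le> (\<integral>z. chi c q z * dvk s e (z - y) \<partial>lborel)"
    if "0 < e" "0 \<le> r" "0 \<le> m" "\<And>z. z \<in> ball p r \<Longrightarrow> z \<in> ball c (3*q/4) \<and> m \<le> dvk s e (z - y)" for e r m p y
  proof -
    have "(m * x0) * (?v * r ^ DIM('a)) = (\<integral>z. (m * x0) * indicator (ball p r) z \<partial>lborel)"
      using that content_ball[of r p] emeasure_lborel_ball_finite[of p r] by (simp add: content_ball)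
    also have "\<dots> \<le> (\<integral>z. chi c q z * dvk s e (z - y) \<partial>lborel)"
    proof (rule integral_mono)
      show "integrable lborel (\<lambda>z. (m * x0) * indicator (ball p r) z)"
        using emeasure_lborel_ball_finite[of p r] by (intro integrable_mult_right integrable_real_indicator) auto
      show "integrable lborel (\<lambda>z. chi c q z * dvk s e (z - y))"
        using that s q by (intro integrable_chi_dvk) auto
      show "(m * x0) * indicator (ball p r) z \<le> chi c q z * dvk s e (z - y)" for z
      proof (cases "z \<in> ball p r")
        case True
        have "x0 * m \<le> chi c q z * dvk s e (z - y)"
          using that(3) that(4)[OF True] chi_ge[OF q, of z c] chi_nonneg[of c q z] unfolding x0_def
          by (intro mult_mono) auto
        then show ?thesis using True by (simp add: mult.commute)
      next
        case False
        then show ?thesis using chi_nonneg[of c q z] dvk_nonneg[OF s(2), of e "z - y"] by simp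
      qed
    qed
    finally show ?thesis .
  qed
  have vp: "0 < ?v" by (simp add: unit_ball_vol_pos)
  show ?thesis
  proof (cases "s < ?d - 1")
    case True
    \<comment> \<open>As d >= d - s - 1, the divergence is at least (d - s - 1) times
      \<open>pk (s+1)\<close>; in the latter, 1 bounds e and 2q bounds |z - y|.\<close>
    define m where "m = (?d - s - 1) * (1 + (2*q)\<^sup>2) powr (-((s+1)/2))"
    have "0 < 1 + (2*q)\<^sup>2" by (intro add_pos_nonneg) auto
    then have m: "0 < m" unfolding m_def using True by (intro mult_pos_pos) (auto simp del: power_mult_distrib)
    show ?thesis
    proof (rule that)
      show "0 < (m * x0) * (?v * (q/2) ^ DIM('a))" using m x0 vp q by simp
      fix e y assume e: "0 < e" "e \<le> 1" "e \<le> q/4" and y: "y \<in> ball c (q/2)"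
      show "(m * x0) * (?v * (q/2) ^ DIM('a)) \<le> (\<integral>z. chi c q z * dvk s e (z - y) \<partial>lborel)"
      proof (rule key[OF e(1)])
        fix z assume z: "z \<in> ball c (q/2)"
        have n: "norm (z - y) \<le> 2*q" using z y q dist_triangle2[of z y c] by (auto simp: dist_norm norm_minus_commute)
        have "(1 + (2*q)\<^sup>2) powr (-((s+1)/2)) \<le> pk (s+1) e (z - y)"
        proof -
          have "(norm (z - y))\<^sup>2 \<le> (2*q)\<^sup>2" using n by (intro power_mono) auto
          moreover have "e\<^sup>2 \<le> 1" using e by (simp add: power_le_one)
          ultimately show ?thesis
            unfolding pk_def using e s by (intro powr_mono2') (auto intro: add_pos_nonneg)
        qed
        then have "m \<le> (?d - s - 1) * pk (s+1) e (z - y)" unfolding m_def using True by (intro mult_left_mono) auto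
        also have "\<dots> = (?d - s - 1) * (e\<^sup>2 + (norm (z - y))\<^sup>2) * pk (s+3) e (z - y)"
          using pk_shift[OF e(1), of "z - y" "s+1"] by (simp add: mult.assoc add.assoc)
        also have "\<dots> \<le> dvk s e (z - y)"
          unfolding dvk_def using s by (intro mult_right_mono) (auto simp: algebra_simps)
        finally show "z \<in> ball c (3*q/4) \<and> m \<le> dvk s e (z - y)" using z q by auto
      qed (use q m in auto)
    qed
  next
    case False
    then have sd: "s = ?d - 1" using s by simp
    define \<kappa> where "\<kappa> = x0 * ?d * 2 powr (-((s+3)/2)) * ?v"
    show ?thesis
    proof (rule that)
      show "0 < \<kappa>" using x0 vp by (simp add: \<kappa>_def)
      fix e y assume e: "0 < e" "e \<le> 1" "e \<le> q/4" and y: "y \<in> ball c (q/2)"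
      \<comment> \<open>The coefficient of |w|^2 vanishes here. On the ball of radius e about y the
        divergence has size e^(-(s+1)) = e^(-d), which the volume of that ball compensates
        exactly.\<close>
      define m where "m = ?d * e\<^sup>2 * (2 * e\<^sup>2) powr (-((s+3)/2))"
      have "(m * x0) * (?v * e ^ DIM('a)) \<le> (\<integral>z. chi c q z * dvk s e (z - y) \<partial>lborel)"
      proof (rule key[OF e(1)])
        fix z assume z: "z \<in> ball y e"
        have "(norm (z - y))\<^sup>2 \<le> e\<^sup>2" using z by (intro power_mono) (auto simp: dist_norm norm_minus_commute)
        then have "(2 * e\<^sup>2) powr (-((s+3)/2)) \<le> pk (s+3) e (z - y)"
          unfolding pk_def using e s by (intro powr_mono2') (auto intro!: add_pos_nonneg)
        then have "m \<le> dvk s e (z - y)"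
          unfolding m_def dvk_def using sd by (intro mult_mono) auto
        then show "z \<in> ball c (3*q/4) \<and> m \<le> dvk s e (z - y)"
          using z y e dist_triangle[of c z y] by auto
      qed (use e in \<open>auto simp: m_def\<close>)
      moreover have "(m * x0) * (?v * e ^ DIM('a)) = \<kappa>"
      proof -
        have 1: "(2 * e\<^sup>2) powr (-((s+3)/2)) = 2 powr (-((s+3)/2)) * e powr (-(s+3))"
          unfolding powr_mult sq_powr_half[OF e(1), of "s+3"] ..
        have 2: "e\<^sup>2 * (e powr (-(s+3)) * e ^ DIM('a)) = 1"
        proof -
          have "e\<^sup>2 * (e powr (-(s+3)) * e ^ DIM('a)) = e powr 2 * (e powr (-(s+3)) * e powr ?d)"
            using e by (simp add: powr_realpow)
          also have "\<dots> = e powr (2 + (-(s+3) + ?d))" by (simp only: powr_add)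
          also have "2 + (-(s+3) + ?d) = 0" using sd by simp
          finally show ?thesis using e by simp
        qed
        have "(m * x0) * (?v * e ^ DIM('a)) = \<kappa> * (e\<^sup>2 * (e powr (-(s+3)) * e ^ DIM('a)))"
          unfolding m_def 1 \<kappa>_def by (simp only: mult_ac)
        then show ?thesis unfolding 2 by simp
      qed
      ultimately show "\<kappa> \<le> (\<integral>z. chi c q z * dvk s e (z - y) \<partial>lborel)" by simp
    qed
  qed
qed

context growth_measure
begin

text \<open>The limit would force the integrals of \<open>vf\<close> against V to tend to 0, the
  integral of \<open>vf\<close> against a constant, whereas \<open>test_identity\<close> keeps them
  above \<kappa> times the mass of a smaller ball.\<close>

lemma not_constant_field:
  assumes s: "s \<le> real DIM('a) - 1" and q: "0 < q" and pos: "0 < emeasure M (ball c (q/2))"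
    and lim: "AE z in lborel. z \<in> cball c q \<longrightarrow> (\<lambda>n. V ((1/2)^n) z) \<longlonglongrightarrow> l"
  shows False
proof -
  have sd: "s < real DIM('a)" using s by simp
  obtain \<kappa> where \<kappa>: "0 < \<kappa>" "\<And>e y. 0 < e \<Longrightarrow> e \<le> 1 \<Longrightarrow> e \<le> q/4 \<Longrightarrow> y \<in> ball c (q/2) \<Longrightarrow> \<kappa> \<le> (\<integral>z. chi c q z * dvk s e (z - y) \<partial>lborel)"
    using chi_dvk_lower[OF s_pos s q, of c] by blast
  have fin: "emeasure M (ball c (q/2)) < \<infinity>" by (rule finite_balls)
  have low: "\<kappa> * measure M (ball c (q/2)) \<le> (\<integral>z. vf c q z \<bullet> V e z \<partial>lborel)" if e: "0 < e" "e \<le> 1" "e \<le> q/4" for e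
  proof -
    have "\<kappa> * measure M (ball c (q/2)) = (\<integral>y. \<kappa> * indicator (ball c (q/2)) y \<partial>M)" using fin by simp
    also have "\<dots> \<le> (\<integral>y. (\<integral>z. chi c q z * dvk s e (z - y) \<partial>lborel) \<partial>M)"
    proof (rule integral_mono)
      show "integrable M (\<lambda>y. \<kappa> * indicator (ball c (q/2)) y)"
        using fin by (intro integrable_mult_right integrable_real_indicator) auto
      show "integrable M (\<lambda>y. \<integral>z. chi c q z * dvk s e (z - y) \<partial>lborel)" by (rule test_identity(2)[OF e(1) q])
      show "\<kappa> * indicator (ball c (q/2)) y \<le> (\<integral>z. chi c q z * dvk s e (z - y) \<partial>lborel)" for y
      proof (cases "y \<in> ball c (q/2)")
        case False
        have "0 \<le> (\<integral>z. chi c q z * dvk s e (z - y) \<partial>lborel)"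
          by (intro Bochner_Integration.integral_nonneg mult_nonneg_nonneg chi_nonneg dvk_nonneg s)
        then show ?thesis using False by simp
      qed (use \<kappa>(2)[OF e] in simp)
    qed
    also have "\<dots> = (\<integral>z. vf c q z \<bullet> V e z \<partial>lborel)" by (rule test_identity(1)[OF e(1) q, symmetric])
    finally show ?thesis .
  qed
  obtain C where C: "0 \<le> C" "\<And>z. z \<in> cball c q \<Longrightarrow> norm (V 1 z) \<le> C" using V_bounded_on[of 1 c q] by auto
  let ?w = "\<lambda>z. 4*q^3 * (indicator (cball c q) z * enn2real (W s z) + (CF + C) * indicator (cball c q) z)"
  have Wf: "AE z in lborel. W s z < \<infinity>" by (rule AE_W_finite[OF sd])
  have w: "integrable lborel ?w"
  proof (intro integrable_mult_right Bochner_Integration.integrable_add integrable_real_indicator)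
    show "integrable lborel (\<lambda>z. indicator (cball c q) z * enn2real (W s z))"
    proof (rule integrableI_nonneg)
      have "(\<integral>\<^sup>+z. ennreal (indicator (cball c q) z * enn2real (W s z)) \<partial>lborel) \<le> (\<integral>\<^sup>+z. indicator (cball c q) z * W s z \<partial>lborel)"
        by (intro nn_integral_mono) (auto simp: indicator_def ennreal_enn2real_if)
      also have "\<dots> < \<infinity>" using q by (intro nn_integral_W_local[OF sd]) auto
      finally show "(\<integral>\<^sup>+z. ennreal (indicator (cball c q) z * enn2real (W s z)) \<partial>lborel) < \<infinity>" .
    qed auto
  qed (use emeasure_lborel_cball_finite[of c q] in auto)
  have "(\<lambda>n. \<integral>z. vf c q z \<bullet> V ((1/2)^n) z \<partial>lborel) \<longlonglongrightarrow> (\<integral>z. vf c q z \<bullet> l \<partial>lborel)"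
  proof (rule integral_dominated_convergence[OF _ _ w])
    show "AE z in lborel. (\<lambda>n. vf c q z \<bullet> V ((1/2)^n) z) \<longlonglongrightarrow> vf c q z \<bullet> l"
      using lim
    proof eventually_elim
      case (elim z)
      show ?case
      proof (cases "z \<in> cball c q")
        case True
        then show ?thesis using elim by (intro tendsto_inner tendsto_const) auto
      next
        case False
        then show ?thesis using vf_outside[of q z c] q by simp
      qed
    qed
    show "AE z in lborel. norm (vf c q z \<bullet> V ((1/2)^n) z) \<le> ?w z" for n
      using Wf
    proof eventually_elim
      case (elim z)
      show ?case
      proof (cases "z \<in> cball c q")
        case True
        have "norm (V ((1/2)^n) z - V 1 z) \<le> enn2real (W s z) + CF"
          using elim by (intro V_near_bound) (auto simp: power_le_one)
        then have "norm (V ((1/2)^n) z) \<le> enn2real (W s z) + CF + C"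
          using C(2)[OF True] norm_triangle_sub[of "V ((1/2)^n) z" "V 1 z"] by linarith
        then have "norm (vf c q z) * norm (V ((1/2)^n) z) \<le> 4*q^3 * (enn2real (W s z) + CF + C)"
          using q by (intro mult_mono norm_vf_le) auto
        moreover have "\<bar>vf c q z \<bullet> V ((1/2)^n) z\<bar> \<le> norm (vf c q z) * norm (V ((1/2)^n) z)" by (rule Cauchy_Schwarz_ineq2)
        ultimately show ?thesis using True by (simp add: add.assoc)
      next
        case False
        then show ?thesis using vf_outside[of q z c] q by simp
      qed
    qed
  qed measurable
  then have "(\<lambda>n. \<integral>z. vf c q z \<bullet> V ((1/2)^n) z \<partial>lborel) \<longlonglongrightarrow> 0" unfolding vf_integral_zero .
  moreover have "0 < \<kappa> * measure M (ball c (q/2))"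
    using \<kappa>(1) pos fin by (simp add: measure_def enn2real_positive_iff)
  ultimately have "\<forall>\<^sub>F n in sequentially. (\<integral>z. vf c q z \<bullet> V ((1/2)^n) z \<partial>lborel) < \<kappa> * measure M (ball c (q/2))"
    by (rule order_tendstoD)
  moreover have "(\<lambda>n. (1/2)^n) \<longlonglongrightarrow> (0::real)" by (rule LIMSEQ_power_zero) simp
  then have "\<forall>\<^sub>F n in sequentially. (1/2)^n < min 1 (q/4)" using q by (intro order_tendstoD) auto
  ultimately have "\<forall>\<^sub>F n in sequentially. False"
  proof eventually_elim
    case (elim n)
    then show ?case using low[of "(1/2)^n"] by auto
  qed
  then show False by simp
qed

text \<open>For t < 1 this is Chebyshev's inequality for \<open>W\<close>, the centre having no
  mass. For t >= 1 the growth bound suffices, as t^s <= t^s'; the factor 2^s comes from enclosing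
  the closed ball in an open one of twice the radius.\<close>

lemma measure_cball_le_powr:
  assumes W: "W s' z < \<infinity>" and s': "s < s'" and t: "0 < t"
  shows "measure M (cball z t) \<le> (enn2real (W s' z) + \<Lambda> * 2 powr s) * t powr s'"
proof (cases "t < 1")
  case True
  have "ennreal (t powr (-s')) * emeasure M (cball z t - {z}) = (\<integral>\<^sup>+y. ennreal (t powr (-s')) * indicator (cball z t - {z}) y \<partial>M)"
    by (intro nn_integral_cmult_indicator[symmetric]) auto
  also have "\<dots> \<le> W s' z" unfolding W_def
  proof (rule nn_integral_mono)
    fix y
    show "ennreal (t powr (-s')) * indicator (cball z t - {z}) y \<le> (if dist z y < 1 then ennreal (norm (z - y) powr (-s')) else 0)"
    proof (cases "y \<in> cball z t - {z}")
      case True': True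
      then have "t powr (-s') \<le> norm (z - y) powr (-s')" using s' s_pos by (intro powr_mono2') (auto simp: dist_norm)
      then show ?thesis using True' True by (auto intro: ennreal_leI)
    qed simp
  qed
  also have "emeasure M (cball z t - {z}) = emeasure M (cball z t)"
    using emeasure_singleton[of z] by (intro emeasure_Diff_null_set) (auto simp: null_sets_def)
  finally have "ennreal (t powr (-s') * measure M (cball z t)) \<le> ennreal (enn2real (W s' z))"
    using finite_balls(1)[of z t] W by (simp add: emeasure_eq_ennreal_measure ennreal_mult)
  then have "t powr (-s') * measure M (cball z t) \<le> enn2real (W s' z)" by (subst (asm) ennreal_le_iff) auto
  then have "measure M (cball z t) \<le> enn2real (W s' z) * t powr s'" using t by (simp add: powr_minus field_simps)
  also have "\<dots> \<le> (enn2real (W s' z) + \<Lambda> * 2 powr s) * t powr s'" using \<Lambda>_pos by (intro mult_right_mono) auto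
  finally show ?thesis .
next
  case False
  have "emeasure M (cball z t) \<le> emeasure M (ball z (2*t))" using t by (intro emeasure_mono) auto
  also have "\<dots> \<le> ennreal (\<Lambda> * (2*t) powr s)" using t by (intro growth) auto
  finally have "ennreal (measure M (cball z t)) \<le> ennreal (\<Lambda> * (2*t) powr s)"
    using finite_balls(1)[of z t] by (simp add: emeasure_eq_ennreal_measure)
  then have "measure M (cball z t) \<le> \<Lambda> * (2*t) powr s" using \<Lambda>_pos by (subst (asm) ennreal_le_iff) auto
  also have "\<dots> = \<Lambda> * 2 powr s * t powr s" using t by (simp add: powr_mult)
  also have "\<dots> \<le> \<Lambda> * 2 powr s * t powr s'" using False s' \<Lambda>_pos by (intro mult_left_mono powr_mono) auto
  also have "\<dots> \<le> (enn2real (W s' z) + \<Lambda> * 2 powr s) * t powr s'" by (intro mult_right_mono) auto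
  finally show ?thesis .
qed


text \<open>Here x is a scale and u a point. The factor 3 is 2^2 - 1. The mass is used only at radii
  at least x, which is all that the selection of a radius provides.\<close>

lemma V_double_step:
  assumes e: "0 < x" and B: "0 \<le> B" and \<kappa>: "s \<le> \<kappa>" "\<kappa> < s + 2"
    and m: "\<And>r. x \<le> r \<Longrightarrow> emeasure M (ball u r) \<le> ennreal (B * r powr \<kappa>)"
  shows "norm (V x u - V (2*x) u) \<le> (s+1)/2 * 3 * cup \<kappa> (s+2) * B * x powr (\<kappa> - s)"
proof -
  have "(\<integral>y. pk (s+2) x (u - y) \<partial>M) \<le> cup \<kappa> (s+2) * B * x powr (\<kappa> - (s+2))"
  proof (rule nn_bound_real(2))
    show "(\<integral>\<^sup>+y. ennreal (pk (s+2) x (u - y)) \<partial>M) \<le> ennreal (cup \<kappa> (s+2) * B * x powr (\<kappa> - (s+2)))"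
      using e \<kappa> s_pos B by (intro nn_integral_pk_dyadic m sets_M) (auto simp: mult_le_cancel_right1)
    show "0 \<le> cup \<kappa> (s+2) * B * x powr (\<kappa> - (s+2))" using B cup_pos[of \<kappa> "s+2"] \<kappa> by simp
  qed auto
  then have "(s+1)/2 * ((2*x)\<^sup>2 - x\<^sup>2) * (\<integral>y. pk (s+2) x (u - y) \<partial>M) \<le> (s+1)/2 * ((2*x)\<^sup>2 - x\<^sup>2) * (cup \<kappa> (s+2) * B * x powr (\<kappa> - (s+2)))"
    using s_pos by (intro mult_left_mono) (auto simp: power_mult_distrib)
  moreover have "norm (V x u - V (2*x) u) \<le> (s+1)/2 * ((2*x)\<^sup>2 - x\<^sup>2) * (\<integral>y. pk (s+2) x (u - y) \<partial>M)"
    using e by (intro V_scale) auto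
  moreover have "x\<^sup>2 * x powr (\<kappa> - (s+2)) = x powr (\<kappa> - s)"
  proof -
    have "x\<^sup>2 * x powr (\<kappa> - (s+2)) = x powr 2 * x powr (\<kappa> - (s+2))" using e by simp
    also have "\<dots> = x powr (\<kappa> - s)" by (simp flip: powr_add)
    finally show ?thesis .
  qed
  then have "(s+1)/2 * ((2*x)\<^sup>2 - x\<^sup>2) * (cup \<kappa> (s+2) * B * x powr (\<kappa> - (s+2))) = (s+1)/2 * 3 * cup \<kappa> (s+2) * B * x powr (\<kappa> - s)"
    by (simp add: power_mult_distrib)
  ultimately show ?thesis by linarith
qed

lemma exists_dyadic_between:
  assumes "0 < e" "e < (T::real)"
  obtains N :: nat where "T \<le> 2^N * e" "2^N * e < 2 * T"
proof -
  obtain n where "T / e < 2^n" using real_arch_pow[of 2 "T/e"] by auto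
  then have n: "T \<le> 2^n * e" using assms by (simp add: field_simps)
  define N where "N = (LEAST N::nat. T \<le> 2^N * e)"
  have N: "T \<le> 2^N * e" unfolding N_def using n by (rule LeastI)
  obtain N' where N': "N = Suc N'" using N assms by (cases N) auto
  have "\<not> T \<le> 2^N' * e" using not_less_Least[of N' "\<lambda>N. T \<le> 2^N * e"] N' N_def by auto
  then show ?thesis using N N' by (intro that[of N]) auto
qed

section \<open>The case s at most d - 1\<close>

text \<open>The conclusion of \<open>reflectionless_average\<close>; both cases extract from
  reflectionlessness exactly this.\<close>

definition avg_const :: "'a \<Rightarrow> bool" where
  "avg_const l \<longleftrightarrow> (\<forall>e L \<psi> c \<rho>. 0 < e \<longrightarrow> 0 < \<rho> \<longrightarrow> lipc L \<psi> c \<rho> \<longrightarrow>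
    norm (\<integral>x. \<psi> x *\<^sub>R (V e x - l) \<partial>M) \<le> cj s * \<Lambda> * L * e * measure M (cball c \<rho>))"

text \<open>Unlike for \<open>tent\<close>, the width w of the transition is independent of the
  radius t, so the Lipschitz constant can be adapted to the mass.\<close>

definition plateau :: "'a \<Rightarrow> real \<Rightarrow> real \<Rightarrow> 'a \<Rightarrow> real" where
  "plateau z t w y = max 0 (min 1 (1 - (dist z y - t) / w))"

lemma lipc_plateau:
  assumes "0 < w" "0 \<le> t"
  shows "lipc (1/w) (plateau z t w) z (t + w)"
  unfolding lipc_def
proof
  show "(1/w)-lipschitz_on UNIV (plateau z t w)"
  proof (rule lipschitz_onI)
    fix x y
    have "\<bar>plateau z t w x - plateau z t w y\<bar> \<le> \<bar>(dist z x - t) / w - (dist z y - t) / w\<bar>"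
      unfolding plateau_def by (auto simp: max_def min_def)
    also have "\<dots> = \<bar>dist z x - dist z y\<bar> / w" using assms by (simp add: diff_divide_distrib[symmetric] abs_divide)
    also have "\<dots> \<le> dist x y / w"
      using assms dist_triangle2[of z x y] dist_triangle[of z y x]
      by (intro divide_right_mono) (auto simp: dist_commute abs_le_iff)
    finally show "dist (plateau z t w x) (plateau z t w y) \<le> 1 / w * dist x y" by (simp add: dist_real_def)
  qed (use assms in simp)
  show "\<forall>x. x \<notin> cball z (t + w) \<longrightarrow> plateau z t w x = 0"
    using assms by (auto simp: plateau_def max_def min_def field_simps)
qed

text \<open>At scale \<tau> the bump is a plateau of radius t between \<tau> and 2 \<tau> and of
  transition width w = g t, averaged at scale e = \<delta> w. The average error is then of order
  \<delta>, while s' > s makes V e u - V \<tau> z of order \<tau>^(s'-s) on the carrier. C may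
  depend on \<delta>, which is fixed before \<tau> tends to 0.\<close>

lemma V_limit_at_thin_point:
  assumes l: "avg_const l" and supp: "\<And>r. 0 < r \<Longrightarrow> 0 < emeasure M (ball z r)"
    and s': "s < s'" "s' < s + 1" and W: "W s' z < \<infinity>" and \<delta>: "0 < \<delta>" "\<delta> \<le> 1"
  shows "\<exists>C. \<forall>\<tau>>0. norm (V \<tau> z - l) \<le> cj s * \<Lambda> * 3 powr s' * \<delta> + C * \<tau> powr (s' - s)"
proof -
  define q where "q = s' - s"
  have q: "0 < q" using s' by (simp add: q_def)
  define B0 where "B0 = enn2real (W s' z) + \<Lambda> * 2 powr s"
  have B0: "0 < B0" unfolding B0_def using \<Lambda>_pos by (intro add_nonneg_pos) auto
  define m where "m t = measure M (cball z t)" for t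
  have mB: "m t \<le> B0 * t powr s'" if "0 < t" for t
    unfolding m_def B0_def using W s'(1) that by (rule measure_cball_le_powr)
  have mpos: "0 < m t" if "0 < t" for t
  proof -
    have "0 < emeasure M (ball z t)" using that by (rule supp)
    also have "\<dots> \<le> emeasure M (cball z t)" by (intro emeasure_mono) auto
    finally show ?thesis unfolding m_def using finite_balls(1)[of z t] by (simp add: measure_def enn2real_positive_iff)
  qed
  have sub_m: "emeasure M (ball u r) \<le> ennreal (m t)" if "ball u r \<subseteq> cball z t" for u r t
  proof -
    have "emeasure M (ball u r) \<le> emeasure M (cball z t)" using that by (intro emeasure_mono) auto
    then show ?thesis unfolding m_def using finite_balls(1)[of z t] by (simp add: emeasure_eq_ennreal_measure)
  qed
  \<comment> \<open>Chosen so that m t <= B0 t^s' becomes g t <= t/4, a hypothesis of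
    \<open>select_radius\<close>.\<close>
  define c0 where "c0 = 1 / (4 * B0 powr (1/s'))"
  have c0: "0 < c0" using B0 by (simp add: c0_def)
  have s'p: "0 < s'" using s' s_pos by linarith
  define g where "g t = c0 * m t powr (1/s')" for t
  have g4: "g t \<le> t/4" if "0 < t" for t
  proof -
    have "m t powr (1/s') \<le> (B0 * t powr s') powr (1/s')" using that mB mpos[OF that] s'p by (intro powr_mono2) auto
    also have "\<dots> = B0 powr (1/s') * t" using that s'p B0 by (simp add: powr_mult powr_powr)
    finally have "g t \<le> c0 * (B0 powr (1/s') * t)" unfolding g_def using c0 by (intro mult_left_mono) auto
    also have "\<dots> = t/4" using B0 by (simp add: c0_def)
    finally show ?thesis .
  qed
  have gm: "m t = (g t / c0) powr s'" if "0 < t" for t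
    using c0 s'p mpos[OF that] by (simp add: g_def powr_powr)
  have gpos: "0 < g t" if "0 < t" for t using c0 mpos[OF that] by (simp add: g_def)
  define B where "B = (4 / (\<delta> * c0)) powr s'"
  have B: "0 < B" using \<delta> c0 by (simp add: B_def)
  define C1 where "C1 = (s+1)/2 * 3 * cup s' (s+2) * B / (2 powr q - 1)"
  define C2 where "C2 = ctd s 1 * cup s' (s+1) * B0"
  define C3 where "C3 = (s+1)/2 * 64 * cup s' (s+2) * B0"
  have "1 < (2::real) powr q" using q by (simp add: gr_one_powr)
  then have C123: "0 \<le> C1" "0 \<le> C2" "0 \<le> C3"
    unfolding C1_def C2_def C3_def using s_pos B B0 cup_pos[of s' "s+2"] cup_pos[of s' "s+1"] ctd_pos[OF s_pos, of 1] s'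
    by (intro divide_nonneg_nonneg mult_nonneg_nonneg; simp)+
  show ?thesis
  proof (intro exI allI impI)
    fix \<tau> :: real assume \<tau>: "0 < \<tau>"
    obtain t where t: "\<tau> \<le> t" "t \<le> 2 * \<tau>" and tg: "\<And>t'. t \<le> t' \<Longrightarrow> g t' \<le> 2 * g t + (t' - t)"
      using select_radius[of \<tau> g] \<tau> gpos[OF \<tau>] g4 by blast
    have t0: "0 < t" using t \<tau> by linarith
    define w where "w = g t"
    have w: "0 < w" "w \<le> t/4" using gpos[OF t0] g4[OF t0] by (auto simp: w_def)
    define e where "e = \<delta> * w"
    have e: "0 < e" "e \<le> w" using \<delta> w by (auto simp: e_def mult_le_cancel_right1)
    \<comment> \<open>The selection at t' = t + w gives g (t + w) <= 3 g t, so the carrier has at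
      most 3^s' times the mass of the plateau: the comparison that fails for a general
      measure.\<close>
    have mt: "m (t + w) \<le> 3 powr s' * m t"
    proof -
      have "g (t + w) \<le> 3 * g t" using tg[of "t + w"] w by (simp add: w_def)
      then have "g (t + w) / c0 \<le> 3 * (g t / c0)" using c0 by (simp add: divide_right_mono)
      then have "(g (t + w) / c0) powr s' \<le> (3 * (g t / c0)) powr s'"
        using s'p c0 gpos[of "t + w"] t0 w by (intro powr_mono2) auto
      also have "\<dots> = 3 powr s' * m t" unfolding powr_mult gm[OF t0] ..
      finally show ?thesis using gm[of "t + w"] t0 w by simp
    qed
    \<comment> \<open>For y = max x w the ball lies in the one of radius t + w + y about z, where
      the selection gives g <= 2 w + (w + y) <= 4 y. As x >= \<delta> w, y is at most x / \<delta>;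
      hence the constant B.\<close>
    have mass: "emeasure M (ball u x) \<le> ennreal (B * x powr s')" if u: "u \<in> cball z (t + w)" and x: "e \<le> x" for u x
    proof -
      have xp: "0 < x" using x e by linarith
      define y where "y = max x w"
      have y: "x \<le> y" "w \<le> y" "y \<le> x / \<delta>"
        using x \<delta> xp by (auto simp: y_def e_def field_simps max_def mult_le_cancel_right1)
      have sub: "ball u x \<subseteq> cball z (t + w + y)"
      proof
        fix v assume "v \<in> ball u x"
        then show "v \<in> cball z (t + w + y)" using u y dist_triangle[of z v u] by auto
      qed
      have "g (t + w + y) \<le> 4 * y" using tg[of "t + w + y"] w y by (simp add: w_def)
      also have "\<dots> \<le> 4 * (x / \<delta>)" using y by simp
      finally have "g (t + w + y) / c0 \<le> 4 * (x / \<delta>) / c0" using c0 by (intro divide_right_mono) auto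
      also have "\<dots> = (4 / (\<delta> * c0)) * x" by simp
      finally have "(g (t + w + y) / c0) powr s' \<le> ((4 / (\<delta> * c0)) * x) powr s'"
        using s'p c0 gpos[of "t + w + y"] t0 w y xp by (intro powr_mono2) auto
      also have "\<dots> = B * x powr s'" unfolding powr_mult B_def ..
      finally have "m (t + w + y) \<le> B * x powr s'"
        using gm[of "t + w + y"] t0 w y xp by simp
      then show ?thesis using sub_m[OF sub] by (meson ennreal_leI order_trans)
    qed
    \<comment> \<open>The radius \<rho> = 2^N e lies between 2 t and 4 t: large enough to cover |z -
      u|, and at most 8 \<tau>, so that its powers cost only constants.\<close>
    have "e < 2 * t" using e w by linarith
    then obtain N where N: "2 * t \<le> 2^N * e" "2^N * e < 2 * (2 * t)" using exists_dyadic_between[OF e(1)] by blast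
    define \<rho> where "\<rho> = 2^N * e"
    have \<rho>: "0 < \<rho>" "2 * t \<le> \<rho>" "\<rho> \<le> 8 * \<tau>" "\<tau> \<le> \<rho>" using N t t0 by (auto simp: \<rho>_def)
    have massz: "emeasure M (ball z x) \<le> ennreal (B0 * x powr s')" if "0 < x" for x
      using sub_m[of z x x] mB[OF that] by (meson ball_subset_cball ennreal_leI order_trans)
    \<comment> \<open>Three moves: up in scale from e to \<rho> at u, across from u to z at scale
      \<rho>, and back in scale from \<rho> to \<tau> at z.\<close>
    have F: "norm (V e u - V \<tau> z) \<le> (C1 * 8 powr q + C2 * 8 powr q + C3) * \<tau> powr q" if u: "u \<in> cball z (t + w)" for u
    proof -
      have "norm (V e u - V (2^N * e) u) \<le> ((s+1)/2 * 3 * cup s' (s+2) * B) / (2 powr q - 1) * (2^N * e) powr q"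
      proof (rule norm_diff_dyadic_le[OF q])
        show "0 \<le> (s+1)/2 * 3 * cup s' (s+2) * B" using s_pos B cup_pos[of s' "s+2"] s' by simp
        fix i :: nat
        have ei: "e \<le> 2^i * e" using e by (simp add: mult_le_cancel_right1)
        show "norm (V (2^i * e) u - V (2 * (2^i * e)) u) \<le> (s+1)/2 * 3 * cup s' (s+2) * B * (2^i * e) powr q"
          unfolding q_def using e B s' by (intro V_double_step mass[OF u] order_trans[OF ei]) auto
      qed
      then have 1: "norm (V e u - V \<rho> u) \<le> C1 * \<rho> powr q" by (simp add: \<rho>_def C1_def)
      have zu: "norm (z - u) \<le> 1 * \<rho>" using u w \<rho> t0 by (auto simp: dist_norm)
      have "(\<integral>y. pk (s+1) \<rho> (z - y) \<partial>M) \<le> cup s' (s+1) * B0 * \<rho> powr (s' - (s+1))"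
      proof (rule nn_bound_real(2))
        show "(\<integral>\<^sup>+y. ennreal (pk (s+1) \<rho> (z - y)) \<partial>M) \<le> ennreal (cup s' (s+1) * B0 * \<rho> powr (s' - (s+1)))"
          using \<rho> s' s_pos B0 by (intro nn_integral_pk_dyadic massz sets_M) auto
        show "0 \<le> cup s' (s+1) * B0 * \<rho> powr (s' - (s+1))" using B0 cup_pos[of s' "s+1"] s' by simp
      qed auto
      then have "norm (V \<rho> z - V \<rho> u) \<le> ctd s 1 * \<rho> * (cup s' (s+1) * B0 * \<rho> powr (s' - (s+1)))"
        using zu ctd_pos[OF s_pos, of 1]
        by (intro order_trans[OF V_trans(1)[OF \<rho>(1) zu]] mult_mono mult_left_mono integral_pk_nonneg mult_nonneg_nonneg) (use \<rho> in auto)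
      also have "\<dots> = C2 * (\<rho> powr 1 * \<rho> powr (s' - (s+1)))" using \<rho> by (simp add: C2_def mult_ac)
      also have "\<rho> powr 1 * \<rho> powr (s' - (s+1)) = \<rho> powr q" unfolding powr_add[symmetric] by (simp add: q_def)
      finally have 2: "norm (V \<rho> z - V \<rho> u) \<le> C2 * \<rho> powr q" .
      have "(\<integral>y. pk (s+2) \<tau> (z - y) \<partial>M) \<le> cup s' (s+2) * B0 * \<tau> powr (s' - (s+2))"
      proof (rule nn_bound_real(2))
        show "(\<integral>\<^sup>+y. ennreal (pk (s+2) \<tau> (z - y)) \<partial>M) \<le> ennreal (cup s' (s+2) * B0 * \<tau> powr (s' - (s+2)))"
          using \<tau> s' s_pos B0 by (intro nn_integral_pk_dyadic massz sets_M) auto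
        show "0 \<le> cup s' (s+2) * B0 * \<tau> powr (s' - (s+2))" using B0 cup_pos[of s' "s+2"] s' by simp
      qed auto
      moreover have "\<rho>\<^sup>2 - \<tau>\<^sup>2 \<le> 64 * \<tau>\<^sup>2" using power_mono[OF \<rho>(3), of 2] \<rho> by (simp add: power_mult_distrib) (smt (verit) zero_le_power2)
      ultimately have "norm (V \<tau> z - V \<rho> z) \<le> (s+1)/2 * (64 * \<tau>\<^sup>2) * (cup s' (s+2) * B0 * \<tau> powr (s' - (s+2)))"
        using s_pos \<rho> \<tau> power_mono[OF \<rho>(4), of 2]
        by (intro order_trans[OF V_scale[OF \<tau> \<rho>(4)]] mult_mono mult_left_mono integral_pk_nonneg mult_nonneg_nonneg) auto
      also have "\<dots> = C3 * (\<tau> powr 2 * \<tau> powr (s' - (s+2)))" using \<tau> by (simp add: C3_def mult_ac)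
      also have "\<tau> powr 2 * \<tau> powr (s' - (s+2)) = \<tau> powr q" unfolding powr_add[symmetric] by (simp add: q_def)
      finally have 3: "norm (V \<tau> z - V \<rho> z) \<le> C3 * \<tau> powr q" .
      have "\<rho> powr q \<le> (8 * \<tau>) powr q" using \<rho> q by (intro powr_mono2) auto
      then have \<rho>q: "\<rho> powr q \<le> 8 powr q * \<tau> powr q" using \<tau> by (simp add: powr_mult)
      have "V e u - V \<tau> z = (V e u - V \<rho> u) - (V \<rho> z - V \<rho> u) - (V \<tau> z - V \<rho> z)" by simp
      then have "norm (V e u - V \<tau> z) \<le> norm (V e u - V \<rho> u) + norm (V \<rho> z - V \<rho> u) + norm (V \<tau> z - V \<rho> z)"
        by (metis (no_types, opaque_lifting) norm_triangle_ineq4 add_right_mono order_trans)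
      also have "\<dots> \<le> C1 * (8 powr q * \<tau> powr q) + C2 * (8 powr q * \<tau> powr q) + C3 * \<tau> powr q"
        using 1 2 3 mult_left_mono[OF \<rho>q C123(1)] mult_left_mono[OF \<rho>q C123(2)] by linarith
      finally show ?thesis by (simp add: algebra_simps)
    qed
    let ?\<psi> = "plateau z t w"
    have lip: "lipc (1/w) ?\<psi> z (t + w)" using w t0 by (intro lipc_plateau) auto
    have "m t = (\<integral>y. indicator (cball z t) y \<partial>M)" using finite_balls(1)[of z t] by (simp add: m_def)
    also have "\<dots> \<le> (\<integral>y. ?\<psi> y \<partial>M)"
    proof (rule integral_mono)
      show "indicator (cball z t) y \<le> ?\<psi> y" for y
        using w by (auto simp: plateau_def indicator_def max_def min_def field_simps)
      show "integrable M (indicator (cball z t) :: 'a \<Rightarrow> real)" using finite_balls(1)[of z t] by (intro integrable_real_indicator) auto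
      show "integrable M ?\<psi>" using lip by (rule integrable_lipc)
    qed
    finally have I: "m t \<le> (\<integral>y. ?\<psi> y \<partial>M)" .
    have tw: "0 < t + w" using t0 w by linarith
    have E: "norm (\<integral>x. ?\<psi> x *\<^sub>R (V e x - l) \<partial>M) \<le> cj s * \<Lambda> * (1/w) * e * measure M (cball z (t + w))"
      using l e(1) tw lip unfolding avg_const_def by blast
    have "norm (V \<tau> z - l) \<le> cj s * \<Lambda> * (1/w) * e * measure M (cball z (t + w)) / (\<integral>y. ?\<psi> y \<partial>M) + (C1 * 8 powr q + C2 * 8 powr q + C3) * \<tau> powr q"
    proof (rule average_bound[OF e(1) lip _ _ E F])
      show "0 \<le> ?\<psi> y" for y by (simp add: plateau_def)
      show "0 < (\<integral>y. ?\<psi> y \<partial>M)" using I mpos[OF t0] by linarith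
    qed
    also have "cj s * \<Lambda> * (1/w) * e * measure M (cball z (t + w)) / (\<integral>y. ?\<psi> y \<partial>M) \<le> cj s * \<Lambda> * \<delta> * (3 powr s' * m t) / m t"
      using I mpos[OF t0] mt cj_pos[OF s_pos] \<Lambda>_pos \<delta> w
      by (intro frac_le mult_nonneg_nonneg) (auto simp: e_def m_def intro!: mult_left_mono)
    also have "\<dots> = cj s * \<Lambda> * 3 powr s' * \<delta>" using mpos[OF t0] by simp
    finally show "norm (V \<tau> z - l) \<le> cj s * \<Lambda> * 3 powr s' * \<delta> + (C1 * 8 powr q + C2 * 8 powr q + C3) * \<tau> powr (s' - s)"
      by (simp add: q_def)
  qed
qed

lemma V_tendsto_at_thin_point:
  assumes l: "avg_const l" and supp: "\<And>r. 0 < r \<Longrightarrow> 0 < emeasure M (ball z r)"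
    and s': "s < s'" "s' < s + 1" and W: "W s' z < \<infinity>"
  shows "(\<lambda>n. V ((1/2)^n) z) \<longlonglongrightarrow> l"
proof (rule LIMSEQ_I)
  fix r :: real assume r: "0 < r"
  let ?K = "cj s * \<Lambda> * 3 powr s'"
  have K: "0 < ?K" using cj_pos[OF s_pos] \<Lambda>_pos by simp
  define \<delta> where "\<delta> = min 1 (r / (2 * ?K))"
  have \<delta>: "0 < \<delta>" "\<delta> \<le> 1" "?K * \<delta> \<le> r / 2"
    using K r by (auto simp: \<delta>_def min_def field_simps)
  obtain C where C: "\<And>\<tau>. 0 < \<tau> \<Longrightarrow> norm (V \<tau> z - l) \<le> ?K * \<delta> + C * \<tau> powr (s' - s)"
    using V_limit_at_thin_point[OF l supp s' W \<delta>(1,2)] by blast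
  have "(\<lambda>n. (1/2)^n) \<longlonglongrightarrow> (0::real)" by (rule LIMSEQ_power_zero) simp
  then have "(\<lambda>n. C * ((1/2)^n) powr (s' - s)) \<longlonglongrightarrow> C * 0"
    using s' by (intro tendsto_mult tendsto_const tendsto_zero_powrI) auto
  then have "\<forall>\<^sub>F n in sequentially. C * ((1/2)^n) powr (s' - s) < r / 2" using r by (intro order_tendstoD) auto
  then obtain N where N: "\<And>n. N \<le> n \<Longrightarrow> C * ((1/2)^n) powr (s' - s) < r / 2" by (auto simp: eventually_sequentially)
  show "\<exists>no. \<forall>n\<ge>no. norm (V ((1/2)^n) z - l) < r"
  proof (intro exI allI impI)
    fix n assume "N \<le> n"
    then show "norm (V ((1/2)^n) z - l) < r" using N[of n] C[of "(1/2)^n"] \<delta>(3) by force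
  qed
qed

lemma thin_case:
  assumes l: "avg_const l" and s: "s \<le> real DIM('a) - 1" and q: "0 < q"
    and supp: "\<And>z r. z \<in> cball c q \<Longrightarrow> 0 < r \<Longrightarrow> 0 < emeasure M (ball z r)"
  shows False
proof -
  \<comment> \<open>Any exponent strictly between s and the smaller of d and s + 1 would do: below d
    for finiteness of \<open>W\<close>, below s + 1 for convergence of the tails.\<close>
  define s' where "s' = s + 1/2"
  have s': "s < s'" "s' < s + 1" "s' < real DIM('a)" using s by (auto simp: s'_def)
  have "AE z in lborel. z \<in> cball c q \<longrightarrow> (\<lambda>n. V ((1/2)^n) z) \<longlonglongrightarrow> l"
    using AE_W_finite[OF s'(3)]
  proof eventually_elim
    case (elim z)
    show ?case using V_tendsto_at_thin_point[OF l supp s'(1,2) elim] by blast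
  qed
  with s q supp[of c "q/2"] show False by (intro not_constant_field[of q c l]) auto
qed

end

section \<open>V as an average of its limit at scale 0\<close>

lemma nn_integral_lborel_scale:
  fixes f :: "'a::euclidean_space \<Rightarrow> ennreal"
  assumes [measurable]: "f \<in> borel_measurable borel" and c: "0 < c"
  shows "(\<integral>\<^sup>+x. f x \<partial>lborel) = ennreal (c ^ DIM('a)) * (\<integral>\<^sup>+x. f (c *\<^sub>R x) \<partial>lborel)"
  by (subst lborel_affine[of c 0]) (use c in \<open>simp_all add: nn_integral_density nn_integral_distr nn_integral_cmult\<close>)

definition pk_mass :: "'a::euclidean_space itself \<Rightarrow> real \<Rightarrow> real" where
  "pk_mass _ k = (\<integral>z. pk k 1 (z :: 'a) \<partial>lborel)"

lemma integrable_pk_lborel: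
  fixes p :: "'a::euclidean_space"
  assumes "real DIM('a) < k" "0 < r"
  shows "integrable lborel (\<lambda>z. pk k r (z - p))"
proof -
  interpret leb: growth_measure "lborel :: 'a measure" "real DIM('a)" "unit_ball_vol (real DIM('a))" by (rule growth_measure_lborel)
  show ?thesis using leb.integrable_pk[of r k p] assms by (simp add: pk_commute)
qed

lemma nn_integral_pk_lborel:
  fixes p :: "'a::euclidean_space"
  assumes "real DIM('a) < k" "0 < r"
  shows "(\<integral>\<^sup>+z. ennreal (pk k r (z - p)) \<partial>lborel) = ennreal (pk_mass TYPE('a) k * r powr (real DIM('a) - k))"
proof -
  have I0: "0 \<le> pk_mass TYPE('a) k" unfolding pk_mass_def by (intro Bochner_Integration.integral_nonneg) auto
  have one: "(\<integral>\<^sup>+z. ennreal (pk k 1 (z :: 'a)) \<partial>lborel) = ennreal (pk_mass TYPE('a) k)"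
    unfolding pk_mass_def using integrable_pk_lborel[of k 1 "0::'a"] assms by (intro nn_integral_eq_integral) auto
  have sc: "pk k r (r *\<^sub>R z) = r powr (-k) * pk k 1 z" for z :: 'a
  proof -
    have "r\<^sup>2 + (norm (r *\<^sub>R z))\<^sup>2 = r\<^sup>2 * (1\<^sup>2 + (norm z)\<^sup>2)" using assms by (simp add: power_mult_distrib algebra_simps)
    then show ?thesis unfolding pk_def using sq_powr_half[OF assms(2), of k] by (simp add: powr_mult)
  qed
  have "(\<integral>\<^sup>+z. ennreal (pk k r (z - p)) \<partial>lborel) = (\<integral>\<^sup>+z. ennreal (pk k r ((p + z) - p)) \<partial>lborel)"
    by (rule nn_integral_lborel_translate[symmetric]) measurable
  also have "\<dots> = (\<integral>\<^sup>+z. ennreal (pk k r (z :: 'a)) \<partial>lborel)" by simp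
  also have "\<dots> = ennreal (r ^ DIM('a)) * (\<integral>\<^sup>+z. ennreal (pk k r (r *\<^sub>R (z :: 'a))) \<partial>lborel)"
    using assms by (intro nn_integral_lborel_scale) auto
  also have "(\<integral>\<^sup>+z. ennreal (pk k r (r *\<^sub>R (z :: 'a))) \<partial>lborel) = ennreal (r powr (-k)) * (\<integral>\<^sup>+z. ennreal (pk k 1 (z :: 'a)) \<partial>lborel)"
    unfolding sc by (subst nn_integral_cmult[symmetric]) (auto simp: ennreal_mult)
  also have "ennreal (r ^ DIM('a)) * (ennreal (r powr (-k)) * (\<integral>\<^sup>+z. ennreal (pk k 1 (z :: 'a)) \<partial>lborel)) = ennreal (r ^ DIM('a) * (r powr (-k) * pk_mass TYPE('a) k))"
    unfolding one using assms I0 by (simp add: ennreal_mult)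
  also have "r ^ DIM('a) * (r powr (-k) * pk_mass TYPE('a) k) = pk_mass TYPE('a) k * (r powr real DIM('a) * r powr (-k))"
    using assms by (simp add: powr_realpow)
  also have "r powr real DIM('a) * r powr (-k) = r powr (real DIM('a) - k)" unfolding powr_add[symmetric] by simp
  finally show ?thesis .
qed

lemma integral_pk_lborel:
  fixes p :: "'a::euclidean_space"
  assumes "real DIM('a) < k" "0 < r"
  shows "(\<integral>z. pk k r (z - p) \<partial>lborel) = pk_mass TYPE('a) k * r powr (real DIM('a) - k)"
proof -
  have I0: "0 \<le> pk_mass TYPE('a) k" unfolding pk_mass_def by (intro Bochner_Integration.integral_nonneg) auto
  have "ennreal (\<integral>z. pk k r (z - p) \<partial>lborel) = (\<integral>\<^sup>+z. ennreal (pk k r (z - p)) \<partial>lborel)"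
    using integrable_pk_lborel[OF assms] by (intro nn_integral_eq_integral[symmetric]) auto
  also have "\<dots> = ennreal (pk_mass TYPE('a) k * r powr (real DIM('a) - k))" by (rule nn_integral_pk_lborel[OF assms])
  finally show ?thesis
    using I0 by (subst (asm) ennreal_inj) (auto intro: Bochner_Integration.integral_nonneg)
qed

lemma pk_mass_pos:
  assumes "real DIM('a::euclidean_space) < k"
  shows "0 < pk_mass TYPE('a) k"
proof -
  have k: "0 \<le> k" using assms by (meson less_eq_real_def of_nat_0_le_iff order_trans)
  have "0 < 2 powr (-(k/2)) * unit_ball_vol (real DIM('a))" by (simp add: unit_ball_vol_pos)
  also have "\<dots> = (\<integral>z. 2 powr (-(k/2)) * indicator (ball (0::'a) 1) z \<partial>lborel)"
    using emeasure_lborel_ball_finite[of "0::'a" 1] by (simp add: content_ball)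
  also have "\<dots> \<le> pk_mass TYPE('a) k" unfolding pk_mass_def
  proof (rule integral_mono)
    show "integrable lborel (\<lambda>z. 2 powr (-(k/2)) * indicator (ball (0::'a) 1) z)"
      using emeasure_lborel_ball_finite[of "0::'a" 1] by (intro integrable_mult_right integrable_real_indicator) auto
    show "integrable lborel (pk k 1 :: 'a \<Rightarrow> real)" using integrable_pk_lborel[of k 1 "0::'a"] assms by simp
    show "2 powr (-(k/2)) * indicator (ball 0 1) z \<le> pk k 1 (z :: 'a)" for z
    proof (cases "z \<in> ball 0 1")
      case True
      then have "1\<^sup>2 + (norm z)\<^sup>2 \<le> 2" by (simp add: power_le_one)
      then have "2 powr (-(k/2)) \<le> pk k 1 z" unfolding pk_def using k by (intro powr_mono2') (auto intro: add_pos_nonneg)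
      then show ?thesis using True by simp
    qed simp
  qed
  finally show ?thesis .
qed

text \<open>The Beta function \<open>B(b, k - b)\<close>.\<close>

definition beta_int :: "real \<Rightarrow> real \<Rightarrow> real" where
  "beta_int b k = enn2real (\<integral>\<^sup>+a. indicator {0<..} a * ennreal (a powr (b-1) * (a + 1) powr (-k)) \<partial>lborel)"

text \<open>Near 0 the integrand is bounded since b >= 1, so the whole integral compares with that
  of \<open>pk\<close> on the real line. In the application b = (s+1)/2, and b >= 1 means s >=
  1.\<close>

lemma beta_int_nn:
  assumes "1 \<le> b" "b < k"
  shows "(\<integral>\<^sup>+a. indicator {0<..} a * ennreal (a powr (b-1) * (a + 1) powr (-k)) \<partial>lborel) = ennreal (beta_int b k)"
proof -
  have "(\<integral>\<^sup>+a. indicator {0<..} a * ennreal (a powr (b-1) * (a + 1) powr (-k)) \<partial>lborel) \<le> (\<integral>\<^sup>+a. ennreal (pk (k - b + 1) 1 (a - (0::real))) \<partial>lborel)"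
  proof (rule nn_integral_mono)
    fix a :: real
    show "indicator {0<..} a * ennreal (a powr (b-1) * (a + 1) powr (-k)) \<le> ennreal (pk (k - b + 1) 1 (a - 0))"
    proof (cases "0 < a")
      case True
      have "a powr (b-1) * (a + 1) powr (-k) \<le> (a + 1) powr (b-1) * (a + 1) powr (-k)"
        using True assms by (intro mult_right_mono powr_mono2) auto
      also have "\<dots> = (a + 1) powr (-(k - b + 1))" unfolding powr_add[symmetric] by (rule arg_cong[of _ _ "(powr) (a + 1)"]) simp
      also have "\<dots> = ((a + 1)\<^sup>2) powr (-((k - b + 1)/2))" using True by (intro sq_powr_half[symmetric]) auto
      also have "\<dots> \<le> pk (k - b + 1) 1 a" unfolding pk_def using True assms
        by (intro powr_mono2') (auto simp: power2_sum intro: add_pos_nonneg)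
      finally show ?thesis using True by (simp add: ennreal_leI)
    qed simp
  qed
  also have "\<dots> = ennreal (pk_mass TYPE(real) (k - b + 1) * 1 powr (real DIM(real) - (k - b + 1)))"
    using assms by (intro nn_integral_pk_lborel) auto
  also have "\<dots> < \<infinity>" by simp
  finally show ?thesis unfolding beta_int_def by (simp add: less_top)
qed

lemma beta_int_pos:
  assumes "1 \<le> b" "b < k"
  shows "0 < beta_int b k"
proof -
  have "0 < (\<integral>\<^sup>+a. indicator {0<..} a * ennreal (a powr (b-1) * (a + 1) powr (-k)) \<partial>lborel)"
  proof (rule ccontr)
    assume "\<not> ?thesis"
    then have "(\<integral>\<^sup>+a. indicator {0<..} a * ennreal (a powr (b-1) * (a + 1) powr (-k)) \<partial>lborel) = 0" by simp
    then have "AE a in lborel. indicator {0<..} a * ennreal (a powr (b-1) * (a + 1) powr (-k)) = 0"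
      by (subst (asm) nn_integral_0_iff_AE) auto
    then have "AE a in lborel. a \<notin> {0<..<1::real}"
    proof eventually_elim
      case (elim a)
      then show ?case by (auto simp: indicator_def split: if_splits)
    qed
    then have "{0<..<1::real} \<in> null_sets lborel" by (subst AE_iff_null_sets) auto
    then have "emeasure lborel {0<..<1::real} = 0" by (rule null_setsD1)
    moreover have "emeasure lborel {0<..<1::real} = 1" by (subst emeasure_lborel_Ioo) auto
    ultimately show False by simp
  qed
  then show ?thesis unfolding beta_int_nn[OF assms] by simp
qed

text \<open>Substituting (Y/X) a for a separates the variables; the powers of X and Y are the two
  factors that the Feynman formula merges.\<close>

lemma beta_int_scaled:
  assumes "1 \<le> b" "b < k" "0 < X" "0 < Y"
  shows "(\<integral>\<^sup>+a. indicator {0<..} a * ennreal (a powr (b-1) * (a * X + Y) powr (-k)) \<partial>lborel) = ennreal (beta_int b k * X powr (-b) * Y powr (b - k))"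
proof -
  define c where "c = Y / X"
  have c: "0 < c" "c * X = Y" using assms by (auto simp: c_def)
  have "(\<integral>\<^sup>+a. indicator {0<..} a * ennreal (a powr (b-1) * (a * X + Y) powr (-k)) \<partial>lborel)
    = ennreal \<bar>c\<bar> * (\<integral>\<^sup>+a. indicator {0<..} (0 + c * a) * ennreal ((0 + c * a) powr (b-1) * ((0 + c * a) * X + Y) powr (-k)) \<partial>lborel)"
    using c by (intro nn_integral_real_affine) auto
  also have "(\<integral>\<^sup>+a. indicator {0<..} (0 + c * a) * ennreal ((0 + c * a) powr (b-1) * ((0 + c * a) * X + Y) powr (-k)) \<partial>lborel)
     = (\<integral>\<^sup>+a. ennreal (c powr (b-1) * Y powr (-k)) * (indicator {0<..} a * ennreal (a powr (b-1) * (a + 1) powr (-k))) \<partial>lborel)"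
  proof (rule nn_integral_cong)
    fix a :: real
    show "indicator {0<..} (0 + c * a) * ennreal ((0 + c * a) powr (b-1) * ((0 + c * a) * X + Y) powr (-k))
      = ennreal (c powr (b-1) * Y powr (-k)) * (indicator {0<..} a * ennreal (a powr (b-1) * (a + 1) powr (-k)))"
    proof (cases "0 < a")
      case True
      have "(0 + c * a) * X + Y = Y * (a + 1)" using c(2) by (simp add: algebra_simps)
      then have "(0 + c * a) powr (b-1) * ((0 + c * a) * X + Y) powr (-k) = (c powr (b-1) * Y powr (-k)) * (a powr (b-1) * (a + 1) powr (-k))"
        by (simp add: powr_mult)
      then show ?thesis using True c by (simp add: ennreal_mult zero_less_mult_iff)
    qed (use c in \<open>simp add: zero_less_mult_iff\<close>)
  qed
  also have "\<dots> = ennreal (c powr (b-1) * Y powr (-k)) * ennreal (beta_int b k)"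
    unfolding beta_int_nn[OF assms(1,2), symmetric] by (intro nn_integral_cmult) measurable
  also have "ennreal \<bar>c\<bar> * \<dots> = ennreal (c * (c powr (b-1) * Y powr (-k)) * beta_int b k)"
    using c beta_int_pos[OF assms(1,2)] by (simp add: ennreal_mult mult.assoc)
  also have "c * (c powr (b-1) * Y powr (-k)) * beta_int b k = beta_int b k * X powr (-b) * Y powr (b - k)"
  proof -
    have "c * c powr (b-1) = c powr 1 * c powr (b-1)" using c by simp
    also have "\<dots> = c powr b" unfolding powr_add[symmetric] by simp
    also have "\<dots> = Y powr b * X powr (-b)" unfolding c_def by (simp add: powr_divide powr_minus_divide)
    finally have 1: "c * c powr (b-1) = Y powr b * X powr (-b)" .
    have 2: "Y powr (b - k) = Y powr b * Y powr (-k)" unfolding powr_add[symmetric] by simp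
    have "c * (c powr (b-1) * Y powr (-k)) * beta_int b k = (c * c powr (b-1)) * Y powr (-k) * beta_int b k" by simp
    then show ?thesis unfolding 1 2 by (simp only: mult_ac)
  qed
  finally show ?thesis .
qed

text \<open>Completing the square in z: p is a weighted mean of x and the origin, r the new scale.
  The last two identities eliminate r and p once z has been integrated out.\<close>

lemma quadratic_shift:
  fixes x z :: "'a::euclidean_space"
  assumes "0 < a" "0 < e"
  defines "r \<equiv> sqrt (e\<^sup>2 * (1 + a) + a * (norm x)\<^sup>2) / (1 + a)" and "p \<equiv> (a / (1 + a)) *\<^sub>R x"
  shows "0 < r" and "a * (norm (x - z))\<^sup>2 + (e\<^sup>2 + (norm z)\<^sup>2) = (1 + a) * (r\<^sup>2 + (norm (z - p))\<^sup>2)"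
    and "(1 + a)\<^sup>2 * r\<^sup>2 = a * (e\<^sup>2 + (norm x)\<^sup>2) + e\<^sup>2" and "x - p = (1 / (1 + a)) *\<^sub>R x"
proof -
  have R: "0 < e\<^sup>2 * (1 + a) + a * (norm x)\<^sup>2" using assms(1,2) by (intro add_pos_nonneg) auto
  then show "0 < r" using assms(1) by (simp add: r_def)
  have r2: "r\<^sup>2 = (e\<^sup>2 * (1 + a) + a * (norm x)\<^sup>2) / (1 + a)\<^sup>2"
    using R by (simp add: r_def power_divide)
  have "(1 + a)\<^sup>2 * r\<^sup>2 = e\<^sup>2 * (1 + a) + a * (norm x)\<^sup>2" unfolding r2 using assms(1) by simp
  then show "(1 + a)\<^sup>2 * r\<^sup>2 = a * (e\<^sup>2 + (norm x)\<^sup>2) + e\<^sup>2" by (simp add: algebra_simps)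
  show "x - p = (1 / (1 + a)) *\<^sub>R x"
  proof -
    have "x - p = (1 - a / (1 + a)) *\<^sub>R x" by (simp add: p_def scaleR_diff_left)
    also have "1 - a / (1 + a) = 1 / (1 + a)" using assms(1) by (simp add: field_simps)
    finally show ?thesis .
  qed
  define t where "t = 1 + a"
  have t: "0 < t" "a = t - 1" using assms(1) by (auto simp: t_def)
  have e1: "(norm (x - z))\<^sup>2 = (norm x)\<^sup>2 - 2 * (x \<bullet> z) + (norm z)\<^sup>2"
    unfolding power2_norm_eq_inner by (simp add: algebra_simps inner_commute)
  have e2: "(norm (z - p))\<^sup>2 = (norm z)\<^sup>2 - 2 * (a / t) * (x \<bullet> z) + (a / t)\<^sup>2 * (norm x)\<^sup>2"
    unfolding power2_norm_eq_inner p_def t_def[symmetric] by (simp add: algebra_simps inner_commute power2_eq_square)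
  show "a * (norm (x - z))\<^sup>2 + (e\<^sup>2 + (norm z)\<^sup>2) = (1 + a) * (r\<^sup>2 + (norm (z - p))\<^sup>2)"
    unfolding e1 e2 r2 t_def[symmetric] unfolding t(2) using t(1) by (simp add: field_simps power2_eq_square)
qed

text \<open>One double integral, the Feynman integrand with |x - z| and e replaced by 1, is
  evaluated in both orders. This identifies the constant of \<open>kernel_convolution\<close> as the
  total mass of the averaging kernel without evaluating Gamma functions.\<close>

lemma beta_int_Ik_relation:
  fixes s :: real
  defines "D \<equiv> real DIM('a::euclidean_space)" and "b \<equiv> (s+1)/2"
  assumes s: "1 < s" "s < D"
  shows "beta_int b (D+1) * pk_mass TYPE('a) (2*D+1-s) = pk_mass TYPE('a) (2*D+2) * beta_int b (D/2+1)"
proof -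
  have b: "1 \<le> b" "b < D+1" "b < D/2+1" using s by (auto simp: b_def field_simps)
  let ?f = "\<lambda>(z::'a) a. indicator {0<..} a * ennreal (a powr (b-1) * (a * 1 + (1\<^sup>2 + (norm z)\<^sup>2)) powr (-(D+1)))"
  have I: "0 < pk_mass TYPE('a) (2*D+1-s)" "0 < pk_mass TYPE('a) (2*D+2)" using s by (auto intro!: pk_mass_pos simp: D_def)
  have B: "0 < beta_int b (D+1)" "0 < beta_int b (D/2+1)" using b by (auto intro: beta_int_pos)
  have "(\<integral>\<^sup>+z. \<integral>\<^sup>+a. ?f z a \<partial>lborel \<partial>lborel) = (\<integral>\<^sup>+z. ennreal (beta_int b (D+1)) * ennreal (pk (2*D+1-s) 1 (z - (0::'a))) \<partial>lborel)"
  proof (rule nn_integral_cong)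
    fix z :: 'a
    have "0 < 1\<^sup>2 + (norm z)\<^sup>2" by (intro add_pos_nonneg) auto
    then have "(\<integral>\<^sup>+a. ?f z a \<partial>lborel) = ennreal (beta_int b (D+1) * 1 powr (-b) * (1\<^sup>2 + (norm z)\<^sup>2) powr (b - (D+1)))"
      using b by (intro beta_int_scaled) auto
    also have "b - (D+1) = -((2*D+1-s)/2)" by (simp add: b_def field_simps)
    finally show "(\<integral>\<^sup>+a. ?f z a \<partial>lborel) = ennreal (beta_int b (D+1)) * ennreal (pk (2*D+1-s) 1 (z - 0))"
      using B by (simp add: pk_def ennreal_mult)
  qed
  also have "\<dots> = ennreal (beta_int b (D+1)) * (\<integral>\<^sup>+z. ennreal (pk (2*D+1-s) 1 (z - (0::'a))) \<partial>lborel)"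
    by (intro nn_integral_cmult) measurable
  also have "\<dots> = ennreal (beta_int b (D+1)) * ennreal (pk_mass TYPE('a) (2*D+1-s) * 1 powr (real DIM('a) - (2*D+1-s)))"
    using s by (subst nn_integral_pk_lborel) (auto simp: D_def)
  also have "\<dots> = ennreal (beta_int b (D+1) * pk_mass TYPE('a) (2*D+1-s))" using B I by (simp add: ennreal_mult)
  finally have 1: "(\<integral>\<^sup>+z. \<integral>\<^sup>+a. ?f z a \<partial>lborel \<partial>lborel) = ennreal (beta_int b (D+1) * pk_mass TYPE('a) (2*D+1-s))" .
  have "(\<integral>\<^sup>+a. \<integral>\<^sup>+z. ?f z a \<partial>lborel \<partial>lborel) = (\<integral>\<^sup>+a. ennreal (pk_mass TYPE('a) (2*D+2)) * (indicator {0<..} a * ennreal (a powr (b-1) * (a * 1 + 1) powr (-(D/2+1)))) \<partial>lborel)"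
  proof (rule nn_integral_cong)
    fix a :: real
    show "(\<integral>\<^sup>+z. ?f z a \<partial>lborel) = ennreal (pk_mass TYPE('a) (2*D+2)) * (indicator {0<..} a * ennreal (a powr (b-1) * (a * 1 + 1) powr (-(D/2+1))))"
    proof (cases "0 < a")
      case True
      have eq: "?f z a = ennreal (a powr (b-1)) * ennreal (pk (2*D+2) (sqrt (a+1)) (z - 0))" for z
      proof -
        have "-(D+1) = -((2*D+2)/2)" by (simp add: field_simps)
        moreover have "a * 1 + (1\<^sup>2 + (norm z)\<^sup>2) = (sqrt (a+1))\<^sup>2 + (norm (z - 0))\<^sup>2" using True by simp
        ultimately show ?thesis unfolding pk_def using True by (simp only: ennreal_mult powr_ge_zero) simp
      qed
      have "(\<integral>\<^sup>+z. ?f z a \<partial>lborel) = ennreal (a powr (b-1)) * (\<integral>\<^sup>+z. ennreal (pk (2*D+2) (sqrt (a+1)) (z - (0::'a))) \<partial>lborel)"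
        unfolding eq by (intro nn_integral_cmult) measurable
      also have "\<dots> = ennreal (a powr (b-1)) * ennreal (pk_mass TYPE('a) (2*D+2) * sqrt (a+1) powr (D - (2*D+2)))"
        using True by (subst nn_integral_pk_lborel) (auto simp: D_def)
      also have "sqrt (a+1) powr (D - (2*D+2)) = (a * 1 + 1) powr (-(D/2+1))"
      proof -
        have "sqrt (a+1) powr c = (a * 1 + 1) powr (c / 2)" for c
          using True by (simp add: powr_half_sqrt[symmetric] powr_powr)
        moreover have "(D - (2*D+2)) / 2 = -(D/2+1)" by (simp add: field_simps)
        ultimately show ?thesis by (simp only:)
      qed
      finally show ?thesis using True I by (simp add: ennreal_mult mult_ac)
    qed simp
  qed
  also have "\<dots> = ennreal (pk_mass TYPE('a) (2*D+2)) * (\<integral>\<^sup>+a. indicator {0<..} a * ennreal (a powr (b-1) * (a * 1 + 1) powr (-(D/2+1))) \<partial>lborel)"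
    by (intro nn_integral_cmult) measurable
  also have "\<dots> = ennreal (pk_mass TYPE('a) (2*D+2) * beta_int b (D/2+1))"
    using b I B by (subst beta_int_scaled) (auto simp: ennreal_mult)
  also have "(\<integral>\<^sup>+a. \<integral>\<^sup>+z. ?f z a \<partial>lborel \<partial>lborel) = (\<integral>\<^sup>+z. \<integral>\<^sup>+a. ?f z a \<partial>lborel \<partial>lborel)"
    by (rule lborel_pair.Fubini') measurable
  finally show ?thesis using 1 B I by (simp add: ennreal_inj)
qed

lemma integrable_pk_kr_0:
  fixes x :: "'a::euclidean_space"
  assumes s: "0 < s" "s < real DIM('a)" and e: "0 < e" and k: "real DIM('a) < k"
  shows "integrable lborel (\<lambda>z. pk k e z *\<^sub>R kr s 0 (x - z))"
proof -
  interpret leb: growth_measure "lborel :: 'a measure" "real DIM('a)" "unit_ball_vol (real DIM('a))" by (rule growth_measure_lborel)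
  have k0: "0 \<le> k" using k by (meson less_eq_real_def of_nat_0_le_iff order_trans)
  show ?thesis
  proof (rule integrableI_bounded)
    have "(\<integral>\<^sup>+z. ennreal (norm (pk k e z *\<^sub>R kr s 0 (x - z))) \<partial>lborel) \<le>
      (\<integral>\<^sup>+z. ennreal (e powr (-k)) * (indicator (ball x 1) z * ennreal (norm (x - z) powr (-s))) + ennreal (pk k e (z - 0)) \<partial>lborel)"
    proof (rule nn_integral_mono)
      fix z
      show "ennreal (norm (pk k e z *\<^sub>R kr s 0 (x - z))) \<le> ennreal (e powr (-k)) * (indicator (ball x 1) z * ennreal (norm (x - z) powr (-s))) + ennreal (pk k e (z - 0))"
      proof (cases "z = x")
        case False
        then have n: "norm (pk k e z *\<^sub>R kr s 0 (x - z)) = pk k e z * norm (x - z) powr (-s)" by (simp add: norm_kr_0)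
        show ?thesis
        proof (cases "z \<in> ball x 1")
          case True
          have "pk k e z * norm (x - z) powr (-s) \<le> e powr (-k) * norm (x - z) powr (-s)"
            using e k0 by (intro mult_right_mono pk_le_scale) auto
          then have "ennreal (pk k e z * norm (x - z) powr (-s)) \<le> ennreal (e powr (-k)) * ennreal (norm (x - z) powr (-s))"
            by (simp add: ennreal_mult[symmetric] ennreal_leI)
          then show ?thesis unfolding n using True by (intro add_increasing2) auto
        next
          case out: False
          have "norm (x - z) powr (-s) \<le> 1 powr (-s)" using out s by (intro powr_mono2') (auto simp: dist_norm)
          then have "pk k e z * norm (x - z) powr (-s) \<le> pk k e z * 1" by (intro mult_left_mono) auto
          then show ?thesis unfolding n by (intro add_increasing) (auto intro: ennreal_leI)
        qed
      qed simp
    qed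
    also have "\<dots> = ennreal (e powr (-k)) * (\<integral>\<^sup>+z. indicator (ball x 1) z * ennreal (norm (x - z) powr (-s)) \<partial>lborel) + (\<integral>\<^sup>+z. ennreal (pk k e (z - (0::'a))) \<partial>lborel)"
      by (subst nn_integral_add) (auto simp: nn_integral_cmult)
    also have "\<dots> < \<infinity>"
    proof -
      have "(\<integral>\<^sup>+z. indicator (ball x 1) z * ennreal (norm (x - z) powr (-s)) \<partial>lborel) < \<infinity>"
        using leb.nn_integral_near_le[of 1 s x] s by (auto intro: le_less_trans)
      moreover have "(\<integral>\<^sup>+z. ennreal (pk k e (z - (0::'a))) \<partial>lborel) < \<infinity>"
        using nn_integral_pk_lborel[OF k e, of 0] by simp
      ultimately show ?thesis by (simp add: ennreal_mult_less_top)
    qed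
    finally show "(\<integral>\<^sup>+z. ennreal (norm (pk k e z *\<^sub>R kr s 0 (x - z))) \<partial>lborel) < \<infinity>" .
  qed measurable
qed

text \<open>Feynman parametrisation: the product of \<open>|x - z|\<^bsup>-2b\<^esup>\<close> and the other power is an integral
  over \<open>a > 0\<close> of powers of \<open>a |x - z|\<^sup>2 + e\<^sup>2 + |z|\<^sup>2\<close>. Completing the square makes the \<open>z\<close>-integral elementary, and what remains is the same Beta-type integral in \<open>a\<close>.\<close>

lemma kernel_convolution:
  fixes x :: "'a::euclidean_space"
  defines "D \<equiv> real DIM('a)"
  assumes s: "1 < s" "s < D" and e: "0 < e"
  shows "(\<integral>z. pk (2*D+1-s) e z *\<^sub>R kr s 0 (x - z) \<partial>lborel) = (pk_mass TYPE('a) (2*D+1-s) * e powr (s-1-D)) *\<^sub>R kr s e x"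
proof -
  define b where "b = (s+1)/2"
  have b: "1 \<le> b" "b < D+1" "b < D/2+1" using s by (auto simp: b_def field_simps)
  \<comment> \<open>The exponent D + 1 is the sum of b and (2 D + 1 - s)/2, the two exponents being
    merged.\<close>
  define h where "h z a = indicator {0<..} a * (a powr (b-1) * (a * (norm (x - z))\<^sup>2 + (e\<^sup>2 + (norm z)\<^sup>2)) powr (-(D+1)))" for z a
  have h0: "0 \<le> h z a" for z a by (simp add: h_def)
  have hm [measurable]: "(\<lambda>(z,a). h z a) \<in> borel_measurable (lborel \<Otimes>\<^sub>M lborel)" unfolding h_def by measurable
  have B: "0 < beta_int b (D+1)" "0 < beta_int b (D/2+1)" using b by (auto intro: beta_int_pos)
  have I: "0 < pk_mass TYPE('a) (2*D+2)" by (auto intro!: pk_mass_pos simp: D_def)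
  have inner_a: "(\<integral>\<^sup>+a. ennreal (h z a) \<partial>lborel) = ennreal (beta_int b (D+1) * (((norm (x - z))\<^sup>2) powr (-b) * pk (2*D+1-s) e z))" if "z \<noteq> x" for z
  proof -
    have pos: "0 < (norm (x - z))\<^sup>2" "0 < e\<^sup>2 + (norm z)\<^sup>2" using that e by (auto intro: add_pos_nonneg)
    have "(\<integral>\<^sup>+a. ennreal (h z a) \<partial>lborel) = (\<integral>\<^sup>+a. indicator {0<..} a * ennreal (a powr (b-1) * (a * (norm (x - z))\<^sup>2 + (e\<^sup>2 + (norm z)\<^sup>2)) powr (-(D+1))) \<partial>lborel)"
      unfolding h_def by (intro nn_integral_cong) (auto simp: indicator_def)
    also have "\<dots> = ennreal (beta_int b (D+1) * ((norm (x - z))\<^sup>2) powr (-b) * (e\<^sup>2 + (norm z)\<^sup>2) powr (b - (D+1)))"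
      using b pos by (intro beta_int_scaled) auto
    also have "b - (D+1) = -((2*D+1-s)/2)" by (simp add: b_def field_simps)
    finally show ?thesis by (simp add: pk_def mult.assoc)
  qed
  have krb: "kr s 0 w = ((norm w)\<^sup>2) powr (-b) *\<^sub>R w" for w :: 'a by (simp add: kr_def pk_def b_def)
  have inner_norm: "(\<integral>\<^sup>+a. ennreal (norm (h z a *\<^sub>R (x - z))) \<partial>lborel) = ennreal (beta_int b (D+1) * norm (pk (2*D+1-s) e z *\<^sub>R kr s 0 (x - z)))" for z
  proof (cases "z = x")
    case False
    have "(\<integral>\<^sup>+a. ennreal (norm (h z a *\<^sub>R (x - z))) \<partial>lborel) = (\<integral>\<^sup>+a. ennreal (norm (x - z)) * ennreal (h z a) \<partial>lborel)"
      using h0 by (intro nn_integral_cong) (simp add: ennreal_mult[symmetric] mult.commute)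
    also have "\<dots> = ennreal (norm (x - z)) * (\<integral>\<^sup>+a. ennreal (h z a) \<partial>lborel)" unfolding h_def by (intro nn_integral_cmult) measurable
    also have "\<dots> = ennreal (norm (x - z) * (beta_int b (D+1) * (((norm (x - z))\<^sup>2) powr (-b) * pk (2*D+1-s) e z)))"
      unfolding inner_a[OF False] by (intro ennreal_mult[symmetric]) (use B in auto)
    finally show ?thesis by (simp add: krb mult_ac)
  qed simp
  let ?F = "\<lambda>z a. h z a *\<^sub>R (x - z)"
  have Fm: "(\<lambda>(z,a). ?F z a) \<in> borel_measurable (lborel \<Otimes>\<^sub>M lborel)" by measurable
  have kD: "real DIM('a) < 2*D+1-s" using s by (simp add: D_def)
  have Ii: "integrable lborel (\<lambda>z. pk (2*D+1-s) e z *\<^sub>R kr s 0 (x - z))"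
    using s e kD by (intro integrable_pk_kr_0) (auto simp: D_def)
  have Fi: "integrable (lborel \<Otimes>\<^sub>M lborel) (\<lambda>(z,a). ?F z a)"
  proof (rule integrableI_bounded[OF Fm])
    have "(\<integral>\<^sup>+p. ennreal (norm ((\<lambda>(z,a). ?F z a) p)) \<partial>(lborel \<Otimes>\<^sub>M lborel)) = (\<integral>\<^sup>+z. \<integral>\<^sup>+a. ennreal (norm (?F z a)) \<partial>lborel \<partial>lborel)"
      by (subst lborel.nn_integral_fst[symmetric]) (use Fm in auto)
    also have "\<dots> = (\<integral>\<^sup>+z. ennreal (norm (beta_int b (D+1) *\<^sub>R (pk (2*D+1-s) e z *\<^sub>R kr s 0 (x - z)))) \<partial>lborel)"
      unfolding inner_norm using B by (intro nn_integral_cong) simp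
    also have "\<dots> < \<infinity>" using integrable_scaleR_right[OF Ii, of "beta_int b (D+1)"] unfolding integrable_iff_bounded by auto
    finally show "(\<integral>\<^sup>+p. ennreal (norm ((\<lambda>(z,a). ?F z a) p)) \<partial>(lborel \<Otimes>\<^sub>M lborel)) < \<infinity>" .
  qed
  have int_a: "(\<integral>a. ?F z a \<partial>lborel) = beta_int b (D+1) *\<^sub>R (pk (2*D+1-s) e z *\<^sub>R kr s 0 (x - z))" for z
  proof (cases "z = x")
    case False
    have C0: "0 \<le> beta_int b (D+1) * (((norm (x - z))\<^sup>2) powr (-b) * pk (2*D+1-s) e z)" using B by simp
    have hmz: "h z \<in> borel_measurable lborel" unfolding h_def by measurable
    have hi: "integrable lborel (h z)"
      using inner_a[OF False] h0 hmz by (intro integrableI_nonneg) auto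
    have "ennreal (\<integral>a. h z a \<partial>lborel) = ennreal (beta_int b (D+1) * (((norm (x - z))\<^sup>2) powr (-b) * pk (2*D+1-s) e z))"
      using inner_a[OF False] hi h0 by (subst nn_integral_eq_integral[symmetric]) auto
    then have "(\<integral>a. h z a \<partial>lborel) = beta_int b (D+1) * (((norm (x - z))\<^sup>2) powr (-b) * pk (2*D+1-s) e z)"
      using C0 h0 by (subst (asm) ennreal_inj) (auto intro: Bochner_Integration.integral_nonneg)
    moreover have "(\<integral>a. ?F z a \<partial>lborel) = (\<integral>a. h z a \<partial>lborel) *\<^sub>R (x - z)" using hi by (intro integral_scaleR_left) auto
    ultimately show ?thesis by (simp add: krb mult_ac)
  qed simp
  define X where "X = e\<^sup>2 + (norm x)\<^sup>2"
  have X: "0 < X" using e by (auto simp: X_def intro: add_pos_nonneg)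
  define u where "u a = indicator {0<..} a * (a powr (b-1) * (a * X + e\<^sup>2) powr (-(D/2+1)))" for a :: real
  have int_z: "(\<integral>z. ?F z a \<partial>lborel) = (pk_mass TYPE('a) (2*D+2) * u a) *\<^sub>R x" for a
  proof (cases "0 < a")
    case True
    define r where "r = sqrt (e\<^sup>2 * (1 + a) + a * (norm x)\<^sup>2) / (1 + a)"
    define p where "p = (a / (1 + a)) *\<^sub>R x"
    note qs = quadratic_shift[OF True e, of x, folded r_def p_def]
    have hz: "h z a = (a powr (b-1) * (1 + a) powr (-(D+1))) * pk (2*D+2) r (z - p)" for z
    proof -
      have "-((2*D+2)/2) = -(D+1)" by (simp add: field_simps)
      then show ?thesis unfolding h_def qs(2) powr_mult pk_def using True by (simp only: mult_ac) simp
    qed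
    have pki: "integrable lborel (\<lambda>z. pk (2*D+2) r (z - p))" using qs(1) by (intro integrable_pk_lborel) (auto simp: D_def)
    \<comment> \<open>The shifted kernel is even about p, so z may be replaced by p in x - z; what
      survives is x - p = x / (1 + a), parallel to x.\<close>
    have odd: "(\<integral>z. pk (2*D+2) r (z - p) *\<^sub>R (z - p) \<partial>lborel) = 0"
    proof -
      have "(\<integral>z. pk (2*D+2) r (z - p) *\<^sub>R (z - p) \<partial>lborel) = (\<integral>z. pk (2*D+2) r ((p + z) - p) *\<^sub>R ((p + z) - p) \<partial>lborel)"
        by (rule integral_lborel_translate(1)[symmetric]) measurable
      also have "\<dots> = 0" by (rule integral_lborel_odd) auto
      finally show ?thesis .
    qed
    have oddi: "integrable lborel (\<lambda>z. pk (2*D+2) r (z - p) *\<^sub>R (z - p))"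
    proof (rule Bochner_Integration.integrable_bound[OF integrable_pk_lborel[of "2*D+1" r p]])
      show "AE z in lborel. norm (pk (2*D+2) r (z - p) *\<^sub>R (z - p)) \<le> norm (pk (2*D+1) r (z - p))"
        using norm_mult_pk_le[OF qs(1), of _ "2*D+1"] by (intro AE_I2) (simp add: mult.commute add.assoc)
    qed (use qs(1) in \<open>auto simp: D_def\<close>)
    have "(\<integral>z. ?F z a \<partial>lborel) = (\<integral>z. (a powr (b-1) * (1 + a) powr (-(D+1))) *\<^sub>R (pk (2*D+2) r (z - p) *\<^sub>R (x - p) - pk (2*D+2) r (z - p) *\<^sub>R (z - p)) \<partial>lborel)"
      unfolding hz by (intro Bochner_Integration.integral_cong) (auto simp: algebra_simps)
    also have "\<dots> = (a powr (b-1) * (1 + a) powr (-(D+1))) *\<^sub>R ((\<integral>z. pk (2*D+2) r (z - p) \<partial>lborel) *\<^sub>R (x - p) - 0)"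
      using pki oddi odd by (subst integral_scaleR_right) auto
    also have "(\<integral>z. pk (2*D+2) r (z - p) \<partial>lborel) = pk_mass TYPE('a) (2*D+2) * r powr (real DIM('a) - (2*D+2))"
      using qs(1) by (intro integral_pk_lborel) (auto simp: D_def)
    also have "(a powr (b-1) * (1 + a) powr (-(D+1))) *\<^sub>R ((pk_mass TYPE('a) (2*D+2) * r powr (real DIM('a) - (2*D+2))) *\<^sub>R (x - p) - 0)
       = (pk_mass TYPE('a) (2*D+2) * (a powr (b-1) * (((1 + a) powr (-(D+1)) * (1 / (1 + a))) * r powr (-(D+2))))) *\<^sub>R x"
      unfolding qs(4) D_def by (simp add: mult_ac)
    also have "((1 + a) powr (-(D+1)) * (1 / (1 + a))) * r powr (-(D+2)) = (a * X + e\<^sup>2) powr (-(D/2+1))"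
    proof -
      have "(1 + a) powr (-(D+1)) * (1 / (1 + a)) = (1 + a) powr (-(D+1)) * (1 + a) powr (-1)"
        using True by (simp add: powr_minus_divide)
      also have "\<dots> = (1 + a) powr (-(D+2))" unfolding powr_add[symmetric]
        by (rule arg_cong[of _ _ "(powr) (1 + a)"]) simp
      finally have "((1 + a) powr (-(D+1)) * (1 / (1 + a))) * r powr (-(D+2)) = ((1 + a) * r) powr (-(D+2))"
        by (simp add: powr_mult)
      also have "\<dots> = (((1 + a) * r)\<^sup>2) powr (-((D+2)/2))" using True qs(1) by (intro sq_powr_half[symmetric]) auto
      also have "((1 + a) * r)\<^sup>2 = a * X + e\<^sup>2" using qs(3) by (simp add: power_mult_distrib X_def)
      also have "-((D+2)/2) = -(D/2+1)" by (simp add: field_simps)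
      finally show ?thesis .
    qed
    finally show ?thesis using True by (simp add: u_def)
  qed (simp add: h_def u_def)
  have u0: "0 \<le> u a" for a by (simp add: u_def)
  have um: "u \<in> borel_measurable lborel" unfolding u_def by measurable
  have unn: "(\<integral>\<^sup>+a. ennreal (u a) \<partial>lborel) = ennreal (beta_int b (D/2+1) * X powr (-b) * (e\<^sup>2) powr (b - (D/2+1)))"
  proof -
    have "(\<integral>\<^sup>+a. ennreal (u a) \<partial>lborel) = (\<integral>\<^sup>+a. indicator {0<..} a * ennreal (a powr (b-1) * (a * X + e\<^sup>2) powr (-(D/2+1))) \<partial>lborel)"
      unfolding u_def by (intro nn_integral_cong) (auto simp: indicator_def)
    also have "\<dots> = ennreal (beta_int b (D/2+1) * X powr (-b) * (e\<^sup>2) powr (b - (D/2+1)))"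
      using b X e by (intro beta_int_scaled) auto
    finally show ?thesis .
  qed
  have ui: "integrable lborel u" using unn u0 um by (intro integrableI_nonneg) auto
  have "ennreal (\<integral>a. u a \<partial>lborel) = ennreal (beta_int b (D/2+1) * X powr (-b) * (e\<^sup>2) powr (b - (D/2+1)))"
    using unn ui u0 by (subst nn_integral_eq_integral[symmetric]) auto
  then have ueq: "(\<integral>a. u a \<partial>lborel) = beta_int b (D/2+1) * X powr (-b) * (e\<^sup>2) powr (b - (D/2+1))"
    using B u0 by (subst (asm) ennreal_inj) (auto intro: Bochner_Integration.integral_nonneg)
  have ee: "(e\<^sup>2) powr (b - (D/2+1)) = e powr (s-1-D)"
  proof -
    have "b - (D/2+1) = -((D+1-s)/2)" by (simp add: b_def field_simps)
    then have "(e\<^sup>2) powr (b - (D/2+1)) = e powr (-(D+1-s))" using sq_powr_half[OF e, of "D+1-s"] by simp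
    also have "-(D+1-s) = s-1-D" by simp
    finally show ?thesis .
  qed
  have krX: "kr s e x = X powr (-b) *\<^sub>R x" by (simp add: kr_def pk_def X_def b_def)
  have "beta_int b (D+1) *\<^sub>R (\<integral>z. pk (2*D+1-s) e z *\<^sub>R kr s 0 (x - z) \<partial>lborel) = (\<integral>z. \<integral>a. ?F z a \<partial>lborel \<partial>lborel)"
    unfolding int_a by (rule integral_scaleR_right[symmetric])
  also have "\<dots> = (\<integral>a. \<integral>z. ?F z a \<partial>lborel \<partial>lborel)"
    using lborel_pair.Fubini_integral[OF Fi] by simp
  also have "\<dots> = (\<integral>a. pk_mass TYPE('a) (2*D+2) * u a \<partial>lborel) *\<^sub>R x"
    unfolding int_z by (rule integral_scaleR_left) (intro integrable_mult_right ui)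
  also have "(\<integral>a. pk_mass TYPE('a) (2*D+2) * u a \<partial>lborel) = (pk_mass TYPE('a) (2*D+2) * beta_int b (D/2+1)) * X powr (-b) * e powr (s-1-D)"
    using ueq ee by simp
  also have "pk_mass TYPE('a) (2*D+2) * beta_int b (D/2+1) = beta_int b (D+1) * pk_mass TYPE('a) (2*D+1-s)"
    unfolding b_def D_def using s by (intro beta_int_Ik_relation[symmetric]) (auto simp: D_def)
  finally have "beta_int b (D+1) *\<^sub>R (\<integral>z. pk (2*D+1-s) e z *\<^sub>R kr s 0 (x - z) \<partial>lborel) = beta_int b (D+1) *\<^sub>R ((pk_mass TYPE('a) (2*D+1-s) * e powr (s-1-D)) *\<^sub>R kr s e x)"
    unfolding krX by (simp add: mult_ac)
  from scaleR_left_imp_eq[OF _ this] show ?thesis using B by simp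
qed

lemma integral_lborel_reflect:
  fixes f :: "'a::euclidean_space \<Rightarrow> 'b::{banach, second_countable_topology}"
  assumes [measurable]: "f \<in> borel_measurable borel"
  shows "(\<integral>u. f (x - u) \<partial>lborel) = (\<integral>u. f u \<partial>lborel)"
proof -
  have "(\<integral>u. f u \<partial>lborel) = (\<integral>u. f (x + u) \<partial>lborel)" by (rule integral_lborel_translate(1)[symmetric]) measurable
  also have "\<dots> = (\<integral>u. f (x + - u) \<partial>lborel)"
    by (subst lborel_affine[of "-1" 0]) (simp_all add: integral_density integral_distr density_1)
  finally show ?thesis by simp
qed

lemma kr_tendsto_0:
  fixes w :: "'a::euclidean_space"
  shows "(\<lambda>n. kr s (1 / real (Suc n)) w) \<longlonglongrightarrow> kr s 0 w"
proof (cases "w = 0")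
  case False
  have "(\<lambda>n. (1 / real (Suc n))) \<longlonglongrightarrow> 0" by (rule LIMSEQ_Suc[OF lim_1_over_n])
  then show ?thesis unfolding kr_def pk_def using False by (intro tendsto_intros) auto
qed simp

section \<open>Representation of V by \<open>V0\<close> and the Harnack inequality\<close>

context growth_measure
begin

text \<open>The integral is known to converge where \<open>W s z\<close> is finite, hence almost
  everywhere for s < d; elsewhere its value is immaterial.\<close>

definition V0 :: "'a \<Rightarrow> 'a" where
  "V0 z = (\<integral>y. kr s 0 (z - y) - kr s 1 (- y) \<partial>M)"

definition CN :: real where "CN = ctd s 1 * cup s (s+1) * \<Lambda>"

lemma CN_nonneg: "0 \<le> CN"
  unfolding CN_def using ctd_pos[OF s_pos, of 1] cup_pos[of s "s+1"] \<Lambda>_pos by simp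

text \<open>The segment from 0 to z is cut into at most 1 + |z| steps of length at most 1, each
  costing \<open>CN\<close>. Linear growth in |z| is what an averaging kernel of decay 2 d + 1 - s
  can absorb.\<close>

lemma integral_kr_shift_le:
  "(\<integral>y. norm (kr s 1 (z - y) - kr s 1 (- y)) \<partial>M) \<le> (1 + norm z) * CN"
proof -
  define N where "N = nat \<lceil>norm z\<rceil>"
  have N: "norm z \<le> real N" "real N \<le> 1 + norm z" by (auto simp: N_def) linarith+
  define w where "w = (1 / real N) *\<^sub>R z"
  have w: "norm w \<le> 1" using N by (cases "N = 0") (auto simp: w_def field_simps)
  have zw: "z = real N *\<^sub>R w" using N by (cases "N = 0") (auto simp: w_def)
  have int: "integrable M (\<lambda>y. kr s 1 (p - y) - kr s 1 (p' - y))" for p p'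
    by (rule integral_kr_trans(2)[where D="norm (p - p')"]) auto
  have "(\<integral>y. norm (kr s 1 (real i *\<^sub>R w - y) - kr s 1 (0 - y)) \<partial>M) \<le> real i * CN" for i
  proof (induction i)
    case (Suc i)
    have "(\<integral>y. norm (kr s 1 (real (Suc i) *\<^sub>R w - y) - kr s 1 (0 - y)) \<partial>M) \<le>
      (\<integral>y. norm (kr s 1 (real (Suc i) *\<^sub>R w - y) - kr s 1 (real i *\<^sub>R w - y)) + norm (kr s 1 (real i *\<^sub>R w - y) - kr s 1 (0 - y)) \<partial>M)"
    proof (intro integral_mono Bochner_Integration.integrable_add integrable_norm int)
      show "norm (kr s 1 (real (Suc i) *\<^sub>R w - y) - kr s 1 (0 - y)) \<le> norm (kr s 1 (real (Suc i) *\<^sub>R w - y) - kr s 1 (real i *\<^sub>R w - y)) + norm (kr s 1 (real i *\<^sub>R w - y) - kr s 1 (0 - y))" for y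
        using norm_triangle_ineq[of "kr s 1 (real (Suc i) *\<^sub>R w - y) - kr s 1 (real i *\<^sub>R w - y)" "kr s 1 (real i *\<^sub>R w - y) - kr s 1 (0 - y)"]
        by (simp only: diff_add_cancel add_diff_eq diff_add_eq)
    qed
    also have "\<dots> = (\<integral>y. norm (kr s 1 (real (Suc i) *\<^sub>R w - y) - kr s 1 (real i *\<^sub>R w - y)) \<partial>M) + (\<integral>y. norm (kr s 1 (real i *\<^sub>R w - y) - kr s 1 (0 - y)) \<partial>M)"
      by (intro Bochner_Integration.integral_add integrable_norm int)
    also have "\<dots> \<le> CN + real i * CN"
    proof (intro add_mono Suc)
      have "norm (real (Suc i) *\<^sub>R w - real i *\<^sub>R w) \<le> 1 * 1" using w by (simp flip: scaleR_diff_left)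
      from integral_kr_trans_le[OF _ this]
      show "(\<integral>y. norm (kr s 1 (real (Suc i) *\<^sub>R w - y) - kr s 1 (real i *\<^sub>R w - y)) \<partial>M) \<le> CN" by (simp add: CN_def)
    qed
    finally show ?case by (simp add: algebra_simps)
  qed simp
  from this[of N] have "(\<integral>y. norm (kr s 1 (z - y) - kr s 1 (- y)) \<partial>M) \<le> real N * CN" using zw by simp
  also have "\<dots> \<le> (1 + norm z) * CN" using N CN_nonneg by (intro mult_right_mono)
  finally show ?thesis .
qed

lemma nn_integral_V0_kernel:
  "(\<integral>\<^sup>+y. ennreal (norm (kr s 0 (z - y) - kr s 1 (- y))) \<partial>M) \<le> W s z + ennreal (CF + (1 + norm z) * CN)"
proof -
  have "(\<integral>\<^sup>+y. ennreal (norm (kr s 0 (z - y) - kr s 1 (- y))) \<partial>M) \<le>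
    (\<integral>\<^sup>+y. ennreal (norm (kr s 1 (z - y) - kr s 0 (z - y))) + ennreal (norm (kr s 1 (z - y) - kr s 1 (- y))) \<partial>M)"
  proof (rule nn_integral_mono)
    fix y
    have "norm (kr s 0 (z - y) - kr s 1 (- y)) \<le> norm (kr s 1 (z - y) - kr s 0 (z - y)) + norm (kr s 1 (z - y) - kr s 1 (- y))"
      using norm_triangle_ineq[of "kr s 0 (z - y) - kr s 1 (z - y)" "kr s 1 (z - y) - kr s 1 (- y)"]
      by (simp add: norm_minus_commute)
    then show "ennreal (norm (kr s 0 (z - y) - kr s 1 (- y))) \<le> ennreal (norm (kr s 1 (z - y) - kr s 0 (z - y))) + ennreal (norm (kr s 1 (z - y) - kr s 1 (- y)))"
      by (simp flip: ennreal_plus)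
  qed
  also have "\<dots> = (\<integral>\<^sup>+y. ennreal (norm (kr s 1 (z - y) - kr s 0 (z - y))) \<partial>M) + (\<integral>\<^sup>+y. ennreal (norm (kr s 1 (z - y) - kr s 1 (- y))) \<partial>M)"
    by (intro nn_integral_add) measurable
  also have "(\<integral>\<^sup>+y. ennreal (norm (kr s 1 (z - y) - kr s 1 (- y))) \<partial>M) = ennreal (\<integral>y. norm (kr s 1 (z - y) - kr s 1 (- y)) \<partial>M)"
    using integrable_V[of 1 z] by (intro nn_integral_eq_integral) auto
  also have "(\<integral>\<^sup>+y. ennreal (norm (kr s 1 (z - y) - kr s 0 (z - y))) \<partial>M) + ennreal (\<integral>y. norm (kr s 1 (z - y) - kr s 1 (- y)) \<partial>M)
     \<le> (W s z + ennreal CF) + ennreal ((1 + norm z) * CN)"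
    by (intro add_mono nn_integral_J1 ennreal_leI integral_kr_shift_le)
  also have "\<dots> = W s z + ennreal (CF + (1 + norm z) * CN)"
    using CF_nonneg CN_nonneg by (simp add: ennreal_plus add.assoc)
  finally show ?thesis .
qed

lemma V_tendsto_V0:
  assumes W: "W s z < \<infinity>"
  shows "(\<lambda>n. V (1 / real (Suc n)) z) \<longlonglongrightarrow> V0 z"
  unfolding V_def V0_def
proof (rule integral_dominated_convergence[where w="\<lambda>y. norm (kr s 1 (z - y) - kr s 0 (z - y)) + norm (kr s 1 (z - y) - kr s 1 (- y))"])
  have "(\<integral>\<^sup>+y. ennreal (norm (kr s 1 (z - y) - kr s 0 (z - y))) \<partial>M) < \<infinity>"
    using nn_integral_J1[of z] W by (auto intro: le_less_trans simp: ennreal_add_eq_top less_top)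
  then have "integrable M (\<lambda>y. kr s 1 (z - y) - kr s 0 (z - y))" by (intro integrableI_bounded) auto
  then show "integrable M (\<lambda>y. norm (kr s 1 (z - y) - kr s 0 (z - y)) + norm (kr s 1 (z - y) - kr s 1 (- y)))"
    using integrable_V[of 1 z] by (intro Bochner_Integration.integrable_add integrable_norm) auto
  show "AE y in M. norm (kr s (1 / real (Suc n)) (z - y) - kr s 1 (- y)) \<le> norm (kr s 1 (z - y) - kr s 0 (z - y)) + norm (kr s 1 (z - y) - kr s 1 (- y))" for n
  proof (rule AE_I2)
    fix y
    have "norm (kr s (1 / real (Suc n)) (z - y) - kr s 1 (z - y)) \<le> norm (kr s 1 (z - y) - kr s 0 (z - y))"
      using s_pos by (intro kr_diff_le_limit_diff) auto
    then show "norm (kr s (1 / real (Suc n)) (z - y) - kr s 1 (- y)) \<le> norm (kr s 1 (z - y) - kr s 0 (z - y)) + norm (kr s 1 (z - y) - kr s 1 (- y))"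
      using norm_triangle_ineq[of "kr s (1 / real (Suc n)) (z - y) - kr s 1 (z - y)" "kr s 1 (z - y) - kr s 1 (- y)"] by simp
  qed
  show "AE y in M. (\<lambda>n. kr s (1 / real (Suc n)) (z - y) - kr s 1 (- y)) \<longlonglongrightarrow> kr s 0 (z - y) - kr s 1 (- y)"
    by (intro AE_I2 tendsto_diff tendsto_const kr_tendsto_0)
qed measurable

text \<open>By Tonelli z is integrated first; \<open>pk\<close> is comparable at points less than 1
  apart, so it comes out as \<open>pk k e (x - y)\<close>, which is integrable against the
  measure.\<close>

lemma nn_integral_pk_W:
  assumes s: "s < real DIM('a)" and e: "0 < e" and k: "s < k"
  shows "(\<integral>\<^sup>+z. ennreal (pk k e (x - z)) * W s z \<partial>lborel) < \<infinity>"
proof -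
  let ?d = "real DIM('a)"
  interpret leb: growth_measure "lborel :: 'a measure" ?d "unit_ball_vol ?d" by (rule growth_measure_lborel)
  interpret P: pair_sigma_finite "lborel :: 'a measure" M ..
  let ?k = "\<lambda>z y. (if dist z y < 1 then ennreal (norm (z - y) powr (-s)) else 0)"
  let ?C = "cdn ?d s * unit_ball_vol ?d * 1 powr (?d - s)"
  define c where "c = (2 + 2 * (1/e)\<^sup>2) powr (k/2)"
  have k0: "0 \<le> k" using k s_pos by linarith
  have "(\<integral>\<^sup>+z. ennreal (pk k e (x - z)) * W s z \<partial>lborel) = (\<integral>\<^sup>+z. \<integral>\<^sup>+y. ennreal (pk k e (x - z)) * ?k z y \<partial>M \<partial>lborel)"
    unfolding W_def by (intro nn_integral_cong nn_integral_cmult[symmetric]) measurable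
  also have "\<dots> = (\<integral>\<^sup>+y. \<integral>\<^sup>+z. ennreal (pk k e (x - z)) * ?k z y \<partial>lborel \<partial>M)"
    by (rule P.Fubini'[symmetric]) measurable
  also have "\<dots> \<le> (\<integral>\<^sup>+y. ennreal (c * ?C) * ennreal (pk k e (x - y)) \<partial>M)"
  proof (rule nn_integral_mono)
    fix y
    have "(\<integral>\<^sup>+z. ennreal (pk k e (x - z)) * ?k z y \<partial>lborel) \<le> (\<integral>\<^sup>+z. ennreal (c * pk k e (x - y)) * (indicator (ball y 1) z * ennreal (norm (y - z) powr (-s))) \<partial>lborel)"
    proof (rule nn_integral_mono)
      fix z
      show "ennreal (pk k e (x - z)) * ?k z y \<le> ennreal (c * pk k e (x - y)) * (indicator (ball y 1) z * ennreal (norm (y - z) powr (-s)))"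
      proof (cases "dist z y < 1")
        case True
        have "e\<^sup>2 + (norm (x - y))\<^sup>2 \<le> (2 + 2 * (1/e)\<^sup>2) * (e\<^sup>2 + (norm (x - z))\<^sup>2)"
          using True e by (intro sum_sq_comparable) (auto simp: dist_norm norm_minus_commute)
        then have "pk k e (x - z) \<le> c * pk k e (x - y)"
          unfolding c_def using e k0 by (intro pk_compare add_pos_nonneg) auto
        then show ?thesis using True by (auto simp: dist_commute norm_minus_commute intro!: mult_right_mono ennreal_leI)
      qed simp
    qed
    also have "\<dots> = ennreal (c * pk k e (x - y)) * (\<integral>\<^sup>+z. indicator (ball y 1) z * ennreal (norm (y - z) powr (-s)) \<partial>lborel)"
      by (intro nn_integral_cmult) measurable
    also have "\<dots> \<le> ennreal (c * pk k e (x - y)) * ennreal ?C"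
      using s by (intro mult_left_mono leb.nn_integral_near_le) auto
    also have "\<dots> = ennreal (c * ?C) * ennreal (pk k e (x - y))"
      using cdn_pos[OF s] unit_ball_vol_pos[of ?d] by (simp add: ennreal_mult[symmetric] c_def mult_ac)
    finally show "(\<integral>\<^sup>+z. ennreal (pk k e (x - z)) * ?k z y \<partial>lborel) \<le> ennreal (c * ?C) * ennreal (pk k e (x - y))" .
  qed
  also have "\<dots> = ennreal (c * ?C) * (\<integral>\<^sup>+y. ennreal (pk k e (x - y)) \<partial>M)" by (intro nn_integral_cmult) measurable
  also have "\<dots> \<le> ennreal (c * ?C) * ennreal (cup s k * \<Lambda> * e powr (s - k))"
    using e k by (intro mult_left_mono nn_integral_pk_le) auto
  also have "\<dots> < \<infinity>" by (simp add: ennreal_mult_less_top)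
  finally show ?thesis .
qed

text \<open>\<open>kernel_convolution\<close> integrated over the measure. Its constant equals the
  total mass of the averaging kernel, so the renormalising term is reproduced with the same factor
  and V is a genuine average of \<open>V0\<close>.\<close>

lemma V_representation:
  fixes x :: 'a
  defines "D \<equiv> real DIM('a)"
  assumes s: "1 < s" "s < D" and e: "0 < e"
  shows "integrable lborel (\<lambda>z. pk (2*D+1-s) e (x - z) *\<^sub>R V0 z)"
    and "(\<integral>z. pk (2*D+1-s) e (x - z) *\<^sub>R V0 z \<partial>lborel) = (pk_mass TYPE('a) (2*D+1-s) * e powr (s-1-D)) *\<^sub>R V e x"
proof -
  let ?k = "2*D+1-s" and ?c = "pk_mass TYPE('a) (2*D+1-s) * e powr (s-1-D)"
  have kD: "real DIM('a) < ?k" "real DIM('a) < ?k - 1" "s < ?k" using s by (auto simp: D_def)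
  interpret P: pair_sigma_finite "lborel :: 'a measure" M ..
  let ?f = "\<lambda>z y. pk ?k e (x - z) *\<^sub>R (kr s 0 (z - y) - kr s 1 (- y))"
  have fm: "(\<lambda>(z,y). ?f z y) \<in> borel_measurable (lborel \<Otimes>\<^sub>M M)" by measurable
  have fi: "integrable (lborel \<Otimes>\<^sub>M M) (\<lambda>(z,y). ?f z y)"
  proof (rule integrableI_bounded[OF fm])
    let ?C = "CF + CN + norm x * CN"
    have C0: "0 \<le> ?C" using CF_nonneg CN_nonneg by simp
    have "(\<integral>\<^sup>+p. ennreal (norm ((\<lambda>(z,y). ?f z y) p)) \<partial>(lborel \<Otimes>\<^sub>M M)) = (\<integral>\<^sup>+z. \<integral>\<^sup>+y. ennreal (norm (?f z y)) \<partial>M \<partial>lborel)"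
      by (subst nn_integral_fst[symmetric]) (use fm in auto)
    also have "\<dots> \<le> (\<integral>\<^sup>+z. ennreal (pk ?k e (x - z)) * W s z + (ennreal ?C * ennreal (pk ?k e (z - x)) + ennreal CN * ennreal (pk (?k - 1) e (z - x))) \<partial>lborel)"
    proof (rule nn_integral_mono)
      fix z
      have nz: "norm z \<le> norm x + norm (x - z)" using norm_triangle_sub[of z x] by (simp add: norm_minus_commute)
      have p1: "pk ?k e (x - z) * norm (x - z) \<le> pk (?k - 1) e (x - z)"
        using norm_mult_pk_le[OF e, of "x - z" "?k - 1"] unfolding diff_add_cancel by (simp only: mult.commute)
      have "pk ?k e (x - z) * (CF + (1 + norm z) * CN) \<le> pk ?k e (x - z) * (CF + (1 + (norm x + norm (x - z))) * CN)"
        using nz CN_nonneg by (intro mult_left_mono add_mono mult_right_mono) auto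
      also have "\<dots> = ?C * pk ?k e (x - z) + CN * (pk ?k e (x - z) * norm (x - z))" by (simp add: algebra_simps)
      also have "\<dots> \<le> ?C * pk ?k e (x - z) + CN * pk (?k - 1) e (x - z)"
        using p1 CN_nonneg by (intro add_left_mono mult_left_mono)
      finally have pb: "pk ?k e (x - z) * (CF + (1 + norm z) * CN) \<le> ?C * pk ?k e (z - x) + CN * pk (?k - 1) e (z - x)"
        by (simp add: pk_commute)
      have "(\<integral>\<^sup>+y. ennreal (norm (?f z y)) \<partial>M) = (\<integral>\<^sup>+y. ennreal (pk ?k e (x - z)) * ennreal (norm (kr s 0 (z - y) - kr s 1 (- y))) \<partial>M)"
        by (intro nn_integral_cong) (simp add: ennreal_mult)
      also have "\<dots> = ennreal (pk ?k e (x - z)) * (\<integral>\<^sup>+y. ennreal (norm (kr s 0 (z - y) - kr s 1 (- y))) \<partial>M)"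
        by (intro nn_integral_cmult) measurable
      also have "\<dots> \<le> ennreal (pk ?k e (x - z)) * (W s z + ennreal (CF + (1 + norm z) * CN))"
        by (intro mult_left_mono nn_integral_V0_kernel) auto
      also have "\<dots> = ennreal (pk ?k e (x - z)) * W s z + ennreal (pk ?k e (x - z) * (CF + (1 + norm z) * CN))"
        using CF_nonneg CN_nonneg by (simp add: distrib_left ennreal_mult)
      also have "\<dots> \<le> ennreal (pk ?k e (x - z)) * W s z + ennreal (?C * pk ?k e (z - x) + CN * pk (?k - 1) e (z - x))"
        using pb by (intro add_left_mono ennreal_leI)
      also have "ennreal (?C * pk ?k e (z - x) + CN * pk (?k - 1) e (z - x)) = ennreal ?C * ennreal (pk ?k e (z - x)) + ennreal CN * ennreal (pk (?k - 1) e (z - x))"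
        using C0 CN_nonneg by (simp add: ennreal_plus ennreal_mult del: distrib_right)
      finally show "(\<integral>\<^sup>+y. ennreal (norm (?f z y)) \<partial>M) \<le> ennreal (pk ?k e (x - z)) * W s z + (ennreal ?C * ennreal (pk ?k e (z - x)) + ennreal CN * ennreal (pk (?k - 1) e (z - x)))" .
    qed
    also have "\<dots> = (\<integral>\<^sup>+z. ennreal (pk ?k e (x - z)) * W s z \<partial>lborel) + (ennreal ?C * (\<integral>\<^sup>+z. ennreal (pk ?k e (z - x)) \<partial>lborel) + ennreal CN * (\<integral>\<^sup>+z. ennreal (pk (?k - 1) e (z - x)) \<partial>lborel))"
      by (simp add: nn_integral_add nn_integral_cmult)
    also have "\<dots> < \<infinity>"
      using nn_integral_pk_W[OF _ e kD(3), of x] s nn_integral_pk_lborel[OF kD(1) e, of x] nn_integral_pk_lborel[OF kD(2) e, of x]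
      by (auto simp: ennreal_mult_less_top D_def)
    finally show "(\<integral>\<^sup>+p. ennreal (norm ((\<lambda>(z,y). ?f z y) p)) \<partial>(lborel \<Otimes>\<^sub>M M)) < \<infinity>" .
  qed
  have Wf: "AE z in lborel. W s z < \<infinity>" using s by (intro AE_W_finite) (simp add: D_def)
  have V0i: "integrable M (\<lambda>y. kr s 0 (z - y) - kr s 1 (- y))" if "W s z < \<infinity>" for z
    using nn_integral_V0_kernel[of z] that by (intro integrableI_bounded) (auto intro: le_less_trans simp: less_top ennreal_add_eq_top)
  have inner_y: "AE z in lborel. (\<integral>y. ?f z y \<partial>M) = pk ?k e (x - z) *\<^sub>R V0 z"
    using Wf
  proof eventually_elim
    case (elim z)
    then show ?case unfolding V0_def by (intro integral_scaleR_right)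
  qed
  have V0m: "V0 \<in> borel_measurable borel"
  proof -
    have "(\<lambda>z. \<integral>y. kr s 0 (z - y) - kr s 1 (- y) \<partial>M) \<in> borel_measurable borel" by measurable
    then show ?thesis unfolding V0_def .
  qed
  have m1: "(\<lambda>z. \<integral>y. ?f z y \<partial>M) \<in> borel_measurable lborel" by measurable
  have m2: "(\<lambda>z. pk ?k e (x - z) *\<^sub>R V0 z) \<in> borel_measurable lborel" using V0m by measurable
  have i1: "integrable lborel (\<lambda>z. \<integral>y. ?f z y \<partial>M)" using P.integrable_fst[OF fi] .
  show "integrable lborel (\<lambda>z. pk ?k e (x - z) *\<^sub>R V0 z)"
    using i1 inner_y by (subst integrable_cong_AE[OF m2 m1]) auto
  have inner_z: "(\<integral>z. ?f z y \<partial>lborel) = ?c *\<^sub>R (kr s e (x - y) - kr s 1 (- y))" for y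
  proof -
    have a1: "integrable lborel (\<lambda>z. pk ?k e (x - z))" using integrable_pk_lborel[OF kD(1) e, of x] by (simp add: pk_commute)
    have cv: "(\<integral>u. pk ?k e u *\<^sub>R kr s 0 ((x - y) - u) \<partial>lborel) = ?c *\<^sub>R kr s e (x - y)"
      using kernel_convolution[of s e "x - y"] s e by (simp add: D_def)
    have g: "(\<integral>u. pk ?k e u *\<^sub>R kr s 0 ((x - y) - u) \<partial>lborel) = (\<integral>z. pk ?k e (x - z) *\<^sub>R kr s 0 (z - y) \<partial>lborel)"
    proof -
      have "(\<integral>u. pk ?k e u *\<^sub>R kr s 0 ((x - y) - u) \<partial>lborel) = (\<integral>z. pk ?k e (x - z) *\<^sub>R kr s 0 ((x - y) - (x - z)) \<partial>lborel)"
        by (rule integral_lborel_reflect[symmetric]) measurable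
      then show ?thesis by simp
    qed
    have a2: "integrable lborel (\<lambda>z. pk ?k e (x - z) *\<^sub>R kr s 0 (z - y))"
    proof -
      have "integrable lborel (\<lambda>u. pk ?k e u *\<^sub>R kr s 0 ((y - x) - u))"
        using s e kD s_pos by (intro integrable_pk_kr_0) (auto simp: D_def)
      then have "integrable lborel (\<lambda>u. pk ?k e (- x + u) *\<^sub>R kr s 0 ((y - x) - (- x + u)))"
        by (intro integral_lborel_translate(2)[where a="-x" and f="\<lambda>u. pk ?k e u *\<^sub>R kr s 0 ((y - x) - u)"]) measurable
      then have "integrable lborel (\<lambda>u. - (pk ?k e (- x + u) *\<^sub>R kr s 0 ((y - x) - (- x + u))))" by (rule integrable_minus)
      moreover have "- (pk ?k e (- x + u) *\<^sub>R kr s 0 ((y - x) - (- x + u))) = pk ?k e (x - u) *\<^sub>R kr s 0 (u - y)" for u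
      proof -
        have "pk ?k e (- x + u) = pk ?k e (x - u)" using pk_minus[of ?k e "x - u"] by simp
        moreover have "kr s 0 ((y - x) - (- x + u)) = - kr s 0 (u - y)" using kr_minus[of s 0 "u - y"] by simp
        ultimately show ?thesis by simp
      qed
      ultimately show ?thesis by (simp only:)
    qed
    have "(\<integral>z. ?f z y \<partial>lborel) = (\<integral>z. pk ?k e (x - z) *\<^sub>R kr s 0 (z - y) - pk ?k e (x - z) *\<^sub>R kr s 1 (- y) \<partial>lborel)"
      by (simp only: scaleR_diff_right)
    also have "\<dots> = (\<integral>z. pk ?k e (x - z) *\<^sub>R kr s 0 (z - y) \<partial>lborel) - (\<integral>z. pk ?k e (x - z) *\<^sub>R kr s 1 (- y) \<partial>lborel)"
      by (intro Bochner_Integration.integral_diff a2 integrable_scaleR_left a1)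
    also have "(\<integral>z. pk ?k e (x - z) *\<^sub>R kr s 1 (- y) \<partial>lborel) = (\<integral>z. pk ?k e (x - z) \<partial>lborel) *\<^sub>R kr s 1 (- y)"
      by (intro integral_scaleR_left a1)
    also have "(\<integral>z. pk ?k e (x - z) \<partial>lborel) = (\<integral>z. pk ?k e (z - x) \<partial>lborel)" by (simp add: pk_commute)
    also have "\<dots> = ?c" unfolding integral_pk_lborel[OF kD(1) e] by (simp add: D_def)
    finally show ?thesis using cv g by (simp add: scaleR_diff_right scaleR_add_right)
  qed
  have "(\<integral>z. pk ?k e (x - z) *\<^sub>R V0 z \<partial>lborel) = (\<integral>z. \<integral>y. ?f z y \<partial>M \<partial>lborel)"
    using inner_y by (intro integral_cong_AE m1 m2) auto
  also have "\<dots> = (\<integral>y. \<integral>z. ?f z y \<partial>lborel \<partial>M)" using P.Fubini_integral[OF fi] by simp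
  also have "\<dots> = ?c *\<^sub>R V e x" unfolding inner_z V_def by (rule integral_scaleR_right)
  finally show "(\<integral>z. pk ?k e (x - z) *\<^sub>R V0 z \<partial>lborel) = ?c *\<^sub>R V e x" .
qed

text \<open>m minus the component of V - l along u is an average of a function that is nonnegative
  almost everywhere, so domination of one averaging kernel by another compares its values. The power
  of e'/e comes from normalising the kernels to mass 1.\<close>

lemma V_harnack:
  fixes x x' u l :: 'a
  defines "D \<equiv> real DIM('a)"
  assumes s: "1 < s" "s < D" and e: "0 < e" "0 < e'"
    and bd: "\<And>r z. 0 < r \<Longrightarrow> (V r z - l) \<bullet> u \<le> m"
    and C: "0 \<le> C" "\<And>z. pk (2*D+1-s) e' (x' - z) \<le> C * pk (2*D+1-s) e (x - z)"
  shows "m - (V e' x' - l) \<bullet> u \<le> C * (e'/e) powr (D+1-s) * (m - (V e x - l) \<bullet> u)"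
proof -
  let ?k = "2*D+1-s" and ?I = "pk_mass TYPE('a) (2*D+1-s)"
  have kD: "real DIM('a) < ?k" using s by (simp add: D_def)
  have I: "0 < ?I" by (rule pk_mass_pos[OF kD])
  define f where "f z = m - (V0 z - l) \<bullet> u" for z
  have f0: "AE z in lborel. 0 \<le> f z"
  proof -
    have "AE z in lborel. W s z < \<infinity>" using s by (intro AE_W_finite) (simp add: D_def)
    then show ?thesis
    proof eventually_elim
      case (elim z)
      have "(\<lambda>n. (V (1 / real (Suc n)) z - l) \<bullet> u) \<longlonglongrightarrow> (V0 z - l) \<bullet> u"
        by (intro tendsto_intros V_tendsto_V0 elim)
      then have "(V0 z - l) \<bullet> u \<le> m" by (rule LIMSEQ_le_const2) (intro exI allI impI bd, simp)
      then show ?case by (simp add: f_def)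
    qed
  qed
  have rep: "integrable lborel (\<lambda>z. pk ?k r (p - z) * f z)"
    "(\<integral>z. pk ?k r (p - z) * f z \<partial>lborel) = ?I * r powr (s-1-D) * (m - (V r p - l) \<bullet> u)" if r: "0 < r" for r p
  proof -
    have s': "s < real DIM('a)" using s by (simp add: D_def)
    note R = V_representation[OF s(1) s' r, of p, folded D_def]
    have a1: "integrable lborel (\<lambda>z. pk ?k r (p - z))" using integrable_pk_lborel[OF kD r, of p] by (simp add: pk_commute)
    have a2: "(\<integral>z. pk ?k r (p - z) \<partial>lborel) = ?I * r powr (s-1-D)"
      using integral_pk_lborel[OF kD r, of p] by (simp add: pk_commute D_def)
    have eq: "(\<lambda>z. pk ?k r (p - z) * f z) = (\<lambda>z. (m + l \<bullet> u) * pk ?k r (p - z) - (pk ?k r (p - z) *\<^sub>R V0 z) \<bullet> u)"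
      by (auto simp: f_def algebra_simps)
    show "integrable lborel (\<lambda>z. pk ?k r (p - z) * f z)"
      unfolding eq by (intro Bochner_Integration.integrable_diff integrable_mult_right integrable_inner_left a1 R)
    have "(\<integral>z. pk ?k r (p - z) * f z \<partial>lborel) = (\<integral>z. (m + l \<bullet> u) * pk ?k r (p - z) \<partial>lborel) - (\<integral>z. (pk ?k r (p - z) *\<^sub>R V0 z) \<bullet> u \<partial>lborel)"
      unfolding eq by (intro Bochner_Integration.integral_diff integrable_mult_right integrable_inner_left a1 R)
    also have "(\<integral>z. (pk ?k r (p - z) *\<^sub>R V0 z) \<bullet> u \<partial>lborel) = (\<integral>z. pk ?k r (p - z) *\<^sub>R V0 z \<partial>lborel) \<bullet> u"
      by (intro integral_inner_left R)
    also have "\<dots> = ?I * r powr (s-1-D) * (V r p \<bullet> u)" unfolding R(2) by simp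
    also have "(\<integral>z. (m + l \<bullet> u) * pk ?k r (p - z) \<partial>lborel) = (m + l \<bullet> u) * (?I * r powr (s-1-D))"
      by (simp only: integral_mult_right_zero a2)
    finally show "(\<integral>z. pk ?k r (p - z) * f z \<partial>lborel) = ?I * r powr (s-1-D) * (m - (V r p - l) \<bullet> u)"
      by (simp add: algebra_simps)
  qed
  have "(\<integral>z. pk ?k e' (x' - z) * f z \<partial>lborel) \<le> (\<integral>z. C * (pk ?k e (x - z) * f z) \<partial>lborel)"
  proof (rule integral_mono_AE)
    show "AE z in lborel. pk ?k e' (x' - z) * f z \<le> C * (pk ?k e (x - z) * f z)"
      using f0
    proof eventually_elim
      case (elim z)
      then show ?case using mult_right_mono[OF C(2)[of z] elim] by (simp add: mult.assoc)
    qed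
  qed (use rep e in auto)
  then have "?I * (e' powr (s-1-D) * (m - (V e' x' - l) \<bullet> u)) \<le> ?I * (C * e powr (s-1-D) * (m - (V e x - l) \<bullet> u))"
    using rep(2)[OF e(1), of x] rep(2)[OF e(2), of x'] by (simp add: mult_ac)
  then have "e' powr (s-1-D) * (m - (V e' x' - l) \<bullet> u) \<le> C * e powr (s-1-D) * (m - (V e x - l) \<bullet> u)"
    using I by simp
  then have "e' powr (D+1-s) * (e' powr (s-1-D) * (m - (V e' x' - l) \<bullet> u)) \<le> e' powr (D+1-s) * (C * e powr (s-1-D) * (m - (V e x - l) \<bullet> u))"
    by (rule mult_left_mono) simp
  moreover have 1: "e' powr (D+1-s) * e' powr (s-1-D) = 1" using e unfolding powr_add[symmetric] by simp
  moreover have 2: "e' powr (D+1-s) * e powr (s-1-D) = (e'/e) powr (D+1-s)"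
  proof -
    have "s-1-D = -(D+1-s)" by simp
    then show ?thesis by (simp only: powr_divide powr_minus_divide) simp
  qed
  have "e' powr (D+1-s) * (e' powr (s-1-D) * (m - (V e' x' - l) \<bullet> u)) = m - (V e' x' - l) \<bullet> u"
    unfolding mult.assoc[symmetric] 1 by simp
  moreover have "e' powr (D+1-s) * (C * e powr (s-1-D) * (m - (V e x - l) \<bullet> u))
      = C * (e' powr (D+1-s) * e powr (s-1-D)) * (m - (V e x - l) \<bullet> u)"
    by (simp only: mult_ac)
  ultimately show ?thesis unfolding 2 by linarith
qed


section \<open>The case s greater than d - 1\<close>

text \<open>A smoothed, scale-invariant form of the mass of the ball divided by t^s. By
  \<open>V_scale\<close> it bounds the change of V between t and 2 t up to a constant, and the
  weight t^2 limits its growth to a factor 4 when t doubles.\<close>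

definition dens :: "'a \<Rightarrow> real \<Rightarrow> real" where
  "dens x t = t\<^sup>2 * (\<integral>y. pk (s+2) t (x - y) \<partial>M)"

lemma dens_le:
  assumes "0 < t"
  shows "dens x t \<le> cup s (s+2) * \<Lambda>"
proof -
  have "dens x t \<le> t\<^sup>2 * (cup s (s+2) * \<Lambda> * t powr (s - (s+2)))"
    unfolding dens_def using assms by (intro mult_left_mono integral_pk_le) auto
  also have "\<dots> = cup s (s+2) * \<Lambda> * (t powr 2 * t powr (s - (s+2)))" using assms by simp
  also have "t powr 2 * t powr (s - (s+2)) = 1" unfolding powr_add[symmetric] using assms by simp
  finally show ?thesis by simp
qed

lemma dens_pos:
  assumes nz: "0 < emeasure M (ball c0 r0)" and t: "0 < t"
  shows "0 < dens x t"
proof -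
  have int: "integrable M (\<lambda>y. pk (s+2) t (x - y))" using t by (intro integrable_pk) auto
  have nn: "0 \<le> (\<integral>y. pk (s+2) t (x - y) \<partial>M)" by (rule integral_pk_nonneg)
  have "(\<integral>y. pk (s+2) t (x - y) \<partial>M) \<noteq> 0"
  proof
    assume "(\<integral>y. pk (s+2) t (x - y) \<partial>M) = 0"
    then have "AE y in M. pk (s+2) t (x - y) = 0"
      using int by (subst (asm) integral_nonneg_eq_0_iff_AE) auto
    then have "AE y in M. y \<notin> ball c0 r0"
    proof eventually_elim
      case (elim y)
      then show ?case using pk_pos[OF t, of "s+2" "x - y"] by simp
    qed
    then have "ball c0 r0 \<in> null_sets M" by (subst AE_iff_null_sets) auto
    then show False using nz by (simp add: null_setsD1)
  qed
  then have "0 < (\<integral>y. pk (s+2) t (x - y) \<partial>M)" using nn by linarith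
  then show ?thesis unfolding dens_def using t by (intro mult_pos_pos zero_less_power)
qed

text \<open>The weighted densities 2^(-i n) \<open>dens\<close> are bounded, and j comes within a
  factor 2 of their supremum. Seen from j, densities decay geometrically towards smaller scales and
  grow at rate at most n towards larger ones.\<close>

lemma exists_good_scale:
  assumes nz: "0 < emeasure M (ball c0 r0)" and r: "0 < r" and n: "0 < n"
  shows "\<exists>j::nat. \<forall>i::nat. dens x (2^i * r) \<le> 2 * 2 powr ((real i - real j) * n) * dens x (2^j * r)"
proof -
  define f where "f i = 2 powr (- real i * n) * dens x (2^i * r)" for i :: nat
  have fp: "0 < f i" for i unfolding f_def using dens_pos[OF nz, of "2^i * r" x] r by simp
  have fle: "f i \<le> cup s (s+2) * \<Lambda>" for i
  proof -
    have "2 powr (- real i * n) \<le> (2::real) powr 0" using n by (intro powr_mono) auto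
    then have "f i \<le> 1 * dens x (2^i * r)" unfolding f_def using dens_pos[OF nz, of "2^i * r" x] r by (intro mult_right_mono) auto
    then show ?thesis using dens_le[of "2^i * r" x] r by simp
  qed
  have bdd: "bdd_above (range f)" using fle by (intro bdd_aboveI[of _ "cup s (s+2) * \<Lambda>"]) auto
  define S where "S = (SUP i. f i)"
  have fS: "f i \<le> S" for i unfolding S_def using bdd by (intro cSUP_upper) auto
  have "S / 2 < S" using fS[of 0] fp[of 0] by simp
  then obtain j where j: "S / 2 < f j" unfolding S_def using bdd by (subst (asm) less_cSUP_iff) auto
  show ?thesis
  proof (intro exI allI)
    fix i :: nat
    have "f i \<le> 2 * f j" using fS[of i] j by linarith
    then have "2 powr (real i * n) * f i \<le> 2 powr (real i * n) * (2 * f j)" by (rule mult_left_mono) simp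
    moreover have "2 powr (real i * n) * f i = dens x (2^i * r)"
    proof -
      have "2 powr (real i * n) * f i = (2 powr (real i * n) * 2 powr (- real i * n)) * dens x (2^i * r)" by (simp add: f_def)
      also have "2 powr (real i * n) * 2 powr (- real i * n) = (1::real)" unfolding powr_add[symmetric] by simp
      finally show ?thesis by simp
    qed
    moreover have "2 powr (real i * n) * (2 * f j) = 2 * 2 powr ((real i - real j) * n) * dens x (2^j * r)"
    proof -
      have "2 powr (real i * n) * (2 * f j) = 2 * (2 powr (real i * n) * 2 powr (- real j * n)) * dens x (2^j * r)" by (simp add: f_def)
      also have "2 powr (real i * n) * 2 powr (- real j * n) = (2::real) powr ((real i - real j) * n)"
        unfolding powr_add[symmetric] by (rule arg_cong[of _ _ "(powr) 2"]) (simp add: algebra_simps)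
      finally show ?thesis .
    qed
    ultimately show "dens x (2^i * r) \<le> 2 * 2 powr ((real i - real j) * n) * dens x (2^j * r)" by simp
  qed
qed

lemma pk_scale_compare:
  fixes w :: 'a
  assumes "0 < R" "0 < T" "T \<le> 2 * norm w" "0 \<le> k"
  shows "pk k R w \<le> 5 powr (k/2) * pk k T w"
proof (rule pk_compare)
  have "T\<^sup>2 \<le> (2 * norm w)\<^sup>2" using assms by (intro power_mono) auto
  then show "T\<^sup>2 + (norm w)\<^sup>2 \<le> 5 * (R\<^sup>2 + (norm w)\<^sup>2)" by (simp add: power_mult_distrib) (smt (verit) zero_le_power2)
qed (use assms in auto)

text \<open>Since n < 2, the integral of \<open>pk (s+2)\<close> at scale 2^a R is a small fraction
  of the one at scale R. Hence at least half of the latter comes from the ball of radius 2^a R / 2,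
  while the kernel is bounded below on the ball of twice that radius: the two masses are
  comparable.\<close>

lemma good_ball:
  assumes nz: "0 < emeasure M (ball c0 r0)" and n: "0 < n" "n < 2"
  obtains a :: nat and C1 :: real where "0 < C1"
    "\<forall>x R. 0 < R \<longrightarrow> (\<forall>i::nat. dens x (2^i * R) \<le> 2 * 2 powr (real i * n) * dens x R) \<longrightarrow>
      0 < measure M (ball x (2^a * R / 2)) \<and> measure M (cball x (2^a * R)) \<le> C1 * measure M (ball x (2^a * R / 2))"
proof -
  define K where "K = 5 powr ((s+2)/2) * (2::real)"
  have K: "0 < K" by (simp add: K_def)
  define \<theta> where "\<theta> = (2::real) powr (n - 2)"
  have \<theta>: "0 < \<theta>" "\<theta> < 1" using n by (auto simp: \<theta>_def powr_less_one)
  \<comment> \<open>\<theta>^a compares the allowed growth 2^(a n) with A^2; it is made so small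
    that the far part takes at most half of the integral at scale R.\<close>
  obtain a :: nat where a: "\<theta> ^ a < 1 / (2 * K)" using real_arch_pow_inv[of "1 / (2 * K)" \<theta>] K \<theta> by auto
  define A where "A = (2::real)^a"
  have A: "0 < A" by (simp add: A_def)
  have Aa: "2 powr (real a * n) / A\<^sup>2 = \<theta> ^ a"
  proof -
    have "\<theta> ^ a = 2 powr ((n - 2) * real a)" unfolding \<theta>_def by (simp add: powr_powr flip: powr_realpow)
    also have "(n - 2) * real a = real a * n - real a * 2" by (simp add: algebra_simps)
    also have "2 powr (real a * n - real a * 2) = 2 powr (real a * n) / 2 powr (real a * 2)" by (rule powr_diff)
    also have "2 powr (real a * 2) = A\<^sup>2" unfolding A_def by (simp add: powr_powr[symmetric] powr_realpow)
    finally show ?thesis by simp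
  qed
  define c where "c = 1 + A\<^sup>2"
  have c: "0 < c" unfolding c_def by (intro add_pos_nonneg) auto
  show ?thesis
  proof (rule that, safe)
    show "0 < 2 * c powr ((s+2)/2)" using c by simp
    fix x R assume R: "0 < (R::real)" and "\<forall>i::nat. dens x (2^i * R) \<le> 2 * 2 powr (real i * n) * dens x R"
    then have sel: "dens x (2^i * R) \<le> 2 * 2 powr (real i * n) * dens x R" for i :: nat by blast
    define \<Phi> where "\<Phi> t = (\<integral>y. pk (s+2) t (x - y) \<partial>M)" for t
    have \<Phi>R: "0 < \<Phi> R" using dens_pos[OF nz R, of x] R by (simp add: dens_def \<Phi>_def zero_less_mult_iff)
    have "(A * R)\<^sup>2 * \<Phi> (A * R) \<le> 2 * 2 powr (real a * n) * (R\<^sup>2 * \<Phi> R)"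
      using sel[of a] by (simp add: dens_def \<Phi>_def A_def)
    then have "A\<^sup>2 * \<Phi> (A * R) \<le> 2 * 2 powr (real a * n) * \<Phi> R"
    proof -
      assume "(A * R)\<^sup>2 * \<Phi> (A * R) \<le> 2 * 2 powr (real a * n) * (R\<^sup>2 * \<Phi> R)"
      then have "R\<^sup>2 * (A\<^sup>2 * \<Phi> (A * R)) \<le> R\<^sup>2 * (2 * 2 powr (real a * n) * \<Phi> R)"
        by (simp add: power_mult_distrib mult_ac)
      then show ?thesis using R by simp
    qed
    then have "\<Phi> (A * R) \<le> (2 * 2 powr (real a * n) * \<Phi> R) / A\<^sup>2" using A by (simp add: field_simps)
    also have "\<dots> = 2 * (2 powr (real a * n) / A\<^sup>2) * \<Phi> R" by simp
    finally have \<Phi>A: "\<Phi> (A * R) \<le> 2 * \<theta> ^ a * \<Phi> R" unfolding Aa .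
    have "\<Phi> R \<le> (\<integral>y. R powr (-(s+2)) * indicator (ball x (A * R / 2)) y + 5 powr ((s+2)/2) * pk (s+2) (A * R) (x - y) \<partial>M)"
      unfolding \<Phi>_def
    proof (rule integral_mono)
      show "integrable M (\<lambda>y. pk (s+2) R (x - y))" using R by (intro integrable_pk) auto
      show "integrable M (\<lambda>y. R powr (-(s+2)) * indicator (ball x (A * R / 2)) y + 5 powr ((s+2)/2) * pk (s+2) (A * R) (x - y))"
        using R A finite_balls(2)[of x "A * R / 2"]
        by (intro Bochner_Integration.integrable_add integrable_mult_right integrable_pk integrable_real_indicator) auto
      fix y
      show "pk (s+2) R (x - y) \<le> R powr (-(s+2)) * indicator (ball x (A * R / 2)) y + 5 powr ((s+2)/2) * pk (s+2) (A * R) (x - y)"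
      proof (cases "y \<in> ball x (A * R / 2)")
        case True
        then show ?thesis using pk_le_scale[of "s+2" R "x - y"] R s_pos by (simp add: add_increasing2)
      next
        case False
        then have "A * R \<le> 2 * norm (x - y)" by (auto simp: dist_norm)
        then show ?thesis using pk_scale_compare[of R "A * R" "x - y" "s+2"] False R A s_pos by simp
      qed
    qed
    also have "\<dots> = R powr (-(s+2)) * measure M (ball x (A * R / 2)) + 5 powr ((s+2)/2) * \<Phi> (A * R)"
      unfolding \<Phi>_def using R A finite_balls(2)[of x "A * R / 2"] integrable_pk[of "A * R" "s+2" x]
      by (subst Bochner_Integration.integral_add) (auto intro!: integrable_mult_right integrable_real_indicator)
    also have "\<dots> \<le> R powr (-(s+2)) * measure M (ball x (A * R / 2)) + 5 powr ((s+2)/2) * (2 * \<theta> ^ a * \<Phi> R)"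
      using \<Phi>A by (intro add_left_mono mult_left_mono) auto
    also have "5 powr ((s+2)/2) * (2 * \<theta> ^ a * \<Phi> R) = (K * \<theta> ^ a) * \<Phi> R" by (simp add: K_def)
    also have "\<dots> \<le> (1/2) * \<Phi> R"
    proof (intro mult_right_mono)
      show "K * \<theta> ^ a \<le> 1/2" using a K by (simp add: field_simps)
    qed (use \<Phi>R in simp)
    finally have low: "\<Phi> R \<le> 2 * (R powr (-(s+2)) * measure M (ball x (A * R / 2)))" by simp
    have pos: "0 < measure M (ball x (A * R / 2))"
    proof (rule ccontr)
      assume "\<not> ?thesis"
      then have "measure M (ball x (A * R / 2)) = 0" using measure_nonneg[of M "ball x (A * R / 2)"] by linarith
      then have "\<Phi> R \<le> 0" using low by (metis mult_zero_right)
      then show False using \<Phi>R by linarith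
    qed
    have up: "c powr (-((s+2)/2)) * R powr (-(s+2)) * measure M (cball x (A * R)) \<le> \<Phi> R"
    proof -
      have "c powr (-((s+2)/2)) * R powr (-(s+2)) * measure M (cball x (A * R)) = (\<integral>y. c powr (-((s+2)/2)) * R powr (-(s+2)) * indicator (cball x (A * R)) y \<partial>M)"
        using finite_balls(1)[of x "A * R"] by simp
      also have "\<dots> \<le> \<Phi> R" unfolding \<Phi>_def
      proof (rule integral_mono)
        show "integrable M (\<lambda>y. pk (s+2) R (x - y))" using R by (intro integrable_pk) auto
        show "integrable M (\<lambda>y. c powr (-((s+2)/2)) * R powr (-(s+2)) * indicator (cball x (A * R)) y)"
          using finite_balls(1)[of x "A * R"] by (intro integrable_mult_right integrable_real_indicator) auto
        fix y
        show "c powr (-((s+2)/2)) * R powr (-(s+2)) * indicator (cball x (A * R)) y \<le> pk (s+2) R (x - y)"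
        proof (cases "y \<in> cball x (A * R)")
          case True
          have "(norm (x - y))\<^sup>2 \<le> (A * R)\<^sup>2" using True by (intro power_mono) (auto simp: dist_norm)
          then have "R\<^sup>2 + (norm (x - y))\<^sup>2 \<le> c * R\<^sup>2" by (simp add: c_def power_mult_distrib algebra_simps)
          then have "(c * R\<^sup>2) powr (-((s+2)/2)) \<le> pk (s+2) R (x - y)"
            unfolding pk_def using R s_pos by (intro powr_mono2') (auto intro: add_pos_nonneg)
          then show ?thesis using True sq_powr_half[OF R, of "s+2"] by (simp add: powr_mult)
        qed simp
      qed
      finally show ?thesis .
    qed
    have "R powr (-(s+2)) * (c powr (-((s+2)/2)) * measure M (cball x (A * R))) \<le> R powr (-(s+2)) * (2 * measure M (ball x (A * R / 2)))"
      using up low by (simp add: mult_ac)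
    then have "c powr (-((s+2)/2)) * measure M (cball x (A * R)) \<le> 2 * measure M (ball x (A * R / 2))" using R by simp
    then have "c powr ((s+2)/2) * (c powr (-((s+2)/2)) * measure M (cball x (A * R))) \<le> c powr ((s+2)/2) * (2 * measure M (ball x (A * R / 2)))"
      by (rule mult_left_mono) simp
    also have "c powr ((s+2)/2) * (c powr (-((s+2)/2)) * measure M (cball x (A * R))) = (c powr ((s+2)/2) * c powr (-((s+2)/2))) * measure M (cball x (A * R))"
      by (rule mult.assoc[symmetric])
    also have "c powr ((s+2)/2) * c powr (-((s+2)/2)) = 1" unfolding powr_add[symmetric] using c by simp
    finally have "measure M (cball x (A * R)) \<le> 2 * c powr ((s+2)/2) * measure M (ball x (A * R / 2))"
      by (simp only: mult_1_left mult.assoc mult.left_commute)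
    with pos show "0 < measure M (ball x (2^a * R / 2))" "measure M (cball x (2^a * R)) \<le> 2 * c powr ((s+2)/2) * measure M (ball x (2^a * R / 2))"
      by (simp_all add: A_def)
  qed
qed

text \<open>Combines the selected scale with \<open>good_ball\<close>: the averages are now
  normalised by the integral of \<psi> instead of the mass of its carrier, and V hardly changes on
  the way up from r to scales well below the selected one. The numbers a and C are uniform in x and
  r.\<close>

lemma good_test:
  assumes l: "avg_const l" and nz: "0 < emeasure M (ball c0 r0)" and n: "0 < n" "n < 2"
  obtains a :: nat and C :: real where "0 \<le> C"
    "\<forall>x r. 0 < r \<longrightarrow> (\<exists>(j::nat) \<psi>. lipc (1 / (2^a * (2^j * r))) \<psi> x (2^a * (2^j * r)) \<and> (\<forall>y. 0 \<le> \<psi> y) \<and> 0 < (\<integral>y. \<psi> y \<partial>M)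
      \<and> (\<forall>e>0. norm (\<integral>y. \<psi> y *\<^sub>R (V e y - l) \<partial>M) \<le> C * (e / (2^a * (2^j * r))) * (\<integral>y. \<psi> y \<partial>M))
      \<and> (\<forall>i. norm (V r x - V (2^i * r) x) \<le> C * 2 powr (- n * (real j - real i))))"
proof -
  obtain a :: nat and C1 :: real where C1: "0 < C1" "\<forall>x R. 0 < R \<longrightarrow> (\<forall>i::nat. dens x (2^i * R) \<le> 2 * 2 powr (real i * n) * dens x R) \<longrightarrow>
      0 < measure M (ball x (2^a * R / 2)) \<and> measure M (cball x (2^a * R)) \<le> C1 * measure M (ball x (2^a * R / 2))"
    by (rule good_ball[OF nz n])
  define Cd where "Cd = cup s (s+2) * \<Lambda>"
  have Cd: "0 < Cd" unfolding Cd_def using cup_pos[of s "s+2"] \<Lambda>_pos by simp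
  define Ca where "Ca = cj s * \<Lambda> * (2 * C1)"
  define Cb where "Cb = (s+1)/2 * 3 * 2 * Cd / (2 powr n - 1)"
  have n1: "1 < (2::real) powr n" using n by (simp add: gr_one_powr)
  have Ca: "0 \<le> Ca" unfolding Ca_def using cj_pos[OF s_pos] \<Lambda>_pos C1 by simp
  have Cb: "0 \<le> Cb" unfolding Cb_def using n1 Cd s_pos by (intro divide_nonneg_nonneg mult_nonneg_nonneg) auto
  show ?thesis
  proof (rule that[rotated], intro allI impI)
    show "0 \<le> Ca + Cb" using Ca Cb by simp
  next
    fix x r assume r: "0 < (r::real)"
    obtain j :: nat where j: "\<And>i::nat. dens x (2^i * r) \<le> 2 * 2 powr ((real i - real j) * n) * dens x (2^j * r)"
      using exists_good_scale[OF nz r n(1)] by blast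
    define R where "R = 2^j * r"
    have R: "0 < R" using r by (simp add: R_def)
    have sel: "dens x (2^i * R) \<le> 2 * 2 powr (real i * n) * dens x R" for i :: nat
    proof -
      have e: "2^(i + j) * r = 2^i * R" by (simp add: R_def power_add)
      show ?thesis using j[of "i + j"] unfolding e by (simp add: R_def)
    qed
    define \<rho> where "\<rho> = 2^a * R"
    have \<rho>: "0 < \<rho>" using R by (simp add: \<rho>_def)
    have m: "0 < measure M (ball x (\<rho> / 2))" "measure M (cball x \<rho>) \<le> C1 * measure M (ball x (\<rho> / 2))"
      using C1(2)[rule_format, OF R sel] by (simp_all only: \<rho>_def)
    let ?\<psi> = "tent x \<rho>"
    have lip: "lipc (1/\<rho>) ?\<psi> x \<rho>" using \<rho> by (rule lipc_tent)
    have fin: "emeasure M (ball x (\<rho>/2)) < \<infinity>" by (rule finite_balls)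
    have I: "measure M (ball x (\<rho> / 2)) / 2 \<le> (\<integral>y. ?\<psi> y \<partial>M)"
    proof -
      have "measure M (ball x (\<rho> / 2)) / 2 = (\<integral>y. (1/2) * indicator (ball x (\<rho>/2)) y \<partial>M)" using fin by simp
      also have "\<dots> \<le> (\<integral>y. ?\<psi> y \<partial>M)"
      proof (intro integral_mono integrable_mult_right integrable_real_indicator integrable_lipc[OF lip])
        show "1 / 2 * indicator (ball x (\<rho>/2)) y \<le> ?\<psi> y" for y
          using tent_ge_half[OF \<rho>, of y x] tent_nonneg[of x \<rho> y] by (cases "y \<in> ball x (\<rho>/2)") auto
      qed (use fin in auto)
      finally show ?thesis .
    qed
    have A: "norm (\<integral>y. ?\<psi> y *\<^sub>R (V e y - l) \<partial>M) \<le> (Ca + Cb) * (e / \<rho>) * (\<integral>y. ?\<psi> y \<partial>M)" if e: "0 < e" for e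
    proof -
      have "norm (\<integral>y. ?\<psi> y *\<^sub>R (V e y - l) \<partial>M) \<le> cj s * \<Lambda> * (1/\<rho>) * e * measure M (cball x \<rho>)"
        using l e \<rho> lip unfolding avg_const_def by blast
      also have "\<dots> = cj s * \<Lambda> * (e/\<rho>) * measure M (cball x \<rho>)" by simp
      also have "\<dots> \<le> cj s * \<Lambda> * (e/\<rho>) * (C1 * (2 * (\<integral>y. ?\<psi> y \<partial>M)))"
      proof (intro mult_left_mono mult_nonneg_nonneg)
        have "C1 * measure M (ball x (\<rho> / 2)) \<le> C1 * (2 * (\<integral>y. ?\<psi> y \<partial>M))" using I C1(1) by (intro mult_left_mono) auto
        then show "measure M (cball x \<rho>) \<le> C1 * (2 * (\<integral>y. ?\<psi> y \<partial>M))" using m by linarith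
      qed (use cj_pos[OF s_pos] \<Lambda>_pos e \<rho> in auto)
      also have "\<dots> = Ca * (e/\<rho>) * (\<integral>y. ?\<psi> y \<partial>M)" by (simp add: Ca_def)
      also have "\<dots> \<le> (Ca + Cb) * (e / \<rho>) * (\<integral>y. ?\<psi> y \<partial>M)"
        using Cb e \<rho> I m by (intro mult_right_mono) auto
      finally show ?thesis .
    qed
    have B: "norm (V r x - V (2^i * r) x) \<le> (Ca + Cb) * 2 powr (- n * (real j - real i))" for i :: nat
    proof -
      \<comment> \<open>The density at the selected scale R is at most Cd, so a doubling at scale t
        costs (t / R)^n up to a constant, and the sum is governed by its last term.\<close>
      define K where "K = (s+1)/2 * 3 * 2 * Cd * R powr (- n)"
      have "norm (V r x - V (2^i * r) x) \<le> K / (2 powr n - 1) * (2^i * r) powr n"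
      proof (rule norm_diff_dyadic_le[OF n(1)])
        show "0 \<le> K" unfolding K_def using s_pos Cd by simp
        fix i' :: nat
        let ?t = "2^i' * r"
        have t: "0 < ?t" using r by simp
        have "norm (V ?t x - V (2 * ?t) x) \<le> (s+1)/2 * ((2 * ?t)\<^sup>2 - ?t\<^sup>2) * (\<integral>y. pk (s+2) ?t (x - y) \<partial>M)"
          using t r by (intro V_scale) auto
        also have "\<dots> = (s+1)/2 * 3 * dens x ?t" by (simp add: dens_def power_mult_distrib)
        also have "\<dots> \<le> (s+1)/2 * 3 * (2 * 2 powr ((real i' - real j) * n) * dens x R)"
          using j[of i'] s_pos by (intro mult_left_mono) (auto simp: R_def)
        also have "\<dots> \<le> (s+1)/2 * 3 * (2 * 2 powr ((real i' - real j) * n) * Cd)"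
          using dens_le[OF R, of x] s_pos by (intro mult_left_mono) (auto simp: Cd_def)
        also have "2 powr ((real i' - real j) * n) = ?t powr n * R powr (-n)"
        proof -
          have "?t powr n * R powr (-n) = (?t / R) powr n" by (simp add: powr_divide powr_minus_divide)
          also have "?t / R = 2 powr (real i' - real j)" using r by (simp add: R_def powr_diff powr_realpow)
          finally show ?thesis by (simp add: powr_powr)
        qed
        finally show "norm (V ?t x - V (2 * ?t) x) \<le> K * ?t powr n" by (simp only: K_def mult_ac)
      qed
      also have "\<dots> = Cb * ((2^i * r) powr n * R powr (-n))" by (simp add: K_def Cb_def)
      also have "(2^i * r) powr n * R powr (-n) = 2 powr (- n * (real j - real i))"
      proof -
        have "(2^i * r) powr n * R powr (-n) = ((2^i * r) / R) powr n" by (simp add: powr_divide powr_minus_divide)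
        also have "(2^i * r) / R = 2 powr (real i - real j)" using r by (simp add: R_def powr_diff powr_realpow)
        also have "(2 powr (real i - real j)) powr n = 2 powr (- n * (real j - real i))"
          unfolding powr_powr by (rule arg_cong[of _ _ "(powr) 2"]) (simp add: algebra_simps)
        finally show ?thesis .
      qed
      also have "Cb * 2 powr (- n * (real j - real i)) \<le> (Ca + Cb) * 2 powr (- n * (real j - real i))"
        using Ca by (intro mult_right_mono) auto
      finally show ?thesis .
    qed
    have "0 < (\<integral>y. ?\<psi> y \<partial>M)" using I m by linarith
    then show "\<exists>(j::nat) \<psi>. lipc (1 / (2^a * (2^j * r))) \<psi> x (2^a * (2^j * r)) \<and> (\<forall>y. 0 \<le> \<psi> y) \<and> 0 < (\<integral>y. \<psi> y \<partial>M)
      \<and> (\<forall>e>0. norm (\<integral>y. \<psi> y *\<^sub>R (V e y - l) \<partial>M) \<le> (Ca + Cb) * (e / (2^a * (2^j * r))) * (\<integral>y. \<psi> y \<partial>M))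
      \<and> (\<forall>i. norm (V r x - V (2^i * r) x) \<le> (Ca + Cb) * 2 powr (- n * (real j - real i)))"
      using A B lip tent_nonneg[of x \<rho>]
      by (intro exI[of _ j] exI[of _ ?\<psi>] conjI allI impI) (simp_all only: R_def[symmetric] \<rho>_def[symmetric])
  qed
qed

text \<open>Makes the supremum of the extremal argument finite. Averages are taken at the scale of
  the bump itself, e = \<rho>, so their error is a constant, and V r x stays at bounded distance
  from the averaged values.\<close>

lemma V_bounded:
  assumes l: "avg_const l" and nz: "0 < emeasure M (ball c0 r0)"
  obtains B where "\<And>r x. 0 < r \<Longrightarrow> norm (V r x - l) \<le> B"
proof -
  obtain a :: nat and C :: real where C: "0 \<le> C" and T: "\<forall>x r. 0 < r \<longrightarrow> (\<exists>(j::nat) \<psi>. lipc (1 / (2^a * (2^j * r))) \<psi> x (2^a * (2^j * r)) \<and> (\<forall>y. 0 \<le> \<psi> y) \<and> 0 < (\<integral>y. \<psi> y \<partial>M)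
      \<and> (\<forall>e>0. norm (\<integral>y. \<psi> y *\<^sub>R (V e y - l) \<partial>M) \<le> C * (e / (2^a * (2^j * r))) * (\<integral>y. \<psi> y \<partial>M))
      \<and> (\<forall>i. norm (V r x - V (2^i * r) x) \<le> C * 2 powr (- 1 * (real j - real i))))"
    by (rule good_test[OF l nz, of 1]) simp_all
  define F where "F = C + (s+1)/2 * (2^a)\<^sup>2 * (cup s (s+2) * \<Lambda>) + ctd s 1 * 1 * cup s (s+1) * \<Lambda>"
  show ?thesis
  proof (rule that)
    fix r x assume r: "0 < (r::real)"
    obtain j :: nat and \<psi> where lip: "lipc (1 / (2^a * (2^j * r))) \<psi> x (2^a * (2^j * r))" and nn: "\<And>y. 0 \<le> \<psi> y" and I: "0 < (\<integral>y. \<psi> y \<partial>M)"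
      and A: "\<And>e. 0 < e \<Longrightarrow> norm (\<integral>y. \<psi> y *\<^sub>R (V e y - l) \<partial>M) \<le> C * (e / (2^a * (2^j * r))) * (\<integral>y. \<psi> y \<partial>M)"
      and B: "\<And>i. norm (V r x - V (2^i * r) x) \<le> C * 2 powr (- 1 * (real j - real i))"
      using T[rule_format, OF r, of x] by blast
    define R where "R = 2^j * r"
    define \<rho> where "\<rho> = 2^a * R"
    have R: "0 < R" "0 < \<rho>" "R \<le> \<rho>" using r by (auto simp: R_def \<rho>_def)
    have 1: "norm (V r x - V R x) \<le> C" using B[of j] by (simp add: R_def)
    have 2: "norm (V R x - V \<rho> x) \<le> (s+1)/2 * (2^a)\<^sup>2 * (cup s (s+2) * \<Lambda>)"
    proof -
      have "norm (V R x - V \<rho> x) \<le> (s+1)/2 * (\<rho>\<^sup>2 - R\<^sup>2) * (\<integral>y. pk (s+2) R (x - y) \<partial>M)" using R by (intro V_scale) auto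
      also have "\<dots> \<le> (s+1)/2 * \<rho>\<^sup>2 * (\<integral>y. pk (s+2) R (x - y) \<partial>M)"
        using s_pos by (intro mult_right_mono mult_left_mono integral_pk_nonneg) auto
      also have "\<dots> = (s+1)/2 * (2^a)\<^sup>2 * dens x R" by (simp add: \<rho>_def dens_def power_mult_distrib)
      also have "\<dots> \<le> (s+1)/2 * (2^a)\<^sup>2 * (cup s (s+2) * \<Lambda>)" using s_pos R by (intro mult_left_mono dens_le) auto
      finally show ?thesis .
    qed
    have 3: "norm (V \<rho> u - V r x) \<le> F" if "u \<in> cball x \<rho>" for u
    proof -
      have "norm (V \<rho> x - V \<rho> u) \<le> ctd s 1 * 1 * cup s (s+1) * \<Lambda>"
        using that R by (intro V_trans(2)) (auto simp: dist_norm)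
      moreover have "norm (V \<rho> u - V r x) \<le> norm (V \<rho> x - V \<rho> u) + norm (V R x - V \<rho> x) + norm (V r x - V R x)"
        using norm_triangle_ineq[of "(V \<rho> u - V \<rho> x) + (V \<rho> x - V R x)" "V R x - V r x"] norm_triangle_ineq[of "V \<rho> u - V \<rho> x" "V \<rho> x - V R x"]
        by (simp add: norm_minus_commute)
      ultimately show ?thesis using 1 2 unfolding F_def by linarith
    qed
    have "norm (V r x - l) \<le> C * (\<rho> / \<rho>) * (\<integral>y. \<psi> y \<partial>M) / (\<integral>y. \<psi> y \<partial>M) + F"
    proof (rule average_bound[OF R(2) _ nn I _ 3])
      show "lipc (1 / \<rho>) \<psi> x \<rho>" using lip by (simp add: \<rho>_def R_def)
      show "norm (\<integral>y. \<psi> y *\<^sub>R (V \<rho> y - l) \<partial>M) \<le> C * (\<rho> / \<rho>) * (\<integral>y. \<psi> y \<partial>M)" using A[OF R(2)] by (simp add: \<rho>_def R_def)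
    qed
    then show "norm (V r x - l) \<le> C + F" using I R by simp
  qed
qed


text \<open>The Harnack inequality transfers the near-maximality of \<open>V r x\<close> first to the scale \<open>2\<^bsup>j-k\<^esup> r\<close> and then to
  scale \<open>2\<^bsup>-b\<^esup> \<rho>\<close> at every point of the ball carrying the bump \<open>\<psi>\<close>, where the averages are small.\<close>

lemma extremal_step:
  fixes x u l :: 'a
  defines "D \<equiv> real DIM('a)"
  assumes s: "1 < s" "s < D" and u: "norm u = 1" and C: "0 \<le> C" and r: "0 < r"
    and bd: "\<And>r z. 0 < r \<Longrightarrow> (V r z - l) \<bullet> u \<le> m" and near: "m - (V r x - l) \<bullet> u \<le> \<eta>"
    and lip: "lipc (1 / (2^a * (2^j * r))) \<psi> x (2^a * (2^j * r))" and nn: "\<And>y. 0 \<le> \<psi> y" and I: "0 < (\<integral>y. \<psi> y \<partial>M)"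
    and A: "\<And>e. 0 < e \<Longrightarrow> norm (\<integral>y. \<psi> y *\<^sub>R (V e y - l) \<partial>M) \<le> C * (e / (2^a * (2^j * r))) * (\<integral>y. \<psi> y \<partial>M)"
    and B: "\<And>i. norm (V r x - V (2^i * r) x) \<le> C * 2 powr (- n * (real j - real i))"
  shows "m \<le> C / 2^b + (3 * 4^b + 2) powr ((2*D+1-s)/2) * (2^a * 2^k) powr (D+1-s) * (\<eta> + C * 2 powr (- n * real k))"
proof -
  define R where "R = 2^j * r"
  define \<rho> where "\<rho> = 2^a * R"
  \<comment> \<open>Truncated subtraction: for k > j the scale e is r itself and V r x need not be
    moved.\<close>
  define i where "i = j - k"
  define e where "e = 2^i * r"
  define e' where "e' = \<rho> / 2^b"
  \<comment> \<open>From |x - z|^2 <= 2 \<rho>^2 + 2 |y - z|^2, e <= \<rho> and \<rho>^2 = 4^b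
    e'^2.\<close>
  define c where "c = 3 * 4^b + (2::real)"
  define G where "G = c powr ((2*D+1-s)/2) * (2^a * 2^k) powr (D+1-s) * (\<eta> + C * 2 powr (- n * real k))"
  have pos: "0 < R" "0 < \<rho>" "0 < e" "0 < e'" "0 < c" using r by (auto simp: R_def \<rho>_def e_def e'_def c_def intro: add_pos_pos)
  have eR: "e \<le> R" unfolding e_def R_def i_def using r by (intro mult_right_mono power_increasing) auto
  have R\<rho>: "R \<le> \<rho>" using pos(1) by (simp add: \<rho>_def)
  have Re: "R \<le> 2^k * e"
  proof -
    have "(2::real)^j \<le> 2^(k + i)" by (intro power_increasing) (auto simp: i_def)
    then have "2^j * r \<le> 2^(k + i) * r" using r by (intro mult_right_mono) auto
    then show ?thesis by (simp add: R_def e_def power_add mult.assoc)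
  qed
  have e'e: "e' / e \<le> 2^a * 2^k"
  proof -
    have "e' \<le> \<rho> / 1" unfolding e'_def using pos by (intro divide_left_mono) auto
    also have "\<dots> \<le> 2^a * (2^k * e)" unfolding \<rho>_def using Re by simp
    finally show ?thesis using pos by (simp add: pos_divide_le_eq mult.assoc)
  qed
  have dV: "norm (V r x - V e x) \<le> C * 2 powr (- n * real k)"
  proof (cases "k \<le> j")
    case True
    then have "real j - real i = real k" by (simp add: i_def)
    then show ?thesis using B[of i] by (simp add: e_def)
  next
    case False
    then have "e = r" by (simp add: e_def i_def)
    then show ?thesis using C by simp
  qed
  have gap: "m - (V e x - l) \<bullet> u \<le> \<eta> + C * 2 powr (- n * real k)"
  proof -
    have "(V r x - l) \<bullet> u - (V e x - l) \<bullet> u = (V r x - V e x) \<bullet> u" by (simp add: inner_diff_left)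
    also have "\<dots> \<le> norm (V r x - V e x)" using norm_cauchy_schwarz[of "V r x - V e x" u] u by simp
    finally show ?thesis using dV near by linarith
  qed
  have low: "m - (V e' y - l) \<bullet> u \<le> G" if y: "y \<in> cball x \<rho>" for y
  proof -
    have cmp: "pk (2*D+1-s) e' (y - z) \<le> c powr ((2*D+1-s)/2) * pk (2*D+1-s) e (x - z)" for z
    proof (rule pk_compare)
      have "norm (x - z) \<le> \<rho> + norm (y - z)"
        using y norm_triangle_ineq[of "x - y" "y - z"] by (auto simp: dist_norm)
      then have "(norm (x - z))\<^sup>2 \<le> (\<rho> + norm (y - z))\<^sup>2" by (rule power_mono) simp
      also have "\<dots> \<le> 2 * \<rho>\<^sup>2 + 2 * (norm (y - z))\<^sup>2"
        using sum_squares_bound[of \<rho> "norm (y - z)"] by (simp add: power2_sum)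
      finally have 1: "(norm (x - z))\<^sup>2 \<le> 2 * \<rho>\<^sup>2 + 2 * (norm (y - z))\<^sup>2" .
      have 2: "e\<^sup>2 \<le> \<rho>\<^sup>2" using eR R\<rho> pos by (intro power_mono) auto
      have "(2::real) ^ b * 2 ^ b = 4 ^ b" by (simp flip: power_mult_distrib)
      then have 3: "\<rho>\<^sup>2 = 4^b * e'\<^sup>2" by (simp add: e'_def power_divide power2_eq_square)
      have "e\<^sup>2 + (norm (x - z))\<^sup>2 \<le> 3 * (4^b * e'\<^sup>2) + 2 * (norm (y - z))\<^sup>2" using 1 2 unfolding 3 by linarith
      also have "\<dots> \<le> c * (e'\<^sup>2 + (norm (y - z))\<^sup>2)" by (simp add: c_def algebra_simps)
      finally show "e\<^sup>2 + (norm (x - z))\<^sup>2 \<le> c * (e'\<^sup>2 + (norm (y - z))\<^sup>2)" .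
    qed (use pos s in auto)
    have "m - (V e' y - l) \<bullet> u \<le> c powr ((2*D+1-s)/2) * (e'/e) powr (D+1-s) * (m - (V e x - l) \<bullet> u)"
      unfolding D_def
      by (rule V_harnack) (use s pos bd cmp in \<open>auto simp: D_def\<close>)
    also have "\<dots> \<le> c powr ((2*D+1-s)/2) * (2^a * 2^k) powr (D+1-s) * (m - (V e x - l) \<bullet> u)"
      using e'e pos s bd[OF pos(3), of x] by (intro mult_right_mono mult_left_mono powr_mono2) auto
    also have "\<dots> \<le> G" unfolding G_def using gap by (intro mult_left_mono) auto
    finally show ?thesis .
  qed
  let ?I = "\<integral>y. \<psi> y \<partial>M"
  have lip': "lipc (1 / \<rho>) \<psi> x \<rho>" using lip by (simp add: \<rho>_def R_def)
  have i1: "integrable M \<psi>" using integrable_lipc[OF lip'] .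
  have i2: "integrable M (\<lambda>y. \<psi> y *\<^sub>R (V e' y - l))"
    unfolding scaleR_diff_right using i1 integrable_lipc_V[OF pos(4) lip']
    by (intro Bochner_Integration.integrable_diff integrable_scaleR_left) auto
  have i3: "integrable M (\<lambda>y. (\<psi> y *\<^sub>R (V e' y - l)) \<bullet> u)" using i2 by (rule integrable_inner_left)
  have "m * ?I - (\<integral>y. \<psi> y *\<^sub>R (V e' y - l) \<partial>M) \<bullet> u = (\<integral>y. m * \<psi> y - (\<psi> y *\<^sub>R (V e' y - l)) \<bullet> u \<partial>M)"
    unfolding Bochner_Integration.integral_diff[OF integrable_mult_right[OF i1] i3] integral_inner_left[OF i2] by simp
  also have "\<dots> \<le> (\<integral>y. G * \<psi> y \<partial>M)"
  proof (intro integral_mono Bochner_Integration.integrable_diff integrable_mult_right i1 i3)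
    fix y
    show "m * \<psi> y - (\<psi> y *\<^sub>R (V e' y - l)) \<bullet> u \<le> G * \<psi> y"
    proof (cases "y \<in> cball x \<rho>")
      case True
      have "\<psi> y * (m - (V e' y - l) \<bullet> u) \<le> \<psi> y * G" using low[OF True] nn by (rule mult_left_mono)
      then show ?thesis by (simp add: algebra_simps)
    next
      case False
      then have "\<psi> y = 0" using lip' by (auto simp: lipc_def)
      then show ?thesis by simp
    qed
  qed
  also have "\<dots> = G * ?I" by simp
  finally have 1: "m * ?I - (\<integral>y. \<psi> y *\<^sub>R (V e' y - l) \<partial>M) \<bullet> u \<le> G * ?I" .
  have "(\<integral>y. \<psi> y *\<^sub>R (V e' y - l) \<partial>M) \<bullet> u \<le> norm (\<integral>y. \<psi> y *\<^sub>R (V e' y - l) \<partial>M)"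
    using norm_cauchy_schwarz[of "\<integral>y. \<psi> y *\<^sub>R (V e' y - l) \<partial>M" u] u by simp
  also have "\<dots> \<le> C * (e' / \<rho>) * ?I" using A[OF pos(4)] by (simp add: \<rho>_def R_def)
  also have "e' / \<rho> = 1 / 2^b" using pos by (simp add: e'_def)
  finally have "m * ?I \<le> (C / 2^b + G) * ?I" using 1 by (simp add: algebra_simps)
  then have "m \<le> C / 2^b + G" using I by simp
  then show ?thesis unfolding G_def c_def .
qed

text \<open>With m the supremum and b fixed, letting k tend to infinity removes the Harnack term;
  then b tends to infinity and the average error C / 2^b vanishes, so m <= 0.\<close>

lemma V_le_const:
  fixes u l :: 'a
  assumes l: "avg_const l" and nz: "0 < emeasure M (ball c0 r0)"
    and s: "1 < s" "real DIM('a) - 1 < s" "s < real DIM('a)" and u: "norm u = 1" and r: "0 < r"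
  shows "(V r x - l) \<bullet> u \<le> 0"
proof -
  define D where "D = real DIM('a)"
  \<comment> \<open>The midpoint of d + 1 - s and 2, which are in this order because s > d - 1.
    Above d + 1 - s the decay of the differences of V beats the Harnack loss; below 2 the selection
    of a good ball works.\<close>
  define n where "n = (D + 3 - s) / 2"
  have n: "0 < n" "n < 2" "D + 1 - s < n" using s by (auto simp: n_def D_def)
  obtain a :: nat and C :: real where C: "0 \<le> C" and T: "\<forall>x r. 0 < r \<longrightarrow> (\<exists>(j::nat) \<psi>. lipc (1 / (2^a * (2^j * r))) \<psi> x (2^a * (2^j * r)) \<and> (\<forall>y. 0 \<le> \<psi> y) \<and> 0 < (\<integral>y. \<psi> y \<partial>M)
      \<and> (\<forall>e>0. norm (\<integral>y. \<psi> y *\<^sub>R (V e y - l) \<partial>M) \<le> C * (e / (2^a * (2^j * r))) * (\<integral>y. \<psi> y \<partial>M))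
      \<and> (\<forall>i. norm (V r x - V (2^i * r) x) \<le> C * 2 powr (- n * (real j - real i))))"
    by (rule good_test[OF l nz n(1,2)])
  obtain B where B: "\<And>r x. 0 < r \<Longrightarrow> norm (V r x - l) \<le> B" by (rule V_bounded[OF l nz]) blast
  define S where "S = (\<lambda>(r, x). (V r x - l) \<bullet> u) ` ({0<..} \<times> UNIV)"
  define m where "m = Sup S"
  have "bdd_above S"
  proof (rule bdd_aboveI[of _ B])
    fix v assume "v \<in> S"
    then obtain r x where v: "0 < r" "v = (V r x - l) \<bullet> u" by (auto simp: S_def)
    then show "v \<le> B" using norm_cauchy_schwarz[of "V r x - l" u] u B[of r x] by simp
  qed
  then have bd: "(V r z - l) \<bullet> u \<le> m" if "0 < r" for r z
    unfolding m_def by (rule cSup_upper[rotated]) (use that in \<open>force simp: S_def\<close>)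
  have near: "\<exists>r>0. \<exists>x. m - (V r x - l) \<bullet> u \<le> \<eta>" if "0 < \<eta>" for \<eta>
  proof -
    have "S \<noteq> {}" by (auto simp: S_def)
    moreover have "m - \<eta> < Sup S" using that by (simp add: m_def)
    ultimately obtain v where "v \<in> S" "m - \<eta> < v" using less_cSupD by blast
    then obtain r x where "0 < r" "m - \<eta> < (V r x - l) \<bullet> u" by (auto simp: S_def)
    then show ?thesis by (intro exI[of _ r] exI[of _ x] conjI) auto
  qed
  define \<theta> where "\<theta> = (2::real) powr (D + 1 - s - n)"
  have \<theta>: "0 < \<theta>" "\<theta> < 1" using n by (auto simp: \<theta>_def powr_less_one)
  have main: "m \<le> C / 2^b + (3 * 4^b + 2) powr ((2*D+1-s)/2) * (2^a) powr (D+1-s) * (1 + C) * \<theta> ^ k" for b k :: nat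
  proof -
    \<comment> \<open>The distance to the supremum is taken as small as the change of V over k
      scales.\<close>
    obtain r x where rx: "0 < r" "m - (V r x - l) \<bullet> u \<le> 2 powr (- n * real k)" using near[of "2 powr (- n * real k)"] by auto
    obtain j :: nat and \<psi> where "lipc (1 / (2^a * (2^j * r))) \<psi> x (2^a * (2^j * r))" "\<And>y. 0 \<le> \<psi> y" "0 < (\<integral>y. \<psi> y \<partial>M)"
      "\<And>e. 0 < e \<Longrightarrow> norm (\<integral>y. \<psi> y *\<^sub>R (V e y - l) \<partial>M) \<le> C * (e / (2^a * (2^j * r))) * (\<integral>y. \<psi> y \<partial>M)"
      "\<And>i. norm (V r x - V (2^i * r) x) \<le> C * 2 powr (- n * (real j - real i))"
      using T[rule_format, OF rx(1), of x] by blast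
    from extremal_step[OF s(1,3) u C rx(1) bd rx(2) this, of b k]
    have "m \<le> C / 2^b + (3 * 4^b + 2) powr ((2*D+1-s)/2) * ((2^a * 2^k) powr (D+1-s) * (2 powr (- n * real k) + C * 2 powr (- n * real k)))"
      by (simp add: D_def mult.assoc)
    also have "(2^a * 2^k) powr (D+1-s) * (2 powr (- n * real k) + C * 2 powr (- n * real k)) = (2^a) powr (D+1-s) * (1 + C) * \<theta> ^ k"
    proof -
      have "(2^a * 2^k) powr (D+1-s) * (2 powr (- n * real k) + C * 2 powr (- n * real k)) = (2^a) powr (D+1-s) * (1 + C) * ((2^k) powr (D+1-s) * 2 powr (- n * real k))"
        by (simp add: powr_mult algebra_simps)
      also have "(2^k) powr (D+1-s) * 2 powr (- n * real k) = 2 powr (real k * (D+1-s)) * 2 powr (- n * real k)"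
        by (simp add: powr_powr flip: powr_realpow)
      also have "\<dots> = 2 powr ((D+1-s-n) * real k)" unfolding powr_add[symmetric] by (rule arg_cong[of _ _ "(powr) 2"]) (simp add: algebra_simps)
      also have "\<dots> = \<theta> ^ k" unfolding \<theta>_def by (simp add: powr_powr flip: powr_realpow)
      finally show ?thesis .
    qed
    finally show ?thesis by (simp add: mult.assoc)
  qed
  have "m \<le> C / 2^b" for b :: nat
  proof (rule LIMSEQ_le_const)
    have "(\<lambda>k. \<theta> ^ k) \<longlonglongrightarrow> 0" using \<theta> by (intro LIMSEQ_power_zero) auto
    from tendsto_add[OF tendsto_const tendsto_mult_right_zero[OF this]]
    show "(\<lambda>k. C / 2^b + (3 * 4^b + 2) powr ((2*D+1-s)/2) * (2^a) powr (D+1-s) * (1 + C) * \<theta> ^ k) \<longlonglongrightarrow> C / 2^b" by fastforce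
    show "\<exists>N. \<forall>k\<ge>N. m \<le> C / 2^b + (3 * 4^b + 2) powr ((2*D+1-s)/2) * (2^a) powr (D+1-s) * (1 + C) * \<theta> ^ k" using main by blast
  qed
  moreover have "(\<lambda>b. C / 2^b) \<longlonglongrightarrow> 0" by (intro LIMSEQ_divide_realpow_zero) simp
  ultimately have "m \<le> 0" by (intro LIMSEQ_le_const) auto
  then show ?thesis using bd[OF r, of x] by linarith
qed

text \<open>\<open>V_le_const\<close> holds for every unit vector, in particular for the direction
  of V r x - l.\<close>

lemma V_eq_const:
  fixes l :: 'a
  assumes l: "avg_const l" and nz: "0 < emeasure M (ball c0 r0)"
    and s: "1 < s" "real DIM('a) - 1 < s" "s < real DIM('a)" and r: "0 < r"
  shows "V r x = l"
proof (rule ccontr)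
  assume "V r x \<noteq> l"
  then have N: "norm (V r x - l) > 0" by simp
  define u where "u = (1 / norm (V r x - l)) *\<^sub>R (V r x - l)"
  have "norm u = 1" using N by (simp add: u_def)
  from V_le_const[OF l nz s this r, of x]
  have "(norm (V r x - l))\<^sup>2 / norm (V r x - l) \<le> 0" unfolding u_def power2_norm_eq_inner by simp
  then show False using N by (simp add: power2_eq_square)
qed


section \<open>Exclusion of a constant field for s > d - 1\<close>

lemma integrable_chi_pk:
  fixes c y :: 'a
  assumes e: "0 < e" and q: "0 \<le> q"
  shows "integrable lborel (\<lambda>z. chi c q z * pk (s+1) e (z - y))"
proof (rule integrable_lborel_cball[where c=c and q=q and C="q^4 * e powr (-(s+1))"])
  fix z
  have "chi c q z * pk (s+1) e (z - y) \<le> q^4 * e powr (-(s+1))"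
    using s_pos e q by (intro mult_mono pk_le_scale chi_le) auto
  then show "norm (chi c q z * pk (s+1) e (z - y)) \<le> q^4 * e powr (-(s+1))" using chi_nonneg[of c q z] by simp
  show "chi c q z * pk (s+1) e (z - y) = 0" if "z \<notin> cball c q" using chi_outside[OF q that] by simp
qed measurable

text \<open>Integrating over y first, the kernel of decay s + 1 leaves a constant times 1/e
  uniformly in z; the bump then contributes only its height and volume.\<close>

lemma nn_integral_chi_pk_le:
  assumes e: "0 < e" and q: "0 < q"
  shows "(\<integral>\<^sup>+y. ennreal (\<integral>z. chi c q z * pk (s+1) e (z - y) \<partial>lborel) \<partial>M)
    \<le> ennreal (q^4 * (cup s (s+1) * \<Lambda>) * measure lborel (cball c q) * e powr (-1))"
proof -
  interpret P: pair_sigma_finite M "lborel :: 'a measure" ..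
  let ?A = "q^4 * (cup s (s+1) * \<Lambda> * e powr (-1))"
  have A: "0 \<le> ?A" using cup_pos[of s "s+1"] \<Lambda>_pos by simp
  have "(\<integral>\<^sup>+y. ennreal (\<integral>z. chi c q z * pk (s+1) e (z - y) \<partial>lborel) \<partial>M) = (\<integral>\<^sup>+y. (\<integral>\<^sup>+z. ennreal (chi c q z * pk (s+1) e (z - y)) \<partial>lborel) \<partial>M)"
    using e q by (intro nn_integral_cong nn_integral_eq_integral[symmetric] integrable_chi_pk) (auto simp: chi_nonneg)
  also have "\<dots> = (\<integral>\<^sup>+z. (\<integral>\<^sup>+y. ennreal (chi c q z * pk (s+1) e (z - y)) \<partial>M) \<partial>lborel)"
    by (rule P.Fubini'[symmetric]) measurable
  also have "\<dots> \<le> (\<integral>\<^sup>+z. ennreal ?A * indicator (cball c q) z \<partial>lborel)"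
  proof (rule nn_integral_mono)
    fix z
    show "(\<integral>\<^sup>+y. ennreal (chi c q z * pk (s+1) e (z - y)) \<partial>M) \<le> ennreal ?A * indicator (cball c q) z"
    proof (cases "z \<in> cball c q")
      case True
      have "(\<integral>\<^sup>+y. ennreal (chi c q z * pk (s+1) e (z - y)) \<partial>M) \<le> (\<integral>\<^sup>+y. ennreal (q^4) * ennreal (pk (s+1) e (z - y)) \<partial>M)"
        using q by (intro nn_integral_mono) (auto simp: ennreal_mult'[symmetric] intro!: ennreal_leI mult_right_mono chi_le)
      also have "\<dots> = ennreal (q^4) * (\<integral>\<^sup>+y. ennreal (pk (s+1) e (z - y)) \<partial>M)" by (rule nn_integral_cmult) measurable
      also have "\<dots> \<le> ennreal (q^4) * ennreal (cup s (s+1) * \<Lambda> * e powr (s - (s+1)))"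
        using e by (intro mult_left_mono nn_integral_pk_le) auto
      also have "\<dots> = ennreal ?A" using q by (simp add: ennreal_mult'[symmetric])
      finally show ?thesis using True by simp
    next
      case False
      then show ?thesis using chi_outside[of q z c] q by simp
    qed
  qed
  also have "\<dots> = ennreal ?A * emeasure lborel (cball c q)" by (rule nn_integral_cmult_indicator) simp
  also have "\<dots> = ennreal (?A * measure lborel (cball c q))"
    using A emeasure_lborel_cball_finite[of c q] by (simp add: emeasure_eq_ennreal_measure ennreal_mult'[symmetric] less_top)
  finally show ?thesis by (simp add: mult_ac)
qed

text \<open>With \<open>\<sigma> = s + 1 - d\<close>, the mollified mass \<open>f e\<close> would satisfy \<open>f (t e) \<ge> \<kappa> f e\<close> with
  \<open>\<kappa> t > 1\<close> by convexity, contradicting \<open>f e = O(1/e)\<close>.\<close>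

lemma V_not_constant:
  assumes s: "real DIM('a) - 1 < s" "s < real DIM('a)" and nz: "0 < emeasure M (ball c0 r0)"
    and const: "\<And>r x. 0 < r \<Longrightarrow> V r x = l"
  shows False
proof -
  define \<sigma> where "\<sigma> = s + 1 - real DIM('a)"
  have \<sigma>: "0 < \<sigma>" "\<sigma> < 1" using s by (auto simp: \<sigma>_def)
  define g where "g e y = (\<integral>z. chi 0 1 z * pk (s+1) e (z - y) \<partial>lborel)" for e and y :: 'a
  define h where "h e y = (\<integral>z. chi 0 1 z * dvk s e (z - y) \<partial>lborel)" for e and y :: 'a
  define f where "f e = (\<integral>y. g e y \<partial>M)" for e
  define K where "K = cup s (s+1) * \<Lambda> * measure lborel (cball (0::'a) 1)"
  have K: "0 \<le> K" using cup_pos[of s "s+1"] \<Lambda>_pos by (simp add: K_def)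
  note inner_int = integrable_chi_pk[OF _ zero_le_one, of _ "0::'a"]
  have g0: "0 \<le> g e y" for e y unfolding g_def by (intro Bochner_Integration.integral_nonneg) (simp add: chi_nonneg)
  have gm [measurable]: "g e \<in> borel_measurable M" for e
    unfolding g_def by (rule lborel.borel_measurable_lebesgue_integral) measurable
  have gi: "integrable M (g e)" and fle: "f e \<le> K * e powr (-1)" if e: "0 < e" for e
  proof -
    have "(\<integral>\<^sup>+y. ennreal (g e y) \<partial>M) \<le> ennreal (K * e powr (-1))"
      using nn_integral_chi_pk_le[OF e, of 1 0] by (simp add: g_def K_def)
    note nn_bound_real[OF gm g0 this]
    then show "integrable M (g e)" "f e \<le> K * e powr (-1)" using K by (auto simp: f_def)
  qed
  have hi: "integrable M (h e)" and h0: "(\<integral>y. h e y \<partial>M) = 0" if e: "0 < e" for e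
  proof -
    show "integrable M (h e)" unfolding h_def using e by (intro test_identity(2)) auto
    \<comment> \<open>Constancy of V enters here: it makes the left-hand side of
      \<open>test_identity\<close> vanish.\<close>
    show "(\<integral>y. h e y \<partial>M) = 0"
      using test_identity(1)[OF e zero_less_one, of 0] vf_integral_zero[of 0 1 l] const[OF e] by (simp add: h_def)
  qed
  have gpos: "0 < g e y" if e: "0 < e" for e y
  proof -
    have "g e y \<noteq> 0"
    proof
      assume "g e y = 0"
      then have "AE z in lborel. chi 0 1 z * pk (s+1) e (z - y) = 0"
        unfolding g_def using inner_int[OF e, of y] chi_nonneg[of "0::'a" 1] by (subst (asm) integral_nonneg_eq_0_iff_AE) auto
      then have "AE z in lborel. z \<notin> ball (0::'a) (3*1/4)"
      proof eventually_elim
        case (elim z)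
        then show ?case using pk_pos[OF e, of "s+1" "z - y"] chi_ge[of 1 z 0] by auto
      qed
      then have "ball (0::'a) (3/4) \<in> null_sets lborel" by (subst AE_iff_null_sets) auto
      then have "measure lborel (ball (0::'a) (3/4)) = 0" by (simp add: measure_def null_setsD1)
      then show False using content_ball_pos[of "3/4" "0::'a"] by simp
    qed
    then show ?thesis using g0[of e y] by linarith
  qed
  have fpos: "0 < f 1"
  proof -
    have "f 1 \<noteq> 0"
    proof
      assume "f 1 = 0"
      then have "AE y in M. g 1 y = 0" using gi[of 1] g0 unfolding f_def by (subst (asm) integral_nonneg_eq_0_iff_AE) auto
      then have "AE y in M. y \<notin> ball c0 r0"
      proof eventually_elim
        case (elim y)
        then show ?case using gpos[of 1 y] by simp
      qed
      then have "ball c0 r0 \<in> null_sets M" by (subst AE_iff_null_sets) auto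
      then show False using nz by (simp add: null_setsD1)
    qed
    moreover have "0 \<le> f 1" unfolding f_def using g0 by (intro Bochner_Integration.integral_nonneg) auto
    ultimately show ?thesis by linarith
  qed
  \<comment> \<open>Makes 1 - \<sigma> - \<sigma> \<eta> = (1 - \<sigma>)(1 - \<sigma>/2) positive,
    which gives \<kappa> t > 1 below; this relies on \<sigma> < 1, that is, s < d.\<close>
  define \<eta> where "\<eta> = (1 - \<sigma>) / 2"
  have \<eta>: "0 < \<eta>" "\<eta> < 1" using \<sigma> by (auto simp: \<eta>_def)
  define \<kappa> where "\<kappa> = 1 - \<sigma> * \<eta> / 2"
  have "\<sigma> * \<eta> < 1 * 1" using \<sigma> \<eta> by (intro mult_strict_mono) auto
  then have \<kappa>: "0 < \<kappa>" by (simp add: \<kappa>_def)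
  define t where "t = sqrt (1 + \<eta>)"
  have t: "0 < t" "t\<^sup>2 = 1 + \<eta>" using \<eta> by (auto simp: t_def)
  \<comment> \<open>The tangent inequality between e^2 + |w|^2 and (1 + \<eta>) e^2 + |w|^2,
    combined with the identity \<open>dvk\<close> = (s+1) e^2 \<open>pk (s+3)\<close> - \<sigma>
    \<open>pk (s+1)\<close>. The divergence will integrate to zero, leaving only the loss
    \<kappa>.\<close>
  have pt: "\<kappa> * pk (s+1) e w - \<eta> / 2 * dvk s e w \<le> pk (s+1) (t * e) w" if e: "0 < e" for e and w :: 'a
  proof -
    let ?A = "e\<^sup>2 + (norm w)\<^sup>2"
    have A: "0 < ?A" using e by (intro add_pos_nonneg) auto
    have sh: "?A * pk (s+3) e w = pk (s+1) e w" using pk_shift[OF e, of w "s+1"] by (simp add: add.commute add.left_commute)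
    have d: "dvk s e w = (s+1) * e\<^sup>2 * pk (s+3) e w - \<sigma> * pk (s+1) e w"
      unfolding dvk_def \<sigma>_def sh[symmetric] by (simp add: algebra_simps)
    have tA: "(t * e)\<^sup>2 + (norm w)\<^sup>2 = ?A + \<eta> * e\<^sup>2" using t by (simp add: power_mult_distrib algebra_simps)
    have "pk (s+1) e w - pk (s+1) (t * e) w \<le> (s+1)/2 * ((?A + \<eta> * e\<^sup>2) - ?A) * ?A powr (-((s+1)/2) - 1)"
      unfolding pk_def tA using A \<eta> s_pos by (intro powr_minus_diff_le) (auto intro: add_pos_nonneg)
    also have "?A powr (-((s+1)/2) - 1) = pk (s+3) e w"
      unfolding pk_def by (rule arg_cong[of _ _ "(powr) ?A"]) (simp add: field_simps)
    finally have "pk (s+1) e w - pk (s+1) (t * e) w \<le> \<eta> / 2 * ((s+1) * e\<^sup>2 * pk (s+3) e w)" by (simp add: mult_ac)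
    then show ?thesis unfolding d \<kappa>_def by (simp add: algebra_simps)
  qed
  have step: "\<kappa> * f e \<le> f (t * e)" if e: "0 < e" for e
  proof -
    have te: "0 < t * e" using t e by simp
    have "\<kappa> * g e y - \<eta> / 2 * h e y \<le> g (t * e) y" for y
    proof -
      note i = inner_int[OF e, of y] integrable_chi_dvk[OF e s_pos zero_le_one, of 0 y]
      have "\<kappa> * g e y - \<eta> / 2 * h e y = (\<integral>z. \<kappa> * (chi 0 1 z * pk (s+1) e (z - y)) - \<eta> / 2 * (chi 0 1 z * dvk s e (z - y)) \<partial>lborel)"
        unfolding g_def h_def
        by (subst Bochner_Integration.integral_diff[OF integrable_mult_right[OF i(1)] integrable_mult_right[OF i(2)]]) simp
      also have "\<dots> \<le> g (t * e) y" unfolding g_def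
      proof (intro integral_mono Bochner_Integration.integrable_diff integrable_mult_right i inner_int te)
        fix z :: 'a
        have "chi 0 1 z * (\<kappa> * pk (s+1) e (z - y) - \<eta> / 2 * dvk s e (z - y)) \<le> chi 0 1 z * pk (s+1) (t * e) (z - y)"
          using pt[OF e] chi_nonneg by (intro mult_left_mono) auto
        then show "\<kappa> * (chi 0 1 z * pk (s+1) e (z - y)) - \<eta> / 2 * (chi 0 1 z * dvk s e (z - y)) \<le> chi 0 1 z * pk (s+1) (t * e) (z - y)"
          by (simp add: algebra_simps)
      qed
      finally show ?thesis .
    qed
    then have "(\<integral>y. \<kappa> * g e y - \<eta> / 2 * h e y \<partial>M) \<le> f (t * e)" unfolding f_def
      by (intro integral_mono Bochner_Integration.integrable_diff integrable_mult_right gi hi e te)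
    moreover have "(\<integral>y. \<kappa> * g e y - \<eta> / 2 * h e y \<partial>M) = \<kappa> * f e"
      unfolding Bochner_Integration.integral_diff[OF integrable_mult_right[OF gi[OF e]] integrable_mult_right[OF hi[OF e]]] f_def
      using h0[OF e] by simp
    ultimately show ?thesis by simp
  qed
  have iter: "\<kappa> ^ n * f 1 \<le> f (t ^ n)" for n :: nat
  proof (induction n)
    case (Suc n)
    have "\<kappa> * (\<kappa> ^ n * f 1) \<le> \<kappa> * f (t ^ n)" using Suc \<kappa> by (intro mult_left_mono) auto
    also have "\<dots> \<le> f (t * t ^ n)" using t by (intro step) simp
    finally show ?case by simp
  qed simp
  have "1 < \<kappa> * t"
  proof -
    have "1 < (1 - \<sigma> * \<eta>) * (1 + \<eta>)"
    proof -
      have "(1 - \<sigma> * \<eta>) * (1 + \<eta>) - 1 = \<eta> * (1 - \<sigma> - \<sigma> * \<eta>)" by (simp add: algebra_simps)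
      also have "1 - \<sigma> - \<sigma> * \<eta> = (1 - \<sigma>) * (1 - \<sigma> / 2)" by (simp add: \<eta>_def field_simps)
      finally show ?thesis using \<eta> \<sigma> by (smt (verit) mult_pos_pos divide_pos_pos field_sum_of_halves)
    qed
    also have "\<dots> \<le> \<kappa>\<^sup>2 * t\<^sup>2"
    proof -
      have "\<kappa>\<^sup>2 = 1 - \<sigma> * \<eta> + (\<sigma> * \<eta> / 2)\<^sup>2" by (simp add: \<kappa>_def power2_eq_square algebra_simps)
      then have "1 - \<sigma> * \<eta> \<le> \<kappa>\<^sup>2" by simp
      then show ?thesis unfolding t(2) using \<eta> by (intro mult_right_mono) auto
    qed
    finally have "1\<^sup>2 < (\<kappa> * t)\<^sup>2" by (simp add: power_mult_distrib)
    then show ?thesis using \<kappa> t by (intro power_less_imp_less_base[of 1 2]) auto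
  qed
  then obtain n where n: "K / f 1 < (\<kappa> * t) ^ n" using real_arch_pow by blast
  have "\<kappa> ^ n * f 1 \<le> K * (t ^ n) powr (-1)" using iter[of n] fle[of "t ^ n"] t by simp
  then have "(\<kappa> ^ n * f 1) * t ^ n \<le> K" using t by (simp add: powr_minus field_simps)
  moreover have "K < (\<kappa> * t) ^ n * f 1" using n fpos by (simp add: pos_divide_less_eq)
  ultimately show False by (simp add: power_mult_distrib mult_ac)
qed

end

theorem theorem1p4:
  fixes \<mu> :: "'a::euclidean_space measure" and s :: real
  assumes "DIM('a) \<ge> 2" and "0 < s" and "s < real DIM('a)"
    and "reflectionless s \<mu>"
  shows "interior (closure (measure_support \<mu>)) = {}"
proof (rule ccontr)
  assume "interior (closure (measure_support \<mu>)) \<noteq> {}"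
  then obtain c where "c \<in> interior (closure (measure_support \<mu>))" by blast
  then obtain q where q: "0 < q" "cball c q \<subseteq> closure (measure_support \<mu>)"
    by (meson interior_subset mem_interior_cball subset_trans)
  obtain \<Lambda> where \<Lambda>: "0 < \<Lambda>" "good s \<Lambda> \<mu>" and b: "loc_finite_borel_measure \<mu>"
    using assms(4) unfolding reflectionless_def by blast
  interpret growth_measure \<mu> s \<Lambda>
    using \<Lambda> b assms(2) by unfold_locales (auto simp: loc_finite_borel_measure_def good_def nice_def)
  \<comment> \<open>Every ball about a point of the closure contains a ball of half the radius about
    a point of the support.\<close>
  have supp: "0 < emeasure \<mu> (ball z r)" if z: "z \<in> cball c q" and r: "0 < r" for z r
  proof -
    obtain x where x: "x \<in> measure_support \<mu>" "dist x z < r / 2"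
      using z q(2) r closure_approachable[of z "measure_support \<mu>"] half_gt_zero[OF r] by blast
    then have "0 < emeasure \<mu> (ball x (r / 2))" using r by (auto simp: measure_support_def)
    also have "\<dots> \<le> emeasure \<mu> (ball z r)"
    proof (rule emeasure_mono)
      show "ball x (r / 2) \<subseteq> ball z r"
      proof
        fix y assume "y \<in> ball x (r / 2)"
        then show "y \<in> ball z r" using x(2) dist_triangle[of z y x] by (simp add: dist_commute)
      qed
    qed simp
    finally show ?thesis .
  qed
  then have nz: "0 < emeasure \<mu> (ball c q)" using q by simp
  obtain l where "\<And>e L \<psi> c \<rho>. 0 < e \<Longrightarrow> 0 < \<rho> \<Longrightarrow> lipc L \<psi> c \<rho> \<Longrightarrow>
      norm (\<integral>x. \<psi> x *\<^sub>R (V e x - l) \<partial>\<mu>) \<le> cj s * \<Lambda> * L * e * measure \<mu> (cball c \<rho>)"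
    by (rule reflectionless_average[OF assms(4) nz]) blast
  then have l: "avg_const l" unfolding avg_const_def by blast
  show False
  proof (cases "s \<le> real DIM('a) - 1")
    case True
    then show ?thesis using thin_case[OF l _ q(1) supp] by blast
  next
    case False
    \<comment> \<open>Dimension at least two enters here: it turns s > d - 1 into s > 1, as the
      convolution formula requires.\<close>
    then have s: "real DIM('a) - 1 < s" "1 < s" using assms(1) by auto
    show ?thesis
      by (rule V_not_constant[OF s(1) assms(3) nz V_eq_const[OF l nz s(2,1) assms(3)]])
  qed
qed

end
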